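(* Let $B$ be a non-zero finite skew brace such that $(B,\cdot)$ is nilpotent. Then $B$ admits an ideal of index $p$ for some prime $p$.
   Context: A skew brace is a triple $B=(B,+,\cdot)$ such that $(B,+)$ and $(B,\cdot)$ are groups (neither assumed abelian) on the same underlying set and $a\cdot(b+c)=a\cdot b-a+a\cdot c$ for all $a,b,c\in B$. The two identity elements coincide and are denoted by $0$; "non-zero" means $|B|>1$. For $a\in B$, $\lambda_a(b)=-a+a\cdot b$ defines an automorphism of $(B,+)$. A left ideal of $B$ is a subgroup $I\leq (B,+)$ with $\lambda_b(I)=I$ for every $b\in B$. An ideal of $B$ is a left ideal that is normal in both $(B,+)$ and $(B,\cdot)$. The index of an ideal $I$ is $|B/I|$. *)

theory Defs
  imports "HOL-Algebra.Algebra" "HOL-Computational_Algebra.Primes"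
begin

text \<open>
  A skew brace is carried by the record type of rings: \<open>\<otimes>\<close> is its multiplication and
  \<open>\<oplus>\<close> its addition, which need not be commutative. Nothing from the locale \<open>ring\<close>
  is assumed. The equality of the two identity elements follows from the axioms; see
  \<open>one_eq_zero\<close> below.
\<close>

locale skew_brace = group B for B :: "('a, 'm) ring_scheme" (structure) +
  assumes additive_group: "group (add_monoid B)"
    and brace_distrib:
      "\<lbrakk>a \<in> carrier B; b \<in> carrier B; c \<in> carrier B\<rbrakk>
        \<Longrightarrow> a \<otimes> (b \<oplus> c) = ((a \<otimes> b) \<ominus> a) \<oplus> (a \<otimes> c)"

lemma (in skew_brace) one_eq_zero: "\<one> = \<zero>"
proof -
  interpret add: group "add_monoid B" by (rule additive_group)
  have zc: "\<zero> \<in> carrier B" and oc: "\<one> \<in> carrier B"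
    using add.one_closed by simp_all
  have nc: "\<ominus> \<one> \<in> carrier B"
    using add.inv_closed[of \<one>] oc by (simp add: a_inv_def)
  have "\<zero> = \<one> \<otimes> (\<zero> \<oplus> \<zero>)"
    using zc add.r_one[of \<zero>] by simp
  also have "\<dots> = (\<zero> \<ominus> \<one>) \<oplus> \<zero>"
    using brace_distrib[OF oc zc zc] zc by simp
  also have "\<dots> = \<ominus> \<one>"
    using add.l_one[of "\<ominus> \<one>"] add.r_one[of "\<ominus> \<one>"] nc by (simp add: a_minus_def)
  finally have "\<ominus> \<one> = \<zero>" by simp
  then show ?thesis
    using add.r_inv[of \<one>] add.r_one[of \<one>] oc by (simp add: a_inv_def)
qed

definition lambda_map :: "('a, 'm) ring_scheme \<Rightarrow> 'a \<Rightarrow> 'a \<Rightarrow> 'a" where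
  "lambda_map B a b = (\<ominus>\<^bsub>B\<^esub> a) \<oplus>\<^bsub>B\<^esub> (a \<otimes>\<^bsub>B\<^esub> b)"

definition left_brace_ideal :: "'a set \<Rightarrow> ('a, 'm) ring_scheme \<Rightarrow> bool" where
  "left_brace_ideal I B \<longleftrightarrow>
    subgroup I (add_monoid B) \<and> (\<forall>b \<in> carrier B. lambda_map B b ` I = I)"

definition brace_ideal :: "'a set \<Rightarrow> ('a, 'm) ring_scheme \<Rightarrow> bool" where
  "brace_ideal I B \<longleftrightarrow> left_brace_ideal I B \<and> I \<lhd> add_monoid B \<and> I \<lhd> B"

text \<open>
  The library's \<open>B Quot I\<close> has the additive cosets of \<open>I\<close> as its elements. For an ideal of
  a skew brace, \<open>a \<otimes> I = a \<oplus> \<lambda>\<^sub>a(I) = a \<oplus> I\<close>, so these are also the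
  multiplicative cosets, and \<open>B Quot I\<close> is the quotient skew brace.
\<close>

definition brace_index :: "('a, 'm) ring_scheme \<Rightarrow> 'a set \<Rightarrow> nat" where
  "brace_index B I = order (B Quot I)"

text \<open>The lower central series, numbered from 0.\<close>

primrec lower_central :: "('a, 'm) monoid_scheme \<Rightarrow> nat \<Rightarrow> 'a set" where
  "lower_central G 0 = carrier G"
| "lower_central G (Suc n) = generate G
    (\<Union>x \<in> lower_central G n. \<Union>y \<in> carrier G.
      {x \<otimes>\<^bsub>G\<^esub> y \<otimes>\<^bsub>G\<^esub> (inv\<^bsub>G\<^esub> x) \<otimes>\<^bsub>G\<^esub> (inv\<^bsub>G\<^esub> y)})"

definition nilpotent_group :: "('a, 'm) monoid_scheme \<Rightarrow> bool" where
  "nilpotent_group G \<longleftrightarrow> group G \<and> (\<exists>n. lower_central G n = {\<one>\<^bsub>G\<^esub>})"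

end

theory Submission
  imports Defs "HOL-Library.Poly_Mapping" "Jordan_Normal_Form.Char_Poly" "HOL-Number_Theory.Cong"
begin

text \<open>
  Let \<open>X\<close>, \<open>Y\<close> and \<open>T\<close> be the groups of permutations of \<open>B\<close> formed by the maps \<open>\<lambda>\<^sub>a\<close>, by the
  left multiplications and by the left translations. Then \<open>Y X = X T\<close> is a finite group \<open>\<Gamma>\<close>, and
  \<open>X\<close> and \<open>Y\<close> are images of \<open>(B,\<cdot>)\<close>, hence nilpotent. If \<open>N\<close> is a normal subgroup of \<open>\<Gamma>\<close> of
  prime index that contains \<open>X\<close> or \<open>Y\<close>, then the elements \<open>a\<close> whose translation lies in \<open>N\<close> form an
  ideal of the same index.

  To find \<open>N\<close> it suffices to show, for a finite group \<open>G\<close> that is the product of nilpotent subgroups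
  \<open>U\<close> and \<open>V\<close> not both equal to \<open>G\<close>, that \<open>U\<close> or \<open>V\<close> lies in a proper normal subgroup. By induction
  one may assume that \<open>U\<close> and \<open>V\<close> supplement every nontrivial normal subgroup. A solvable
  normal subgroup is then dealt with by Sylow's theorem. If a prime \<open>p\<close> divides both orders, a
  maximal \<open>p\<close>-subgroup that contains the Sylow \<open>p\<close>-subgroup of \<open>U\<close> and permutes with all conjugates of that
  of \<open>V\<close> is normalised by these conjugates (Kegel), which yields a normal \<open>p\<close>-subgroup or two
  normal subgroups with trivial intersection and nilpotent quotients. If the orders are coprime,
  \<open>G\<close> is solvable (Wielandt): a minimal counterexample is simple; it is excluded by Burnside's theorem
  on classes of prime power size if \<open>U\<close> or \<open>V\<close> has prime power order, and otherwise by a transfer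
  argument in the centraliser of a \<open>p\<close>-subgroup.
\<close>

text \<open>The identity \<open>L a = T a + lam a\<close> makes the ideal possible. Modulo a normal
  subgroup \<open>N\<close> that contains all \<open>lam a\<close>, the map \<open>T\<close> agrees
  with the homomorphism \<open>L\<close> of the multiplicative group; if \<open>N\<close> contains
  all \<open>L a\<close>, then \<open>T a \<in> N\<close> is equivalent to
  \<open>lam a \<in> N\<close>. So one and the same set is the preimage of \<open>N\<close> under a
  homomorphism of each of the two groups. The case that both factors are all of \<Gamma> is excluded
  because every \<open>lam a\<close> fixes zero, whereas \<open>L a\<close> moves it to
  \<open>a\<close>. The reduction on normal subgroups passes to quotients, which leave the given
  type. Therefore the inductions run in \<open>nat sym\<close>, which contains a copy of every
  finite group. Burnside's theorem is usually proved with Galois conjugates of character values.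
  Here the class is that of an element \<open>z\<close> of prime order, so the conjugates are the
  values at multiples of \<open>z\<close>; a sum over these multiples replaces the field trace, and
  integrality is obtained by letting numbers act on one fixed lattice.\<close>

text \<open>
  Groups are written additively, without commutativity, so that the type class \<open>group_add\<close> serves for
  all of them. Differences stay in the form \<open>a + - b\<close>, for which associativity normalises.
\<close>

declare add_uminus_conv_diff [simp del]

lemmas gs = add.assoc minus_add

subsection \<open>Finite subgroups\<close>

text \<open>\<open>grp\<close> stands apart from its finite form \<open>sub\<close> because
  \<open>gen\<close> intersects arbitrary subgroups; \<open>sub_gen\<close> recovers finiteness from
  a finite ambient group.\<close>

definition grp :: "'g::group_add set \<Rightarrow> bool" where
  "grp H \<longleftrightarrow> 0 \<in> H \<and> (\<forall>x\<in>H. \<forall>y\<in>H. x + y \<in> H) \<and> (\<forall>x\<in>H. - x \<in> H)"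

definition sub :: "'g::group_add set \<Rightarrow> bool" where
  "sub H \<longleftrightarrow> finite H \<and> grp H"

primrec tm :: "nat \<Rightarrow> 'g::group_add \<Rightarrow> 'g" where
  "tm 0 x = 0"
| "tm (Suc n) x = x + tm n x"

definition cj :: "'g::group_add \<Rightarrow> 'g set \<Rightarrow> 'g set" where
  "cj g V = (\<lambda>x. g + x + - g) ` V"

definition splus :: "'g::group_add set \<Rightarrow> 'g set \<Rightarrow> 'g set" (infixl "\<boxplus>" 65) where
  "V \<boxplus> Y = {x + y | x y. x \<in> V \<and> y \<in> Y}"

definition gen :: "'g::group_add set \<Rightarrow> 'g set" where
  "gen S = \<Inter>{K. grp K \<and> S \<subseteq> K}"

definition nml :: "'g::group_add set \<Rightarrow> 'g set \<Rightarrow> bool" where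
  "nml N H \<longleftrightarrow> sub N \<and> N \<subseteq> H \<and> (\<forall>h\<in>H. \<forall>n\<in>N. h + n + - h \<in> N)"

lemma subD: assumes "sub H"
  shows "finite H" "0 \<in> H" "x \<in> H \<Longrightarrow> y \<in> H \<Longrightarrow> x + y \<in> H" "x \<in> H \<Longrightarrow> - x \<in> H"
  using assms by (auto simp: sub_def grp_def)

lemma subI: "finite H \<Longrightarrow> 0 \<in> H \<Longrightarrow> (\<And>x y. x \<in> H \<Longrightarrow> y \<in> H \<Longrightarrow> x + y \<in> H)
    \<Longrightarrow> (\<And>x. x \<in> H \<Longrightarrow> - x \<in> H) \<Longrightarrow> sub H"
  by (auto simp: sub_def grp_def)

lemma sub_cj_mem: "sub H \<Longrightarrow> g \<in> H \<Longrightarrow> x \<in> H \<Longrightarrow> g + x + - g \<in> H"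
  by (simp add: subD)

lemma sub_minus_iff: "sub H \<Longrightarrow> - x \<in> H \<longleftrightarrow> x \<in> H"
  using subD(4)[of H x] subD(4)[of H "-x"] by auto

lemma sub_add_left: "sub H \<Longrightarrow> x \<in> H \<Longrightarrow> x + y \<in> H \<longleftrightarrow> y \<in> H"
  using subD(3)[of H x y] subD(3)[of H "-x" "x+y"] subD(4)[of H x] by (auto simp: gs)

lemma sub_add_right: "sub H \<Longrightarrow> y \<in> H \<Longrightarrow> x + y \<in> H \<longleftrightarrow> x \<in> H"
  using subD(3)[of H x y] subD(3)[of H "x+y" "-y"] subD(4)[of H y] by (auto simp: gs)

lemma sub_Int: "sub H \<Longrightarrow> sub K \<Longrightarrow> sub (H \<inter> K)"
  by (auto simp: sub_def grp_def)

lemma sub_zero: "sub {0}"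
  by (auto simp: sub_def grp_def)

lemma sub_card_pos: "sub H \<Longrightarrow> card H > 0"
  using subD(1,2) card_gt_0_iff by blast

lemma sub_card1: assumes "sub H" shows "card H = 1 \<longleftrightarrow> H = {0}"
proof
  assume "card H = 1"
  then obtain a where "H = {a}" "0 \<in> H" using assms card_1_singletonE subD(2) by metis
  then show "H = {0}" by simp
qed simp

lemma cj_mem: "x \<in> cj g V \<longleftrightarrow> - g + x + g \<in> V"
proof
  assume "- g + x + g \<in> V"
  then have "g + (- g + x + g) + - g \<in> cj g V" unfolding cj_def by blast
  then show "x \<in> cj g V" by (simp add: gs)
qed (auto simp: cj_def gs)

lemma cj_0 [simp]: "cj 0 V = V" by (simp add: cj_def)
lemma cj_cj [simp]: "cj g (cj h V) = cj (g + h) V" by (auto simp: cj_mem gs)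
lemma card_cj [simp]: "card (cj g V) = card V"
  unfolding cj_def by (rule card_image) (auto simp: inj_on_def)
lemma finite_cj [simp]: "finite (cj g V) = finite V"
  unfolding cj_def by (rule finite_image_iff) (auto simp: inj_on_def)
lemma cj_mono: "V \<subseteq> Y \<Longrightarrow> cj g V \<subseteq> cj g Y" by (auto simp: cj_mem)
lemma cj_Int: "cj g (V \<inter> Y) = cj g V \<inter> cj g Y" by (auto simp: cj_mem)
lemma cj_zero [simp]: "cj g {0} = {0}" by (auto simp: cj_def)
lemma cj_eq_zero: "cj g V = {0} \<longleftrightarrow> V = {0}"
  by (metis cj_0 cj_cj cj_zero left_minus)

lemma grp_cj: "grp H \<Longrightarrow> grp (cj g H)"
  unfolding grp_def cj_mem
proof (intro conjI ballI, goal_cases)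
  case 1 then show ?case by simp
next
  case (2 x y)
  then have "(- g + x + g) + (- g + y + g) \<in> H" by (auto simp: cj_mem)
  then show ?case by (simp add: gs cj_mem)
next
  case (3 x)
  then have "- (- g + x + g) \<in> H" by (auto simp: cj_mem)
  then show ?case by (simp add: gs cj_mem)
qed

lemma sub_cj: "sub H \<Longrightarrow> sub (cj g H)"
  by (simp add: sub_def grp_cj)

lemma cj_sub_mem: "sub H \<Longrightarrow> g \<in> H \<Longrightarrow> V \<subseteq> H \<Longrightarrow> cj g V \<subseteq> H"
  by (auto simp: subD cj_def)

lemma sub_cj_self: "sub H \<Longrightarrow> g \<in> H \<Longrightarrow> cj g H = H"
  using cj_sub_mem[of H g H] by (intro card_subset_eq) (simp_all add: subD(1))

lemma cj_eqI: "finite V \<Longrightarrow> cj g V \<subseteq> V \<Longrightarrow> cj g V = V"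
  by (rule card_subset_eq) auto

lemma nmlD: assumes "nml N H" shows "sub N" "N \<subseteq> H" "h \<in> H \<Longrightarrow> n \<in> N \<Longrightarrow> h + n + - h \<in> N"
  using assms by (auto simp: nml_def)

lemma nml_cj: "nml N H \<Longrightarrow> h \<in> H \<Longrightarrow> cj h N = N"
  by (rule cj_eqI) (auto simp: cj_def nml_def sub_def)

lemma nmlI_cj: "sub N \<Longrightarrow> N \<subseteq> H \<Longrightarrow> (\<And>h. h \<in> H \<Longrightarrow> cj h N \<subseteq> N) \<Longrightarrow> nml N H"
  by (auto simp: nml_def cj_def)

lemma nml_refl: "sub H \<Longrightarrow> nml H H" by (auto simp: nml_def subD)
lemma nml_zero: "sub H \<Longrightarrow> nml {0} H" by (auto simp: nml_def sub_zero subD)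

lemma nml_mono: "nml N H \<Longrightarrow> K \<subseteq> H \<Longrightarrow> N \<subseteq> K \<Longrightarrow> nml N K" by (auto simp: nml_def)

lemma nml_Int: "nml N H \<Longrightarrow> sub K \<Longrightarrow> K \<subseteq> H \<Longrightarrow> nml (N \<inter> K) K"
  unfolding nml_def by (auto simp: sub_Int subD)

lemma nml_Int2: "nml N H \<Longrightarrow> nml M H \<Longrightarrow> nml (N \<inter> M) H"
  unfolding nml_def by (auto simp: sub_Int)

lemma grp_gen: "grp (gen S)" by (auto simp: gen_def grp_def)
lemma gen_inc: "S \<subseteq> gen S" by (auto simp: gen_def)
lemma gen_least: "grp K \<Longrightarrow> S \<subseteq> K \<Longrightarrow> gen S \<subseteq> K" by (auto simp: gen_def)
lemma sub_gen: "sub H \<Longrightarrow> S \<subseteq> H \<Longrightarrow> sub (gen S) \<and> gen S \<subseteq> H"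
  using gen_least[of H S] grp_gen[of S] by (auto simp: sub_def intro: finite_subset)

lemma cj_gen: "cj g (gen S) = gen (cj g S)"
proof
  have "S \<subseteq> cj (-g) (gen (cj g S))" using cj_mono[OF gen_inc[of "cj g S"], of "-g"] by simp
  then have "gen S \<subseteq> cj (-g) (gen (cj g S))" by (intro gen_least grp_cj grp_gen)
  then have "cj g (gen S) \<subseteq> cj g (cj (-g) (gen (cj g S)))" by (rule cj_mono)
  then show "cj g (gen S) \<subseteq> gen (cj g S)" by simp
  show "gen (cj g S) \<subseteq> cj g (gen S)" by (intro gen_least grp_cj grp_gen cj_mono gen_inc)
qed

lemma splusI: "x \<in> V \<Longrightarrow> y \<in> Y \<Longrightarrow> x + y \<in> V \<boxplus> Y" by (auto simp: splus_def)
lemma splusE: assumes "z \<in> V \<boxplus> Y" obtains x y where "x \<in> V" "y \<in> Y" "z = x + y"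
  using assms by (auto simp: splus_def)
lemma splus_assoc: "(V \<boxplus> Y) \<boxplus> Z = V \<boxplus> (Y \<boxplus> Z)"
  unfolding splus_def by (auto simp: gs) (metis add.assoc)+
lemma splus_mono: "V \<subseteq> V' \<Longrightarrow> Y \<subseteq> Y' \<Longrightarrow> V \<boxplus> Y \<subseteq> V' \<boxplus> Y'" by (auto simp: splus_def)
lemma splus_subset: "sub H \<Longrightarrow> V \<subseteq> H \<Longrightarrow> Y \<subseteq> H \<Longrightarrow> V \<boxplus> Y \<subseteq> H"
  by (auto simp: splus_def subset_iff intro!: subD(3))
lemma splus_left: "0 \<in> Y \<Longrightarrow> V \<subseteq> V \<boxplus> Y" unfolding splus_def by force
lemma splus_right: "0 \<in> V \<Longrightarrow> Y \<subseteq> V \<boxplus> Y" unfolding splus_def by force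
lemma cj_splus: "cj g (V \<boxplus> Y) = cj g V \<boxplus> cj g Y"
proof -
  have *: "g + (x + y) + - g = (g + x + - g) + (g + y + - g)" for x y by (simp add: gs)
  show ?thesis
  proof
    show "cj g (V \<boxplus> Y) \<subseteq> cj g V \<boxplus> cj g Y"
      using * by (auto simp: splus_def cj_def simp del: add.assoc)
    show "cj g V \<boxplus> cj g Y \<subseteq> cj g (V \<boxplus> Y)"
    proof
      fix z assume "z \<in> cj g V \<boxplus> cj g Y"
      then obtain x y where "z = (g + x + - g) + (g + y + - g)" "x \<in> V" "y \<in> Y"
        by (auto simp: splus_def cj_def)
      then have "z = g + (x + y) + - g" "x + y \<in> V \<boxplus> Y" using * by (auto intro: splusI)
      then show "z \<in> cj g (V \<boxplus> Y)" unfolding cj_def by blast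
    qed
  qed
qed
lemma finite_splus: "finite V \<Longrightarrow> finite Y \<Longrightarrow> finite (V \<boxplus> Y)"
proof -
  have "V \<boxplus> Y = (\<lambda>(x,y). x+y) ` (V \<times> Y)" by (auto simp: splus_def)
  then show "finite V \<Longrightarrow> finite Y \<Longrightarrow> finite (V \<boxplus> Y)" by simp
qed

lemma minus_splus: "sub V \<Longrightarrow> sub Y \<Longrightarrow> z \<in> V \<boxplus> Y \<Longrightarrow> - z \<in> Y \<boxplus> V"
  unfolding splus_def by (auto simp: minus_add) (use subD(4) in blast)

lemma sub_splus_comm: assumes "sub V" "sub Y" "sub (V \<boxplus> Y)" shows "V \<boxplus> Y = Y \<boxplus> V"
proof
  show "V \<boxplus> Y \<subseteq> Y \<boxplus> V"
    using minus_splus[OF assms(1,2)] subD(4)[OF assms(3)] by (metis minus_minus subsetI)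
  show "Y \<boxplus> V \<subseteq> V \<boxplus> Y"
    using minus_splus[OF assms(2,1)] subD(4)[OF assms(3)] by (metis minus_minus subsetI)
qed

lemma sub_splus: assumes V: "sub V" and Y: "sub Y" and c: "Y \<boxplus> V \<subseteq> V \<boxplus> Y" shows "sub (V \<boxplus> Y)"
proof (rule subI)
  show "finite (V \<boxplus> Y)" by (simp add: finite_splus subD V Y)
  show "0 \<in> V \<boxplus> Y" using splusI[of 0 V 0 Y] V Y by (simp add: subD)
  fix a assume a: "a \<in> V \<boxplus> Y"
  show "- a \<in> V \<boxplus> Y" using minus_splus[OF V Y a] c by blast
  fix b assume b: "b \<in> V \<boxplus> Y"
  obtain x y x' y' where *: "a = x + y" "b = x' + y'" "x \<in> V" "y \<in> Y" "x' \<in> V" "y' \<in> Y"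
    using a b by (auto elim!: splusE)
  have "y + x' \<in> V \<boxplus> Y" using c * splusI by blast
  then obtain x2 y2 where "y + x' = x2 + y2" "x2 \<in> V" "y2 \<in> Y" by (auto elim!: splusE)
  then have "a + b = (x + x2) + (y2 + y')" using * by (metis add.assoc)
  then show "a + b \<in> V \<boxplus> Y" using * \<open>x2 \<in> V\<close> \<open>y2 \<in> Y\<close> by (auto intro!: splusI simp: subD V Y)
qed

lemma sub_splus_norm: assumes V: "sub V" and Y: "sub Y" and n: "\<And>x. x \<in> V \<Longrightarrow> cj x Y \<subseteq> Y"
  shows "sub (V \<boxplus> Y)" "V \<boxplus> Y = Y \<boxplus> V"
proof -
  have "Y \<boxplus> V \<subseteq> V \<boxplus> Y"
  proof
    fix z assume "z \<in> Y \<boxplus> V"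
    then obtain x y where "z = y + x" "x \<in> V" "y \<in> Y" by (auto elim!: splusE)
    moreover have "- x + y + x \<in> Y" using n[of "-x"] \<open>x \<in> V\<close> \<open>y \<in> Y\<close> V by (auto simp: cj_def subD)
    moreover have "y + x = x + (- x + y + x)" by (simp add: gs)
    ultimately show "z \<in> V \<boxplus> Y" by (metis splusI)
  qed
  then show *: "sub (V \<boxplus> Y)" by (rule sub_splus[OF V Y])
  show "V \<boxplus> Y = Y \<boxplus> V" by (rule sub_splus_comm[OF V Y *])
qed

text \<open>The modular law. It supplies the factorisations of subgroups that contain one of the two
  factors.\<close>

lemma dedekind: assumes "sub H" "B \<subseteq> H" "H \<subseteq> A \<boxplus> B" shows "H = (H \<inter> A) \<boxplus> B"
proof
  show "(H \<inter> A) \<boxplus> B \<subseteq> H" using assms by (auto simp: splus_def subD)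
  show "H \<subseteq> (H \<inter> A) \<boxplus> B"
  proof
    fix h assume h: "h \<in> H"
    then obtain a b where "a \<in> A" "b \<in> B" "h = a + b" using assms by (blast elim: splusE)
    moreover then have "a \<in> H" using h assms sub_add_right by blast
    ultimately show "h \<in> (H \<inter> A) \<boxplus> B" by (auto intro: splusI)
  qed
qed

subsection \<open>Cosets and Lagrange\<close>

definition lcos :: "'g::group_add set \<Rightarrow> 'g set \<Rightarrow> 'g set set" where
  "lcos H P = (\<lambda>h. (+) h ` P) ` H"

lemma lc_mem: "(x::'g::group_add) \<in> (+) h ` P \<longleftrightarrow> - h + x \<in> P"
proof
  assume "- h + x \<in> P"
  then have "h + (- h + x) \<in> (+) h ` P" by (rule imageI)
  then show "x \<in> (+) h ` P" by (simp add: gs)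
qed (auto simp: gs)

lemma lc_eq: assumes "sub P" shows "(+) h ` P = (+) k ` P \<longleftrightarrow> - h + k \<in> P"
proof
  assume "(+) h ` P = (+) k ` P"
  then show "- h + k \<in> P" using lc_mem[of k k P] lc_mem[of k h P] subD(2)[OF assms] by simp
next
  assume a: "- h + k \<in> P"
  show "(+) h ` P = (+) k ` P"
  proof (rule Set.set_eqI)
    fix x
    have "- h + x = (- h + k) + (- k + x)" by (simp add: gs)
    then show "x \<in> (+) h ` P \<longleftrightarrow> x \<in> (+) k ` P" using sub_add_left[OF assms a] by (simp add: lc_mem)
  qed
qed

lemma card_lcos_splus: assumes "finite H" "sub P"
  shows "card (lcos H P) * card P = card (H \<boxplus> P)"
proof -
  have U: "H \<boxplus> P = \<Union>(lcos H P)" by (auto simp: lcos_def splus_def)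
  have "card P * card (lcos H P) = card (\<Union>(lcos H P))"
  proof (rule card_partition)
    show "finite (lcos H P)" using assms by (simp add: lcos_def)
    show "finite (\<Union> (lcos H P))" using assms finite_splus U subD by metis
    fix c assume "c \<in> lcos H P"
    then show "card c = card P" by (auto simp: lcos_def intro!: card_image)
  next
    fix c1 c2 assume "c1 \<in> lcos H P" "c2 \<in> lcos H P" "c1 \<noteq> c2"
    then obtain h k where hk: "c1 = (+) h ` P" "c2 = (+) k ` P" by (auto simp: lcos_def)
    show "c1 \<inter> c2 = {}"
    proof (rule ccontr)
      assume "c1 \<inter> c2 \<noteq> {}"
      then obtain x where "x \<in> (+) h ` P" "x \<in> (+) k ` P" using hk by blast
      then have x: "- h + x \<in> P" "- k + x \<in> P" by (simp_all only: lc_mem)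
      have "- h + k = (- h + x) + - (- k + x)" by (simp add: gs)
      then have "- h + k \<in> P" using x assms by (simp add: subD)
      then show False using \<open>c1 \<noteq> c2\<close> hk lc_eq[OF assms(2)] by blast
    qed
  qed
  then show ?thesis by (simp add: U mult.commute)
qed

lemma splus_absorb: "sub H \<Longrightarrow> sub P \<Longrightarrow> P \<subseteq> H \<Longrightarrow> H \<boxplus> P = H"
  using splus_subset[of H H P] splus_left[of P H] subD(2) by blast

lemma card_lcos: "sub H \<Longrightarrow> sub P \<Longrightarrow> P \<subseteq> H \<Longrightarrow> card (lcos H P) * card P = card H"
  using card_lcos_splus[of H P] splus_absorb[of H P] subD(1)[of H] by simp

lemma lagrange_sub: "sub H \<Longrightarrow> sub P \<Longrightarrow> P \<subseteq> H \<Longrightarrow> card P dvd card H"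
  by (metis card_lcos dvd_triv_right)

text \<open>Intersection with \<open>V\<close> matches the cosets \<open>h + Y\<close>,
  \<open>h \<in> V\<close>, with the cosets of \<open>V \<inter> Y\<close> in \<open>V\<close>; both
  products are then counted by cosets.\<close>

lemma card_splus: assumes V: "sub V" and Y: "sub Y"
  shows "card (V \<boxplus> Y) * card (V \<inter> Y) = card V * card Y"
proof -
  have I: "sub (V \<inter> Y)" using assms by (rule sub_Int)
  have "card (lcos V Y) = card (lcos V (V \<inter> Y))"
  proof (rule bij_betw_same_card)
    have 1: "((+) h ` Y) \<inter> V = (+) h ` (V \<inter> Y)" if "h \<in> V" for h
    proof (rule Set.set_eqI)
      fix x show "x \<in> ((+) h ` Y) \<inter> V \<longleftrightarrow> x \<in> (+) h ` (V \<inter> Y)"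
        using sub_add_left[OF V, of "-h" x] subD(4)[OF V that] by (auto simp: lc_mem)
    qed
    show "bij_betw (\<lambda>c. c \<inter> V) (lcos V Y) (lcos V (V \<inter> Y))"
    proof (rule bij_betw_imageI)
      show "(\<lambda>c. c \<inter> V) ` lcos V Y = lcos V (V \<inter> Y)"
        unfolding lcos_def image_image by (rule image_cong) (simp_all add: 1)
      show "inj_on (\<lambda>c. c \<inter> V) (lcos V Y)"
      proof (rule inj_onI)
        fix c d assume "c \<in> lcos V Y" "d \<in> lcos V Y" and e: "c \<inter> V = d \<inter> V"
        then obtain h k where hk: "c = (+) h ` Y" "d = (+) k ` Y" "h \<in> V" "k \<in> V" by (auto simp: lcos_def)
        then have "(+) h ` (V \<inter> Y) = (+) k ` (V \<inter> Y)" using e 1 by simp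
        then have "- h + k \<in> Y" using lc_eq[OF I] by blast
        then show "c = d" using hk lc_eq[OF Y] by blast
      qed
    qed
  qed
  moreover have "card (lcos V Y) * card Y = card (V \<boxplus> Y)" by (rule card_lcos_splus) (simp_all add: assms subD)
  moreover have "card (lcos V (V \<inter> Y)) * card (V \<inter> Y) = card V" by (rule card_lcos) (simp_all add: V I)
  ultimately show ?thesis by (metis mult.assoc mult.commute)
qed

lemma sub_eqI: "sub H \<Longrightarrow> K \<subseteq> H \<Longrightarrow> card H \<le> card K \<Longrightarrow> K = H"
  by (simp add: card_seteq subD)

subsection \<open>Multiples\<close>

lemma tm_add: "tm (m + n) x = tm m x + tm n x" by (induct m) (simp_all add: gs)
lemma tm_mult: "tm (m * n) x = tm m (tm n x)" by (induct m) (simp_all add: tm_add)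
lemma tm_comm: "tm m x + tm n x = tm n x + tm m x" by (metis add.commute tm_add)
lemma tm_1 [simp]: "tm (Suc 0) x = x" by simp
lemma tm_zero [simp]: "tm n 0 = 0" by (induct n) simp_all
lemma tm_mem: "sub H \<Longrightarrow> x \<in> H \<Longrightarrow> tm n x \<in> H" by (induct n) (simp_all add: subD)
lemma tm_cj: "tm n (g + x + - g) = g + tm n x + - g" by (induct n) (simp_all add: gs)
lemma tm_commute: assumes "x + y = y + x" shows "tm n (x + y) = tm n x + tm n y"
    and "tm n x + y = y + tm n x"
proof -
  show 1: "tm n x + y = y + tm n x" for n
    by (induct n) (use assms in \<open>simp_all add: gs\<close>, metis add.assoc)
  show "tm n (x + y) = tm n x + tm n y"
    by (induct n) (use 1 in \<open>simp_all add: gs\<close>, metis 1 add.assoc)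
qed
lemma tm_neg: "tm n (- x) = - tm n x"
proof (induct n)
  case (Suc n)
  have "tm n x + x = x + tm n x" using tm_comm[of n x 1] by simp
  have "tm (Suc n) (- x) = - x + - tm n x" using Suc by simp
  also have "\<dots> = - (tm n x + x)" by (simp add: minus_add)
  also have "\<dots> = - tm (Suc n) x" using \<open>tm n x + x = x + tm n x\<close> by simp
  finally show ?case .
qed simp
lemma tm_eq0_gcd: assumes "tm m x = 0" "tm n x = 0" shows "tm (gcd m n) x = 0"
proof (cases "m = 0")
  case True then show ?thesis using assms by simp
next
  case False
  then obtain a b where "a * m = b * n + gcd m n" using bezout_nat[of m n] by (auto simp: mult.commute)
  then have "tm (a * m) x = tm (b * n) x + tm (gcd m n) x" by (metis tm_add)
  then show ?thesis using assms by (simp add: tm_mult)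
qed
lemma tm_dvd: "tm m x = 0 \<Longrightarrow> m dvd n \<Longrightarrow> tm n x = 0"
  by (metis dvd_def mult.commute tm_mult tm_zero)

text \<open>The bridge to the library's \<open>group\<close> locale, through which the existence of
  Sylow subgroups and the exponent law \<open>tm_card\<close> are imported.\<close>

definition toG :: "'g::group_add set \<Rightarrow> 'g monoid" where
  "toG H = \<lparr>carrier = H, monoid.mult = (+), one = 0\<rparr>"

lemma toG_group: assumes "sub H" shows "group (toG H)"
proof (rule groupI)
  fix x assume "x \<in> carrier (toG H)"
  then show "\<exists>y\<in>carrier (toG H). y \<otimes>\<^bsub>toG H\<^esub> x = \<one>\<^bsub>toG H\<^esub>"
    by (intro bexI[of _ "- x"]) (simp_all add: toG_def subD[OF assms])
qed (simp_all add: toG_def subD[OF assms] gs)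

lemma toG_sub: assumes "sub H" "subgroup K (toG H)" shows "sub K \<and> K \<subseteq> H"
proof -
  interpret group "toG H" by (rule toG_group[OF assms(1)])
  have K: "K \<subseteq> H" using subgroup.subset[OF assms(2)] by (simp add: toG_def)
  have "- x \<in> K" if "x \<in> K" for x
  proof -
    have "inv\<^bsub>toG H\<^esub> x = - x"
      by (rule inv_equality) (use that K in \<open>auto simp: toG_def subD[OF assms(1)]\<close>)
    then show ?thesis using subgroup.m_inv_closed[OF assms(2) that] by simp
  qed
  moreover have "finite K" using K subD(1)[OF assms(1)] finite_subset by blast
  ultimately show ?thesis using K subgroup.one_closed[OF assms(2)] subgroup.m_closed[OF assms(2)]
    by (auto simp: toG_def intro!: subI)
qed

lemma tm_card: assumes "sub H" "x \<in> H" shows "tm (card H) x = 0"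
proof -
  interpret group "toG H" by (rule toG_group[OF assms(1)])
  have pw: "x [^]\<^bsub>toG H\<^esub> n = tm n x" for n
  proof (induct n)
    case (Suc n)
    have "x [^]\<^bsub>toG H\<^esub> Suc n = tm n x + x" using Suc by (simp add: toG_def)
    also have "\<dots> = tm (Suc n) x" using tm_comm[of n x 1] by simp
    finally show ?case .
  qed (simp add: toG_def)
  have "x [^]\<^bsub>toG H\<^esub> Coset.order (toG H) = \<one>\<^bsub>toG H\<^esub>"
    by (rule pow_order_eq_1) (use assms in \<open>auto simp: toG_def\<close>)
  then show ?thesis by (simp add: pw) (simp add: toG_def Coset.order_def)
qed

lemma sylow_exists: assumes "sub H" "Factorial_Ring.prime (p::nat)"
  obtains P where "sub P" "P \<subseteq> H" "card P = p ^ multiplicity p (card H)"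
proof -
  have "\<not> is_unit p" using assms(2) by (auto dest: not_prime_unit)
  then obtain m where m: "card H = p ^ multiplicity p (card H) * m"
    by (metis dvdE multiplicity_dvd)
  interpret group "toG H" by (rule toG_group[OF assms(1)])
  have "\<exists>P. subgroup P (toG H) \<and> card P = p ^ multiplicity p (card H)"
    by (rule Sylow.sylow_thm[of _ _ _ m]) (use assms m is_group in \<open>auto simp: toG_def Coset.order_def subD\<close>)
  then show ?thesis using that toG_sub[OF assms(1)] by blast
qed

subsection \<open>Groups of prime power order acting on finite sets\<close>

text \<open>An orbit with more than one point has the index of a proper stabiliser as its size, a
  power of \<open>p\<close> other than 1. The action \<open>f\<close> is a plain function with laws
  on \<open>S\<close>, so that cosets, subgroups and elements can all be the points.\<close>

lemma pgroup_fixed_points: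
  assumes P: "sub P" "card P = p ^ a" and p: "Factorial_Ring.prime (p::nat)" and S: "finite S"
    and f0: "\<And>s. s \<in> S \<Longrightarrow> f 0 s = s"
    and fadd: "\<And>x y s. x \<in> P \<Longrightarrow> y \<in> P \<Longrightarrow> s \<in> S \<Longrightarrow> f (x + y) s = f x (f y s)"
    and fS: "\<And>x s. x \<in> P \<Longrightarrow> s \<in> S \<Longrightarrow> f x s \<in> S"
  shows "\<exists>k. card S = card {s \<in> S. \<forall>x\<in>P. f x s = s} + p * k"
proof -
  define Ob where "Ob s = (\<lambda>x. f x s) ` P" for s
  define F where "F = {s \<in> S. \<forall>x\<in>P. f x s = s}"
  note P' = subD[OF P(1)]
  have inO: "s \<in> Ob s" if "s \<in> S" for s using imageI[OF P'(2), of "\<lambda>x. f x s"] f0[OF that] by (simp add: Ob_def)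
  have cancel: "f (- x) (f x s) = s" if "x \<in> P" "s \<in> S" for x s
    using fadd[of "-x" x s] that P'(4) f0 by simp
  have Oeq: "Ob t = Ob s" if tO: "t \<in> Ob s" and "s \<in> S" for t s
  proof -
    obtain x where x: "x \<in> P" "t = f x s" using tO unfolding Ob_def by blast
    have 1: "f y t = f (y + x) s" if "y \<in> P" for y using fadd[of y x s] x that \<open>s \<in> S\<close> by simp
    have 2: "f y s = f (y + - x) t" if "y \<in> P" for y
      using fadd[of y "-x" "f x s"] x that \<open>s \<in> S\<close> P'(4) cancel fS by simp
    have "f y t \<in> Ob s" if "y \<in> P" for y unfolding Ob_def 1[OF that] using x that P'(3) by (intro imageI)
    moreover have "f y s \<in> Ob t" if "y \<in> P" for y unfolding Ob_def 2[OF that] using x that P'(3,4) by (intro imageI) simp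
    ultimately show ?thesis by (intro equalityI) (auto simp: Ob_def)
  qed
  have Odvd: "p dvd card (Ob s)" if s: "s \<in> S - F" for s
  proof -
    define St where "St = {x \<in> P. f x s = s}"
    have sS: "s \<in> S" using s by simp
    have subSt: "sub St"
    proof (rule subI)
      fix x assume "x \<in> St" then show "- x \<in> St" using cancel[of x s] sS P'(4) by (auto simp: St_def)
    qed (use sS P' f0 fadd in \<open>auto simp: St_def\<close>)
    \<comment> \<open>The fibres of the orbit map are the cosets of the stabiliser, which gives the
      orbit its size.\<close>
    have fib: "{x \<in> P. f x s = f y s} = (+) y ` St" if y: "y \<in> P" for y
    proof (rule Set.set_eqI)
      fix x
      have "f x s = f y s \<longleftrightarrow> f (- y + x) s = s" if "x \<in> P"
      proof
        assume "f x s = f y s"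
        then show "f (- y + x) s = s" using fadd[of "-y" x s] y that sS P'(4) cancel by simp
      next
        assume "f (- y + x) s = s"
        then have "f y (f (- y + x) s) = f y s" by simp
        then show "f x s = f y s" using fadd[of y "-y+x" s] y that sS P' by (simp add: gs)
      qed
      moreover have "x \<in> P \<longleftrightarrow> - y + x \<in> P" using sub_add_left[OF P(1), of "-y" x] P'(4) y by simp
      ultimately show "x \<in> {x \<in> P. f x s = f y s} \<longleftrightarrow> x \<in> (+) y ` St"
        by (auto simp: lc_mem St_def)
    qed
    have "lcos P St = (\<lambda>t. {x \<in> P. f x s = t}) ` Ob s"
      unfolding lcos_def Ob_def image_image by (rule image_cong) (simp_all add: fib)
    moreover have "inj_on (\<lambda>t. {x \<in> P. f x s = t}) (Ob s)"
      by (rule inj_onI) (auto simp: Ob_def)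
    ultimately have "card (lcos P St) = card (Ob s)" by (simp add: card_image)
    then have d: "card (Ob s) * card St = p ^ a"
      using card_lcos[OF P(1) subSt] P(2) by (auto simp: St_def)
    then have "card (Ob s) dvd p ^ a" by (metis dvd_triv_left)
    then obtain b where b: "card (Ob s) = p ^ b" using divides_primepow_nat[OF p] by blast
    have "b \<noteq> 0"
    proof
      assume "b = 0"
      then obtain t where "Ob s = {t}" using b card_1_singletonE by auto
      then have "Ob s = {s}" using inO[OF sS] by auto
      then have "s \<in> F" using sS by (auto simp: Ob_def F_def)
      then show False using s by simp
    qed
    then show ?thesis using b by simp
  qed
  have "p dvd card (\<Union>(Ob ` (S - F)))"
  proof (rule dvd_partition)
    show "finite (\<Union>(Ob ` (S - F)))" using S P'(1) by (auto simp: Ob_def)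
    show "\<forall>c\<in>Ob ` (S - F). p dvd card c" using Odvd by blast
    show "\<forall>c1\<in>Ob ` (S - F). \<forall>c2\<in>Ob ` (S - F). c1 \<noteq> c2 \<longrightarrow> c1 \<inter> c2 = {}"
    proof clarify
      fix s t assume "s \<in> S" "t \<in> S" "Ob s \<noteq> Ob t"
      then show "Ob s \<inter> Ob t = {}" using Oeq[of _ s] Oeq[of _ t] by blast
    qed
  qed
  moreover have "\<Union>(Ob ` (S - F)) = S - F"
  proof
    show "S - F \<subseteq> \<Union>(Ob ` (S - F))" using inO by blast
    show "\<Union>(Ob ` (S - F)) \<subseteq> S - F"
    proof clarify
      fix s t assume s: "s \<in> S" "s \<notin> F" "t \<in> Ob s"
      have tS: "t \<in> S" using s fS by (auto simp: Ob_def)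
      have "t \<notin> F"
      proof
        assume "t \<in> F"
        then have "Ob t \<subseteq> {t}" by (auto simp: Ob_def F_def)
        then have "s = t" using Oeq[OF s(3,1)] inO[OF s(1)] by blast
        then show False using \<open>t \<in> F\<close> s by simp
      qed
      then show "t \<in> S - F" using tS by simp
    qed
  qed
  ultimately have "p dvd card (S - F)" by (simp only:)
  then obtain k where "card (S - F) = p * k" by (rule dvdE)
  moreover have "card S = card F + card (S - F)"
    using card_Diff_subset[of F S] card_mono[of S F] S finite_subset[of F S] by (auto simp: F_def)
  ultimately show ?thesis by (auto simp: F_def)
qed

lemma pgroup_fix_exists:
  assumes P: "sub P" "card P = p ^ a" and p: "Factorial_Ring.prime (p::nat)" and S: "finite S"
    and f0: "\<And>s. s \<in> S \<Longrightarrow> f 0 s = s"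
    and fadd: "\<And>x y s. x \<in> P \<Longrightarrow> y \<in> P \<Longrightarrow> s \<in> S \<Longrightarrow> f (x + y) s = f x (f y s)"
    and fS: "\<And>x s. x \<in> P \<Longrightarrow> s \<in> S \<Longrightarrow> f x s \<in> S"
    and nd: "\<not> p dvd card S"
  shows "\<exists>s\<in>S. \<forall>x\<in>P. f x s = s"
proof (rule ccontr)
  assume "\<not> ?thesis"
  then have "{s \<in> S. \<forall>x\<in>P. f x s = s} = {}" by blast
  then have "card {s \<in> S. \<forall>x\<in>P. f x s = s} = 0" by (simp only: card.empty)
  with pgroup_fixed_points[of P p a S f, OF P p S f0 fadd fS] show False using nd by auto
qed

subsection \<open>Sylow subgroups\<close>

definition syl :: "nat \<Rightarrow> 'g::group_add set \<Rightarrow> 'g set \<Rightarrow> bool" where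
  "syl p P H \<longleftrightarrow> sub P \<and> P \<subseteq> H \<and> card P = p ^ multiplicity p (card H)"

definition pgrp :: "nat \<Rightarrow> 'g::group_add set \<Rightarrow> bool" where
  "pgrp p P \<longleftrightarrow> sub P \<and> (\<exists>a. card P = p ^ a)"

definition nrm :: "'g::group_add set \<Rightarrow> 'g set \<Rightarrow> 'g set" where
  "nrm H V = {h \<in> H. cj h V = V}"

definition cen :: "'g::group_add set \<Rightarrow> 'g set \<Rightarrow> 'g set" where
  "cen H V = {h \<in> H. \<forall>v\<in>V. h + v = v + h}"

lemma syl_pgrp: "syl p P H \<Longrightarrow> pgrp p P" by (auto simp: syl_def pgrp_def)

lemma sub_nrm: assumes "sub H" shows "sub (nrm H V)"
proof (rule subI)
  fix x y assume "x \<in> nrm H V" "y \<in> nrm H V"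
  then have "cj (x + y) V = V" "x + y \<in> H" using assms cj_cj[of x y V] by (auto simp: nrm_def subD)
  then show "x + y \<in> nrm H V" by (simp add: nrm_def)
next
  fix x assume x: "x \<in> nrm H V"
  then have "cj (-x) (cj x V) = cj (-x) V" by (simp add: nrm_def del: cj_cj)
  then have "cj (-x) V = V" by simp
  then show "- x \<in> nrm H V" using x assms by (simp add: nrm_def subD)
qed (use assms in \<open>auto simp: nrm_def subD\<close>)

lemma sub_cen: assumes "sub H" shows "sub (cen H V)"
proof (rule subI)
  fix x y assume a: "x \<in> cen H V" "y \<in> cen H V"
  show "x + y \<in> cen H V" unfolding cen_def
  proof (intro CollectI conjI ballI)
    fix v assume v: "v \<in> V"
    have "y + v = v + y" using a v by (simp add: cen_def)
    then have "x + y + v = x + v + y" by (metis add.assoc)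
    also have "x + v = v + x" using a v by (simp add: cen_def)
    also have "v + x + y = v + (x + y)" by (simp add: add.assoc)
    finally show "x + y + v = v + (x + y)" .
  qed (use a assms in \<open>simp add: cen_def subD\<close>)
next
  fix x assume x: "x \<in> cen H V"
  show "- x \<in> cen H V" unfolding cen_def
  proof (intro CollectI conjI ballI)
    fix v assume "v \<in> V"
    then have "- x + (x + v) + - x = - x + (v + x) + - x" using x by (simp add: cen_def)
    then show "- x + v = v + - x" by (simp add: gs)
  qed (use x assms in \<open>simp add: cen_def subD\<close>)
qed (use assms in \<open>auto simp: cen_def subD\<close>)

lemma nrm_sub: "nrm H V \<subseteq> H" by (auto simp: nrm_def)
lemma cen_sub: "cen H V \<subseteq> H" by (auto simp: cen_def)
lemma cen_cj_id: "(h::'g::group_add) + v = v + h \<Longrightarrow> h + v + - h = v" by (simp add: gs)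
lemma cen_iff: "(h::'g::group_add) + v = v + h \<longleftrightarrow> h + v + - h = v"
proof
  assume "h + v + - h = v"
  then have "(h + v + - h) + h = v + h" by simp
  then show "h + v = v + h" by (simp add: gs)
qed (rule cen_cj_id)

lemma cen_nrm: "cen H V \<subseteq> nrm H V"
proof
  fix h assume h: "h \<in> cen H V"
  then have "cj h V = (\<lambda>v. v) ` V" unfolding cj_def by (intro image_cong refl cen_cj_id) (simp add: cen_def)
  then show "h \<in> nrm H V" using h by (simp add: nrm_def cen_def)
qed

lemma nrm_self: "sub H \<Longrightarrow> sub V \<Longrightarrow> V \<subseteq> H \<Longrightarrow> V \<subseteq> nrm H V"
  by (auto simp: nrm_def sub_cj_self)

lemma nml_nrm: "sub H \<Longrightarrow> sub V \<Longrightarrow> V \<subseteq> H \<Longrightarrow> nml V (nrm H V)"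
  by (intro nmlI_cj) (auto simp: nrm_self, auto simp: nrm_def)

lemma cen_cj_mem: assumes "h \<in> H" "sub H" "cj h V = V" "x \<in> cen H V" shows "h + x + - h \<in> cen H V"
  unfolding cen_def
proof (intro CollectI conjI ballI)
  show "h + x + - h \<in> H" using assms by (simp add: cen_def subD)
  fix v assume v: "v \<in> V"
  then have "v \<in> cj h V" using assms by simp
  then have w: "- h + v + h \<in> V" by (simp add: cj_mem)
  have "h + x + - h + v = h + (x + (- h + v + h)) + - h" by (simp add: gs)
  also have "\<dots> = h + ((- h + v + h) + x) + - h" using assms(4) w by (simp add: cen_def)
  also have "\<dots> = v + (h + x + - h)" by (simp add: gs)
  finally show "h + x + - h + v = v + (h + x + - h)" .
qed

lemma nml_cen: "nml V H \<Longrightarrow> sub H \<Longrightarrow> nml (cen H V) H"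
  unfolding nml_def using cen_cj_mem[of _ H V] nml_cj[of V H] by (auto simp: sub_cen cen_sub nml_def dest: subsetD[OF cen_sub])

lemma nml_cen_nrm: "sub H \<Longrightarrow> nml (cen H V) (nrm H V)"
  unfolding nml_def using cen_cj_mem[of _ H V] cen_nrm[of H V] by (auto simp: sub_cen nrm_def)

lemma mult_le: "sub H \<Longrightarrow> sub K \<Longrightarrow> K \<subseteq> H \<Longrightarrow> multiplicity p (card K) \<le> multiplicity p (card H)"
  by (metis dvd_imp_multiplicity_le lagrange_sub sub_card_pos less_numeral_extra(3))

lemma mult_pow: "Factorial_Ring.prime (p::nat) \<Longrightarrow> multiplicity p (p ^ a) = a"
  by (metis multiplicity_same_power not_prime_0 not_prime_unit)

lemma syl_mult: "Factorial_Ring.prime p \<Longrightarrow> syl p P H \<Longrightarrow> multiplicity p (card P) = multiplicity p (card H)"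
  by (simp add: syl_def mult_pow)

lemma syl_between: assumes "Factorial_Ring.prime p" "syl p P H" "sub H" "sub K" "P \<subseteq> K" "K \<subseteq> H" shows "syl p P K"
proof -
  have "multiplicity p (card K) \<le> multiplicity p (card H)" by (rule mult_le) fact+
  moreover have "multiplicity p (card P) \<le> multiplicity p (card K)" by (rule mult_le) (use assms in \<open>auto simp: syl_def\<close>)
  ultimately show ?thesis using assms syl_mult[OF assms(1,2)] by (simp add: syl_def)
qed

lemma sylI: assumes p: "Factorial_Ring.prime p" and "pgrp p P" "P \<subseteq> H" "sub H" "multiplicity p (card H) \<le> multiplicity p (card P)"
  shows "syl p P H"
proof -
  obtain a where a: "card P = p ^ a" "sub P" using assms by (auto simp: pgrp_def)
  have "multiplicity p (card P) = multiplicity p (card H)" using mult_le[of H P p] assms a by simp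
  then show ?thesis using a assms by (simp add: syl_def mult_pow)
qed

lemma sylI_nd: assumes p: "Factorial_Ring.prime p" and P: "pgrp p P" "P \<subseteq> H" "sub H" and nd: "card H = card P * m" "\<not> p dvd m"
  shows "syl p P H"
proof (rule sylI[OF p P])
  have "m > 0" using nd by (cases m) auto
  then have "multiplicity p (card H) = multiplicity p (card P)"
    using nd p P sub_card_pos[of P] by (simp add: prime_elem_multiplicity_mult_distrib not_dvd_imp_multiplicity_0 pgrp_def)
  then show "multiplicity p (card H) \<le> multiplicity p (card P)" by simp
qed

lemma syl_index: assumes "Factorial_Ring.prime p" "syl p P H" "sub H" "card H = m * card P" shows "\<not> p dvd m"
proof
  assume "p dvd m"
  then have "p * card P dvd card H" using assms(4) by (simp add: mult_dvd_mono)
  then have "p ^ Suc (multiplicity p (card H)) dvd card H" using assms(2) by (simp add: syl_def)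
  moreover have "card H \<noteq> 0" using sub_card_pos[OF assms(3)] by simp
  moreover have "\<not> is_unit p" using assms(1) not_prime_unit by blast
  ultimately have "Suc (multiplicity p (card H)) \<le> multiplicity p (card H)"
    using multiplicity_geI by blast
  then show False by simp
qed

text \<open>\<open>Q\<close> acts by translation on the cosets of \<open>P\<close>, whose number is
  prime to \<open>p\<close>. That a coset \<open>h + P\<close> is fixed means that \<open>Q\<close>
  lies in the conjugate of \<open>P\<close> by \<open>h\<close>.\<close>

lemma sylow_sub_conj:
  assumes p: "Factorial_Ring.prime p" and H: "sub H" and P: "syl p P H" and Q: "pgrp p Q" "Q \<subseteq> H"
  obtains h where "h \<in> H" "Q \<subseteq> cj h P"
proof -
  have P': "sub P" "P \<subseteq> H" using P by (auto simp: syl_def)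
  have QS: "sub Q" using Q by (simp add: pgrp_def)
  obtain b where b: "card Q = p ^ b" using Q by (auto simp: pgrp_def)
  have nd: "\<not> p dvd card (lcos H P)"
    by (rule syl_index[OF p P H]) (use card_lcos[OF H P'] in simp)
  define f where "f x c = (+) x ` c" for x :: 'a and c
  have fl: "f x ((+) h ` P) = (+) (x + h) ` P" for x h
    by (simp add: f_def image_image gs)
  have "\<exists>c\<in>lcos H P. \<forall>x\<in>Q. f x c = c"
  proof (rule pgroup_fix_exists[OF QS b p _ _ _ _ nd])
    show "finite (lcos H P)" using H by (simp add: lcos_def subD)
    fix c assume "c \<in> lcos H P"
    then obtain h where h: "h \<in> H" "c = (+) h ` P" by (auto simp: lcos_def)
    show "f 0 c = c" by (simp add: h fl)
    show "f (x + y) c = f x (f y c)" for x y by (simp only: h fl add.assoc)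
    show "f x c \<in> lcos H P" if "x \<in> Q" for x
      using h that Q(2) H by (auto simp: fl lcos_def subD)
  qed
  then obtain h where h: "h \<in> H" "\<And>x. x \<in> Q \<Longrightarrow> f x ((+) h ` P) = (+) h ` P" by (auto simp: lcos_def)
  have "Q \<subseteq> cj h P"
  proof
    fix x assume "x \<in> Q"
    then have "(+) h ` P = (+) (x + h) ` P" using h(2) fl by metis
    then have "- h + (x + h) \<in> P" by (simp only: lc_eq[OF P'(1)])
    then show "x \<in> cj h P" by (simp add: cj_mem gs)
  qed
  then show ?thesis using that h by blast
qed

lemma sylow_conj:
  assumes p: "Factorial_Ring.prime p" and H: "sub H" and P: "syl p P H" and Q: "syl p Q H"
  obtains h where "h \<in> H" "Q = cj h P"
proof -
  obtain h where h: "h \<in> H" "Q \<subseteq> cj h P"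
    using sylow_sub_conj[OF p H P, of Q] Q by (auto simp: syl_def pgrp_def)
  have "finite (cj h P)" using P by (simp add: syl_def subD)
  then have "Q = cj h P" using h P Q by (intro card_subset_eq) (auto simp: syl_def)
  then show ?thesis using that h by blast
qed

lemma syl_cj: "sub H \<Longrightarrow> h \<in> H \<Longrightarrow> syl p P H \<Longrightarrow> syl p (cj h P) H"
  by (auto simp: syl_def sub_cj cj_sub_mem dest: subsetD[OF cj_sub_mem])

lemma syl_cj2: "syl p P H \<Longrightarrow> syl p (cj g P) (cj g H)"
  by (auto simp: syl_def sub_cj intro: cj_mono dest: subsetD[OF cj_mono])

text \<open>The Frattini argument: \<open>cj h P\<close> is again a Sylow subgroup of the normal
  subgroup \<open>N\<close>, so an element of \<open>N\<close> carries it back to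
  \<open>P\<close>.\<close>

lemma frattini:
  assumes p: "Factorial_Ring.prime p" and N: "nml N H" and P: "syl p P N" and h: "h \<in> H"
  obtains n where "n \<in> N" "cj (n + h) P = P"
proof -
  have "syl p (cj h P) N" using syl_cj2[OF P, of h] nml_cj[OF N h] by simp
  then obtain n where n: "n \<in> N" "P = cj n (cj h P)" using sylow_conj[OF p _ _ P, of "cj h P"] nmlD(1)[OF N] by blast
  then show ?thesis using that by simp
qed

lemma mult_splus: assumes p: "Factorial_Ring.prime p" and "sub A" "sub B"
  shows "multiplicity p (card (A \<boxplus> B)) + multiplicity p (card (A \<inter> B)) = multiplicity p (card A) + multiplicity p (card B)"
proof -
  have "card (A \<boxplus> B) * card (A \<inter> B) = card A * card B" "card A > 0" "card B > 0"
    using assms by (simp_all add: card_splus sub_card_pos)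
  then show ?thesis
    by (metis p mult_is_0 not_gr0 prime_elem_multiplicity_mult_distrib prime_imp_prime_elem)
qed

lemma pgrp_sub: assumes p: "Factorial_Ring.prime p" and "pgrp p P" "sub Q" "Q \<subseteq> P" shows "pgrp p Q"
proof -
  obtain a where "card P = p ^ a" "sub P" using assms by (auto simp: pgrp_def)
  then have "card Q dvd p ^ a" using lagrange_sub[of P Q] assms by simp
  then show ?thesis using divides_primepow_nat[OF p] assms(3) by (auto simp: pgrp_def)
qed

text \<open>The subgroup \<open>P \<boxplus> N\<close> of \<open>H\<close> has no larger
  \<open>p\<close>-part than \<open>P\<close>; by the product formula the \<open>p\<close>-part of
  \<open>N\<close> is then no larger than that of \<open>P \<inter> N\<close>.\<close>

lemma syl_nml: assumes p: "Factorial_Ring.prime p" and H: "sub H" and N: "nml N H" and P: "syl p P H"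
  shows "syl p (P \<inter> N) N"
proof -
  have NS: "sub N" "N \<subseteq> H" using N by (auto simp: nml_def)
  have PS: "sub P" "P \<subseteq> H" using P by (auto simp: syl_def)
  have PN: "sub (P \<boxplus> N)" by (rule sub_splus_norm) (use NS PS nml_cj[OF N] in auto)
  have le: "P \<boxplus> N \<subseteq> H" using H PS NS by (simp add: splus_subset)
  have "multiplicity p (card (P \<boxplus> N)) \<le> multiplicity p (card H)" by (rule mult_le) fact+
  moreover have "multiplicity p (card P) = multiplicity p (card H)" by (rule syl_mult) fact+
  ultimately have "multiplicity p (card N) \<le> multiplicity p (card (P \<inter> N))"
    using mult_splus[OF p PS(1) NS(1)] by simp
  then show ?thesis using p pgrp_sub[OF p syl_pgrp[OF P], of "P \<inter> N"] NS PS by (intro sylI) (auto simp: sub_Int)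
qed

subsection \<open>Elements of prime power order and nilpotent groups\<close>

definition pel :: "nat \<Rightarrow> 'g::group_add \<Rightarrow> bool" where
  "pel p x \<longleftrightarrow> (\<exists>k. tm (p ^ k) x = 0)"

definition pt :: "nat \<Rightarrow> 'g::group_add set \<Rightarrow> 'g set" where
  "pt p H = {x \<in> H. pel p x}"

text \<open>A finite group is nilpotent iff for each prime its elements of \<open>p\<close>-power order form a subgroup.\<close>

definition nil :: "'g::group_add set \<Rightarrow> bool" where
  "nil H \<longleftrightarrow> sub H \<and> (\<forall>p. Factorial_Ring.prime p \<longrightarrow> sub (pt p H))"

lemma pel_0 [simp]: "pel p 0" by (simp add: pel_def)
lemma pel_minus: "pel p x \<Longrightarrow> pel p (- x)" by (auto simp: pel_def tm_neg)
lemma pel_cj [simp]: "pel p (g + x + - g) \<longleftrightarrow> pel p x"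
proof -
  have "g + y + - g = 0 \<longleftrightarrow> y = 0" for y
  proof
    assume "g + y + - g = 0"
    then have "- g + (g + y + - g) + g = - g + 0 + g" by simp
    then show "y = 0" by (simp add: gs)
  qed simp
  then show ?thesis by (simp add: pel_def tm_cj)
qed
lemma pel_tm: "pel p x \<Longrightarrow> pel p (tm n x)"
  unfolding pel_def by (metis mult.commute tm_mult tm_zero)

lemma pt_sub: "pt p H \<subseteq> H" by (auto simp: pt_def)
lemma pt_0: "sub H \<Longrightarrow> 0 \<in> pt p H" by (simp add: pt_def subD)
lemma pt_mono: "K \<subseteq> H \<Longrightarrow> pt p K \<subseteq> pt p H" by (auto simp: pt_def)
lemma pt_Int: "K \<subseteq> H \<Longrightarrow> pt p K = pt p H \<inter> K" by (auto simp: pt_def)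
lemma pt_cj: "cj g (pt p H) = pt p (cj g H)"
proof -
  have "pel p (- g + x + g) \<longleftrightarrow> pel p x" for x using pel_cj[of p "- g" x] by (simp del: pel_cj)
  then show ?thesis by (simp add: set_eq_iff cj_mem pt_def)
qed
lemma pt_nml: "sub (pt p H) \<Longrightarrow> sub H \<Longrightarrow> nml (pt p H) H"
  unfolding nml_def by (auto simp: pt_def subD)

lemma coprime_zero: assumes "tm m x = 0" "tm n x = 0" "coprime m n" shows "x = 0"
  using tm_eq0_gcd[OF assms(1,2)] assms(3) by simp

lemma pel_coprime: "Factorial_Ring.prime p \<Longrightarrow> Factorial_Ring.prime q \<Longrightarrow> p \<noteq> q \<Longrightarrow> pel p x \<Longrightarrow> pel q x \<Longrightarrow> x = 0"
  unfolding pel_def by (metis coprime_zero coprime_power_left_iff coprime_power_right_iff primes_coprime)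

lemma pgrp_pel: "pgrp p P \<Longrightarrow> x \<in> P \<Longrightarrow> pel p x"
  unfolding pgrp_def pel_def by (metis tm_card)

lemma cauchy: assumes H: "sub H" and p: "Factorial_Ring.prime (p::nat)" "p dvd card H"
  obtains x where "x \<in> H" "x \<noteq> 0" "tm p x = 0"
proof -
  obtain P where P: "sub P" "P \<subseteq> H" "card P = p ^ multiplicity p (card H)"
    using sylow_exists[OF H p(1)] by blast
  have "multiplicity p (card H) > 0"
    using p sub_card_pos[OF H] by (subst prime_multiplicity_gt_zero_iff) auto
  then have "card P \<noteq> 1" using P(3) p(1) by (simp add: prime_nat_iff)
  then have "P \<noteq> {0}" using sub_card1[OF P(1)] by blast
  then obtain x where x: "x \<in> P" "x \<noteq> 0" using subD(2)[OF P(1)] by blast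
  have "pel p x" using P x by (intro pgrp_pel[of p P]) (auto simp: pgrp_def)
  define k where "k = (LEAST k. tm (p ^ k) x = 0)"
  have k: "tm (p ^ k) x = 0" unfolding k_def using \<open>pel p x\<close> by (auto simp: pel_def intro: LeastI)
  obtain j where j: "k = Suc j" using k x by (cases k) auto
  have "tm (p ^ j) x \<noteq> 0" using j not_less_Least[of j "\<lambda>k. tm (p ^ k) x = 0"] by (simp add: k_def)
  moreover have "tm p (tm (p ^ j) x) = 0" using k j by (simp flip: tm_mult)
  moreover have "tm (p ^ j) x \<in> H" using x P H by (auto intro: tm_mem)
  ultimately show ?thesis using that by blast
qed

lemma pgrpI_pel: assumes H: "sub H" and p: "Factorial_Ring.prime (p::nat)" and e: "\<And>x. x \<in> H \<Longrightarrow> pel p x" shows "pgrp p H"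
proof (rule ccontr)
  assume n: "\<not> pgrp p H"
  have nu: "\<not> is_unit p" using p not_prime_unit by blast
  obtain m where m: "card H = p ^ multiplicity p (card H) * m" by (metis dvdE multiplicity_dvd)
  have "m \<noteq> 1" using n m H by (auto simp: pgrp_def)
  then obtain q where q: "Factorial_Ring.prime q" "q dvd m" using prime_factor_nat by blast
  have "\<not> p dvd m"
    using m multiplicity_decompose[of "card H" p] sub_card_pos[OF H] nu
    by (metis nonzero_mult_div_cancel_left mult_is_0 not_gr0)
  then have qp: "q \<noteq> p" using q by auto
  have "q dvd card H" using m q by (metis dvd_mult)
  then obtain x where "x \<in> H" "x \<noteq> 0" "tm q x = 0" using cauchy[OF H q(1)] by blast
  moreover then have "pel q x" by (auto simp: pel_def intro: exI[of _ 1])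
  ultimately show False using pel_coprime[OF q(1) p qp] e by blast
qed

lemma nilD: assumes "nil H" shows "sub H" "Factorial_Ring.prime p \<Longrightarrow> sub (pt p H)"
  using assms by (auto simp: nil_def)

lemma nil_sub: assumes "nil H" "sub K" "K \<subseteq> H" shows "nil K"
  unfolding nil_def using assms by (auto simp: pt_Int[of K H] sub_Int nilD)

lemma nil_pgrp: "Factorial_Ring.prime p \<Longrightarrow> nil H \<Longrightarrow> pgrp p (pt p H)"
  by (intro pgrpI_pel) (auto dest: nilD, auto simp: pt_def)

lemma nil_syl: assumes "Factorial_Ring.prime p" "nil H" shows "syl p (pt p H) H"
proof -
  obtain P where P: "sub P" "P \<subseteq> H" "card P = p ^ multiplicity p (card H)"
    using sylow_exists[OF nilD(1)[OF assms(2)] assms(1)] by blast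
  then have "P \<subseteq> pt p H" using pgrp_pel[of p P] by (auto simp: pt_def pgrp_def)
  then have "multiplicity p (card P) \<le> multiplicity p (card (pt p H))" using mult_le nilD assms P(1) by blast
  then show ?thesis using assms P by (intro sylI nil_pgrp) (auto simp: pt_def nilD mult_pow)
qed

lemma nil_nml: "Factorial_Ring.prime p \<Longrightarrow> nil H \<Longrightarrow> nml (pt p H) H"
  by (simp add: pt_nml nilD)

lemma nml_pt: assumes "nml N H" "nil N" "Factorial_Ring.prime p" shows "nml (pt p N) H"
proof (rule nmlI_cj)
  show "sub (pt p N)" using assms nilD by blast
  show "pt p N \<subseteq> H" using assms by (auto simp: nml_def pt_def)
  show "cj h (pt p N) \<subseteq> pt p N" if "h \<in> H" for h using nml_cj[OF assms(1) that] by (simp add: pt_cj)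
qed

lemma nml_commute: assumes "nml M H" "nml N H" "M \<inter> N = {0}" "m \<in> M" "n \<in> N" shows "m + n = n + m"
proof -
  have mH: "m \<in> H" "n \<in> H" using assms by (auto simp: nml_def)
  have "m + n + - m \<in> N" using assms mH by (simp add: nmlD)
  then have 1: "m + n + - m + - n \<in> N" using assms by (simp add: nml_def subD)
  have "n + - m + - n \<in> M" using assms mH by (simp add: nml_def subD)
  then have "m + (n + - m + - n) \<in> M" using assms by (simp add: nml_def subD)
  then have "m + n + - m + - n = 0" using 1 assms(3) by (auto simp: gs)
  then have "(m + n + - m + - n) + n + m = n + m" by simp
  then show ?thesis by (simp add: gs)
qed

lemma pt_disj: "Factorial_Ring.prime p \<Longrightarrow> Factorial_Ring.prime q \<Longrightarrow> p \<noteq> q \<Longrightarrow> sub H \<Longrightarrow> sub K \<Longrightarrow> pt p H \<inter> pt q K = {0}"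
  using pel_coprime[of p q] by (auto simp: pt_def subD)

lemma pt_commute: assumes "nil H" "Factorial_Ring.prime p" "Factorial_Ring.prime q" "p \<noteq> q" "x \<in> pt p H" "y \<in> pt q H"
  shows "x + y = y + x"
  by (rule nml_commute[of "pt p H" H "pt q H"]) (use assms pt_disj[of p q H H] nilD nil_nml in auto)

text \<open>Splits off a \<open>p\<close>-part and leaves a summand of smaller exponent
  \<open>m\<close>. Both summands are multiples of \<open>x\<close>, so the induction in
  \<open>parts_gen\<close> stays inside the group.\<close>

lemma tm_split: assumes "n > 1" "Factorial_Ring.prime (p::nat)" "p dvd n" "tm n x = 0"
  obtains i j m where "x = tm i x + tm j x" "pel p (tm i x)" "tm m (tm j x) = 0" "0 < m" "m < n"
proof -
  define a where "a = multiplicity p n"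
  obtain m where m: "n = p ^ a * m" by (metis a_def dvdE multiplicity_dvd)
  have nu: "\<not> is_unit p" using assms(2) not_prime_unit by blast
  have ndm: "\<not> p dvd m"
    using m multiplicity_decompose[of n p] assms(1) nu unfolding a_def
    by (metis nonzero_mult_div_cancel_left mult_is_0 not_one_less_zero)
  then have cop: "coprime (p ^ a) m" using assms(2) by (simp add: prime_imp_coprime)
  have "a > 0" unfolding a_def using assms(1-3) by (subst prime_multiplicity_gt_zero_iff) auto
  then have pa: "p ^ a > 1" using assms(2) prime_gt_1_nat[of p] one_less_power[of p a] by simp
  have m0: "m > 0" using m assms(1) by (cases m) auto
  have "gcd m (p ^ a) = 1" using cop by (metis coprime_iff_gcd_eq_1 gcd.commute)
  then obtain u v where uv: "m * u = p ^ a * v + 1" using bezout_nat[of m "p ^ a"] m0 by auto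
  text \<open>Bezout over the naturals: \<open>m u - p\<^sup>a v = 1\<close>, with the second summand made positive modulo \<open>n\<close>.\<close>
  obtain w where w: "p ^ a * w = (n - 1) * (p ^ a * v)" by (metis mult.left_commute)
  have "tm (m * u + (n - 1) * (p ^ a * v)) x = tm (1 + n * (p ^ a * v)) x"
  proof -
    have "m * u + (n - 1) * (p ^ a * v) = 1 + (p ^ a * v + (n - 1) * (p ^ a * v))" using uv by simp
    also have "p ^ a * v + (n - 1) * (p ^ a * v) = n * (p ^ a * v)" using assms(1)
      by (cases n) simp_all
    finally show ?thesis by simp
  qed
  also have "\<dots> = x" using assms(4) tm_mult[of "p ^ a * v" n x] by (simp add: tm_add mult.commute)
  finally have "x = tm (m * u) x + tm (p ^ a * w) x" by (simp add: tm_add w)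
  moreover have "tm (p ^ a) (tm (m * u) x) = 0"
  proof -
    have "p ^ a * (m * u) = u * n" using m by (simp add: mult_ac)
    then show ?thesis using assms(4) by (metis tm_mult tm_zero)
  qed
  moreover have "tm m (tm (p ^ a * w) x) = 0"
  proof -
    have "m * (p ^ a * w) = w * n" using m by (simp add: mult_ac)
    then show ?thesis using assms(4) by (metis tm_mult tm_zero)
  qed
  moreover have "m < n" using m pa m0 by simp
  ultimately show ?thesis using that m0 unfolding pel_def by blast
qed

text \<open>Every element of a finite group is a sum of elements of prime power order. Since
  \<open>S\<close> is a set closed under addition, later proofs can take for it the solutions of a
  commutation equation or of a membership condition.\<close>

lemma parts_gen: assumes H: "sub H" and S: "\<And>x y. x \<in> S \<Longrightarrow> y \<in> S \<Longrightarrow> x + y \<in> S"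
    and pS: "\<And>p. Factorial_Ring.prime p \<Longrightarrow> pt p H \<subseteq> S" shows "H \<subseteq> S"
proof -
  have "x \<in> S" if "n > 0" "tm n x = 0" "x \<in> H" for n x
    using that
  proof (induct n arbitrary: x rule: less_induct)
    case (less n)
    show ?case
    proof (cases "n = 1")
      case True
      then have "x = 0" using less by simp
      then show ?thesis using pt_0[OF H] pS[of 2] by auto
    next
      case False
      then obtain p where p: "Factorial_Ring.prime p" "p dvd n" using prime_factor_nat by blast
      obtain i j m where *: "x = tm i x + tm j x" "pel p (tm i x)" "tm m (tm j x) = 0" "0 < m" "m < n"
        using tm_split[OF _ p less(3)] less(2) False by auto
      have "tm i x \<in> S" using pS[OF p(1)] *(2) tm_mem[OF H less(4)] by (auto simp: pt_def)
      moreover have "tm j x \<in> S" using less(1)[OF *(5,4,3)] tm_mem[OF H less(4)] by blast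
      ultimately show ?thesis using S *(1) by metis
    qed
  qed
  then show ?thesis using tm_card[OF H] sub_card_pos[OF H] by blast
qed

text \<open>The part \<open>pt p H\<close> and its centraliser have a subgroup as their sum; it
  contains every part of \<open>H\<close>, hence all of \<open>H\<close>.\<close>

lemma nil_split: assumes N: "nil H" and p: "Factorial_Ring.prime p" and x: "x \<in> H"
  obtains u v where "u \<in> pt p H" "v \<in> H" "x = u + v" "\<And>w. w \<in> pt p H \<Longrightarrow> v + w = w + v"
proof -
  define C where "C = cen H (pt p H)"
  have H: "sub H" and P: "sub (pt p H)" using N p nilD by auto
  have C: "sub C" unfolding C_def by (rule sub_cen[OF H])
  have "sub (pt p H \<boxplus> C)"
  proof (rule sub_splus_norm(1)[OF P C])
    fix y assume "y \<in> pt p H"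
    then have "y \<in> H" by (auto simp: pt_def)
    then show "cj y C \<subseteq> C" using nml_cj[OF nml_cen[OF nil_nml[OF p N] H], of y] by (simp add: C_def)
  qed
  moreover have "pt q H \<subseteq> pt p H \<boxplus> C" if q: "Factorial_Ring.prime q" for q
  proof (cases "q = p")
    case True then show ?thesis using splus_left[of C "pt p H"] subD(2)[OF C] by simp
  next
    case False
    then have "pt q H \<subseteq> C" using pt_commute[OF N q p] by (auto simp: C_def cen_def pt_def)
    then show ?thesis using splus_right[of "pt p H" C] subD(2)[OF P] by simp
  qed
  ultimately have "H \<subseteq> pt p H \<boxplus> C" using parts_gen[OF H, of "pt p H \<boxplus> C"] subD(3) by blast
  then obtain u v where "u \<in> pt p H" "v \<in> C" "x = u + v" using x by (blast elim: splusE)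
  then show ?thesis using that by (auto simp: C_def cen_def)
qed

lemma nil_eqI: assumes "nil H" "sub K" "K \<subseteq> H" "\<And>p. Factorial_Ring.prime p \<Longrightarrow> pt p H \<subseteq> K" shows "K = H"
  using parts_gen[of H K] assms nilD(1)[of H] subD(3)[of K] by blast

text \<open>The other parts of a nilpotent group commute with \<open>pt p A\<close> anyway, so an
  element that is central in its own part is central.\<close>

lemma part_central:
  assumes A: "nil A" and p: "Factorial_Ring.prime p" and z: "z \<in> pt p A" "\<And>x. x \<in> pt p A \<Longrightarrow> x + z = z + x"
    and x: "x \<in> A" shows "x + z = z + x"
proof -
  have "A \<subseteq> {x. x + z = z + x}"
  proof (rule parts_gen[OF nilD(1)[OF A]])
    fix x y assume xy: "x \<in> {x. x + z = z + x}" "y \<in> {x. x + z = z + x}"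
    have "(x + y) + z = x + (y + z)" by (simp only: add.assoc)
    also have "y + z = z + y" using xy by simp
    also have "x + (z + y) = (x + z) + y" by (simp only: add.assoc)
    also have "x + z = z + x" using xy by simp
    also have "z + x + y = z + (x + y)" by (simp only: add.assoc)
    finally show "x + y \<in> {x. x + z = z + x}" by simp
  next
    fix q :: nat assume q: "Factorial_Ring.prime q"
    show "pt q A \<subseteq> {x. x + z = z + x}"
    proof (cases "q = p")
      case True then show ?thesis using z(2) by blast
    next
      case False then show ?thesis using pt_commute[OF A q p False _ z(1)] by blast
    qed
  qed
  then show ?thesis using x by blast
qed

lemma exists_part: assumes "sub H" "H \<noteq> {0}" obtains p where "Factorial_Ring.prime p" "pt p H \<noteq> {0}"
proof (rule ccontr)
  assume n: "\<not> thesis"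
  have "H \<subseteq> {0}" by (rule parts_gen[OF assms(1)]) (use n that in auto)
  then show False using assms subD(2)[OF assms(1)] by blast
qed

lemma pt_nontrivial: assumes "Factorial_Ring.prime p" "sub H" "p dvd card H" shows "pt p H \<noteq> {0}"
proof -
  obtain x where "x \<in> H" "x \<noteq> 0" "tm p x = 0" using cauchy[OF assms(2,1,3)] by blast
  then have "x \<in> pt p H" by (auto simp: pt_def pel_def intro: exI[of _ 1])
  then show ?thesis using \<open>x \<noteq> 0\<close> by blast
qed

lemma pt_trivial: assumes "Factorial_Ring.prime p" "sub H" "\<not> p dvd card H" shows "pt p H = {0}"
proof -
  have "x = 0" if "x \<in> H" "pel p x" for x
  proof -
    obtain k where "tm (p ^ k) x = 0" using \<open>pel p x\<close> by (auto simp: pel_def)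
    moreover have "coprime (p ^ k) (card H)" using assms by (simp add: prime_imp_coprime)
    ultimately show ?thesis using coprime_zero tm_card[OF assms(2) \<open>x \<in> H\<close>] by blast
  qed
  then show ?thesis using assms subD(2) by (auto simp: pt_def)
qed

text \<open>Under conjugation by \<open>P\<close> the number of fixed points in \<open>N\<close> is
  a multiple of \<open>p\<close>; since 0 is one of them, there is another.\<close>

lemma pgrp_center: assumes p: "Factorial_Ring.prime p" and P: "pgrp p P" and N: "nml N P" "N \<noteq> {0}"
  obtains z where "z \<in> N" "z \<noteq> 0" "\<And>x. x \<in> P \<Longrightarrow> x + z = z + x"
proof -
  have NS: "sub N" "N \<subseteq> P" using N by (auto simp: nml_def)
  have PS: "sub P" using P by (simp add: pgrp_def)
  obtain a where a: "card P = p ^ a" using P by (auto simp: pgrp_def)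
  obtain b where b: "card N = p ^ b" using pgrp_sub[OF p P NS] by (auto simp: pgrp_def)
  have "b \<noteq> 0" using b sub_card1[OF NS(1)] N by auto
  then have dN: "p dvd card N" using b by simp
  have "\<exists>k. card N = card {s \<in> N. \<forall>x\<in>P. x + s + - x = s} + p * k"
  proof (rule pgroup_fixed_points[OF PS a p])
    show "finite N" by (rule subD(1)[OF NS(1)])
    show "x + s + - x \<in> N" if "x \<in> P" "s \<in> N" for x s using nmlD(3)[OF N(1)] that by blast
  qed (simp_all add: gs)
  then obtain k where "card N = card {s \<in> N. \<forall>x\<in>P. x + s + - x = s} + p * k" by blast
  then have d: "p dvd card {s \<in> N. \<forall>x\<in>P. x + s + - x = s}" using dN by (simp add: dvd_add_left_iff)
  have "{s \<in> N. \<forall>x\<in>P. x + s + - x = s} \<noteq> {0}"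
  proof
    assume "{s \<in> N. \<forall>x\<in>P. x + s + - x = s} = {0}"
    then have "card {s \<in> N. \<forall>x\<in>P. x + s + - x = s} = card {0::'a}" by (simp only:)
    then show False using d p by simp
  qed
  moreover have "0 \<in> {s \<in> N. \<forall>x\<in>P. x + s + - x = s}" using NS by (simp add: subD)
  ultimately obtain z where "z \<in> N" "z \<noteq> 0" "\<forall>x\<in>P. x + z + - x = z" by blast
  then have "x + z = z + x" if "x \<in> P" for x using cen_iff[of x z] that by blast
  then show ?thesis using \<open>z \<in> N\<close> \<open>z \<noteq> 0\<close> by (intro that)
qed

text \<open>\<open>H\<close> acts by translation on its own cosets in \<open>P\<close>. The number
  of fixed cosets is a multiple of \<open>p\<close> and \<open>H\<close> is fixed; a second fixed
  coset yields an element of the normaliser outside \<open>H\<close>.\<close>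

lemma pgrp_growth: assumes p: "Factorial_Ring.prime p" and P: "pgrp p P" and H: "sub H" "H \<subset> P"
  obtains x where "x \<in> P" "x \<notin> H" "cj x H = H"
proof -
  have PS: "sub P" using P by (simp add: pgrp_def)
  obtain a where a: "card P = p ^ a" using P by (auto simp: pgrp_def)
  obtain b where b: "card H = p ^ b" using pgrp_sub[OF p P H(1)] H(2) by (auto simp: pgrp_def)
  have cl: "card (lcos P H) * p ^ b = p ^ a" using card_lcos[OF PS H(1)] H(2) a b by auto
  have "card H < card P" using H subD(1)[OF PS] by (simp add: psubset_card_mono)
  then have "card (lcos P H) \<noteq> 1" using cl a b by auto
  moreover obtain c where c: "card (lcos P H) = p ^ c" using cl divides_primepow_nat[OF p] by (metis dvd_triv_left)
  ultimately have dN: "p dvd card (lcos P H)" by (cases c) auto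
  define f where "f x c = (+) x ` c" for x :: 'a and c
  have fl: "f x ((+) h ` H) = (+) (x + h) ` H" for x h by (simp add: f_def image_image gs)
  define F where "F = {c \<in> lcos P H. \<forall>x\<in>H. f x c = c}"
  have "\<exists>k. card (lcos P H) = card F + p * k" unfolding F_def
  proof (rule pgroup_fixed_points[OF H(1) b p])
    show "finite (lcos P H)" using PS by (simp add: lcos_def subD)
    fix c assume "c \<in> lcos P H"
    then obtain h where h: "h \<in> P" "c = (+) h ` H" by (auto simp: lcos_def)
    show "f 0 c = c" by (simp add: h fl)
    show "f (x + y) c = f x (f y c)" for x y by (simp only: h fl add.assoc)
    show "f x c \<in> lcos P H" if "x \<in> H" for x using h that H PS by (auto simp: fl lcos_def subD)
  qed
  then have d: "p dvd card F" using dN by (metis dvd_add_left_iff dvd_triv_left)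
  have "F \<noteq> {H}" using d p by auto
  moreover have "H \<in> F"
  proof -
    have "(+) 0 ` H = H" by simp
    moreover have "f x H = H" if "x \<in> H" for x
      using fl[of x 0] lc_eq[OF H(1), of x 0] subD(4)[OF H(1) that] by simp
    ultimately show ?thesis using subD(2)[OF PS] unfolding F_def lcos_def by blast
  qed
  ultimately obtain c where "c \<in> F" "c \<noteq> H" by blast
  then obtain h where h: "h \<in> P" "c = (+) h ` H" "\<forall>x\<in>H. f x c = c" by (auto simp: F_def lcos_def)
  have "h \<notin> H" using \<open>c \<noteq> H\<close> h lc_eq[OF H(1), of h 0] subD(4)[OF H(1)] by auto
  have "cj (- h) H \<subseteq> H"
  proof
    fix y assume "y \<in> cj (- h) H"
    then obtain x where x: "x \<in> H" "y = - h + x + h" by (auto simp: cj_def)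
    then have "(+) h ` H = (+) (x + h) ` H" using h fl by metis
    then have "- h + (x + h) \<in> H" by (simp only: lc_eq[OF H(1)])
    then show "y \<in> H" using x by (simp add: gs)
  qed
  then have "cj (- h) H = H" using H subD(1) by (intro cj_eqI) auto
  then show ?thesis using that[of "- h"] h \<open>h \<notin> H\<close> sub_minus_iff[OF H(1)] subD(4)[OF PS] by blast
qed

text \<open>Some part \<open>pt p G\<close> is not contained in \<open>H\<close>. By the case of
  \<open>p\<close>-groups, an element of that part outside \<open>H\<close> normalises
  \<open>pt p H\<close>, and it commutes with the remaining parts of \<open>H\<close>.\<close>

lemma nil_growth: assumes N: "nil G" and H: "sub H" "H \<subset> G"
  obtains x where "x \<in> G" "x \<notin> H" "cj x H = H"
proof -
  have G: "sub G" using N nilD by blast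
  obtain p where p: "Factorial_Ring.prime p" "\<not> pt p G \<subseteq> H" using nil_eqI[OF N H(1)] H(2) by blast
  have NH: "nil H" using nil_sub[OF N H(1)] H(2) by blast
  have "pt p H \<subset> pt p G" using p H(2) pt_mono[of H G p] by (auto simp: pt_def)
  then obtain x where x: "x \<in> pt p G" "x \<notin> pt p H" "cj x (pt p H) = pt p H"
    using pgrp_growth[OF p(1) nil_pgrp[OF p(1) N]] nilD(2)[OF NH p(1)] by blast
  have xG: "x \<in> G" "pel p x" using x by (auto simp: pt_def)
  have xH: "x \<notin> H" using x xG by (auto simp: pt_def)
  have "H \<subseteq> cj (- x) H"
  proof (rule parts_gen[OF H(1)])
    show "a + b \<in> cj (- x) H" if "a \<in> cj (- x) H" "b \<in> cj (- x) H" for a b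
      using that sub_cj[OF H(1)] subD(3) by blast
    fix q :: nat assume q: "Factorial_Ring.prime q"
    show "pt q H \<subseteq> cj (- x) H"
    proof (cases "q = p")
      case True
      have "pt p H \<subseteq> cj (- x) (cj x (pt p H))" by simp
      also have "\<dots> \<subseteq> cj (- x) H" unfolding x(3) by (intro cj_mono pt_sub)
      finally show ?thesis using True by simp
    next
      case False
      show ?thesis
      proof
        fix y assume y: "y \<in> pt q H"
        then have "x + y = y + x" using pt_commute[OF N p(1) q False[symmetric] x(1)] H(2) pt_mono[of H G q] by blast
        then have "x + y + - x = y" by (rule cen_cj_id)
        then show "y \<in> cj (- x) H" using y by (auto simp: cj_mem pt_def)
      qed
    qed
  qed
  then have "cj x H \<subseteq> cj x (cj (- x) H)" by (rule cj_mono)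
  then have "cj x H = H" using H subD(1) by (intro cj_eqI) auto
  then show ?thesis using that xG xH by blast
qed

text \<open>A maximal proper subgroup above \<open>H\<close> is normal, because its normaliser is
  strictly larger.\<close>

lemma nil_proper_normal: assumes N: "nil G" and H: "sub H" "H \<subset> G"
  obtains K where "nml K G" "H \<subseteq> K" "K \<noteq> G"
proof -
  have G: "sub G" using N nilD by blast
  define S where "S = {K. sub K \<and> H \<subseteq> K \<and> K \<subset> G}"
  have fS: "finite S" by (rule finite_subset[of _ "Pow G"]) (use subD(1)[OF G] in \<open>auto simp: S_def\<close>)
  have "H \<in> S" using H by (simp add: S_def)
  then obtain K where K: "K \<in> S" "\<And>L. L \<in> S \<Longrightarrow> K \<subseteq> L \<Longrightarrow> K = L"
    using finite_has_maximal[OF fS] by blast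
  have KS: "sub K" "H \<subseteq> K" "K \<subset> G" using K by (auto simp: S_def)
  obtain x where x: "x \<in> G" "x \<notin> K" "cj x K = K" using nil_growth[OF N KS(1,3)] by blast
  have "K \<subseteq> nrm G K" using nrm_self[OF G KS(1)] KS(3) by blast
  then have "nrm G K \<notin> S" using K(2)[of "nrm G K"] x by (auto simp: nrm_def)
  then have "nrm G K = G" using KS \<open>K \<subseteq> nrm G K\<close> sub_nrm[OF G] nrm_sub[of G K] by (auto simp: S_def)
  then have "nml K G" using nml_nrm[OF G KS(1)] KS(3) by auto
  then show ?thesis using that KS by blast
qed

section \<open>Cyclic subgroups and criteria for nilpotency\<close>

lemma sub_cyc: assumes H: "sub H" "x \<in> H" shows "sub (range (\<lambda>n. tm n x))" "range (\<lambda>n. tm n x) \<subseteq> H"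
proof -
  show le: "range (\<lambda>n. tm n x) \<subseteq> H" using tm_mem[OF H] by auto
  show "sub (range (\<lambda>n. tm n x))"
  proof (rule subI)
    show "finite (range (\<lambda>n. tm n x))" using le subD(1)[OF H(1)] by (rule finite_subset)
    show "0 \<in> range (\<lambda>n. tm n x)" by (metis rangeI tm.simps(1))
    show "a + b \<in> range (\<lambda>n. tm n x)" if "a \<in> range (\<lambda>n. tm n x)" "b \<in> range (\<lambda>n. tm n x)" for a b
      using that by (auto simp flip: tm_add)
    fix a assume "a \<in> range (\<lambda>n. tm n x)"
    then obtain n where n: "a = tm n x" by blast
    have "tm ((card H - 1) * n + n) x = 0"
    proof -
      have "(card H - 1) * n + n = n * card H" using sub_card_pos[OF H(1)] by (cases "card H") simp_all
      then show ?thesis using tm_card[OF H] by (simp add: tm_mult)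
    qed
    then have "tm ((card H - 1) * n) x + a = 0" by (simp add: tm_add n)
    then have "- a = tm ((card H - 1) * n) x" by (metis eq_neg_iff_add_eq_0)
    then show "- a \<in> range (\<lambda>n. tm n x)" by simp
  qed
qed

text \<open>The normaliser \<open>L\<close> of a Sylow subgroup is its own normaliser, by Sylow
  conjugacy inside \<open>L\<close>. So the growth condition forces \<open>L = H\<close>, and the
  Sylow subgroup is normal.\<close>

lemma growth_nil: assumes H: "sub H"
    and gr: "\<And>L. sub L \<Longrightarrow> L \<subset> H \<Longrightarrow> \<exists>x\<in>H - L. cj x L = L" shows "nil H"
  unfolding nil_def
proof (intro conjI allI impI H)
  fix p :: nat assume p: "Factorial_Ring.prime p"
  obtain P where P: "sub P" "P \<subseteq> H" "card P = p ^ multiplicity p (card H)"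
    using sylow_exists[OF H p(1)] by blast
  then have sP: "syl p P H" by (simp add: syl_def)
  define L where "L = nrm H P"
  have L: "sub L" "L \<subseteq> H" "P \<subseteq> L" using sub_nrm[OF H] nrm_sub nrm_self[OF H P(1,2)] by (auto simp: L_def)
  have "L = H"
  proof (rule ccontr)
    assume "L \<noteq> H"
    then obtain x where x: "x \<in> H" "x \<notin> L" "cj x L = L" using gr[OF L(1)] L(2) by blast
    have s: "syl p P L" by (rule syl_between[OF p sP H L(1,3,2)])
    have "syl p (cj x P) L" using syl_cj2[OF s, of x] x(3) by simp
    then obtain l where l: "l \<in> L" "cj x P = cj l P" using sylow_conj[OF p L(1) s] by blast
    then have "cj x P = P" by (simp add: L_def nrm_def)
    then show False using x by (simp add: L_def nrm_def)
  qed
  have "pt p H \<subseteq> P"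
  proof
    fix x assume x: "x \<in> pt p H"
    then have xH: "x \<in> H" "pel p x" by (auto simp: pt_def)
    have "pgrp p (range (\<lambda>n. tm n x))"
      by (rule pgrpI_pel[OF sub_cyc(1)[OF H xH(1)] p]) (use xH pel_tm in auto)
    then obtain h where "h \<in> H" "range (\<lambda>n. tm n x) \<subseteq> cj h P"
      using sylow_sub_conj[OF p H sP] sub_cyc(2)[OF H xH(1)] by blast
    moreover then have "cj h P = P" using \<open>L = H\<close> by (auto simp: L_def nrm_def)
    moreover have "x \<in> range (\<lambda>n. tm n x)" by (metis rangeI tm_1)
    ultimately show "x \<in> P" by blast
  qed
  moreover have "P \<subseteq> pt p H" using P pgrp_pel[of p P] by (auto simp: pt_def pgrp_def)
  ultimately show "sub (pt p H)" using P(1) by (simp add: subset_antisym)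
qed

text \<open>Let \<open>Z i\<close> be the first term inside \<open>L\<close>. An element of the
  preceding term outside \<open>L\<close> has all its commutators with \<open>H\<close> in
  \<open>L\<close>, so it normalises \<open>L\<close>, and \<open>growth_nil\<close>
  applies.\<close>

lemma chain_nil: assumes H: "sub H" and Z: "Z 0 = H" "Z n = {0}"
    and c: "\<And>i x y. x \<in> Z i \<Longrightarrow> y \<in> H \<Longrightarrow> x + y + - x + - y \<in> Z (Suc i)" and ZH: "\<And>i. Z i \<subseteq> H"
  shows "nil H"
proof (rule growth_nil[OF H])
  fix L assume L: "sub L" "L \<subset> H"
  define i where "i = (LEAST i. Z i \<subseteq> L)"
  have "Z n \<subseteq> L" using Z subD(2)[OF L(1)] by simp
  then have i: "Z i \<subseteq> L" unfolding i_def by (rule LeastI)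
  have "i \<noteq> 0" using i Z L by (auto intro: notI)
  then obtain j where j: "i = Suc j" by (cases i) auto
  then have "\<not> Z j \<subseteq> L" using not_less_Least[of j "\<lambda>i. Z i \<subseteq> L"] by (simp add: i_def)
  then obtain x where x: "x \<in> Z j" "x \<notin> L" by blast
  have "cj x L \<subseteq> L"
  proof
    fix y assume "y \<in> cj x L"
    then obtain l where l: "l \<in> L" "y = x + l + - x" by (auto simp: cj_def)
    then have "x + l + - x + - l \<in> L" using c[of x j l] x L i j by blast
    then have "x + l + - x + - l + l \<in> L" using l subD(3)[OF L(1)] by blast
    then show "y \<in> L" using l by (simp add: gs)
  qed
  then have "cj x L = L" using L subD(1) by (intro cj_eqI) auto
  then show "\<exists>x\<in>H - L. cj x L = L" using x ZH by blast
qed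

subsection \<open>Transfer\<close>

text \<open>
  \<open>tau\<close> selects a representative of each left coset of \<open>P\<close> in \<open>Y\<close>; the map \<open>l\<close> on \<open>P\<close>
  is additive only modulo \<open>n\<close>, and so is the transfer.
\<close>

definition transfer :: "'g::group_add set \<Rightarrow> 'g set \<Rightarrow> ('g \<Rightarrow> int) \<Rightarrow> ('g set \<Rightarrow> 'g) \<Rightarrow> 'g \<Rightarrow> int" where
  "transfer Y P l tau y = (\<Sum>c\<in>lcos Y P. l (- tau ((+) y ` c) + y + tau c))"

locale transfer_data =
  fixes Y P :: "'g::group_add set" and l :: "'g \<Rightarrow> int" and n :: int
  assumes Y: "sub Y" and P: "sub P" "P \<subseteq> Y"
    and l_add: "\<And>x y. x \<in> P \<Longrightarrow> y \<in> P \<Longrightarrow> [l (x + y) = l x + l y] (mod n)"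
begin

lemma l_0: "[l 0 = 0] (mod n)"
proof -
  have "[l (0 + 0) = l 0 + l 0] (mod n)" by (rule l_add) (simp_all add: subD P)
  then show ?thesis by (simp add: cong_iff_dvd_diff)
qed

lemma l_tm: "x \<in> P \<Longrightarrow> [l (tm k x) = int k * l x] (mod n)"
proof (induct k)
  case 0 then show ?case using l_0 by simp
next
  case (Suc k)
  have "[l (x + tm k x) = l x + l (tm k x)] (mod n)" using Suc(2) P by (intro l_add) (simp_all add: tm_mem)
  also have "[l x + l (tm k x) = l x + int k * l x] (mod n)" using Suc by (intro cong_add) simp_all
  finally show ?case by (simp add: algebra_simps)
qed

lemma coset_img: "(+) x ` ((+) h ` P) = (+) (x + h) ` P"
  by (simp add: image_image add.assoc)

lemma coset_closed: assumes "y \<in> Y" "c \<in> lcos Y P" shows "(+) y ` c \<in> lcos Y P"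
  using assms Y by (auto simp: lcos_def coset_img subD simp del: image_add_atLeastAtMost)

lemma coset_add: "(+) (x + y) ` c = (+) x ` ((+) y ` c)" for x y :: 'g
  unfolding image_image by (rule image_cong) (simp_all add: add.assoc)

lemma coset_bij: assumes "y \<in> Y" shows "bij_betw (\<lambda>c. (+) y ` c) (lcos Y P) (lcos Y P)"
proof (rule bij_betw_byWitness[where f' = "\<lambda>c. (+) (- y) ` c"])
  show "\<forall>a\<in>lcos Y P. (+) (- y) ` (+) y ` a = a" by (simp add: image_image)
  show "\<forall>a\<in>lcos Y P. (+) y ` (+) (- y) ` a = a" by (simp add: image_image)
qed (use assms coset_closed subD(4)[OF Y] in auto)

lemma coset_diff: assumes "c \<in> lcos Y P" "t \<in> c" "t' \<in> c" shows "- t + t' \<in> P"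
proof -
  obtain h where "c = (+) h ` P" using assms by (auto simp: lcos_def)
  then have "- h + t \<in> P" "- h + t' \<in> P" using assms by (simp_all only: lc_mem)
  then have "- (- h + t) + (- h + t') \<in> P" using P by (simp add: subD)
  then show ?thesis by (simp add: gs)
qed

lemma factor_mem: assumes "y \<in> Y" "c \<in> lcos Y P" "t \<in> c" "t' \<in> (+) y ` c" shows "- t' + y + t \<in> P"
  using coset_diff[OF coset_closed[OF assms(1,2)] assms(4), of "y + t"] assms(3) by (simp add: add.assoc)

text \<open>The factor of \<open>y + z\<close> at a coset \<open>c\<close> is the factor of
  \<open>y\<close> at \<open>z + c\<close> plus that of \<open>z\<close> at \<open>c\<close>; the
  first summand is reindexed along the permutation of the cosets by \<open>z\<close>.\<close>

lemma transfer_add: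
  assumes tau: "\<And>c. c \<in> lcos Y P \<Longrightarrow> tau c \<in> c" and "y \<in> Y" "z \<in> Y"
  shows "[transfer Y P l tau (y + z) = transfer Y P l tau y + transfer Y P l tau z] (mod n)"
proof -
  let ?C = "lcos Y P"
  have "[transfer Y P l tau (y + z) = (\<Sum>c\<in>?C. l (- tau ((+) y ` ((+) z ` c)) + y + tau ((+) z ` c)) + l (- tau ((+) z ` c) + z + tau c))] (mod n)"
    unfolding transfer_def
  proof (rule cong_sum)
    fix c assume c: "c \<in> ?C"
    have zc: "(+) z ` c \<in> ?C" using coset_closed assms c by blast
    have "- tau ((+) (y + z) ` c) + (y + z) + tau c = (- tau ((+) y ` ((+) z ` c)) + y + tau ((+) z ` c)) + (- tau ((+) z ` c) + z + tau c)"
      unfolding coset_add by (simp add: gs)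
    then show "[l (- tau ((+) (y + z) ` c) + (y + z) + tau c) = l (- tau ((+) y ` ((+) z ` c)) + y + tau ((+) z ` c)) + l (- tau ((+) z ` c) + z + tau c)] (mod n)"
      using factor_mem[OF assms(2) zc tau[OF zc] tau[OF coset_closed[OF assms(2) zc]]]
        factor_mem[OF assms(3) c tau[OF c] tau[OF zc]] l_add by metis
  qed
  also have "(\<Sum>c\<in>?C. l (- tau ((+) y ` ((+) z ` c)) + y + tau ((+) z ` c)) + l (- tau ((+) z ` c) + z + tau c))
      = transfer Y P l tau y + transfer Y P l tau z"
    unfolding transfer_def sum.distrib
    using sum.reindex_bij_betw[OF coset_bij[OF assms(3)], of "\<lambda>c. l (- tau ((+) y ` c) + y + tau c)"] by simp
  finally show ?thesis .
qed

text \<open>A change of section by \<open>d\<close> alters the summand at \<open>c\<close> by the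
  value of \<open>d\<close> at \<open>c\<close> minus that at \<open>y + c\<close>; these terms
  cancel in the sum because \<open>y\<close> permutes the cosets.\<close>

lemma transfer_indep:
  assumes tau: "\<And>c. c \<in> lcos Y P \<Longrightarrow> tau c \<in> c" and tau': "\<And>c. c \<in> lcos Y P \<Longrightarrow> tau' c \<in> c" and y: "y \<in> Y"
  shows "[transfer Y P l tau' y = transfer Y P l tau y] (mod n)"
proof -
  let ?C = "lcos Y P"
  define d where "d c = - tau c + tau' c" for c
  have d: "d c \<in> P" if "c \<in> ?C" for c unfolding d_def by (rule coset_diff[OF that tau[OF that] tau'[OF that]])
  have "[transfer Y P l tau' y + (\<Sum>c\<in>?C. l (d ((+) y ` c))) = transfer Y P l tau y + (\<Sum>c\<in>?C. l (d c))] (mod n)"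
    unfolding transfer_def sum.distrib[symmetric]
  proof (rule cong_sum)
    fix c assume c: "c \<in> ?C"
    have yc: "(+) y ` c \<in> ?C" using coset_closed y c by blast
    let ?h' = "- tau' ((+) y ` c) + y + tau' c" and ?h = "- tau ((+) y ` c) + y + tau c"
    have h: "?h \<in> P" "?h' \<in> P" by (rule factor_mem[OF y c tau[OF c] tau[OF yc]], rule factor_mem[OF y c tau'[OF c] tau'[OF yc]])
    have "[l ?h' + l (d ((+) y ` c)) = l (d ((+) y ` c)) + l ?h'] (mod n)" by (simp add: add.commute)
    also have "[l (d ((+) y ` c)) + l ?h' = l (d ((+) y ` c) + ?h')] (mod n)" using l_add[OF d[OF yc] h(2)] by (rule cong_sym)
    also have "d ((+) y ` c) + ?h' = ?h + d c" by (simp add: d_def gs)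
    also have "[l (?h + d c) = l ?h + l (d c)] (mod n)" by (rule l_add[OF h(1) d[OF c]])
    finally show "[l ?h' + l (d ((+) y ` c)) = l ?h + l (d c)] (mod n)" .
  qed
  also have "(\<Sum>c\<in>?C. l (d ((+) y ` c))) = (\<Sum>c\<in>?C. l (d c))"
    using sum.reindex_bij_betw[OF coset_bij[OF y], of "\<lambda>c. l (d c)"] by simp
  finally show ?thesis by (simp add: cong_add_rcancel)
qed

text \<open>On \<open>P\<close> itself a section adapted to the cycles of \<open>x\<close> on the cosets evaluates the transfer.\<close>

lemma adapted_section:
  assumes x: "x \<in> P" and inv: "\<And>t k. t \<in> Y \<Longrightarrow> - t + tm k x + t \<in> P \<Longrightarrow> tm k x \<in> P \<Longrightarrow> [l (- t + tm k x + t) = l (tm k x)] (mod n)"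
    and S: "S \<subseteq> lcos Y P" "\<And>c. c \<in> S \<Longrightarrow> (+) x ` c \<in> S"
  shows "\<exists>tau. (\<forall>c\<in>S. tau c \<in> c) \<and> [(\<Sum>c\<in>S. l (- tau ((+) x ` c) + x + tau c)) = int (card S) * l x] (mod n)"
  using S
proof (induct "card S" arbitrary: S rule: less_induct)
  case less
  have xY: "x \<in> Y" using x P by blast
  have finC: "finite (lcos Y P)" using Y by (simp add: lcos_def subD)
  have finS: "finite S" using less(2) finC by (rule finite_subset)
  show ?case
  proof (cases "S = {}")
    case False
    then obtain c0 where c0: "c0 \<in> S" by blast
    then have c0C: "c0 \<in> lcos Y P" using less(2) by blast
    then obtain t where t: "c0 = (+) t ` P" "t \<in> Y" by (auto simp: lcos_def)
    have t0: "t \<in> c0" using t subD(2)[OF P(1)] by (auto simp: image_iff intro!: bexI[of _ 0])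
    define g where "g i = (+) (tm i x) ` c0" for i
    have gS: "g i \<in> S" for i
    proof (induct i)
      case (Suc i)
      have "g (Suc i) = (+) x ` g i" unfolding g_def by (simp add: coset_add[symmetric])
      then show ?case using less(3) Suc by simp
    qed (simp add: g_def c0)
    have g_Suc: "(+) x ` g i = g (Suc i)" for i unfolding g_def by (simp add: coset_add[symmetric])
    have g_add: "g (i + j) = (+) (tm i x) ` g j" for i j unfolding g_def by (simp add: tm_add coset_add)
    have "g (card P) = c0" "card P > 0" using tm_card[OF P(1) x] sub_card_pos[OF P(1)] by (auto simp: g_def)
    then have ex: "\<exists>m>0. g m = c0" by blast
    \<comment> \<open>\<open>m\<close> is the length of the cycle of \<open>x\<close> through the
      coset \<open>c0\<close>; the cosets outside the cycle are handled by the induction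
      hypothesis.\<close>
    define m where "m = (LEAST m. m > 0 \<and> g m = c0)"
    have m: "m > 0" "g m = c0" using LeastI_ex[OF ex] by (auto simp: m_def)
    have mmin: "\<not> (0 < i \<and> g i = c0)" if "i < m" for i using not_less_Least that unfolding m_def by blast
    have ginj: "inj_on g {..<m}"
    proof (rule linorder_inj_onI)
      fix i j assume "i < j" "i \<in> {..<m}" "j \<in> {..<m}"
      show "g i \<noteq> g j"
      proof
        assume e: "g i = g j"
        have "g (m - j + i) = (+) (tm (m - j) x) ` g j" using e by (simp add: g_add)
        also have "\<dots> = g (m - j + j)" by (simp only: g_add)
        also have "\<dots> = c0" using m \<open>j \<in> {..<m}\<close> by simp
        finally have "g (m - j + i) = c0" .
        moreover have "0 < m - j + i" "m - j + i < m" using \<open>i < j\<close> \<open>j \<in> {..<m}\<close> by auto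
        ultimately show False using mmin by blast
      qed
    qed auto
    define Q where "Q = g ` {..<m}"
    have Q: "Q \<subseteq> S" "card Q = m" "finite Q" using gS ginj by (auto simp: Q_def card_image)
    have gQ: "g i \<in> Q" for i
    proof (induct i)
      case 0 then show ?case using m by (auto simp: Q_def)
    next
      case (Suc i)
      then obtain j where j: "j < m" "g i = g j" by (auto simp: Q_def)
      then have "g (Suc i) = g (Suc j)" by (simp flip: g_Suc)
      moreover have "g (Suc j) \<in> Q"
      proof (cases "Suc j = m")
        case True
        then have "g (Suc j) = g 0" using m by (simp add: g_def)
        then show ?thesis using m by (auto simp: Q_def)
      qed (use j in \<open>auto simp: Q_def\<close>)
      ultimately show ?case by simp
    qed
    have Sx: "(+) x ` c \<in> S - Q" if c: "c \<in> S - Q" for c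
    proof -
      have "c \<in> Q" if xc: "(+) x ` c \<in> Q"
      proof -
        obtain i where i: "(+) x ` c = g i" using xc by (auto simp: Q_def)
        have "tm (card P - 1) x + x = tm (card P) x"
          using tm_comm[of "card P - 1" x 1] sub_card_pos[OF P(1)] by (cases "card P") simp_all
        then have "tm (card P - 1) x + x = 0" using tm_card[OF P(1) x] by simp
        then have "c = (+) (tm (card P - 1) x) ` ((+) x ` c)" by (simp add: coset_add[symmetric])
        then have "c = g (card P - 1 + i)" using i by (simp add: g_add)
        then show "c \<in> Q" using gQ by simp
      qed
      then show ?thesis using c less(3) by blast
    qed
    have "card (S - Q) < card S" using Q m finS c0 by (simp add: card_Diff_subset card_mono) (metis card_gt_0_iff c0 empty_iff diff_less)
    then obtain tau' where tau': "\<forall>c\<in>S - Q. tau' c \<in> c"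
      "[(\<Sum>c\<in>S - Q. l (- tau' ((+) x ` c) + x + tau' c)) = int (card (S - Q)) * l x] (mod n)"
      using less(1)[of "S - Q"] less(2) Sx by blast
    \<comment> \<open>Along the cycle the representatives are \<open>tm i x + t\<close>. All factors
      are then 0 except the one that closes the cycle, which is
      \<open>- t + tm m x + t\<close>.\<close>
    define tau where "tau c = (if c \<in> Q then tm (the_inv_into {..<m} g c) x + t else tau' c)" for c
    have tauQ: "tau (g i) = tm i x + t" if "i < m" for i
      using that ginj gQ by (simp add: tau_def the_inv_into_f_f)
    have tc: "tau c \<in> c" if "c \<in> S" for c
    proof (cases "c \<in> Q")
      case True
      then obtain i where i: "i < m" "c = g i" by (auto simp: Q_def)
      then show ?thesis using tauQ t0 by (auto simp: g_def)
    qed (use tau' that in \<open>auto simp: tau_def\<close>)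
    have "(\<Sum>c\<in>S. l (- tau ((+) x ` c) + x + tau c)) = (\<Sum>c\<in>Q. l (- tau ((+) x ` c) + x + tau c)) + (\<Sum>c\<in>S - Q. l (- tau ((+) x ` c) + x + tau c))"
      using finS Q by (simp add: sum.subset_diff add.commute)
    also have "(\<Sum>c\<in>S - Q. l (- tau ((+) x ` c) + x + tau c)) = (\<Sum>c\<in>S - Q. l (- tau' ((+) x ` c) + x + tau' c))"
      using Sx by (intro sum.cong) (auto simp: tau_def)
    also have "(\<Sum>c\<in>Q. l (- tau ((+) x ` c) + x + tau c)) = (\<Sum>i<m. l (- tau (g (Suc i)) + x + tau (g i)))"
      unfolding Q_def using ginj by (subst sum.reindex) (simp_all add: g_Suc)
    also have "\<dots> = (\<Sum>i<m - 1. l (- tau (g (Suc i)) + x + tau (g i))) + l (- tau (g m) + x + tau (g (m - 1)))"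
      using m by (cases m) simp_all
    also have "(\<Sum>i<m - 1. l (- tau (g (Suc i)) + x + tau (g i))) = (\<Sum>i<m - 1. l 0)"
    proof (rule sum.cong)
      fix i assume "i \<in> {..<m - 1}"
      then have "tau (g (Suc i)) = x + tm i x + t" "tau (g i) = tm i x + t" using tauQ[of i] tauQ[of "Suc i"] by (auto simp: gs)
      then show "l (- tau (g (Suc i)) + x + tau (g i)) = l 0" by (simp add: gs)
    qed simp
    also have "- tau (g m) + x + tau (g (m - 1)) = - t + tm m x + t"
    proof -
      have "g m = g 0" using m by (simp add: g_def)
      then have "tau (g m) = t" using tauQ[of 0] m by simp
      moreover have "tau (g (m - 1)) = tm (m - 1) x + t" using tauQ m by simp
      moreover have "tm m x = x + tm (m - 1) x" using m by (cases m) simp_all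
      ultimately show ?thesis by (simp add: gs)
    qed
    finally have eq: "(\<Sum>c\<in>S. l (- tau ((+) x ` c) + x + tau c)) = (\<Sum>i<m - 1. l 0) + l (- t + tm m x + t) + (\<Sum>c\<in>S - Q. l (- tau' ((+) x ` c) + x + tau' c))" .
    have tmP: "tm m x \<in> P" using x P by (simp add: tm_mem)
    have "- t + tm m x + t \<in> P"
    proof -
      have "(+) (tm m x + t) ` P = (+) t ` P" using m(2) t by (simp add: g_def coset_img)
      then have "- (tm m x + t) + t \<in> P" by (simp only: lc_eq[OF P(1)])
      then have "- (- (tm m x + t) + t) \<in> P" using P by (simp add: subD)
      then show ?thesis by (simp add: gs)
    qed
    then have "[l (- t + tm m x + t) = int m * l x] (mod n)" using inv[OF t(2) _ tmP] l_tm[OF x, of m] cong_trans by blast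
    moreover have "[(\<Sum>i<m - 1. l 0) = (\<Sum>i<m - 1. 0)] (mod n)" by (intro cong_sum l_0)
    ultimately have "[(\<Sum>i<m - 1. l 0) + l (- t + tm m x + t) + (\<Sum>c\<in>S - Q. l (- tau' ((+) x ` c) + x + tau' c))
        = 0 + int m * l x + int (card (S - Q)) * l x] (mod n)"
      using tau'(2) by (intro cong_add) simp_all
    moreover have "card (S - Q) + m = card S" using Q finS card_mono[OF finS Q(1)] by (simp add: card_Diff_subset)
    then have "0 + int m * l x + int (card (S - Q)) * l x = int (card S) * l x" by (metis add.commute add_0 distrib_right of_nat_add)
    ultimately show ?thesis using eq tc by (intro exI[of _ tau]) simp
  qed simp
qed

end


text \<open>The adapted section depends on \<open>x\<close>; \<open>transfer_indep\<close> carries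
  the value over to a section fixed beforehand.\<close>

lemma (in transfer_data) transfer_eval:
  assumes x: "x \<in> P" and tau: "\<And>c. c \<in> lcos Y P \<Longrightarrow> tau c \<in> c"
    and inv: "\<And>t k. t \<in> Y \<Longrightarrow> - t + tm k x + t \<in> P \<Longrightarrow> tm k x \<in> P \<Longrightarrow> [l (- t + tm k x + t) = l (tm k x)] (mod n)"
  shows "[transfer Y P l tau x = int (card (lcos Y P)) * l x] (mod n)"
proof -
  have xY: "x \<in> Y" using x P by blast
  obtain tau' where t: "\<And>c. c \<in> lcos Y P \<Longrightarrow> tau' c \<in> c"
    "[(\<Sum>c\<in>lcos Y P. l (- tau' ((+) x ` c) + x + tau' c)) = int (card (lcos Y P)) * l x] (mod n)"
    using adapted_section[OF x inv, of "lcos Y P"] coset_closed[OF xY] by blast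
  have "[transfer Y P l tau x = transfer Y P l tau' x] (mod n)"
    by (rule transfer_indep[OF t(1) tau xY])
  then show ?thesis using t(2) unfolding transfer_def[symmetric] by (rule cong_trans)
qed

text \<open>Conjugation by \<open>k\<close> permutes the cosets and turns \<open>tau\<close> into
  another section \<open>tau'\<close>, so the claim comes down to independence of the
  section.\<close>

lemma (in transfer_data) transfer_conj:
  assumes y: "y \<in> Y" and tau: "\<And>c. c \<in> lcos Y P \<Longrightarrow> tau c \<in> c"
    and k: "cj k Y = Y" "cj k P = P" and inv: "\<And>x. x \<in> P \<Longrightarrow> [l (k + x + - k) = l x] (mod n)"
  shows "[transfer Y P l tau (k + y + - k) = transfer Y P l tau y] (mod n)"
proof -
  have cjc: "cj g ((+) h ` P) = (+) (g + h + - g) ` cj g P" for g h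
  proof -
    have "cj g ((+) h ` P) = (\<lambda>x. g + (h + x) + - g) ` P" by (simp add: cj_def image_image)
    also have "\<dots> = (\<lambda>x. (g + h + - g) + (g + x + - g)) ` P" by (rule image_cong) (simp_all add: gs)
    also have "\<dots> = (+) (g + h + - g) ` cj g P" by (simp add: cj_def image_image)
    finally show ?thesis .
  qed
  have k': "cj (- k) Y = Y" "cj (- k) P = P" using arg_cong[OF k(1), of "cj (-k)"] arg_cong[OF k(2), of "cj (-k)"] by simp_all
  have closed: "cj g c \<in> lcos Y P" if asm: "c \<in> lcos Y P" "cj g Y = Y" "cj g P = P" for g c
  proof -
    obtain h where "h \<in> Y" "c = (+) h ` P" using asm(1) by (auto simp: lcos_def)
    moreover then have "g + h + - g \<in> Y" using asm(2) by (auto simp: cj_def)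
    ultimately show ?thesis using cjc[of g h] asm(3) by (auto simp: lcos_def)
  qed
  have bij: "bij_betw (cj k) (lcos Y P) (lcos Y P)"
    by (rule bij_betw_byWitness[where f' = "cj (- k)"]) (use closed k k' in auto)
  define tau' where "tau' c = k + tau (cj (- k) c) + - k" for c
  have tau': "tau' c \<in> c" if "c \<in> lcos Y P" for c
    using tau[OF closed[OF that k']] by (simp add: tau'_def cj_mem)
  have ky: "k + y + - k \<in> Y" using k(1) y by (auto simp: cj_def)
  have "[transfer Y P l tau (k + y + - k) = transfer Y P l tau' (k + y + - k)] (mod n)"
    by (rule transfer_indep[OF tau' tau ky])
  also have "transfer Y P l tau' (k + y + - k) = (\<Sum>c\<in>lcos Y P. l (- tau' ((+) (k + y + - k) ` cj k c) + (k + y + - k) + tau' (cj k c)))"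
    unfolding transfer_def using sum.reindex_bij_betw[OF bij, of "\<lambda>c. l (- tau' ((+) (k + y + - k) ` c) + (k + y + - k) + tau' c)"] by simp
  also have "[\<dots> = transfer Y P l tau y] (mod n)" unfolding transfer_def
  proof (rule cong_sum)
    fix c assume c: "c \<in> lcos Y P"
    have "(+) (k + y + - k) ` cj k c = cj k ((+) y ` c)"
      unfolding cj_def image_image by (rule image_cong) (simp_all add: gs)
    then have "- tau' ((+) (k + y + - k) ` cj k c) + (k + y + - k) + tau' (cj k c) = k + (- tau ((+) y ` c) + y + tau c) + - k"
      by (simp add: tau'_def gs)
    then show "[l (- tau' ((+) (k + y + - k) ` cj k c) + (k + y + - k) + tau' (cj k c)) = l (- tau ((+) y ` c) + y + tau c)] (mod n)"
      using inv[OF factor_mem[OF y c tau[OF c] tau[OF coset_closed[OF y c]]]] by simp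
  qed
  finally show ?thesis .
qed

subsection \<open>Normal complements\<close>

text \<open>\<open>L\<close> is maximal among the normal subgroups of \<open>P\<close> properly
  inside \<open>M\<close>. The \<open>p\<close>-group \<open>P\<close> fixes a nontrivial coset
  \<open>x + L\<close>, and the multiples of \<open>x\<close> together with \<open>L\<close> form a
  normal subgroup, which must be \<open>M\<close>. So \<open>M\<close> modulo \<open>L\<close> is
  cyclic and central, which lets a transfer take integer values.\<close>

lemma central_chief_factor:
  assumes p: "Factorial_Ring.prime p" and P: "pgrp p P" and M: "nml M P" "M \<noteq> {0}"
  obtains L x where "nml L P" "L \<subset> M" "x \<in> M" "x \<notin> L" "\<And>y. y \<in> P \<Longrightarrow> - x + (y + x + - y) \<in> L"
    "M = range (\<lambda>j. tm j x) \<boxplus> L"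
proof -
  have PS: "sub P" using P by (simp add: pgrp_def)
  have MS: "sub M" "M \<subseteq> P" using M by (auto simp: nml_def)
  define S where "S = {L. nml L P \<and> L \<subset> M}"
  have fS: "finite S" by (rule finite_subset[of _ "Pow P"]) (use subD(1)[OF PS] in \<open>auto simp: S_def nml_def\<close>)
  have "{0} \<in> S" using M nml_zero[OF PS] subD(2)[OF MS(1)] by (auto simp: S_def)
  then obtain L where L: "L \<in> S" "\<And>K. K \<in> S \<Longrightarrow> L \<subseteq> K \<Longrightarrow> L = K"
    using finite_has_maximal[OF fS] by blast
  have LN: "nml L P" "L \<subset> M" "sub L" using L by (auto simp: S_def nml_def)
  have Lcj: "cj y L = L" if "y \<in> P" for y using nml_cj[OF LN(1) that] .
  obtain a where a: "card P = p ^ a" using P by (auto simp: pgrp_def)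
  obtain b where b: "card M = p ^ b" using pgrp_sub[OF p P MS] by (auto simp: pgrp_def)
  have cl: "card (lcos M L) * card L = p ^ b" using card_lcos[OF MS(1) LN(3)] LN(2) b by auto
  have "card L < card M" using LN subD(1)[OF MS(1)] by (simp add: psubset_card_mono)
  then have "card (lcos M L) \<noteq> 1" using cl b by auto
  moreover obtain c where c: "card (lcos M L) = p ^ c" using cl divides_primepow_nat[OF p] by (metis dvd_triv_left)
  ultimately have dN: "p dvd card (lcos M L)" by (cases c) auto
  have cjl: "cj y ((+) h ` L) = (+) (y + h + - y) ` L" if "y \<in> P" for y h
  proof -
    have "cj y ((+) h ` L) = (\<lambda>x. y + (h + x) + - y) ` L" by (simp add: cj_def image_image)
    also have "\<dots> = (\<lambda>x. (y + h + - y) + (y + x + - y)) ` L" by (rule image_cong) (simp_all add: gs)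
    also have "\<dots> = (+) (y + h + - y) ` cj y L" by (simp add: cj_def image_image)
    finally show ?thesis using Lcj[OF that] by simp
  qed
  define F where "F = {c \<in> lcos M L. \<forall>x\<in>P. cj x c = c}"
  have "\<exists>k. card (lcos M L) = card F + p * k" unfolding F_def
  proof (rule pgroup_fixed_points[OF PS a p])
    show "finite (lcos M L)" using MS by (simp add: lcos_def subD)
    fix c assume "c \<in> lcos M L"
    then obtain h where h: "h \<in> M" "c = (+) h ` L" by (auto simp: lcos_def)
    show "cj x c \<in> lcos M L" if "x \<in> P" for x using h that nmlD(3)[OF M(1)] by (auto simp: cjl lcos_def)
  qed simp_all
  then have d: "p dvd card F" using dN by (metis dvd_add_left_iff dvd_triv_left)
  have "F \<noteq> {L}" using d p by auto
  moreover have "L \<in> F"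
  proof -
    have "(+) 0 ` L = L" by simp
    then have "L \<in> lcos M L" using subD(2)[OF MS(1)] unfolding lcos_def by (metis imageI)
    then show ?thesis using Lcj by (simp add: F_def)
  qed
  ultimately obtain c where "c \<in> F" "c \<noteq> L" by blast
  then obtain x where x: "x \<in> M" "c = (+) x ` L" "\<forall>y\<in>P. cj y c = c" by (auto simp: F_def lcos_def)
  have xL: "x \<notin> L" using \<open>c \<noteq> L\<close> x lc_eq[OF LN(3), of x 0] subD(4)[OF LN(3)] by auto
  have com: "- x + (y + x + - y) \<in> L" if "y \<in> P" for y
  proof -
    have "(+) x ` L = (+) (y + x + - y) ` L" using cjl[OF that, of x] x(2,3) that by metis
    then show ?thesis by (simp only: lc_eq[OF LN(3)])
  qed
  define K where "K = range (\<lambda>j. tm j x) \<boxplus> L"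
  have cyc: "sub (range (\<lambda>j. tm j x))" "range (\<lambda>j. tm j x) \<subseteq> M" using sub_cyc[OF MS(1) x(1)] by auto
  have KS: "sub K" unfolding K_def by (rule sub_splus_norm(1)[OF cyc(1) LN(3)]) (use cyc(2) MS(2) Lcj in blast)
  have KM: "K \<subseteq> M" unfolding K_def by (rule splus_subset[OF MS(1) cyc(2)]) (use LN in blast)
  have Kx: "x \<in> K" unfolding K_def using splusI[of x "range (\<lambda>j. tm j x)" 0 L] subD(2)[OF LN(3)] tm_1[of x]
    by (metis add.right_neutral rangeI)
  have KL: "L \<subseteq> K" unfolding K_def using subD(2)[OF cyc(1)] by (rule splus_right)
  have "nml K P"
  proof (rule nmlI_cj[OF KS])
    show "K \<subseteq> P" using KM MS by blast
    fix y assume y: "y \<in> P"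
    have yx: "y + x + - y \<in> K"
      using subD(3)[OF KS Kx, of "- x + (y + x + - y)"] com[OF y] KL by (auto simp: gs)
    have 1: "y + tm j x + - y \<in> K" for j using tm_mem[OF KS yx, of j] by (simp add: tm_cj)
    show "cj y K \<subseteq> K"
    proof
      fix z assume "z \<in> cj y K"
      then obtain k where k: "k \<in> K" "z = y + k + - y" by (auto simp: cj_def)
      then obtain j l where jl: "l \<in> L" "k = tm j x + l" unfolding K_def by (blast elim: splusE)
      have "y + l + - y \<in> K" using nmlD(3)[OF LN(1) y jl(1)] KL by blast
      then have "(y + tm j x + - y) + (y + l + - y) \<in> K" using 1 subD(3)[OF KS] by blast
      then show "z \<in> K" using k jl by (simp add: gs)
    qed
  qed
  then have "K = M" using L(2)[of K] KL KM Kx xL by (auto simp: S_def)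
  then have "M = range (\<lambda>j. tm j x) \<boxplus> L" by (simp add: K_def)
  from that[OF LN(1,2) x(1) xL com this] show ?thesis .
qed

text \<open>By \<open>fus\<close>, the subgroup \<open>P\<close> controls the fusion of its own
  elements. Among the normal \<open>Y\<close> with \<open>K = Y \<boxplus> P\<close> take a minimal
  one. If it met \<open>P\<close> nontrivially, the transfer of \<open>Y\<close> into a cyclic
  factor of \<open>Q = P \<inter> Y\<close> that is central in \<open>P\<close> would be onto, and
  its kernel would be a smaller such subgroup.\<close>

theorem normal_complement:
  assumes K: "sub K" and r: "Factorial_Ring.prime (r::nat)" and P: "syl r P K"
    and fus: "\<And>x k. x \<in> P \<Longrightarrow> k \<in> K \<Longrightarrow> k + x + - k \<in> P \<Longrightarrow> \<exists>y\<in>P. y + x + - y = k + x + - k"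
  obtains Y where "nml Y K" "\<not> r dvd card Y" "K = Y \<boxplus> P"
proof -
  have PS: "sub P" "P \<subseteq> K" "pgrp r P" using P syl_pgrp by (auto simp: syl_def)
  define S where "S = {Y. nml Y K \<and> K = Y \<boxplus> P}"
  have "K \<in> S" using splus_absorb[OF K PS(1,2)] nml_refl[OF K] by (simp add: S_def)
  moreover have "finite S" by (rule finite_subset[of _ "Pow K"]) (use subD(1)[OF K] in \<open>auto simp: S_def nml_def\<close>)
  ultimately obtain Y where Ymin: "Y \<in> S" "\<And>Z. Z \<in> S \<Longrightarrow> Z \<subseteq> Y \<Longrightarrow> Z = Y"
    using finite_has_minimal[of S] by blast
  have YS: "nml Y K" "K = Y \<boxplus> P" "sub Y" "Y \<subseteq> K" using Ymin(1) by (auto simp: S_def nml_def)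
  define Q where "Q = P \<inter> Y"
  have sQ: "syl r Q Y" unfolding Q_def by (rule syl_nml[OF r K YS(1) P])
  have QS: "sub Q" "Q \<subseteq> Y" "Q \<subseteq> P" using sQ by (auto simp: syl_def Q_def)
  have QP: "nml Q P" unfolding Q_def Int_commute[of P] by (rule nml_Int[OF YS(1) PS(1,2)])
  have "Q = {0}"
  proof (rule ccontr)
    assume "Q \<noteq> {0}"
    then obtain L x where L: "nml L P" "L \<subset> Q" and x: "x \<in> Q" "x \<notin> L"
      and com: "\<And>y. y \<in> P \<Longrightarrow> - x + (y + x + - y) \<in> L" and gen: "Q = range (\<lambda>j. tm j x) \<boxplus> L"
      using central_chief_factor[OF r PS(3) QP] by blast
    have LS: "sub L" using L by (simp add: nml_def)
    have Lc: "y + l + - y \<in> L" if "y \<in> P" "l \<in> L" for y l using nmlD(3)[OF L(1)] that by blast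
    have Lc': "- y + l + y \<in> L" if "y \<in> P" "l \<in> L" for y l using Lc[of "- y" l] that PS by (simp add: subD)
    have xP: "x \<in> P" using x QS by blast
    have tmP: "tm j x \<in> P" for j by (rule tm_mem[OF PS(1) xP])
    \<comment> \<open>\<open>R y j\<close> says that \<open>y\<close> agrees with \<open>j\<close>
      times \<open>x\<close> modulo \<open>L\<close>: the discrete logarithm of \<open>y\<close>,
      determined modulo the order \<open>n\<close> of \<open>x\<close> modulo
      \<open>L\<close>.\<close>
    define R where "R y j \<longleftrightarrow> - tm j x + y \<in> L" for y j
    have Rex: "\<exists>j. R y j" if yQ: "y \<in> Q" for y
    proof -
      obtain j l where jl: "l \<in> L" "y = tm j x + l" using yQ unfolding gen by (blast elim: splusE)
      then have "- tm j x + y = l" by simp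
      then show ?thesis using jl(1) unfolding R_def by (intro exI[of _ j]) simp
    qed
    have Radd: "R (y + z) (i + j)" if "R y i" "R z j" for y z i j
    proof -
      have "- tm j x + (- tm i x + y) + tm j x \<in> L" using Lc'[OF tmP, of "- tm i x + y" j] that by (simp add: R_def)
      then have "(- tm j x + (- tm i x + y) + tm j x) + (- tm j x + z) \<in> L" using that(2) subD(3)[OF LS] by (simp add: R_def)
      then show ?thesis by (simp add: R_def tm_add gs)
    qed
    have "tm (card Q) x = 0" by (rule tm_card[OF QS(1) x(1)])
    then have "tm (card Q) x \<in> L" "card Q > 0" using subD(2)[OF LS] sub_card_pos[OF QS(1)] by auto
    then have ex: "\<exists>n>0. tm n x \<in> L" by blast
    define n where "n = (LEAST n. n > 0 \<and> tm n x \<in> L)"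
    have n: "n > 0" "tm n x \<in> L" using LeastI_ex[OF ex] by (auto simp: n_def)
    have nmin: "n dvd k" if k: "tm k x \<in> L" for k
    proof (rule ccontr)
      assume nd: "\<not> n dvd k"
      have "tm (k div n * n) x \<in> L" using tm_mem[OF LS n(2)] by (simp add: tm_mult)
      moreover have "tm k x = tm (k div n * n) x + tm (k mod n) x" by (simp flip: tm_add)
      ultimately have "tm (k mod n) x \<in> L" using k sub_add_left[OF LS] by metis
      moreover have "k mod n > 0" "k mod n < n" using nd n by (auto simp: mod_greater_zero_iff_not_dvd)
      ultimately show False using not_less_Least[of "k mod n" "\<lambda>n. n > 0 \<and> tm n x \<in> L"] by (simp add: n_def)
    qed
    have n1: "n \<noteq> 1" using n x by auto
    have Runi: "[int i = int j] (mod int n)" if "R y i" "R y j" for y i j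
    proof -
      have *: "[int i = int j] (mod int n)" if "R y i" "R y j" "i \<le> j" for i j
      proof -
        have "(- tm i x + y) + - (- tm j x + y) \<in> L" using that LS by (simp add: R_def subD)
        then have "- tm i x + tm j x \<in> L" by (simp add: gs)
        moreover have "tm j x = tm i x + tm (j - i) x" using that by (simp flip: tm_add)
        ultimately have "tm (j - i) x \<in> L" by (simp add: gs)
        then have "n dvd j - i" by (rule nmin)
        then have "int n dvd int j - int i" using that by (metis int_dvd_int_iff of_nat_diff)
        then show ?thesis by (simp add: cong_iff_dvd_diff dvd_diff_commute)
      qed
      show ?thesis using *[of i j] *[of j i] that by (cases "i \<le> j") (auto intro: cong_sym)
    qed
    \<comment> \<open>The choice is harmless, since by \<open>Runi\<close> the candidates agree
      modulo \<open>n\<close>.\<close>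
    define l where "l y = int (SOME j. R y j)" for y
    have lR: "[l y = int j] (mod int n)" if "R y j" for y j unfolding l_def by (rule Runi[OF someI[of "R y", OF that] that])
    have Rl: "\<exists>j. R y j \<and> l y = int j" if "y \<in> Q" for y unfolding l_def using someI_ex[OF Rex[OF that]] by blast
    interpret transfer_data Y Q l "int n"
    proof
      fix y z assume "y \<in> Q" "z \<in> Q"
      then obtain i j where ij: "R y i" "l y = int i" "R z j" "l z = int j" using Rl by metis
      then show "[l (y + z) = l y + l z] (mod int n)" using lR[OF Radd[OF ij(1,3)]] by simp
    qed (use YS QS in auto)
    have l_conj: "[l (y + z + - y) = l z] (mod int n)" if yz: "y \<in> P" "z \<in> Q" for y z
    proof -
      obtain j where j: "R z j" "l z = int j" using Rl yz by blast
      have "R (y + tm j x + - y) j"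
      proof (induct j)
        case 0 show ?case using subD(2)[OF LS] by (simp add: R_def)
      next
        case (Suc j)
        have "R (y + x + - y) 1" using com[OF yz(1)] by (simp add: R_def)
        from Radd[OF this Suc] show ?case by (simp add: gs)
      qed
      moreover have "R (y + (- tm j x + z) + - y) 0" using Lc[OF yz(1)] j by (simp add: R_def)
      ultimately have "R ((y + tm j x + - y) + (y + (- tm j x + z) + - y)) (j + 0)" by (rule Radd)
      then have "R (y + z + - y) j" by (simp add: gs)
      then show ?thesis using lR j by simp
    qed
    define tau :: "'a set \<Rightarrow> 'a" where "tau c = (SOME y. y \<in> c)" for c
    have tau: "tau c \<in> c" if c: "c \<in> lcos Y Q" for c
    proof -
      obtain h where "c = (+) h ` Q" using c by (auto simp: lcos_def)
      then have "c \<noteq> {}" using subD(2)[OF QS(1)] by auto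
      then show ?thesis unfolding tau_def by (simp add: some_in_eq)
    qed
    define V where "V = transfer Y Q l tau"
    define m where "m = card (lcos Y Q)"
    have V_add: "[V (y + z) = V y + V z] (mod int n)" if "y \<in> Y" "z \<in> Y" for y z
      unfolding V_def by (rule transfer_add[OF tau that])
    \<comment> \<open>Elements of \<open>Q\<close> conjugate under \<open>Y\<close> are conjugate
      under \<open>P\<close> by \<open>fus\<close>, and \<open>l\<close> is invariant under
      \<open>P\<close> because \<open>x\<close> is central modulo \<open>L\<close>.\<close>
    have V_Q: "[V y = int m * l y] (mod int n)" if y: "y \<in> Q" for y unfolding V_def m_def
    proof (rule transfer_eval[OF y tau])
      fix t k assume t: "t \<in> Y" "- t + tm k y + t \<in> Q" "tm k y \<in> Q"
      have "- t \<in> K" using t(1) YS(3,4) subD(4) by blast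
      then have "\<exists>z\<in>P. z + tm k y + - z = - t + tm k y + - (- t)"
        using t QS by (intro fus) auto
      then obtain z where "z \<in> P" "z + tm k y + - z = - t + tm k y + t" by auto
      then show "[l (- t + tm k y + t) = l (tm k y)] (mod int n)" using l_conj t(3) by metis
    qed
    have V_conj: "[V (k + y + - k) = V y] (mod int n)" if "k \<in> P" "y \<in> Y" for k y
      unfolding V_def by (rule transfer_conj[OF that(2) tau])
        (use that nml_cj[OF YS(1)] nml_cj[OF QP] PS(2) l_conj in auto)
    \<comment> \<open>\<open>m\<close> is the index of a Sylow \<open>r\<close>-subgroup and
      \<open>n\<close> is a power of \<open>r\<close>; so \<open>m\<close> is invertible modulo
      \<open>n\<close>, which makes the transfer onto.\<close>
    have "\<not> r dvd m" unfolding m_def by (rule syl_index[OF r sQ YS(3)]) (use card_lcos[OF YS(3) QS(1,2)] in simp)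
    moreover have "n dvd card Q" using nmin \<open>tm (card Q) x \<in> L\<close> by blast
    then have "n dvd r ^ multiplicity r (card Y)" using sQ by (simp add: syl_def)
    then obtain b where "n = r ^ b" using divides_primepow_nat[OF r] by blast
    moreover have "coprime (r ^ b) m" if "\<not> r dvd m" using prime_imp_coprime[OF r that] by simp
    ultimately have "coprime m n" by (simp add: coprime_commute)
    then have cop: "coprime (int m) (int n)" by simp
    define Z where "Z = {y \<in> Y. [V y = 0] (mod int n)}"
    have V0: "[V 0 = 0] (mod int n)" using V_add[of 0 0] subD(2)[OF YS(3)] by (simp add: cong_iff_dvd_diff)
    have V_minus: "[V (- y) = - V y] (mod int n)" if "y \<in> Y" for y
    proof -
      have "[V (- y + y) = V (- y) + V y] (mod int n)" using that YS(3) by (intro V_add) (simp_all add: subD)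
      then have "[V (- y) + V y = 0] (mod int n)" using V0 by (metis cong_sym cong_trans left_minus)
      then show ?thesis by (simp add: cong_iff_dvd_diff)
    qed
    have ZS: "sub Z"
    proof (rule subI)
      show "finite Z" using subD(1)[OF YS(3)] by (simp add: Z_def)
      show "0 \<in> Z" using V0 subD(2)[OF YS(3)] by (simp add: Z_def)
      fix y assume y: "y \<in> Z"
      show "- y \<in> Z" using V_minus[of y] y subD(4)[OF YS(3)] dvd_add_left_iff[of "int n" "V y" "V (- y)"]
        by (auto simp: Z_def cong_iff_dvd_diff)
      fix z assume z: "z \<in> Z"
      show "y + z \<in> Z" using V_add[of y z] y z subD(3)[OF YS(3)] cong_add[of "V y" 0 "int n" "V z" 0] cong_trans by (fastforce simp: Z_def)
    qed
    have ZQ: "Y = Z \<boxplus> Q"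
    proof
      show "Z \<boxplus> Q \<subseteq> Y" by (rule splus_subset[OF YS(3)]) (use QS in \<open>auto simp: Z_def\<close>)
      show "Y \<subseteq> Z \<boxplus> Q"
      proof
        fix y assume y: "y \<in> Y"
        \<comment> \<open>With \<open>u\<close> inverse to \<open>m\<close>, the element
          \<open>tm j x\<close> has the same transfer as \<open>y\<close>, so that \<open>y\<close>
          differs from it by an element of the kernel \<open>Z\<close>.\<close>
        obtain u where u: "[int m * u = 1] (mod int n)" using cong_solve_coprime_int[OF cop] by blast
        define j where "j = nat ((u * V y) mod int n)"
        have j: "int j = (u * V y) mod int n" using n by (simp add: j_def)
        have "[V (tm j x) = int m * l (tm j x)] (mod int n)" by (rule V_Q) (simp add: tm_mem QS x)
        also have "[int m * l (tm j x) = int m * int j] (mod int n)" by (intro cong_mult cong_refl lR) (simp add: R_def subD(2)[OF LS])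
        also have "[int m * int j = int m * (u * V y)] (mod int n)" unfolding j by (intro cong_mult cong_refl) simp
        also have "int m * (u * V y) = (int m * u) * V y" by simp
        also have "[(int m * u) * V y = 1 * V y] (mod int n)" using u by (intro cong_mult) simp_all
        finally have Vj: "[V (tm j x) = V y] (mod int n)" by simp
        have tY: "tm j x \<in> Y" "tm j x \<in> Q" using tm_mem[OF QS(1) x(1), of j] QS by auto
        have "[V (y + - tm j x) = V y + V (- tm j x)] (mod int n)" using y tY YS(3) by (intro V_add) (simp_all add: subD)
        also have "[V y + V (- tm j x) = V y + - V (tm j x)] (mod int n)" by (intro cong_add cong_refl V_minus tY)
        also have "[V y + - V (tm j x) = 0] (mod int n)" using Vj by (simp add: cong_iff_dvd_diff dvd_diff_commute add_uminus_conv_diff)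
        finally have "y + - tm j x \<in> Z" using y tY YS(3) by (simp add: Z_def subD)
        then have "(y + - tm j x) + tm j x \<in> Z \<boxplus> Q" using tY by (intro splusI)
        then show "y \<in> Z \<boxplus> Q" by (simp add: gs)
      qed
    qed
    have "Z \<in> S" unfolding S_def
    proof (intro CollectI conjI)
      show "nml Z K"
      proof (rule nmlI_cj[OF ZS])
        show "Z \<subseteq> K" using YS by (auto simp: Z_def)
        fix k assume "k \<in> K"
        then obtain y z where k: "y \<in> Y" "z \<in> P" "k = y + z" using YS(2) by (blast elim: splusE)
        show "cj k Z \<subseteq> Z"
        proof
          fix a assume "a \<in> cj k Z"
          then obtain w where w: "w \<in> Z" "a = k + w + - k" by (auto simp: cj_def)
          have wY: "w \<in> Y" "[V w = 0] (mod int n)" using w by (auto simp: Z_def)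
          have zw: "z + w + - z \<in> Y" using nmlD(3)[OF YS(1)] k PS(2) wY by blast
          have aY: "a = y + (z + w + - z) + - y" using k w by (simp add: gs)
          have ay: "y + (z + w + - z) \<in> Y" "- y \<in> Y" using k zw YS(3) by (simp_all add: subD)
          have "[V a = V (y + (z + w + - z)) + V (- y)] (mod int n)" unfolding aY by (rule V_add[OF ay])
          also have "[V (y + (z + w + - z)) + V (- y) = (V y + V (z + w + - z)) + - V y] (mod int n)"
            by (intro cong_add V_add V_minus k zw)
          also have "[(V y + V (z + w + - z)) + - V y = (V y + V w) + - V y] (mod int n)"
            by (intro cong_add cong_refl V_conj k wY)
          also have "(V y + V w) + - V y = V w" by simp
          finally show "a \<in> Z" using wY(2) ay YS(3) aY by (auto simp: Z_def subD intro: cong_trans)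
        qed
      qed
      have "Q \<boxplus> P = P" using splus_subset[OF PS(1) QS(3)] splus_right[of Q P] subD(2)[OF QS(1)] by blast
      then show "K = Z \<boxplus> P" using YS(2) ZQ splus_assoc[of Z Q P] by simp
    qed
    \<comment> \<open>By minimality the transfer vanishes on \<open>Y\<close>. But its value at
      \<open>x\<close> is \<open>m\<close>, a unit modulo \<open>n\<close>, and \<open>n\<close> is
      not 1.\<close>
    then have "Z = Y" using Ymin(2)[of Z] by (auto simp: Z_def)
    then have "[V x = 0] (mod int n)" using x QS by (auto simp: Z_def)
    then have "[int m * l x = 0] (mod int n)" using V_Q[OF x(1)] by (metis cong_sym cong_trans)
    then have "int n dvd l x" using cop by (simp add: cong_0_iff coprime_dvd_mult_right_iff coprime_commute)
    moreover have "[l x = int 1] (mod int n)" by (rule lR) (simp add: R_def subD(2)[OF LS])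
    ultimately have "int n dvd 1" by (simp add: cong_dvd_iff)
    then show False using n1 by simp
  qed
  then have "card Q = 1" by simp
  then have "multiplicity r (card Y) = 0" using sQ r by (metis One_nat_def nat_power_eq_Suc_0_iff not_prime_1 syl_def)
  then have "\<not> r dvd card Y"
    using r sub_card_pos[OF YS(3)] prime_multiplicity_gt_zero_iff[of r "card Y"] by auto
  then show ?thesis using that YS by blast
qed

subsection \<open>Solvable groups and the Fitting subgroup\<close>

definition der :: "'g::group_add set \<Rightarrow> 'g set" where
  "der H = gen {x + y + - x + - y | x y. x \<in> H \<and> y \<in> H}"

primrec ders :: "'g::group_add set \<Rightarrow> nat \<Rightarrow> 'g set" where
  "ders H 0 = H"
| "ders H (Suc n) = der (ders H n)"

definition solv :: "'g::group_add set \<Rightarrow> bool" where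
  "solv H \<longleftrightarrow> sub H \<and> (\<exists>n. ders H n = {0})"

lemma sub_der: assumes "sub H" shows "sub (der H)" "der H \<subseteq> H"
proof -
  have "{x + y + - x + - y | x y. x \<in> H \<and> y \<in> H} \<subseteq> H"
    by (auto intro!: subD(3)[OF assms] subD(4)[OF assms])
  then show "sub (der H)" "der H \<subseteq> H" using sub_gen[OF assms] by (auto simp: der_def)
qed

lemma der_comm: "x \<in> H \<Longrightarrow> y \<in> H \<Longrightarrow> x + y + - x + - y \<in> der H"
  unfolding der_def by (rule subsetD[OF gen_inc]) blast

lemma der_mono: "H \<subseteq> K \<Longrightarrow> der H \<subseteq> der K"
  unfolding der_def by (intro gen_least grp_gen subset_trans[OF _ gen_inc]) blast

lemma cj_der: "cj g (der H) = der (cj g H)"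
proof -
  have le: "cj g (der H) \<subseteq> der (cj g H)" for g :: 'a and H
    unfolding der_def[of H] cj_gen
  proof (rule gen_least)
    show "grp (der (cj g H))" unfolding der_def by (rule grp_gen)
    show "cj g {x + y + - x + - y | x y. x \<in> H \<and> y \<in> H} \<subseteq> der (cj g H)"
    proof
      fix z assume "z \<in> cj g {x + y + - x + - y | x y. x \<in> H \<and> y \<in> H}"
      then obtain x y where xy: "x \<in> H" "y \<in> H" "z = g + (x + y + - x + - y) + - g" unfolding cj_def by blast
      have "z = (g + x + - g) + (g + y + - g) + - (g + x + - g) + - (g + y + - g)" using xy(3) by (simp add: gs)
      also have "\<dots> \<in> der (cj g H)" by (rule der_comm) (use xy in \<open>simp_all add: cj_def\<close>)
      finally show "z \<in> der (cj g H)" .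
    qed
  qed
  have "cj (- g) (der (cj g H)) \<subseteq> der H" using le[of "- g" "cj g H"] by simp
  then have "cj g (cj (- g) (der (cj g H))) \<subseteq> cj g (der H)" by (rule cj_mono)
  then show ?thesis using le[of g H] by simp
qed

lemma sub_ders: "sub H \<Longrightarrow> sub (ders H n) \<and> ders H n \<subseteq> H"
  by (induct n) (auto dest: sub_der)

lemma ders_mono: "H \<subseteq> K \<Longrightarrow> ders H n \<subseteq> ders K n"
  by (induct n) (auto dest: der_mono)

lemma cj_ders: "cj g (ders H n) = ders (cj g H) n"
  by (induct n) (simp_all add: cj_der)

lemma ders_add: "ders H (m + n) = ders (ders H m) n"
  by (induct n) simp_all

lemma nml_ders: "nml N H \<Longrightarrow> nml (ders N n) H"
  using sub_ders[of N n] by (intro nmlI_cj) (auto simp: cj_ders nml_cj nml_def)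

lemma solv_sub: "solv H \<Longrightarrow> sub K \<Longrightarrow> K \<subseteq> H \<Longrightarrow> solv K"
  unfolding solv_def using ders_mono[of K H] sub_ders[of K] subD(2) by (metis subset_singletonD empty_iff)

lemma nml_splus: assumes "nml M H" "nml N H" "sub H" shows "nml (M \<boxplus> N) H"
proof (rule nmlI_cj)
  show "sub (M \<boxplus> N)" by (rule sub_splus_norm) (use assms nml_cj[of N H] in \<open>auto simp: nml_def\<close>)
  show "M \<boxplus> N \<subseteq> H" using assms by (intro splus_subset) (auto simp: nml_def)
  show "cj h (M \<boxplus> N) \<subseteq> M \<boxplus> N" if "h \<in> H" for h using that assms by (simp add: cj_splus nml_cj)
qed

lemma nml_pgrp_syl: assumes p: "Factorial_Ring.prime p" and H: "sub H" and N: "nml N H" "pgrp p N" and P: "syl p P H"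
  shows "N \<subseteq> P"
proof -
  obtain h where h: "h \<in> H" "N \<subseteq> cj h P" using sylow_sub_conj[OF p H P N(2)] N(1) by (auto simp: nml_def)
  have "cj (- h) N \<subseteq> cj (- h) (cj h P)" using h by (intro cj_mono)
  then show ?thesis using nml_cj[OF N(1) subD(4)[OF H h(1)]] by simp
qed

lemma nilI_syl: assumes H: "sub H" and S: "\<And>p. Factorial_Ring.prime p \<Longrightarrow> \<exists>P. syl p P H \<and> nml P H" shows "nil H"
  unfolding nil_def
proof (intro conjI allI impI H)
  fix p :: nat assume p: "Factorial_Ring.prime p"
  then obtain P where P: "syl p P H" "nml P H" using S by blast
  have "pt p H \<subseteq> P"
  proof
    fix x assume x: "x \<in> pt p H"
    then have xH: "x \<in> H" "pel p x" by (auto simp: pt_def)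
    have "pgrp p (range (\<lambda>n. tm n x))"
      by (rule pgrpI_pel[OF sub_cyc(1)[OF H xH(1)] p]) (use xH pel_tm in auto)
    then obtain h where h: "h \<in> H" "range (\<lambda>n. tm n x) \<subseteq> cj h P"
      using sylow_sub_conj[OF p H P(1)] sub_cyc(2)[OF H xH(1)] by blast
    moreover have "x \<in> range (\<lambda>n. tm n x)" by (metis rangeI tm_1)
    ultimately show "x \<in> P" using nml_cj[OF P(2) h(1)] by blast
  qed
  moreover have "P \<subseteq> pt p H" using P pgrp_pel[OF syl_pgrp[OF P(1)]] by (auto simp: pt_def syl_def)
  ultimately show "sub (pt p H)" using P(1) by (simp add: subset_antisym syl_def)
qed

lemma pgrp_splus: assumes p: "Factorial_Ring.prime p" and "pgrp p P" "pgrp p Q" "sub (P \<boxplus> Q)" shows "pgrp p (P \<boxplus> Q)"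
proof -
  obtain a b where "card P = p ^ a" "card Q = p ^ b" "sub P" "sub Q" using assms by (auto simp: pgrp_def)
  then have "card (P \<boxplus> Q) dvd p ^ (a + b)" using card_splus[of P Q] by (metis dvd_triv_left power_add)
  then show ?thesis using divides_primepow_nat[OF p] assms(4) by (auto simp: pgrp_def)
qed

text \<open>Fitting's theorem. The sum of the \<open>p\<close>-parts of \<open>M\<close> and
  \<open>N\<close> is a normal \<open>p\<close>-subgroup; the product formula, applied to
  \<open>M\<close> and \<open>N\<close> and to their parts, shows that it is a Sylow
  subgroup.\<close>

lemma nil_splus: assumes H: "sub H" and M: "nml M H" "nil M" and N: "nml N H" "nil N" shows "nil (M \<boxplus> N)"
proof (rule nilI_syl)
  have MN: "nml (M \<boxplus> N) H" by (rule nml_splus[OF M(1) N(1) H])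
  then show S: "sub (M \<boxplus> N)" by (simp add: nml_def)
  have le: "M \<subseteq> M \<boxplus> N" "N \<subseteq> M \<boxplus> N" using splus_left[of N M] splus_right[of M N] M N by (auto simp: subD nilD)
  fix p :: nat assume p: "Factorial_Ring.prime p"
  let ?P = "pt p M \<boxplus> pt p N"
  have P: "nml ?P H" by (intro nml_splus nml_pt M N p H)
  have subs: "sub (pt p M)" "sub (pt p N)" "sub (M \<inter> N)" using M N p by (auto simp: nilD sub_Int)
  have "?P \<subseteq> M \<boxplus> N" by (intro splus_mono pt_sub)
  moreover have "pgrp p ?P" by (rule pgrp_splus[OF p]) (use P M N p nil_pgrp in \<open>auto simp: nml_def\<close>)
  moreover have "multiplicity p (card (M \<boxplus> N)) \<le> multiplicity p (card ?P)"
  proof -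
    have "multiplicity p (card (M \<boxplus> N)) + multiplicity p (card (M \<inter> N)) = multiplicity p (card M) + multiplicity p (card N)"
      by (rule mult_splus[OF p]) (use M N nilD in auto)
    moreover have "multiplicity p (card ?P) + multiplicity p (card (pt p M \<inter> pt p N)) = multiplicity p (card (pt p M)) + multiplicity p (card (pt p N))"
      by (rule mult_splus[OF p subs(1,2)])
    moreover have "pt p M \<inter> pt p N = pt p (M \<inter> N)" by (auto simp: pt_def)
    moreover have "multiplicity p (card (pt p M)) = multiplicity p (card M)" "multiplicity p (card (pt p N)) = multiplicity p (card N)"
      using syl_mult[OF p nil_syl[OF p]] M N by auto
    moreover have "multiplicity p (card (pt p (M \<inter> N))) = multiplicity p (card (M \<inter> N))"
      by (rule syl_mult[OF p nil_syl[OF p]]) (use nil_sub[OF M(2) subs(3)] in blast)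
    ultimately show ?thesis by simp
  qed
  ultimately have "syl p ?P (M \<boxplus> N)" using S by (intro sylI[OF p])
  moreover have "nml ?P (M \<boxplus> N)" using P MN \<open>?P \<subseteq> M \<boxplus> N\<close> by (intro nml_mono[OF P]) (auto simp: nml_def)
  ultimately show "\<exists>P. syl p P (M \<boxplus> N) \<and> nml P (M \<boxplus> N)" by blast
qed

text \<open>\<open>W\<close>, its derived subgroup and 0 form a central chain.\<close>

lemma class2_nil: assumes W: "sub W" and c: "\<And>x y. x \<in> der W \<Longrightarrow> y \<in> W \<Longrightarrow> x + y = y + x" shows "nil W"
proof (rule chain_nil[OF W, of "\<lambda>i. if i = 0 then W else if i = 1 then der W else {0}" 2])
  fix i :: nat and x y assume x: "x \<in> (if i = 0 then W else if i = 1 then der W else {0})" and y: "y \<in> W"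
  consider "i = 0" | "i = 1" | "i > 1" by linarith
  then show "x + y + - x + - y \<in> (if Suc i = 0 then W else if Suc i = 1 then der W else {0})"
  proof cases
    case 1 then show ?thesis using x y der_comm[of x W y] by simp
  next
    case 2
    then have "x + y = y + x" using c[of x y] x y by simp
    then have "x + y + - x + - y = 0" by (simp add: gs)
    then show ?thesis using 2 by simp
  next
    case 3 then show ?thesis using x by simp
  qed
next
  fix i show "(if i = 0 then W else if i = 1 then der W else {0}) \<subseteq> W"
    using sub_der(2)[OF W] subD(2)[OF W] by auto
qed simp_all

text \<open>\<open>F\<close> is a maximal nilpotent normal subgroup. If its centraliser were not
  inside \<open>F\<close>, the last term of the derived series of the centraliser that is not inside
  \<open>F\<close> would have its derived subgroup in \<open>F\<close>, hence central; it would be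
  normal and nilpotent of class two, so inside \<open>F\<close> after all.\<close>

lemma fitting: assumes H: "solv H"
  obtains F where "nml F H" "nil F" "cen H F \<subseteq> F" "\<And>N. nml N H \<Longrightarrow> nil N \<Longrightarrow> N \<subseteq> F"
proof -
  have HS: "sub H" using H by (simp add: solv_def)
  define S where "S = {N. nml N H \<and> nil N}"
  have fS: "finite S" by (rule finite_subset[of _ "Pow H"]) (use subD(1)[OF HS] in \<open>auto simp: S_def nml_def\<close>)
  have "nil {0::'a}" by (rule class2_nil[OF sub_zero]) (use sub_der(2)[OF sub_zero] in auto)
  then have "{0} \<in> S" using nml_zero[OF HS] by (simp add: S_def)
  then obtain F where F: "F \<in> S" "\<And>N. N \<in> S \<Longrightarrow> F \<subseteq> N \<Longrightarrow> F = N" using finite_has_maximal[OF fS] by blast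
  have FN: "nml F H" "nil F" "sub F" using F(1) by (auto simp: S_def nml_def)
  have mx: "N \<subseteq> F" if N: "nml N H" "nil N" for N
  proof -
    have "N \<boxplus> F \<in> S" using N FN HS by (auto simp: S_def intro: nml_splus nil_splus)
    moreover have "F \<subseteq> N \<boxplus> F" "N \<subseteq> N \<boxplus> F" using splus_right[of N F] splus_left[of F N] N FN by (auto simp: nml_def subD)
    ultimately show ?thesis using F(2)[of "N \<boxplus> F"] by blast
  qed
  have "cen H F \<subseteq> F"
  proof (rule ccontr)
    assume n: "\<not> cen H F \<subseteq> F"
    have C: "nml (cen H F) H" by (rule nml_cen[OF FN(1) HS])
    obtain k where "ders H k = {0}" using H by (auto simp: solv_def)
    then have "ders (cen H F) k \<subseteq> F" using ders_mono[OF cen_sub[of H F], of k] subD(2)[OF FN(3)] by auto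
    define i where "i = (LEAST i. ders (cen H F) i \<subseteq> F)"
    have i: "ders (cen H F) i \<subseteq> F" unfolding i_def by (rule LeastI) fact
    have "i \<noteq> 0" using i n by (auto intro: notI)
    then obtain j where j: "i = Suc j" by (cases i) auto
    define W where "W = ders (cen H F) j"
    have nW: "\<not> W \<subseteq> F" using j not_less_Least[of j "\<lambda>i. ders (cen H F) i \<subseteq> F"] by (simp add: i_def W_def)
    have W: "nml W H" unfolding W_def by (rule nml_ders[OF C])
    have WC: "W \<subseteq> cen H F" unfolding W_def using sub_ders[of "cen H F" j] C by (simp add: nml_def)
    have dW: "der W \<subseteq> F" using i j by (simp add: W_def)
    have "nil W"
    proof (rule class2_nil)
      show "sub W" using W by (simp add: nml_def)
      fix x y assume "x \<in> der W" "y \<in> W"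
      then show "x + y = y + x" using dW WC by (force simp: cen_def)
    qed
    then show False using mx[OF W] nW by blast
  qed
  then show ?thesis using that FN mx by blast
qed

subsection \<open>Conjugates of a Sylow subgroup\<close>

lemma cj_eq_iff: "cj u V = W \<longleftrightarrow> V = cj (- u) W"
proof
  assume "cj u V = W"
  then have "cj (- u) (cj u V) = cj (- u) W" by (rule arg_cong)
  then show "V = cj (- u) W" by simp
qed simp

lemma card_image_eq:
  assumes e: "\<And>u v. u \<in> U \<Longrightarrow> v \<in> U \<Longrightarrow> f u = f v \<longleftrightarrow> g u = g v"
  shows "card (f ` U) = card (g ` U)"
proof (rule bij_betw_same_card[of "\<lambda>y. g (inv_into U f y)"], rule bij_betw_imageI)
  have i: "inv_into U f y \<in> U" "f (inv_into U f y) = y" if "y \<in> f ` U" for y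
    using that by (simp_all add: inv_into_into f_inv_into_f)
  show "inj_on (\<lambda>y. g (inv_into U f y)) (f ` U)"
  proof (rule inj_onI)
    fix y z assume yz: "y \<in> f ` U" "z \<in> f ` U" "g (inv_into U f y) = g (inv_into U f z)"
    then have "f (inv_into U f y) = f (inv_into U f z)" using e[OF i(1) i(1)] by blast
    then show "y = z" using i(2)[OF yz(1)] i(2)[OF yz(2)] by simp
  qed
  have "g (inv_into U f (f u)) = g u" if "u \<in> U" for u
    using e[OF i(1)[of "f u"] that] i(2)[of "f u"] that by simp
  then show "(\<lambda>y. g (inv_into U f y)) ` f ` U = g ` U" unfolding image_image by (rule image_cong[OF refl])
qed

lemma card_conjugates: assumes U: "sub U"
  shows "card ((\<lambda>u. cj u V) ` U) * card (nrm U V) = card U"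
proof -
  have N: "sub (nrm U V)" "nrm U V \<subseteq> U" by (simp_all add: sub_nrm U nrm_sub)
  have e: "cj u V = cj v V \<longleftrightarrow> (+) u ` nrm U V = (+) v ` nrm U V" if "u \<in> U" "v \<in> U" for u v
  proof -
    have "cj u V = cj v V \<longleftrightarrow> V = cj (- u + v) V"
      by (simp add: cj_eq_iff)
    moreover have "- u + v \<in> U" using that U by (simp add: subD)
    ultimately show ?thesis unfolding lc_eq[OF N(1)] by (auto simp: nrm_def)
  qed
  have "card ((\<lambda>u. cj u V) ` U) = card (lcos U (nrm U V))"
    unfolding lcos_def by (rule card_image_eq[OF e])
  then show ?thesis using card_lcos[OF U N] by simp
qed

text \<open>\<open>R\<close> permutes the conjugates of \<open>P\<close>, because these are the
  Sylow \<open>s\<close>-subgroups of \<open>U\<close>; their number is prime to \<open>r\<close>,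
  so one of them is fixed.\<close>

lemma fix_sylow:
  assumes U: "sub U" and R: "pgrp r R" "Factorial_Ring.prime r" and s: "Factorial_Ring.prime s" and P: "syl s P U"
    and RU: "\<And>x. x \<in> R \<Longrightarrow> cj x U = U" and nd: "\<not> r dvd card ((\<lambda>u. cj u P) ` U)"
  obtains u where "u \<in> U" "\<And>x. x \<in> R \<Longrightarrow> cj x (cj u P) = cj u P"
proof -
  obtain a where a: "sub R" "card R = r ^ a" using R by (auto simp: pgrp_def)
  have "\<exists>Q\<in>(\<lambda>u. cj u P) ` U. \<forall>x\<in>R. cj x Q = Q"
  proof (rule pgroup_fix_exists[OF a R(2) _ _ _ _ nd])
    show "finite ((\<lambda>u. cj u P) ` U)" using U by (simp add: subD)
    fix x Q assume x: "x \<in> R" and "Q \<in> (\<lambda>u. cj u P) ` U"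
    then obtain u where u: "u \<in> U" "Q = cj u P" by blast
    have "syl s (cj x (cj u P)) (cj x U)" by (intro syl_cj2 syl_cj U u P)
    then have "syl s (cj x (cj u P)) U" using RU[OF x] by simp
    then show "cj x Q \<in> (\<lambda>u. cj u P) ` U" using sylow_conj[OF s U P] u by blast
  qed simp_all
  then show ?thesis using that by blast
qed

subsection \<open>Products of nilpotent groups of coprime order: minimal counterexamples\<close>

definition ncl :: "'g::group_add set \<Rightarrow> 'g set \<Rightarrow> 'g set" where
  "ncl G S = gen (\<Union>g\<in>G. cj g S)"

lemma ncl_nml: assumes G: "sub G" and S: "S \<subseteq> G" shows "nml (ncl G S) G" "S \<subseteq> ncl G S"
proof -
  have le: "(\<Union>g\<in>G. cj g S) \<subseteq> G" using cj_sub_mem[OF G _ S] by blast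
  have s: "sub (ncl G S)" "ncl G S \<subseteq> G" using sub_gen[OF G le] by (auto simp: ncl_def)
  show "nml (ncl G S) G"
  proof (rule nmlI_cj[OF s])
    fix h assume h: "h \<in> G"
    have "cj h (\<Union>g\<in>G. cj g S) \<subseteq> (\<Union>g\<in>G. cj g S)"
    proof
      fix x assume "x \<in> cj h (\<Union>g\<in>G. cj g S)"
      then obtain g where g: "g \<in> G" "x \<in> cj h (cj g S)" by (auto simp: cj_def)
      then have "x \<in> cj (h + g) S" by simp
      then show "x \<in> (\<Union>g\<in>G. cj g S)" using subD(3)[OF G h g(1)] by blast
    qed
    then show "cj h (ncl G S) \<subseteq> ncl G S" unfolding ncl_def cj_gen
      by (intro gen_least grp_gen subset_trans[OF _ gen_inc])
  qed
  have "cj 0 S \<subseteq> (\<Union>g\<in>G. cj g S)" using subD(2)[OF G] by blast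
  then show "S \<subseteq> ncl G S" unfolding ncl_def using gen_inc[of "\<Union>g\<in>G. cj g S"] by simp
qed

lemma ncl_least: "sub K \<Longrightarrow> (\<And>g. g \<in> G \<Longrightarrow> cj g S \<subseteq> K) \<Longrightarrow> ncl G S \<subseteq> K"
  unfolding ncl_def by (intro gen_least) (auto simp: sub_def)

lemma coprime_card_Int: assumes "sub A" "sub B" "coprime (card A) (card B)" shows "A \<inter> B = {0}"
proof -
  have "card (A \<inter> B) dvd card A" "card (A \<inter> B) dvd card B" using assms by (auto intro!: lagrange_sub sub_Int)
  then have "card (A \<inter> B) = 1" using assms(3) by (metis coprime_common_divisor_nat nat_dvd_1_iff_1 is_unit_gcd dvd_refl gcd_greatest)
  then show ?thesis using sub_card1[OF sub_Int[OF assms(1,2)]] by blast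
qed

lemma card_splus_coprime: assumes "sub A" "sub B" "coprime (card A) (card B)" shows "card (A \<boxplus> B) = card A * card B"
  using card_splus[OF assms(1,2)] coprime_card_Int[OF assms] by simp

text \<open>The index of \<open>A\<close> in \<open>S \<boxplus> A\<close> divides both the order of
  \<open>S\<close> and the index \<open>c\<close> of \<open>A\<close> in \<open>H\<close>, hence is
  1.\<close>

lemma coprime_absorb:
  assumes S: "sub S" "sub A" "sub (S \<boxplus> A)" and H: "S \<boxplus> A \<subseteq> H" "sub H" "card H = card A * c" and c: "coprime (card S) c"
  shows "S \<subseteq> A"
proof -
  have AS: "A \<subseteq> S \<boxplus> A" "S \<subseteq> S \<boxplus> A" using splus_right[of S A] splus_left[of A S] S by (auto simp: subD)
  obtain k where k: "card (S \<boxplus> A) = card A * k" using lagrange_sub[OF S(3,2) AS(1)] by (auto elim: dvdE)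
  have A0: "card A > 0" by (rule sub_card_pos[OF S(2)])
  have "card (S \<boxplus> A) dvd card H" by (rule lagrange_sub) (use S H in auto)
  then have "k dvd c" using k H(3) A0 by simp
  moreover have "card A * k * card (S \<inter> A) = card S * card A" using card_splus[OF S(1,2)] k by simp
  then have "k * card (S \<inter> A) = card S" using A0 by (simp add: mult.commute mult.left_commute)
  then have "k dvd card S" by (metis dvd_triv_left)
  ultimately have "k = 1" using c by (metis coprime_common_divisor_nat nat_dvd_1_iff_1 is_unit_gcd gcd_greatest coprime_iff_gcd_eq_1)
  then have "A = S \<boxplus> A" using k AS subD(1)[OF S(3)] by (intro card_subset_eq) simp_all
  then show ?thesis using AS(2) by simp
qed

lemma comm_neg: assumes "(a::'g::group_add) + g = g + a" shows "- a + g = g + - a"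
proof -
  have "- a + (a + g) + - a = - a + (g + a) + - a" using assms by simp
  then show ?thesis by (simp add: gs)
qed

text \<open>The parts of \<open>A\<close> other than the \<open>p\<close>-part centralise every
  subset of the \<open>p\<close>-part.\<close>

lemma nrm_pt: assumes A: "nil A" "A \<subseteq> G" "sub G" and p: "Factorial_Ring.prime p" and Y: "Y \<subseteq> pt p A" "pt p A \<subseteq> nrm G Y"
  shows "A \<subseteq> nrm G Y"
proof (rule parts_gen[OF nilD(1)[OF A(1)]])
  show "x + y \<in> nrm G Y" if "x \<in> nrm G Y" "y \<in> nrm G Y" for x y using subD(3)[OF sub_nrm[OF A(3)] that] .
  fix q :: nat assume q: "Factorial_Ring.prime q"
  show "pt q A \<subseteq> nrm G Y"
  proof (cases "q = p")
    case False
    have "pt q A \<subseteq> cen G Y"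
    proof
      fix x assume x: "x \<in> pt q A"
      then have "x \<in> G" using pt_sub[of q A] A(2) by blast
      moreover have "x + y = y + x" if "y \<in> Y" for y using pt_commute[OF A(1) q p False x, of y] Y(1) that by blast
      ultimately show "x \<in> cen G Y" by (simp add: cen_def)
    qed
    then show ?thesis using cen_nrm[of G Y] by blast
  qed (use Y in simp)
qed

text \<open>
  A minimal counterexample to the solvability of a product of nilpotent groups of coprime orders,
  neither of which has prime power order.
\<close>

locale coprime_factor =
  fixes G A B :: "'g::group_add set"
  assumes G: "sub G" and A: "nil A" "A \<subseteq> G" "A \<noteq> {0}" and B: "nil B" "B \<subseteq> G" "B \<noteq> {0}"
    and GAB: "G = A \<boxplus> B" and cop: "coprime (card A) (card B)"
    and simple: "\<And>N. nml N G \<Longrightarrow> N = {0} \<or> N = G"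
    and IH: "\<And>A' B'. sub A' \<Longrightarrow> A' \<subseteq> A \<Longrightarrow> sub B' \<Longrightarrow> B' \<subseteq> B \<Longrightarrow> sub (A' \<boxplus> B') \<Longrightarrow> A' \<boxplus> B' \<noteq> G \<Longrightarrow> solv (A' \<boxplus> B')"
    and A2: "\<And>p. Factorial_Ring.prime p \<Longrightarrow> \<exists>r. Factorial_Ring.prime r \<and> r \<noteq> p \<and> pt r A \<noteq> {0}"
    and B2: "\<And>q. Factorial_Ring.prime q \<Longrightarrow> \<exists>s. Factorial_Ring.prime s \<and> s \<noteq> q \<and> pt s B \<noteq> {0}"
begin

lemma AS: "sub A" and BS: "sub B" using A B nilD by auto

lemma GBA: "G = B \<boxplus> A"
  using GAB sub_splus_comm[OF AS BS] G by simp

text \<open>The assumptions are symmetric in the two factors, so each result of this locale is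
  available for both.\<close>

lemma swap: "coprime_factor G B A"
proof
  fix B' A' assume a: "sub B'" "B' \<subseteq> B" "sub A'" "A' \<subseteq> A" "sub (B' \<boxplus> A')" "B' \<boxplus> A' \<noteq> G"
  have "B' \<boxplus> A' = A' \<boxplus> B'" by (rule sub_splus_comm) (use a in auto)
  then show "solv (B' \<boxplus> A')" using IH[of A' B'] a by simp
qed (use G A B GBA cop simple A2 B2 in \<open>auto simp: coprime_commute\<close>)

lemma Int0: "A \<inter> B = {0}" by (rule coprime_card_Int[OF AS BS cop])

lemma cardG: "card G = card A * card B"
  unfolding GAB by (rule card_splus_coprime[OF AS BS cop])

lemma proper: "A \<noteq> G" "B \<noteq> G"
  using Int0 A(2,3) B(2,3) by auto

lemma not_both: "Factorial_Ring.prime p \<Longrightarrow> p dvd card A \<Longrightarrow> \<not> p dvd card B"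
  using cop not_prime_unit coprime_common_divisor by blast

lemma part_dvd: "Factorial_Ring.prime p \<Longrightarrow> pt p A \<noteq> {0} \<longleftrightarrow> p dvd card A"
  using pt_nontrivial[OF _ AS] pt_trivial[OF _ AS] by blast

lemma part_ne: "Factorial_Ring.prime p \<Longrightarrow> pt p A \<noteq> {0} \<Longrightarrow> Factorial_Ring.prime s \<Longrightarrow> pt s B \<noteq> {0} \<Longrightarrow> p \<noteq> s"
  using not_both part_dvd coprime_factor.part_dvd[OF swap] by blast

lemma sylH: assumes p: "Factorial_Ring.prime p" "p dvd card A" and A': "sub A'" "A' \<subseteq> A" and B': "sub B'" "B' \<subseteq> B"
    and S: "sub (A' \<boxplus> B')"
  shows "syl p (pt p A') (A' \<boxplus> B')"
proof -
  have nA': "nil A'" by (rule nil_sub[OF A(1) A'])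
  have "coprime (card A') (card B')" using cop lagrange_sub[OF AS A'] lagrange_sub[OF BS B'] coprime_divisors by blast
  then have c: "card (A' \<boxplus> B') = card A' * card B'" by (rule card_splus_coprime[OF A'(1) B'(1)])
  have "\<not> p dvd card B'" using not_both[OF p] lagrange_sub[OF BS B'] dvd_trans by blast
  then have "multiplicity p (card (A' \<boxplus> B')) = multiplicity p (card A')"
    using c p(1) sub_card_pos[OF A'(1)] sub_card_pos[OF B'(1)]
    by (simp add: prime_elem_multiplicity_mult_distrib not_dvd_imp_multiplicity_0)
  moreover have "pt p A' \<subseteq> A' \<boxplus> B'" using pt_sub[of p A'] splus_left[of B' A'] subD(2)[OF B'(1)] by blast
  ultimately show ?thesis using nil_syl[OF p(1) nA'] by (auto simp: syl_def)
qed

lemma sylG: "Factorial_Ring.prime p \<Longrightarrow> p dvd card A \<Longrightarrow> syl p (pt p A) G"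
  using sylH[of p A B] AS BS G GAB by simp

lemma part_nml: "Factorial_Ring.prime p \<Longrightarrow> nml (pt p A) A"
  by (rule nil_nml[OF _ A(1)])

lemma fact_sub: assumes "sub H" "B \<subseteq> H" "H \<subseteq> G" shows "H = (H \<inter> A) \<boxplus> B"
  by (rule dedekind) (use assms GAB in auto)

lemma fact_sub': assumes "sub H" "B \<subseteq> H" "H \<subseteq> G" shows "H = B \<boxplus> (H \<inter> A)"
  using fact_sub[OF assms] sub_splus_comm[of "H \<inter> A" B] assms AS BS by (metis sub_Int)

text \<open>Since \<open>G = A \<boxplus> B\<close>, the conjugates of \<open>Y\<close> are
  conjugates under \<open>A\<close> and stay in \<open>A\<close>. The normal closure of
  \<open>Y\<close> is thus proper, and trivial by simplicity.\<close>

lemma invariant_trivial: assumes "Y \<subseteq> A" "sub Y" "\<And>b. b \<in> B \<Longrightarrow> cj b Y = Y" shows "Y = {0}"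
proof -
  have "ncl G Y \<subseteq> A"
  proof (rule ncl_least[OF AS])
    fix g assume "g \<in> G"
    then obtain a b where "a \<in> A" "b \<in> B" "g = a + b" using GAB by (blast elim: splusE)
    then have "cj g Y = cj a Y" using assms(3)[of b] by (simp flip: cj_cj)
    then show "cj g Y \<subseteq> A" using cj_sub_mem[OF AS \<open>a \<in> A\<close> assms(1)] by simp
  qed
  moreover have "ncl G Y = {0} \<or> ncl G Y = G" using simple ncl_nml(1)[OF G] assms(1) A(2) by blast
  ultimately have "ncl G Y = {0}" using proper A(2) by blast
  moreover have "Y \<subseteq> G" using assms(1) A(2) by blast
  ultimately have "Y \<subseteq> {0}" using ncl_nml(2)[OF G, of Y] by simp
  then show ?thesis using subD(2)[OF assms(2)] by blast
qed

text \<open>The conjugates of \<open>Y\<close> under \<open>G\<close> are conjugates under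
  \<open>A \<subseteq> H\<close>, so the normal closure of \<open>Y\<close>, which is
  \<open>G\<close>, lies in \<open>H\<close>.\<close>

lemma overgroup_invariant_full: assumes Y: "Y \<subseteq> B" "Y \<noteq> {0}" "Y \<noteq> {}" "\<And>b. b \<in> B \<Longrightarrow> cj b Y = Y" and H: "sub H" "H \<subseteq> G" "A \<subseteq> H" "Y \<subseteq> H"
  shows "H = G"
proof -
  have "ncl G Y \<subseteq> H"
  proof (rule ncl_least[OF H(1)])
    fix g assume "g \<in> G"
    then obtain a b where "a \<in> A" "b \<in> B" "g = a + b" using GAB by (blast elim: splusE)
    then have "cj g Y = cj a Y" using Y(4)[of b] by (simp flip: cj_cj)
    then show "cj g Y \<subseteq> H" using cj_sub_mem[OF H(1) _ H(4)] \<open>a \<in> A\<close> H(3) by blast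
  qed
  moreover have "ncl G Y = {0} \<or> ncl G Y = G" using simple ncl_nml(1)[OF G] Y(1) B(2) by blast
  moreover have "ncl G Y \<noteq> {0}"
  proof
    assume "ncl G Y = {0}"
    moreover have "Y \<subseteq> G" using Y(1) B(2) by (rule subset_trans)
    ultimately have "Y \<subseteq> {0}" using ncl_nml(2)[OF G, of Y] by simp
    then show False using subset_singletonD[of Y 0] Y(2,3) by simp
  qed
  ultimately show ?thesis using H(2) by blast
qed

lemma nrm_proper: assumes "sub Y" "Y \<noteq> {0}" "Y \<subseteq> A" shows "nrm G Y \<noteq> G"
proof
  assume "nrm G Y = G"
  then have "nml Y G" using nml_nrm[OF G assms(1)] assms(3) A(2) by auto
  then show False using simple[of Y] assms proper A(2) by auto
qed

lemma overgroup_part_full: assumes s: "Factorial_Ring.prime s" "pt s B \<noteq> {0}" and H: "sub H" "H \<subseteq> G" "A \<subseteq> H" "pt s B \<subseteq> H"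
  shows "H = G"
proof (rule overgroup_invariant_full[OF pt_sub s(2) _ _ H])
  show "pt s B \<noteq> {}" using pt_0[OF BS] by blast
  show "cj b (pt s B) = pt s B" if "b \<in> B" for b by (rule nml_cj[OF nil_nml[OF s(1) B(1)] that])
qed

lemma fit_part: assumes l: "Factorial_Ring.prime l" "l dvd card A" and A': "sub A'" "A' \<subseteq> A" and B': "sub B'" "B' \<subseteq> B"
    and S: "sub (A' \<boxplus> B')" and F: "nml F (A' \<boxplus> B')" "nil F"
  shows "nml (pt l F) (A' \<boxplus> B')" "pt l F \<subseteq> pt l A'"
proof -
  show n: "nml (pt l F) (A' \<boxplus> B')" by (rule nml_pt[OF F l(1)])
  show "pt l F \<subseteq> pt l A'"
    by (rule nml_pgrp_syl[OF l(1) S n nil_pgrp[OF l(1) F(2)] sylH[OF l A' B' S]])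
qed

lemma part_dvd': "Factorial_Ring.prime p \<Longrightarrow> pt p B \<noteq> {0} \<longleftrightarrow> p dvd card B"
  by (rule coprime_factor.part_dvd[OF swap])

lemma trivial_part: assumes l: "Factorial_Ring.prime l" "\<not> l dvd card A" "\<not> l dvd card B" and F: "sub F" "F \<subseteq> G"
  shows "pt l F = {0}"
proof -
  have "\<not> l dvd card G" using l by (simp add: cardG prime_dvd_mult_iff)
  then have "\<not> l dvd card F" using lagrange_sub[OF G F] dvd_trans by blast
  then show ?thesis by (rule pt_trivial[OF l(1) F(1)])
qed

text \<open>
  In the situation of the next lemma the Fitting subgroup \<open>F\<close> of the product has order prime to \<open>r\<close>
  and \<open>s\<close>, and the \<open>r\<close>-part of \<open>A\<close> commutes with the \<open>s\<close>-part of \<open>B\<close> modulo \<open>F\<close>; so the former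
  normalises a conjugate of the latter, and all pairs of such conjugates are conjugate.
\<close>

lemma large_factor_False: assumes A': "sub A'" "A' \<subseteq> A" and B': "sub B'" "B' \<subseteq> B" and S: "sub (A' \<boxplus> B')" "A' \<boxplus> B' \<noteq> G"
    and r: "Factorial_Ring.prime r" "pt r A \<noteq> {0}" "r \<noteq> p" and p: "Factorial_Ring.prime p"
    and lA: "\<And>l. Factorial_Ring.prime l \<Longrightarrow> l \<noteq> p \<Longrightarrow> pt l A \<subseteq> A'"
    and s: "Factorial_Ring.prime s" "pt s B \<noteq> {0}" "pt s B \<subseteq> B'"
  shows False
proof -
  interpret sw: coprime_factor G B A by (rule swap)
  define H where "H = A' \<boxplus> B'"
  have HG: "H \<subseteq> G" unfolding H_def GAB using A' B' by (intro splus_mono) auto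
  have HS: "sub H" using S by (simp add: H_def)
  have le: "A' \<subseteq> H" "B' \<subseteq> H" unfolding H_def using splus_left[of B' A'] splus_right[of A' B'] subD(2) A'(1) B'(1) by auto
  have HBA: "A' \<boxplus> B' = B' \<boxplus> A'" by (rule sub_splus_comm[OF A'(1) B'(1) S(1)])
  have "solv H" unfolding H_def by (rule IH[OF A' B' S])
  then obtain F where F: "nml F H" "nil F" "cen H F \<subseteq> F" using fitting by metis
  have FS: "sub F" "F \<subseteq> H" using F by (auto simp: nml_def)
  have Fc: "nml (pt l F) H" if "Factorial_Ring.prime l" for l by (rule nml_pt[OF F(1,2) that])
  have FA: "pt l F \<subseteq> pt l A'" if "Factorial_Ring.prime l" "l dvd card A" for l
    by (rule fit_part(2)[OF that A' B' S(1) F(1,2)[unfolded H_def]])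
  have FB: "pt l F \<subseteq> pt l B'" if "Factorial_Ring.prime l" "l dvd card B" for l
    using sw.fit_part(2)[OF that B' A'] S(1) F(1,2) HBA by (simp add: H_def)
  \<comment> \<open>The normaliser of a nonzero part would contain \<open>A\<close>, whose other
    parts centralise it, as well as \<open>pt s B\<close>; it would then be \<open>G\<close>,
    against simplicity.\<close>
  have FA0: "pt l F = {0}" if l: "Factorial_Ring.prime l" "l dvd card A" "l \<noteq> p" for l
  proof (rule ccontr)
    assume n: "pt l F \<noteq> {0}"
    have sF: "sub (pt l F)" "pt l F \<subseteq> pt l A" using Fc[OF l(1)] FA[OF l(1,2)] pt_mono[OF A'(2)] by (auto simp: nml_def)
    have HN: "H \<subseteq> nrm G (pt l F)" using nml_cj[OF Fc[OF l(1)]] HG by (auto simp: nrm_def)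
    have "A \<subseteq> nrm G (pt l F)"
      by (rule nrm_pt[OF A(1,2) G l(1) sF(2)]) (use lA[OF l(1,3)] le HN in blast)
    then have "nrm G (pt l F) = G"
      by (rule overgroup_part_full[OF s(1,2) sub_nrm[OF G] nrm_sub]) (use s(3) le HN in blast)
    then show False using nrm_proper[OF sF(1) n] sF(2) pt_sub[of l A] by blast
  qed
  have Fs0: "pt s F = {0}"
  proof (rule ccontr)
    assume n: "pt s F \<noteq> {0}"
    have sB: "s dvd card B" using s part_dvd' by blast
    have sF: "sub (pt s F)" "pt s F \<subseteq> pt s B" using Fc[OF s(1)] FB[OF s(1) sB] pt_mono[OF B'(2)] by (auto simp: nml_def)
    have HN: "H \<subseteq> nrm G (pt s F)" using nml_cj[OF Fc[OF s(1)]] HG by (auto simp: nrm_def)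
    have "B \<subseteq> nrm G (pt s F)"
      by (rule nrm_pt[OF B(1,2) G s(1) sF(2)]) (use s(3) le HN in blast)
    then have "nrm G (pt s F) = G"
      by (rule sw.overgroup_part_full[OF r(1,2) sub_nrm[OF G] nrm_sub]) (use lA[OF r(1,3)] le HN in blast)
    then show False using sw.nrm_proper[OF sF(1) n] sF(2) pt_sub[of s B] by blast
  qed
  let ?R = "pt r A" and ?S = "pt s B"
  have RH: "?R \<subseteq> H" and SH: "?S \<subseteq> H" using lA[OF r(1,3)] s(3) le by auto
  \<comment> \<open>The commutator centralises each part of \<open>F\<close>: on the
    \<open>p\<close>-part \<open>a\<close> acts trivially, on the parts from \<open>B\<close> other
    than the \<open>s\<close>-part \<open>b\<close> does, and the remaining parts vanish. Since
    \<open>cen H F \<subseteq> F\<close>, it lies in \<open>F\<close>.\<close>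
  have comm: "a + b + - a + - b \<in> F" if a: "a \<in> ?R" and b: "b \<in> ?S" for a b
  proof -
    let ?c = "a + b + - a + - b"
    have abH: "a \<in> H" "b \<in> H" using a b RH SH by auto
    have cH: "?c \<in> H" using abH by (simp add: subD(3,4)[OF HS])
    define C where "C = {f \<in> F. ?c + f = f + ?c}"
    have "F \<subseteq> C"
    proof (rule parts_gen[OF FS(1)])
      fix x y assume xy: "x \<in> C" "y \<in> C"
      have "?c + (x + y) = (?c + x) + y" by (simp only: add.assoc)
      also have "\<dots> = x + (?c + y)" using xy by (simp add: C_def add.assoc)
      also have "\<dots> = (x + y) + ?c" using xy by (simp add: C_def add.assoc)
      finally show "x + y \<in> C" using xy subD(3)[OF FS(1)] by (simp add: C_def)
    next
      fix l :: nat assume l: "Factorial_Ring.prime l"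
      show "pt l F \<subseteq> C"
      proof
        fix f assume f: "f \<in> pt l F"
        then have fF: "f \<in> F" by (simp add: pt_def)
        have zero: "f \<in> C" if "pt l F = {0}" using that f fF by (auto simp: C_def)
        have "?c + f = f + ?c" if lA: "l dvd card A" "l = p"
        proof -
          define f' where "f' = - b + f + b"
          have "- b \<in> H" using abH(2) by (rule subD(4)[OF HS])
          then have f': "f' \<in> pt l F" using nmlD(3)[OF Fc[OF l], of "- b" f] f by (simp add: f'_def)
          have c: "a + g = g + a" if "g \<in> pt l F" for g
            by (rule pt_commute[OF A(1) r(1) l _ a]) (use r(3) lA FA[OF l lA(1)] pt_mono[OF A'(2)] that in auto)
          have "- a + f' = f' + - a" by (rule comm_neg[OF c[OF f']])
          moreover have "?c + f = a + b + (- a + f') + - b" by (simp add: f'_def gs)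
          ultimately have "?c + f = a + b + (f' + - a) + - b" by simp
          also have "\<dots> = (a + f) + b + - a + - b" by (simp add: f'_def gs)
          also have "\<dots> = f + ?c" using c[OF f] by (simp add: gs)
          finally show ?thesis .
        qed
        moreover have "?c + f = f + ?c" if lB: "l dvd card B" "l \<noteq> s"
        proof -
          define f' where "f' = - a + f + a"
          have "- a \<in> H" using abH(1) by (rule subD(4)[OF HS])
          then have f': "f' \<in> pt l F" using nmlD(3)[OF Fc[OF l], of "- a" f] f by (simp add: f'_def)
          have c: "b + g = g + b" if "g \<in> pt l F" for g
            by (rule pt_commute[OF B(1) s(1) l _ b]) (use lB FB[OF l lB(1)] pt_mono[OF B'(2)] that in auto)
          have "- b + f = f + - b" by (rule comm_neg[OF c[OF f]])
          then have "?c + f = a + b + - a + f + - b" by (simp add: add.assoc)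
          also have "\<dots> = a + (b + f') + - a + - b" by (simp add: f'_def gs)
          also have "\<dots> = a + f' + b + - a + - b" using c[OF f'] by (simp add: gs)
          also have "\<dots> = f + ?c" by (simp add: f'_def gs)
          finally show ?thesis .
        qed
        moreover have "pt l F = {0}" if "\<not> l dvd card A" "\<not> l dvd card B"
          by (rule trivial_part[OF l that FS(1)]) (use FS HG in blast)
        ultimately show "f \<in> C" using zero FA0[OF l] Fs0 fF unfolding C_def by blast
      qed
    qed
    then have "?c \<in> cen H F" using cH by (auto simp: cen_def C_def)
    then show ?thesis using F(3) by blast
  qed
  have sS: "sub ?S" and sR: "sub ?R" using nilD(2)[OF B(1) s(1)] nilD(2)[OF A(1) r(1)] by auto
  \<comment> \<open>\<open>U\<close> is normalised by \<open>?R\<close> because commutators of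
    \<open>?R\<close> with \<open>?S\<close> lie in \<open>F\<close>, and its order is prime to
    \<open>r\<close>; so \<open>fix_sylow\<close> applies.\<close>
  define U where "U = F \<boxplus> ?S"
  have Fn: "cj x F \<subseteq> F" if "x \<in> ?S" for x using nml_cj[OF F(1), of x] SH that by auto
  have US: "sub U" using sub_splus_norm[OF sS FS(1) Fn] by (simp add: U_def)
  have UH: "U \<subseteq> H" unfolding U_def by (rule splus_subset[OF HS FS(2) SH])
  have leU: "F \<subseteq> U" "?S \<subseteq> U" unfolding U_def using splus_left[of ?S F] splus_right[of F ?S] FS sS by (auto simp: subD)
  have sylS: "syl s ?S U"
    by (rule syl_between[OF s(1) sw.sylG[OF s(1)] G US leU(2)]) (use s part_dvd' UH HG in auto)
  have RU: "cj a U = U" if a: "a \<in> ?R" for a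
  proof (rule cj_eqI[OF subD(1)[OF US]])
    have "cj a ?S \<subseteq> U"
    proof
      fix x assume "x \<in> cj a ?S"
      then obtain b where b: "b \<in> ?S" "x = a + b + - a" by (auto simp: cj_def)
      have "x = (a + b + - a + - b) + b" using b by (simp add: gs)
      then show "x \<in> U" unfolding U_def using comm[OF a b(1)] b(1) by (metis splusI)
    qed
    moreover have "cj a F = F" using nml_cj[OF F(1)] a RH by blast
    ultimately have "cj a F \<boxplus> cj a ?S \<subseteq> U" using leU US by (intro splus_subset) auto
    then show "cj a U \<subseteq> U" unfolding U_def cj_splus by simp
  qed
  have "r \<noteq> s" using part_ne r s by blast
  have rA: "r dvd card A" using part_dvd r by blast
  have "\<not> r dvd card F" using FA0[OF r(1) rA r(3)] pt_nontrivial[OF r(1) FS(1)] by blast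
  moreover have "\<not> r dvd card ?S" using not_both[OF r(1) rA] lagrange_sub[OF BS sS pt_sub] dvd_trans by blast
  ultimately have "\<not> r dvd card F * card ?S" using r(1) by (simp add: prime_dvd_mult_iff)
  then have rU: "\<not> r dvd card U" using card_splus[OF FS(1) sS] unfolding U_def by (metis dvd_mult2)
  have "\<not> r dvd card ((\<lambda>u. cj u ?S) ` U)" using card_conjugates[OF US, of ?S] rU by (metis dvd_mult2)
  then obtain u where u: "u \<in> U" "\<And>x. x \<in> ?R \<Longrightarrow> cj x (cj u ?S) = cj u ?S"
    using fix_sylow[OF US nil_pgrp[OF r(1) A(1)] r(1) s(1) sylS RU] by blast
  have "u \<in> G" using u UH HG by blast
  then obtain a0 b0 where ab: "a0 \<in> A" "b0 \<in> B" "u = a0 + b0" using GAB by (blast elim: splusE)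
  have b0S: "cj b0 ?S = ?S" by (rule nml_cj[OF sw.part_nml[OF s(1)] ab(2)])
  have "?R \<subseteq> nrm G ?S"
  proof
    fix a assume a: "a \<in> ?R"
    have "a0 + a + - a0 \<in> ?R" using nmlD(3)[OF part_nml[OF r(1)] ab(1) a] .
    from u(2)[OF this] have "cj (a0 + a + - a0 + (a0 + b0)) ?S = cj (a0 + b0) ?S" unfolding ab(3) by simp
    then have "cj (a0 + a) (cj b0 ?S) = cj a0 (cj b0 ?S)" by (simp add: gs)
    then have "cj a0 (cj a ?S) = cj a0 ?S" unfolding b0S by simp
    then have "cj (- a0) (cj a0 (cj a ?S)) = cj (- a0) (cj a0 ?S)" by simp
    then have "cj a ?S = ?S" by (simp add: gs)
    then show "a \<in> nrm G ?S" using a pt_sub[of r A] A(2) by (auto simp: nrm_def)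
  qed
  moreover have "B \<subseteq> nrm G ?S" using nml_cj[OF sw.part_nml[OF s(1)]] B(2) by (auto simp: nrm_def)
  ultimately have "nrm G ?S = G" by (intro sw.overgroup_part_full[OF r(1,2) sub_nrm[OF G] nrm_sub])
  then show False using sw.nrm_proper[OF sS s(2) pt_sub] by blast
qed

end

section \<open>Proper overgroups of one factor\<close>

context coprime_factor
begin

text \<open>The parts of the Fitting subgroup \<open>F\<close> for primes of \<open>A\<close> lie in
  \<open>A\<close> and are invariant under \<open>B\<close>, hence vanish; so
  \<open>F \<subseteq> B\<close>. If the centraliser of \<open>pt s F\<close> had a nonzero Sylow
  \<open>p\<close>-subgroup \<open>V\<close> with \<open>p\<close> dividing \<open>card A\<close>,
  the normaliser of \<open>V\<close> would contain \<open>pt s B\<close> and all parts of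
  \<open>A\<close> other than the \<open>p\<close>-part, against
  \<open>large_factor_False\<close>.\<close>

lemma overgroup_fitting:
  assumes H: "sub H" "B \<subseteq> H" "H \<subseteq> G" "H \<noteq> G"
  obtains F where "nml F H" "nil F" "F \<subseteq> B" "\<And>N. nml N H \<Longrightarrow> nil N \<Longrightarrow> N \<subseteq> F"
    "\<And>s. Factorial_Ring.prime s \<Longrightarrow> pt s B \<noteq> {0} \<Longrightarrow> cen H (pt s F) \<subseteq> B"
proof -
  interpret sw: coprime_factor G B A by (rule swap)
  define A' where "A' = H \<inter> A"
  have A': "sub A'" "A' \<subseteq> A" "A' \<subseteq> H" using sub_Int[OF H(1) AS] by (auto simp: A'_def)
  have HE: "H = A' \<boxplus> B" unfolding A'_def by (rule fact_sub[OF H(1-3)])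
  have HE': "H = B \<boxplus> A'" unfolding A'_def by (rule fact_sub'[OF H(1-3)])
  have S: "sub (A' \<boxplus> B)" "A' \<boxplus> B \<noteq> G" using H HE by auto
  have cA'B: "coprime (card A') (card B)" by (rule coprime_divisors[OF lagrange_sub[OF AS A'(1,2)] dvd_refl cop])
  have cH: "card H = card B * card A'" unfolding HE using card_splus_coprime[OF A'(1) BS cA'B] by simp
  have inB: "N \<subseteq> B" if N: "nml N H" "coprime (card N) (card A')" for N
  proof (rule coprime_absorb[OF _ BS _ _ H(1) cH N(2)])
    show "sub N" using N by (simp add: nml_def)
    have n: "cj x N \<subseteq> N" if "x \<in> B" for x using nml_cj[OF N(1), of x] that H(2) by auto
    have NB: "sub (B \<boxplus> N)" "B \<boxplus> N = N \<boxplus> B"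
      using sub_splus_norm[OF BS \<open>sub N\<close> n] by auto
    then show "sub (N \<boxplus> B)" by simp
    show "N \<boxplus> B \<subseteq> H" using N H by (intro splus_subset) (auto simp: nml_def)
  qed
  have cop_parts: "coprime (card N) (card A')" if N: "sub N" "\<And>l. Factorial_Ring.prime l \<Longrightarrow> l dvd card A \<Longrightarrow> pt l N = {0}" for N
  proof (rule ccontr)
    assume "\<not> coprime (card N) (card A')"
    then have "gcd (card N) (card A') \<noteq> 1" by (simp add: coprime_iff_gcd_eq_1)
    then obtain l where l: "Factorial_Ring.prime l" "l dvd gcd (card N) (card A')" using prime_factor_nat by blast
    then have "l dvd card N" "l dvd card A" using lagrange_sub[OF AS A'(1,2)] by (auto intro: dvd_trans)
    then show False using N(2)[OF l(1)] pt_nontrivial[OF l(1) N(1)] by blast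
  qed
  have "solv (A' \<boxplus> B)" by (rule IH[OF A'(1,2) BS _ S]) simp
  then have "solv H" by (simp add: HE[symmetric])
  then obtain F where F: "nml F H" "nil F" "cen H F \<subseteq> F" "\<And>N. nml N H \<Longrightarrow> nil N \<Longrightarrow> N \<subseteq> F" using fitting by blast
  have FS: "sub F" "F \<subseteq> H" using F by (auto simp: nml_def)
  have Fl: "pt l F = {0}" if l: "Factorial_Ring.prime l" "l dvd card A" for l
  proof (rule invariant_trivial)
    have n: "nml (pt l F) H" by (rule nml_pt[OF F(1,2) l(1)])
    have "pt l F \<subseteq> pt l A'"
      by (rule fit_part(2)[OF l A'(1,2) BS _ S(1)]) (use F(1,2) HE in auto)
    then show "pt l F \<subseteq> A" using pt_sub[of l A'] A'(2) by blast
    show "sub (pt l F)" using n by (simp add: nml_def)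
    show "cj b (pt l F) = pt l F" if "b \<in> B" for b using nml_cj[OF n] H(2) that by blast
  qed
  have FB: "F \<subseteq> B" by (rule inB[OF F(1)], rule cop_parts[OF FS(1)]) (use Fl in blast)
  have "cen H (pt s F) \<subseteq> B" if s: "Factorial_Ring.prime s" "pt s B \<noteq> {0}" for s
  proof -
    define Q where "Q = cen H (pt s F)"
    have nFs: "nml (pt s F) H" by (rule nml_pt[OF F(1,2) s(1)])
    have Q: "nml Q H" unfolding Q_def by (rule nml_cen[OF nFs H(1)])
    have QS: "sub Q" "Q \<subseteq> H" using Q by (auto simp: nml_def)
    have QF: "x + y = y + x" if "x \<in> Q" "y \<in> pt s F" for x y using that by (auto simp: Q_def cen_def)
    have "pt l Q = {0}" if p: "Factorial_Ring.prime p" "p dvd card A" and lp: "l = p" for l p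
    proof -
      define V where "V = pt p A' \<inter> Q"
      have sylV: "syl p V Q" unfolding V_def
        by (rule syl_nml[OF p(1) H(1) Q]) (use sylH[OF p A'(1,2) BS _ S(1)] HE in simp)
      have VS: "sub V" using sylV by (simp add: syl_def)
      have VA: "V = Q \<inter> pt p A" using QS(2) by (auto simp: V_def A'_def pt_def)
      have "V = {0}"
      proof (rule ccontr)
        assume V0: "V \<noteq> {0}"
        have VleA: "V \<subseteq> A" using VA pt_sub[of p A] by blast
        \<comment> \<open>\<open>V\<close> is the intersection of \<open>Q\<close> with
          \<open>pt p A\<close>, and the latter is normal in \<open>A\<close>; a conjugate under
          \<open>A\<close> that stays in \<open>Q\<close> therefore stays in
          \<open>V\<close>.\<close>
        have keyA: "cj a V = V" if "a \<in> A" "cj a V \<subseteq> Q" for a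
        proof (rule cj_eqI[OF subD(1)[OF VS]])
          have "cj a V \<subseteq> cj a (pt p A)" by (rule cj_mono) (simp add: VA)
          then show "cj a V \<subseteq> V" using nml_cj[OF part_nml[OF p(1)] that(1)] that(2) VA by blast
        qed
        have A'V: "cj a V = V" if a: "a \<in> A'" for a
        proof (rule keyA)
          show "a \<in> A" using a A'(2) by blast
          have "cj a V \<subseteq> cj a Q" by (rule cj_mono) (simp add: VA)
          then show "cj a V \<subseteq> Q" using nml_cj[OF Q, of a] a A'(3) by auto
        qed
        \<comment> \<open>For \<open>g = b + a\<close> in the normaliser, the conjugate of
          \<open>V\<close> by \<open>a\<close> equals that by \<open>- b\<close>, which lies in the
          normal subgroup \<open>Q\<close> of \<open>H\<close>; so both summands normalise
          \<open>V\<close>.\<close>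
        have le1: "nrm G V \<subseteq> nrm B V \<boxplus> nrm A V"
        proof
          fix g assume g: "g \<in> nrm G V"
          then have gG: "g \<in> G" "cj g V = V" by (auto simp: nrm_def)
          obtain b a where ab: "b \<in> B" "a \<in> A" "g = b + a" using gG(1) GBA by (blast elim: splusE)
          have "cj b (cj a V) = V" using gG(2) ab(3) by simp
          then have e: "cj a V = cj (- b) V" using cj_eq_iff[of b "cj a V" V] by blast
          have "- b \<in> H" using ab(1) H(2) subD(4)[OF H(1)] by blast
          then have "cj (- b) V \<subseteq> Q" using nml_cj[OF Q, of "- b"] cj_mono[of V Q "- b"] VA by auto
          then have aV: "cj a V = V" using keyA[OF ab(2)] e by simp
          then have "cj (- b) V = V" using e by simp
          then have "cj b V = V" using cj_eq_iff[of b V V] by simp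
          then have "b \<in> nrm B V" "a \<in> nrm A V" using aV ab by (simp_all add: nrm_def)
          then show "g \<in> nrm B V \<boxplus> nrm A V" unfolding ab(3) by (rule splusI)
        qed
        have le2: "nrm B V \<boxplus> nrm A V \<subseteq> nrm G V"
          by (rule splus_subset[OF sub_nrm[OF G]]) (use A(2) B(2) in \<open>auto simp: nrm_def\<close>)
        have HV: "nrm G V = nrm B V \<boxplus> nrm A V" using le1 le2 by blast
        have subs: "sub (nrm A V)" "sub (nrm B V)" using sub_nrm AS BS by auto
        have "nrm B V \<boxplus> nrm A V = nrm A V \<boxplus> nrm B V"
          by (rule sub_splus_comm[OF subs(2,1)]) (use HV sub_nrm[OF G, of V] in simp)
        then have HV': "nrm G V = nrm A V \<boxplus> nrm B V" using HV by simp
        have BsV: "pt s B \<subseteq> nrm B V"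
        proof -
          have sB: "s dvd card B" using s part_dvd' by blast
          have "syl s (pt s B) H"
            by (rule syl_between[OF s(1) sw.sylG[OF s(1) sB] G H(1) _ H(3)]) (use H(2) pt_sub[of s B] in blast)
          then have sylsQ: "syl s (pt s B \<inter> Q) Q" by (rule syl_nml[OF s(1) H(1) Q])
          \<comment> \<open>An element of \<open>pt s B\<close> in \<open>Q\<close> commutes with
            \<open>pt s F\<close> by definition of \<open>Q\<close> and with the other parts of
            \<open>F\<close> because \<open>B\<close> is nilpotent; so it lies in
            \<open>F\<close>.\<close>
          have "pt s B \<inter> Q \<subseteq> pt s F"
          proof
            fix x assume x: "x \<in> pt s B \<inter> Q"
            define C where "C = {f \<in> F. x + f = f + x}"
            have "F \<subseteq> C"
            proof (rule parts_gen[OF FS(1)])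
              fix f g assume fg: "f \<in> C" "g \<in> C"
              have "x + (f + g) = (x + f) + g" by (simp only: add.assoc)
              also have "\<dots> = f + (x + g)" using fg by (simp add: C_def add.assoc)
              also have "\<dots> = (f + g) + x" using fg by (simp add: C_def add.assoc)
              finally show "f + g \<in> C" using fg subD(3)[OF FS(1)] by (simp add: C_def)
            next
              fix q :: nat assume q: "Factorial_Ring.prime q"
              show "pt q F \<subseteq> C"
              proof
                fix f assume f: "f \<in> pt q F"
                have "x + f = f + x"
                proof (cases "q = s")
                  case True then show ?thesis using QF x f by blast
                next
                  case False
                  have "f \<in> pt q B" using f pt_mono[OF FB] by blast
                  then show ?thesis using pt_commute[OF B(1) s(1) q, of x f] False x by auto
                qed
                then show "f \<in> C" using f by (simp add: C_def pt_def)
              qed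
            qed
            then have "x \<in> cen H F" using x QS(2) by (auto simp: cen_def C_def)
            then have "x \<in> F" using F(3) by blast
            then show "x \<in> pt s F" using x by (auto simp: pt_def)
          qed
          moreover have "pt s F \<inter> Q \<subseteq> nrm Q V"
          proof
            fix x assume x: "x \<in> pt s F \<inter> Q"
            have "v + x = x + v" if "v \<in> V" for v using QF[of v x] x that VA by blast
            then have "x \<in> cen Q V" using x by (simp add: cen_def)
            then show "x \<in> nrm Q V" using cen_nrm[of Q V] by blast
          qed
          ultimately have sle: "pt s B \<inter> Q \<subseteq> nrm Q V" by blast
          have sN: "sub (nrm Q V)" "nrm Q V \<subseteq> Q" by (simp_all add: sub_nrm QS nrm_sub)
          have sS: "sub (pt s B \<inter> Q)" using sylsQ by (simp add: syl_def)
          obtain m where m: "card (nrm Q V) = card (pt s B \<inter> Q) * m" using lagrange_sub[OF sN(1) sS sle] by (auto elim: dvdE)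
          have "card Q = (card ((\<lambda>u. cj u V) ` Q) * m) * card (pt s B \<inter> Q)"
            using card_conjugates[OF QS(1), of V] m by (simp add: mult_ac)
          then have "\<not> s dvd card ((\<lambda>u. cj u V) ` Q) * m" by (rule syl_index[OF s(1) sylsQ QS(1)])
          then have nd: "\<not> s dvd card ((\<lambda>u. cj u V) ` Q)" by (metis dvd_mult2)
          have BQ: "cj x Q = Q" if "x \<in> pt s B" for x using nml_cj[OF Q, of x] that pt_sub[of s B] H(2) by blast
          obtain u where u: "u \<in> Q" "\<And>x. x \<in> pt s B \<Longrightarrow> cj x (cj u V) = cj u V"
            using fix_sylow[OF QS(1) nil_pgrp[OF s(1) B(1)] s(1) p(1) sylV BQ nd] by blast
          \<comment> \<open>The summand \<open>a0\<close> normalises \<open>V\<close> and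
            \<open>b0\<close> normalises \<open>pt s B\<close>, so the passage from \<open>V\<close>
            to its conjugate by \<open>u\<close> can be undone.\<close>
          obtain b0 a0 where ab: "b0 \<in> B" "a0 \<in> A'" "u = b0 + a0" using u(1) QS(2) HE' by (blast elim: splusE)
          have uV: "cj u V = cj b0 V" using A'V[OF ab(2)] ab(3) by (simp flip: cj_cj)
          show ?thesis
          proof
            fix x assume x: "x \<in> pt s B"
            have "b0 + x + - b0 \<in> pt s B" using nmlD(3)[OF sw.part_nml[OF s(1)] ab(1) x] .
            from u(2)[OF this] have "cj (b0 + x + - b0 + b0) V = cj b0 V" unfolding uV by simp
            then have "cj b0 (cj x V) = cj b0 V" by (simp add: gs)
            then have "cj (- b0) (cj b0 (cj x V)) = cj (- b0) (cj b0 V)" by simp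
            then have "cj x V = V" by (simp add: gs)
            then show "x \<in> nrm B V" using x pt_sub[of s B] by (auto simp: nrm_def)
          qed
        qed
        obtain r where r: "Factorial_Ring.prime r" "r \<noteq> p" "pt r A \<noteq> {0}" using A2[OF p(1)] by blast
        have lA: "pt l A \<subseteq> nrm A V" if l: "Factorial_Ring.prime l" "l \<noteq> p" for l
        proof
          fix x assume x: "x \<in> pt l A"
          have "x + v = v + x" if "v \<in> V" for v
            by (rule pt_commute[OF A(1) l(1) p(1) l(2) x]) (use that VA in blast)
          then have "x \<in> cen A V" using x pt_sub[of l A] by (auto simp: cen_def)
          then show "x \<in> nrm A V" using cen_nrm[of A V] by blast
        qed
        show False
          by (rule large_factor_False[OF subs(1) nrm_sub subs(2) nrm_sub _ _ r(1,3,2) p(1) lA s BsV])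
            (use HV' sub_nrm[OF G, of V] nrm_proper[OF VS V0 VleA] in auto)
      qed
      then have "card V = 1" by simp
      then have "multiplicity p (card Q) = 0" using sylV p(1) by (metis One_nat_def nat_power_eq_Suc_0_iff not_prime_1 syl_def)
      then have "\<not> p dvd card Q"
        using p sub_card_pos[OF QS(1)] prime_multiplicity_gt_zero_iff[of p "card Q"] by auto
      then show ?thesis using pt_trivial[OF p(1) QS(1)] lp by simp
    qed
    then have "Q \<subseteq> B" by (intro inB[OF Q] cop_parts[OF QS(1)]) blast
    then show ?thesis by (simp add: Q_def)
  qed
  then show ?thesis using that F FB by blast
qed

text \<open>Each part \<open>pt q B\<close> centralises \<open>pt s F\<close> for some other prime
  \<open>s\<close>. That centraliser is normal in \<open>H\<close> and contained in
  \<open>B\<close>, so the conjugates of the part stay in \<open>B\<close>.\<close>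

lemma overgroup_normal:
  assumes H: "sub H" "B \<subseteq> H" "H \<subseteq> G" "H \<noteq> G" shows "nml B H"
proof -
  obtain F where F: "nml F H" "nil F" "F \<subseteq> B" "\<And>s. Factorial_Ring.prime s \<Longrightarrow> pt s B \<noteq> {0} \<Longrightarrow> cen H (pt s F) \<subseteq> B"
    using overgroup_fitting[OF H] by metis
  show ?thesis
  proof (rule nmlI_cj[OF BS H(2)])
    fix h assume h: "h \<in> H"
    have "B \<subseteq> {b. h + b + - h \<in> B}"
    proof (rule parts_gen[OF BS])
      fix x y assume "x \<in> {b. h + b + - h \<in> B}" "y \<in> {b. h + b + - h \<in> B}"
      then have "(h + x + - h) + (h + y + - h) \<in> B" using subD(3)[OF BS] by blast
      then show "x + y \<in> {b. h + b + - h \<in> B}" by (simp add: gs)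
    next
      fix q :: nat assume q: "Factorial_Ring.prime q"
      obtain s where s: "Factorial_Ring.prime s" "s \<noteq> q" "pt s B \<noteq> {0}" using B2[OF q] by blast
      have Q: "nml (cen H (pt s F)) H" by (rule nml_cen[OF nml_pt[OF F(1,2) s(1)] H(1)])
      show "pt q B \<subseteq> {b. h + b + - h \<in> B}"
      proof
        fix x assume x: "x \<in> pt q B"
        have "x + f = f + x" if "f \<in> pt s F" for f
          by (rule pt_commute[OF B(1) q s(1) s(2)[symmetric] x]) (use that pt_mono[OF F(3)] in blast)
        then have "x \<in> cen H (pt s F)" using x pt_sub[of q B] H(2) by (auto simp: cen_def)
        then have "h + x + - h \<in> cen H (pt s F)" using nmlD(3)[OF Q h] by blast
        then show "x \<in> {b. h + b + - h \<in> B}" using F(4)[OF s(1,3)] by blast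
      qed
    qed
    then show "cj h B \<subseteq> B" by (auto simp: cj_def)
  qed
qed

text \<open>Together with \<open>nrm_factor\<close>: the normaliser of \<open>B\<close> is the
  largest proper overgroup of \<open>B\<close>.\<close>

lemma overgroup_le_nrm: assumes "sub H" "B \<subseteq> H" "H \<subseteq> G" "H \<noteq> G" shows "H \<subseteq> nrm G B"
proof
  fix h assume h: "h \<in> H"
  then have "cj h B = B" by (rule nml_cj[OF overgroup_normal[OF assms]])
  then show "h \<in> nrm G B" using h assms(3) by (auto simp: nrm_def)
qed

lemma nrm_factor: "sub (nrm G B)" "B \<subseteq> nrm G B" "nrm G B \<subseteq> G" "nrm G B \<noteq> G" "nml B (nrm G B)"
  using coprime_factor.nrm_proper[OF swap BS B(3)]
  by (simp_all add: sub_nrm[OF G] nrm_self[OF G BS B(2)] nrm_sub nml_nrm[OF G BS B(2)])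

lemma cen_part: assumes s: "Factorial_Ring.prime s" "pt s B \<noteq> {0}" shows "cen (nrm G B) (pt s B) \<inter> A = {0}"
proof -
  obtain F where F: "F \<subseteq> B" "\<And>N. nml N (nrm G B) \<Longrightarrow> nil N \<Longrightarrow> N \<subseteq> F" "\<And>s. Factorial_Ring.prime s \<Longrightarrow> pt s B \<noteq> {0} \<Longrightarrow> cen (nrm G B) (pt s F) \<subseteq> B"
    using overgroup_fitting[OF nrm_factor(1-4)] by metis
  have "F = B" using F(1) F(2)[OF nrm_factor(5) B(1)] by blast
  then have "cen (nrm G B) (pt s B) \<subseteq> B" using F(3)[OF s] by simp
  then show ?thesis using Int0 subD(2)[OF sub_cen[OF nrm_factor(1)]] subD(2)[OF AS] by blast
qed

text \<open>Let \<open>C\<close> and \<open>K\<close> be the centraliser and normaliser of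
  \<open>V\<close>. For a prime \<open>r\<close> other than \<open>p\<close>, \<open>pt r A\<close>
  is a Sylow subgroup of \<open>C\<close>, so by Frattini \<open>K\<close> is the product of
  \<open>C\<close> with a subgroup of \<open>nrm G A\<close>. Counting shows that
  \<open>Y = pt s B \<inter> C\<close> is nonzero, and its normaliser lies in
  \<open>nrm G B\<close>; then \<open>V\<close> normalises \<open>pt s B\<close> and commutes with
  it, against \<open>cen_part\<close>.\<close>

lemma part_not_normalized: assumes V: "sub V" "V \<noteq> {0}" "V \<subseteq> pt p A" and p: "Factorial_Ring.prime p"
    and s: "Factorial_Ring.prime s" "pt s B \<noteq> {0}" "pt s B \<subseteq> nrm G V"
  shows False
proof -
  interpret sw: coprime_factor G B A by (rule swap)
  obtain r where r: "Factorial_Ring.prime r" "r \<noteq> p" "pt r A \<noteq> {0}" using A2[OF p] by blast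
  have VA: "V \<subseteq> A" using V(3) pt_sub[of p A] by blast
  have VG: "V \<subseteq> G" using VA A(2) by blast
  define K where "K = nrm G V"
  define C where "C = cen G V"
  have K: "sub K" "K \<subseteq> G" "K \<noteq> G" using sub_nrm[OF G] nrm_sub nrm_proper[OF V(1,2) VA] by (auto simp: K_def)
  have C: "nml C K" unfolding C_def K_def by (rule nml_cen_nrm[OF G])
  have CS: "sub C" "C \<subseteq> K" using C by (auto simp: nml_def)
  have RC: "pt r A \<subseteq> C"
  proof
    fix x assume x: "x \<in> pt r A"
    have "x + v = v + x" if "v \<in> V" for v by (rule pt_commute[OF A(1) r(1) p r(2) x]) (use that V(3) in blast)
    then show "x \<in> C" using x pt_sub[of r A] A(2) by (auto simp: C_def cen_def)
  qed
  have rA: "r dvd card A" using part_dvd r by blast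
  have sylC: "syl r (pt r A) C"
    by (rule syl_between[OF r(1) sylG[OF r(1) rA] G CS(1) RC]) (use CS K in blast)
  define L where "L = nrm K (pt r A)"
  have L: "sub L" "L \<subseteq> K" unfolding L_def by (simp_all add: sub_nrm K nrm_sub)
  have sR: "sub (pt r A)" using nilD(2)[OF A(1) r(1)] .
  have nR: "nrm G (pt r A) \<subseteq> nrm G A"
  proof (rule sw.overgroup_le_nrm)
    show "sub (nrm G (pt r A))" by (rule sub_nrm[OF G])
    show "A \<subseteq> nrm G (pt r A)" using nml_cj[OF part_nml[OF r(1)]] A(2) by (auto simp: nrm_def)
    show "nrm G (pt r A) \<noteq> G" by (rule nrm_proper[OF sR r(3) pt_sub])
  qed (rule nrm_sub)
  have LM: "L \<subseteq> nrm G A" using nR K(2) unfolding L_def by (auto simp: nrm_def)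
  have KCL: "K \<subseteq> C \<boxplus> L"
  proof
    fix k assume k: "k \<in> K"
    obtain c where c: "c \<in> C" "cj (c + k) (pt r A) = pt r A" using frattini[OF r(1) C sylC k] by blast
    have "c + k \<in> L" using c k CS K(1) by (auto simp: L_def nrm_def subD)
    moreover have "k = - c + (c + k)" by simp
    ultimately show "k \<in> C \<boxplus> L" using c(1) subD(4)[OF CS(1)] by (metis splusI)
  qed
  have KE: "K = C \<boxplus> L" using KCL splus_subset[OF K(1) CS(2) L(2)] by blast
  let ?S = "pt s B"
  have sS: "sub ?S" using nilD(2)[OF B(1) s(1)] .
  define Y where "Y = ?S \<inter> C"
  have YS: "sub Y" unfolding Y_def by (rule sub_Int[OF sS CS(1)])
  have SK: "?S \<subseteq> K" using s(3) by (simp add: K_def)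
  have "Y \<noteq> {0}"
  proof
    \<comment> \<open>The order of \<open>?S\<close> would divide that of \<open>L\<close> and hence
      that of \<open>nrm G A\<close>. A conjugate of \<open>?S\<close> would then lie in
      \<open>nrm G A\<close>, which would be all of \<open>G\<close>.\<close>
    assume Y0: "Y = {0}"
    have SC: "sub (?S \<boxplus> C)" by (rule sub_splus_norm(1)[OF sS CS(1)]) (use nml_cj[OF C] SK in auto)
    have "card (?S \<boxplus> C) dvd card K" by (rule lagrange_sub[OF K(1) SC splus_subset[OF K(1) SK CS(2)]])
    moreover have "card (?S \<boxplus> C) = card ?S * card C" using card_splus[OF sS CS(1)] Y0 by (simp add: Y_def)
    ultimately obtain t where "card K = card ?S * card C * t" by (auto elim: dvdE)
    moreover have "card K * card (C \<inter> L) = card C * card L" unfolding KE by (rule card_splus[OF CS(1) L(1)])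
    ultimately have "card C * (card ?S * t * card (C \<inter> L)) = card C * card L" by (simp add: mult_ac)
    then have "card L = card ?S * (t * card (C \<inter> L))" using sub_card_pos[OF CS(1)] by (simp add: mult_ac)
    then have "card ?S dvd card L" by simp
    moreover have "card L dvd card (nrm G A)" by (rule lagrange_sub[OF sub_nrm[OF G] L(1) LM])
    ultimately have dM: "card ?S dvd card (nrm G A)" by (rule dvd_trans)
    have sB: "s dvd card B" using s(1,2) part_dvd' by blast
    have sylS: "syl s ?S G" by (rule sw.sylG[OF s(1) sB])
    obtain T where T: "sub T" "T \<subseteq> nrm G A" "card T = s ^ multiplicity s (card (nrm G A))"
      using sylow_exists[OF sub_nrm[OF G] s(1)] by blast
    have "multiplicity s (card ?S) \<le> multiplicity s (card (nrm G A))"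
      using dM sub_card_pos[OF sub_nrm[OF G], of A] by (intro dvd_imp_multiplicity_le) auto
    then have "multiplicity s (card (nrm G A)) = multiplicity s (card G)"
      using syl_mult[OF s(1) sylS] mult_le[OF G sub_nrm[OF G] nrm_sub, of s A] by simp
    then have "syl s T G" using T nrm_sub[of G A] by (auto simp: syl_def)
    then obtain g where g: "g \<in> G" "T = cj g ?S" using sylow_conj[OF s(1) G sylS] by blast
    obtain a b where ab: "a \<in> A" "b \<in> B" "g = a + b" using g(1) GAB by (blast elim: splusE)
    have Ta: "T = cj a ?S" using g(2) ab(3) nml_cj[OF sw.part_nml[OF s(1)] ab(2)] by (simp flip: cj_cj)
    have aM: "- a \<in> nrm G A" using sw.nrm_factor(1,2) ab(1) subD(4) by blast
    have "?S = cj (- a) T" using Ta by simp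
    also have "\<dots> \<subseteq> nrm G A" by (rule cj_sub_mem[OF sub_nrm[OF G] aM T(2)])
    finally have "nrm G A = G" by (intro overgroup_part_full[OF s(1,2) sub_nrm[OF G] nrm_sub sw.nrm_factor(2)])
    then show False using sw.nrm_factor(4) by simp
  qed
  have YB: "Y \<subseteq> B" using pt_sub[of s B] by (auto simp: Y_def)
  have "?S \<subseteq> nrm G Y"
  proof
    fix x assume x: "x \<in> ?S"
    then have "cj x C = C" "cj x ?S = ?S" using nml_cj[OF C] SK sub_cj_self[OF sS] by auto
    then have "cj x Y = Y" by (simp add: Y_def cj_Int)
    then show "x \<in> nrm G Y" using x SK K(2) by (auto simp: nrm_def)
  qed
  then have "B \<subseteq> nrm G Y" by (intro nrm_pt[OF B(1,2) G s(1)]) (auto simp: Y_def)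
  then have YN: "nrm G Y \<subseteq> nrm G B"
    by (intro overgroup_le_nrm sub_nrm[OF G] nrm_sub sw.nrm_proper[OF YS \<open>Y \<noteq> {0}\<close> YB])
  have VN: "V \<subseteq> nrm G B"
  proof
    fix v assume v: "v \<in> V"
    have "v + y = y + v" if "y \<in> Y" for y using that v by (auto simp: Y_def C_def cen_def)
    then have "v \<in> cen G Y" using v VG by (auto simp: cen_def)
    then show "v \<in> nrm G B" using cen_nrm[of G Y] YN by blast
  qed
  have "V \<subseteq> cen (nrm G B) ?S"
  proof
    fix v assume v: "v \<in> V"
    have "v + x = x + v" if x: "x \<in> ?S" for x
    proof -
      have "v + x + - v \<in> ?S" using nmlD(3)[OF nml_pt[OF nrm_factor(5) B(1) s(1)]] VN v x by blast
      then have 1: "v + x + - v + - x \<in> ?S" using subD(3,4)[OF sS] x by blast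
      have "cj x V = V" using x s(3) by (auto simp: nrm_def)
      then have "x + - v + - x \<in> V" using subD(4)[OF V(1) v] by (auto simp: cj_def)
      then have "v + (x + - v + - x) \<in> V" using subD(3)[OF V(1) v] by blast
      then have "v + x + - v + - x \<in> A \<inter> B" using 1 VA pt_sub[of s B] by (auto simp: gs)
      then have "v + x + - v + - x = 0" using Int0 by blast
      then have "(v + x + - v + - x) + x + v = x + v" by simp
      then show ?thesis by (simp add: gs)
    qed
    then show "v \<in> cen (nrm G B) ?S" using VN v by (auto simp: cen_def)
  qed
  then show False using cen_part[OF s(1,2)] VA V(2) subD(2)[OF V(1)] by blast
qed

end

lemma cyclic_pgrp: assumes "sub H" "x \<in> H" "pel p x" "Factorial_Ring.prime p"
  shows "pgrp p (range (\<lambda>n. tm n x))" "x \<in> range (\<lambda>n. tm n x)" "range (\<lambda>n. tm n x) \<subseteq> H"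
proof -
  show "pgrp p (range (\<lambda>n. tm n x))"
    by (rule pgrpI_pel[OF sub_cyc(1)[OF assms(1,2)] assms(4)]) (use assms(3) pel_tm in auto)
  show "x \<in> range (\<lambda>n. tm n x)" by (metis rangeI tm_1)
  show "range (\<lambda>n. tm n x) \<subseteq> H" by (rule sub_cyc(2)[OF assms(1,2)])
qed

section \<open>Centralisers of p-subgroups and the transfer argument\<close>

context coprime_factor
begin

text \<open>The normaliser \<open>H\<close> of \<open>E\<close> is factorised and thus solvable. Its
  Fitting subgroup has no parts for primes of \<open>A\<close>, by
  \<open>part_not_normalized\<close>, and a nonzero part for some prime \<open>s\<close> other than
  \<open>q\<close>; the normaliser of this part contains both \<open>H\<close> and \<open>B\<close>,
  so it lies in \<open>nrm G B\<close>.\<close>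

lemma centralizer_le_normalizer: assumes E: "sub E" "E \<noteq> {0}" "E \<subseteq> pt q B" "E \<subseteq> nrm G A" and q: "Factorial_Ring.prime q"
  shows "cen A E \<subseteq> nrm G B" "nrm G E \<subseteq> nrm G B"
proof -
  interpret sw: coprime_factor G B A by (rule swap)
  define H where "H = nrm G E"
  have EB: "E \<subseteq> B" using E(3) pt_sub[of q B] by blast
  have H: "sub H" "H \<subseteq> G" "H \<noteq> G" using sub_nrm[OF G] nrm_sub sw.nrm_proper[OF E(1,2) EB] by (auto simp: H_def)
  have le: "H \<subseteq> cen A E \<boxplus> nrm B E"
  proof
    fix h assume "h \<in> H"
    then have h: "h \<in> G" "- h \<in> H" using H subD(4) by auto
    then have hE: "cj (- h) E = E" by (simp add: H_def nrm_def)
    have "- h \<in> G" using h H(2) by blast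
    then obtain b a where ab: "b \<in> B" "a \<in> A" "- h = b + a" using GBA by (blast elim: splusE)
    have e: "cj a E = cj (- b) E" using hE ab(3) cj_eq_iff[of b "cj a E" E] by simp
    \<comment> \<open>The commutator of \<open>a\<close> and \<open>x\<close> lies in
      \<open>B\<close>, since \<open>a\<close> carries \<open>E\<close> to a conjugate under
      \<open>B\<close>, and in \<open>A\<close>, since \<open>E\<close> normalises \<open>A\<close>;
      so it is 0.\<close>
    have cm: "a + x = x + a" if x: "x \<in> E" for x
    proof -
      have "a + x + - a \<in> cj (- b) E" using e x by (auto simp: cj_def)
      then have "a + x + - a \<in> B" using cj_sub_mem[OF BS subD(4)[OF BS ab(1)] EB] by blast
      then have 1: "a + x + - a + - x \<in> B" using EB x subD(3,4)[OF BS] by blast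
      have "cj x A = A" using E(4) x by (auto simp: nrm_def)
      then have "x + - a + - x \<in> A" using subD(4)[OF AS ab(2)] by (auto simp: cj_def)
      then have "a + (x + - a + - x) \<in> A" using subD(3)[OF AS ab(2)] by blast
      then have "a + x + - a + - x \<in> A \<inter> B" using 1 by (auto simp: gs)
      then have "a + x + - a + - x = 0" using Int0 by blast
      then have "(a + x + - a + - x) + x + a = x + a" by simp
      then show ?thesis by (simp add: gs)
    qed
    have "a \<in> cen A E" using ab(2) cm by (simp add: cen_def)
    moreover then have "cj a E = E" using cen_nrm[of A E] by (auto simp: nrm_def)
    then have "cj b E = E" using e cj_eq_iff[of b E E] by simp
    then have "b \<in> nrm B E" using ab(1) by (simp add: nrm_def)
    moreover have "h = - a + - b" using arg_cong[OF ab(3), of uminus] by (simp add: minus_add)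
    ultimately show "h \<in> cen A E \<boxplus> nrm B E"
      using subD(4)[OF sub_cen[OF AS]] subD(4)[OF sub_nrm[OF BS]] by (metis splusI)
  qed
  have subs: "sub (cen A E)" "cen A E \<subseteq> A" "sub (nrm B E)" "nrm B E \<subseteq> B"
    by (simp_all add: sub_cen AS cen_sub sub_nrm BS nrm_sub)
  have leH: "cen A E \<subseteq> H" "nrm B E \<subseteq> H"
    using cen_nrm[of A E] A(2) B(2) by (auto simp: H_def nrm_def)
  have HE: "H = cen A E \<boxplus> nrm B E" using le splus_subset[OF H(1) leH] by blast
  have HE': "H = nrm B E \<boxplus> cen A E" using HE sub_splus_comm[OF subs(1,3)] H(1) by simp
  have S: "sub (cen A E \<boxplus> nrm B E)" using HE H(1) by simp
  have "solv (cen A E \<boxplus> nrm B E)" by (rule IH[OF subs S]) (use HE H(3) in simp)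
  then have "solv H" using HE by simp
  then obtain F where F: "nml F H" "nil F" "cen H F \<subseteq> F" using fitting by metis
  have FS: "sub F" "F \<subseteq> H" using F by (auto simp: nml_def)
  have nF: "nml (pt l F) H" if "Factorial_Ring.prime l" for l by (rule nml_pt[OF F(1,2) that])
  have normF: "cj h (pt l F) = pt l F" if "h \<in> H" "Factorial_Ring.prime l" for h l by (rule nml_cj[OF nF[OF that(2)] that(1)])
  obtain s where s: "Factorial_Ring.prime s" "s \<noteq> q" "pt s B \<noteq> {0}" using B2[OF q] by blast
  have sB: "s dvd card B" using s part_dvd' by blast
  have BsE: "pt s B \<subseteq> nrm B E"
  proof
    fix x assume x: "x \<in> pt s B"
    have "x + e = e + x" if "e \<in> E" for e by (rule pt_commute[OF B(1) s(1) q s(2) x]) (use that E(3) in blast)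
    then have "x \<in> cen B E" using x pt_sub[of s B] by (auto simp: cen_def)
    then show "x \<in> nrm B E" using cen_nrm[of B E] by blast
  qed
  then have BsH: "pt s B \<subseteq> H" using leH by blast
  have FA: "pt l F = {0}" if l: "Factorial_Ring.prime l" "l dvd card A" for l
  proof (rule ccontr)
    assume n: "pt l F \<noteq> {0}"
    have "pt l F \<subseteq> pt l (cen A E)" by (rule fit_part(2)[OF l subs S]) (use F(1,2) HE in auto)
    then have "pt l F \<subseteq> pt l A" using pt_mono[OF subs(2)] by blast
    moreover have "pt s B \<subseteq> nrm G (pt l F)" using BsH H(2) normF[OF _ l(1)] by (auto simp: nrm_def)
    moreover have "sub (pt l F)" using nF[OF l(1)] by (simp add: nml_def)
    ultimately show False using part_not_normalized[OF _ n _ l(1) s(1,3)] by blast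
  qed
  have FB: "pt l F \<subseteq> pt l B" if l: "Factorial_Ring.prime l" for l
  proof (cases "l dvd card B")
    case True
    have "pt l F \<subseteq> pt l (nrm B E)"
      by (rule sw.fit_part(2)[OF l True subs(3,4,1,2)]) (use F(1,2) HE' H(1) in auto)
    then show ?thesis using pt_mono[OF subs(4)] by blast
  next
    case False
    then have "pt l F = {0}" using FA[OF l] trivial_part[OF l _ False FS(1)] FS(2) H(2) by blast
    then show ?thesis using pt_0[OF BS] by simp
  qed
  have Fs: "pt s F \<noteq> {0}"
  proof
    assume z: "pt s F = {0}"
    have "x \<in> F" if x: "x \<in> pt s B" for x
    proof -
      define C where "C = {f \<in> F. x + f = f + x}"
      have "F \<subseteq> C"
      proof (rule parts_gen[OF FS(1)])
        fix f g assume fg: "f \<in> C" "g \<in> C"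
        have "x + (f + g) = (x + f) + g" by (simp only: add.assoc)
        also have "\<dots> = f + (x + g)" using fg by (simp add: C_def add.assoc)
        also have "\<dots> = (f + g) + x" using fg by (simp add: C_def add.assoc)
        finally show "f + g \<in> C" using fg subD(3)[OF FS(1)] by (simp add: C_def)
      next
        fix l :: nat assume l: "Factorial_Ring.prime l"
        show "pt l F \<subseteq> C"
        proof
          fix f assume f: "f \<in> pt l F"
          have "x + f = f + x"
          proof (cases "l = s")
            case True then show ?thesis using z f by simp
          next
            case False
            have "f \<in> pt l B" using f FB[OF l] by blast
            then show ?thesis using pt_commute[OF B(1) s(1) l, of x f] False x by auto
          qed
          then show "f \<in> C" using f by (simp add: C_def pt_def)
        qed
      qed
      then have "x \<in> cen H F" using x BsH by (auto simp: cen_def C_def)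
      then show ?thesis using F(3) by blast
    qed
    then have "pt s B \<subseteq> pt s F" by (auto simp: pt_def)
    then show False using z s(3) pt_0[OF BS] by blast
  qed
  have "H \<subseteq> nrm G (pt s F)" using normF[OF _ s(1)] H(2) by (auto simp: nrm_def)
  moreover have "B \<subseteq> nrm G (pt s F)"
    by (rule nrm_pt[OF B(1,2) G s(1) FB[OF s(1)]]) (use BsH calculation in blast)
  moreover have "nrm G (pt s F) \<noteq> G"
    by (rule sw.nrm_proper[OF _ Fs]) (use nF[OF s(1)] FB[OF s(1)] pt_sub[of s B] in \<open>auto simp: nml_def\<close>)
  ultimately have HN: "H \<subseteq> nrm G B" using overgroup_le_nrm[OF sub_nrm[OF G] _ nrm_sub] by blast
  then show "nrm G E \<subseteq> nrm G B" by (simp add: H_def)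
  show "cen A E \<subseteq> nrm G B" using leH HN by blast
qed

text \<open>Suppose the intersection had a nonzero \<open>q\<close>-element with \<open>q\<close>
  dividing \<open>card B\<close>. Some conjugate \<open>E\<close> of its cyclic group under
  \<open>A\<close> lies in \<open>B\<close> and centralises a conjugate \<open>D'\<close> of
  \<open>D\<close>. Two applications of \<open>centralizer_le_normalizer\<close>, one with the
  factors exchanged, would put \<open>cen G D\<close> into \<open>nrm G A\<close>. Hence the order
  of the intersection is prime to \<open>card B\<close>, and \<open>coprime_absorb\<close> puts it
  into \<open>A\<close>.\<close>

lemma cen_Int_nrm_le: assumes D: "sub D" "D \<noteq> {0}" "D \<subseteq> pt p A" "\<not> cen G D \<subseteq> nrm G A" and p: "Factorial_Ring.prime p"
  shows "cen G D \<inter> nrm G A \<subseteq> A"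
proof -
  interpret sw: coprime_factor G B A by (rule swap)
  define M where "M = nrm G A"
  define R where "R = M \<inter> B"
  have M: "sub M" "A \<subseteq> M" "M \<subseteq> G" "M \<noteq> G" "nml A M" using sw.nrm_factor by (auto simp: M_def)
  have R: "sub R" "R \<subseteq> B" using sub_Int[OF M(1) BS] by (auto simp: R_def)
  have MR: "M = R \<boxplus> A" unfolding R_def by (rule sw.fact_sub[OF M(1-3)])
  have MR': "M = A \<boxplus> R" unfolding R_def by (rule sw.fact_sub'[OF M(1-3)])
  have cR: "coprime (card A) (card R)" by (rule coprime_divisors[OF dvd_refl lagrange_sub[OF BS R] cop])
  have cM: "card M = card A * card R" unfolding MR' by (rule card_splus_coprime[OF AS R(1) cR])
  define S where "S = cen G D \<inter> M"
  have S: "sub S" "S \<subseteq> M" unfolding S_def using sub_Int[OF sub_cen[OF G] M(1)] by auto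
  have DA: "D \<subseteq> A" using D(3) pt_sub[of p A] by blast
  have zero: "pt q S = {0}" if q: "Factorial_Ring.prime q" "q dvd card B" for q
  proof (rule ccontr)
    assume "pt q S \<noteq> {0}"
    then obtain e where e: "e \<in> S" "pel q e" "e \<noteq> 0" using pt_0[OF S(1), of q] by (auto simp: pt_def)
    have eM: "e \<in> M" using e S by blast
    note cy = cyclic_pgrp[OF M(1) eM e(2) q(1)]
    have syR: "syl q (pt q R) M" unfolding MR by (rule sw.sylH[OF q R AS _]) (use MR M(1) in auto)
    obtain m where m: "m \<in> M" "range (\<lambda>n. tm n e) \<subseteq> cj m (pt q R)" using sylow_sub_conj[OF q(1) M(1) syR cy(1,3)] by blast
    obtain a b where ab: "a \<in> A" "b \<in> R" "m = a + b" using m(1) MR' by (blast elim: splusE)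
    have "cj b (pt q R) = pt q R" by (rule nml_cj[OF nil_nml[OF q(1) nil_sub[OF B(1) R]] ab(2)])
    then have "cj m (pt q R) = cj a (pt q R)" using ab(3) by (simp flip: cj_cj)
    then have mR: "range (\<lambda>n. tm n e) \<subseteq> cj a (pt q R)" using m(2) by simp
    define E where "E = cj (- a) (range (\<lambda>n. tm n e))"
    have ER: "E \<subseteq> pt q R" using cj_mono[OF mR, of "- a"] by (simp add: E_def)
    have Es: "sub E" unfolding E_def using cy(1) by (intro sub_cj) (simp add: pgrp_def)
    have E0: "E \<noteq> {0}" unfolding E_def cj_eq_zero using cy(2) e(3) by blast
    define D' where "D' = cj (- a) D"
    have D'A: "D' \<subseteq> pt p A" unfolding D'_def
      using cj_mono[OF D(3), of "- a"] nml_cj[OF part_nml[OF p] subD(4)[OF AS ab(1)]] by simp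
    have De: "d + e = e + d" if "d \<in> D" for d using e(1) that by (auto simp: S_def cen_def)
    have "D' \<subseteq> cen A E"
    proof
      fix d assume d: "d \<in> D'"
      have "d + x = x + d" if xE: "x \<in> E" for x
      proof -
        have dD: "a + d + - a \<in> D" using d by (simp add: D'_def cj_mem)
        have "a + x + - a \<in> range (\<lambda>n. tm n e)" using xE by (simp add: E_def cj_mem)
        then obtain n where n: "a + x + - a = tm n e" by (rule rangeE)
        have "tm n e + (a + d + - a) = (a + d + - a) + tm n e" by (rule tm_commute(2)) (use De[OF dD] in simp)
        then have "(a + x + - a) + (a + d + - a) = (a + d + - a) + (a + x + - a)" using n by simp
        then have "- a + ((a + x + - a) + (a + d + - a)) + a = - a + ((a + d + - a) + (a + x + - a)) + a" by simp
        then show ?thesis by (simp add: gs)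
      qed
      then show "d \<in> cen A E" using d D'A pt_sub[of p A] by (auto simp: cen_def)
    qed
    moreover have "cen A E \<subseteq> nrm G B"
      by (rule centralizer_le_normalizer(1)[OF Es E0 _ _ q(1)]) (use ER pt_mono[OF R(2)] pt_sub[of q R] in \<open>auto simp: R_def M_def\<close>)
    ultimately have D'N: "D' \<subseteq> nrm G B" by blast
    have "sub D'" "D' \<noteq> {0}" unfolding D'_def by (simp_all add: sub_cj D cj_eq_zero)
    then have "nrm G D' \<subseteq> M" unfolding M_def by (rule sw.centralizer_le_normalizer(2)[OF _ _ D'A D'N p])
    moreover have "cen G D \<subseteq> M"
    proof
      fix x assume x: "x \<in> cen G D"
      have aG: "a \<in> G" using ab(1) A(2) by blast
      have "cj x D = D" using x cen_nrm[of G D] by (auto simp: nrm_def)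
      then have "cj (- a + x + a) D' = D'" by (simp add: D'_def gs) (simp flip: cj_cj)
      moreover have "- a + x + a \<in> G" using x aG by (simp add: cen_def subD(3,4)[OF G])
      ultimately have "- a + x + a \<in> M" using \<open>nrm G D' \<subseteq> M\<close> by (auto simp: nrm_def)
      then have "a + (- a + x + a) + - a \<in> M" using ab(1) M(2) by (intro sub_cj_mem[OF M(1)]) auto
      then show "x \<in> M" by (simp add: gs)
    qed
    then show False using D(4) by (simp add: M_def)
  qed
  have "S \<subseteq> A"
  proof (rule coprime_absorb[OF S(1) AS _ _ M(1) cM])
    have n: "cj x A \<subseteq> A" if "x \<in> S" for x using nml_cj[OF M(5), of x] that S(2) by auto
    show "sub (S \<boxplus> A)" by (rule sub_splus_norm(1)[OF S(1) AS n])
    show "S \<boxplus> A \<subseteq> M" by (rule splus_subset[OF M(1) S(2) M(2)])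
    show "coprime (card S) (card R)"
    proof (rule ccontr)
      assume "\<not> coprime (card S) (card R)"
      then have "gcd (card S) (card R) \<noteq> 1" by (simp add: coprime_iff_gcd_eq_1)
      then obtain l where l: "Factorial_Ring.prime l" "l dvd gcd (card S) (card R)" using prime_factor_nat by blast
      then have "l dvd card S" "l dvd card B" using lagrange_sub[OF BS R] by (auto intro: dvd_trans)
      then show False using zero[OF l(1)] pt_nontrivial[OF l(1) S(1)] by blast
    qed
  qed
  then show ?thesis by (simp add: S_def M_def)
qed

text \<open>By its size \<open>A\<close> meets each conjugate of itself nontrivially; a conjugate by
  an element outside \<open>M\<close> provides a \<open>p\<close>-subgroup \<open>D\<close> of
  \<open>A\<close> whose centraliser \<open>K\<close> is not inside \<open>M\<close>. Taking
  \<open>D\<close> maximal gives control of fusion in \<open>K\<close>, so a normal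
  \<open>r\<close>-complement exists; in it \<open>pt r A\<close> normalises a Sylow
  \<open>s\<close>-subgroup that is conjugate into \<open>B\<close>, against
  \<open>part_not_normalized\<close>.\<close>

lemma card_less_False: assumes big: "card B < card A" shows False
proof -
  interpret sw: coprime_factor G B A by (rule swap)
  define M where "M = nrm G A"
  have M: "sub M" "A \<subseteq> M" "M \<subseteq> G" "M \<noteq> G" "nml A M" using sw.nrm_factor by (auto simp: M_def)
  have overA: "sub H \<Longrightarrow> A \<subseteq> H \<Longrightarrow> H \<subseteq> G \<Longrightarrow> H \<noteq> G \<Longrightarrow> H \<subseteq> M" for H unfolding M_def by (rule sw.overgroup_le_nrm)
  have nR: "nrm G (pt r A) \<subseteq> M" if r: "Factorial_Ring.prime r" "pt r A \<noteq> {0}" for r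
  proof (rule overA)
    show "sub (nrm G (pt r A))" by (rule sub_nrm[OF G])
    show "A \<subseteq> nrm G (pt r A)" using nml_cj[OF part_nml[OF r(1)]] A(2) by (auto simp: nrm_def)
    show "nrm G (pt r A) \<noteq> G" by (rule nrm_proper[OF nilD(2)[OF A(1) r(1)] r(2) pt_sub])
  qed (rule nrm_sub)
  have cenp: "pt r A \<subseteq> cen G V" if "Factorial_Ring.prime r" "Factorial_Ring.prime p" "r \<noteq> p" "V \<subseteq> pt p A" for r p V
  proof
    fix x assume x: "x \<in> pt r A"
    have "x + v = v + x" if "v \<in> V" for v by (rule pt_commute[OF A(1) _ _ _ x]) (use that \<open>V \<subseteq> pt p A\<close> \<open>r \<noteq> p\<close> \<open>Factorial_Ring.prime r\<close> \<open>Factorial_Ring.prime p\<close> in auto)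
    then show "x \<in> cen G V" using x pt_sub[of r A] A(2) by (auto simp: cen_def)
  qed
  obtain g where g: "g \<in> G" "g \<notin> M" using M(3,4) by blast
  define I where "I = A \<inter> cj g A"
  have I: "sub I" unfolding I_def by (rule sub_Int[OF AS sub_cj[OF AS]])
  have "I \<noteq> {0}"
  proof
    assume "I = {0}"
    then have "card (A \<boxplus> cj g A) = card A * card A" using card_splus[OF AS sub_cj[OF AS], of g] by (simp add: I_def)
    moreover have "card (A \<boxplus> cj g A) \<le> card G"
      by (rule card_mono[OF subD(1)[OF G] splus_subset[OF G A(2) cj_sub_mem[OF G g(1) A(2)]]])
    ultimately show False using big cardG sub_card_pos[OF AS] by simp
  qed
  then obtain p where p: "Factorial_Ring.prime p" "pt p I \<noteq> {0}" using exists_part[OF I] by blast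
  define D0 where "D0 = pt p I"
  have nI: "nil I" by (rule nil_sub[OF A(1) I]) (simp add: I_def)
  have D0: "sub D0" "D0 \<noteq> {0}" "D0 \<subseteq> pt p A" "D0 \<subseteq> cj g (pt p A)"
    unfolding D0_def by (rule nilD(2)[OF nI p(1)], rule p(2)) (simp_all add: pt_cj pt_mono I_def)
  obtain r where r: "Factorial_Ring.prime r" "r \<noteq> p" "pt r A \<noteq> {0}" using A2[OF p(1)] by blast
  let ?P = "pt r A"
  have rA: "r dvd card A" using part_dvd r by blast
  have sR: "sub ?P" using nilD(2)[OF A(1) r(1)] .
  have sylR: "syl r ?P G" by (rule sylG[OF r(1) rA])
  \<comment> \<open>Otherwise \<open>?P\<close> and its conjugate by \<open>g\<close> would be Sylow
    subgroups of \<open>cen G D0\<close> and conjugate there, and \<open>g\<close> would lie in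
    \<open>M\<close>.\<close>
  have "\<not> cen G D0 \<subseteq> M"
  proof
    assume CM: "cen G D0 \<subseteq> M"
    have C: "sub (cen G D0)" "cen G D0 \<subseteq> G" by (simp_all add: sub_cen G cen_sub)
    have P1: "?P \<subseteq> cen G D0" by (rule cenp[OF r(1) p(1) r(2) D0(3)])
    have "cj g ?P \<subseteq> cj g (cen G (cj (- g) D0))"
      by (rule cj_mono, rule cenp[OF r(1) p(1) r(2)]) (use cj_mono[OF D0(4), of "- g"] in simp)
    moreover have "cj g (cen G (cj (- g) D0)) \<subseteq> cen G D0"
    proof
      fix x assume "x \<in> cj g (cen G (cj (- g) D0))"
      then have x: "- g + x + g \<in> cen G (cj (- g) D0)" by (simp add: cj_mem)
      have "g + (- g + x + g) + - g \<in> G" by (rule sub_cj_mem[OF G g(1)]) (use x cen_sub in blast)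
      then have xG: "x \<in> G" by (simp add: gs)
      have "x + d = d + x" if d: "d \<in> D0" for d
      proof -
        have "- g + d + g \<in> cj (- g) D0" using d by (auto simp: cj_def)
        then have "(- g + x + g) + (- g + d + g) = (- g + d + g) + (- g + x + g)" using x unfolding cen_def by blast
        then have "g + ((- g + x + g) + (- g + d + g)) + - g = g + ((- g + d + g) + (- g + x + g)) + - g" by simp
        then show ?thesis by (simp add: gs)
      qed
      then show "x \<in> cen G D0" using xG by (simp add: cen_def)
    qed
    ultimately have P2: "cj g ?P \<subseteq> cen G D0" by blast
    have s1: "syl r ?P (cen G D0)" by (rule syl_between[OF r(1) sylR G C(1) P1 C(2)])
    have s2: "syl r (cj g ?P) (cen G D0)" by (rule syl_between[OF r(1) syl_cj[OF G g(1) sylR] G C(1) P2 C(2)])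
    obtain c where c: "c \<in> cen G D0" "?P = cj c (cj g ?P)" using sylow_conj[OF r(1) C(1) s2 s1] by blast
    then have "c + g \<in> nrm G ?P" using C(2) g(1) subD(3)[OF G] by (auto simp: nrm_def)
    then have "c + g \<in> M" using nR[OF r(1,3)] by blast
    then show False using sub_add_left[OF M(1), of c g] c(1) CM g(2) by blast
  qed
  define Ds where "Ds = {D. sub D \<and> D \<noteq> {0} \<and> D \<subseteq> pt p A \<and> \<not> cen G D \<subseteq> M}"
  have fD: "finite Ds" by (rule finite_subset[of _ "Pow A"]) (use subD(1)[OF AS] pt_sub[of p A] in \<open>auto simp: Ds_def\<close>)
  have "D0 \<in> Ds" using D0 \<open>\<not> cen G D0 \<subseteq> M\<close> by (simp add: Ds_def)
  then obtain D where DD: "D \<in> Ds" "\<And>E. E \<in> Ds \<Longrightarrow> D \<subseteq> E \<Longrightarrow> D = E" using finite_has_maximal[OF fD] by blast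
  have D: "sub D" "D \<noteq> {0}" "D \<subseteq> pt p A" "\<not> cen G D \<subseteq> M" using DD(1) by (auto simp: Ds_def)
  define K where "K = cen G D"
  have K: "sub K" "K \<subseteq> G" by (simp_all add: K_def sub_cen G cen_sub)
  have KM: "K \<inter> M \<subseteq> A" unfolding K_def M_def by (rule cen_Int_nrm_le[OF D(1-3) _ p(1)]) (use D(4) in \<open>simp add: M_def\<close>)
  define S where "S = pt p A \<inter> K"
  have sA: "sub (pt p A)" using nilD(2)[OF A(1) p(1)] .
  have pA: "pgrp p (pt p A)" by (rule nil_pgrp[OF p(1) A(1)])
  have S: "sub S" "S \<subseteq> K" "S \<subseteq> pt p A" "pgrp p S"
    unfolding S_def using sub_Int[OF sA K(1)] pgrp_sub[OF p(1) pA] by auto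
  have pA0: "pt p A \<noteq> {0}" using D(2,3) subD(2)[OF D(1)] by blast
  obtain z where z: "z \<in> pt p A" "z \<noteq> 0" "\<And>x. x \<in> pt p A \<Longrightarrow> x + z = z + x"
    using pgrp_center[OF p(1) pA nml_refl[OF sA] pA0] by blast
  have zA: "x + z = z + x" if "x \<in> A" for x by (rule part_central[OF A(1) p(1) z(1,3) that])
  have zG: "z \<in> G" "z \<in> A" using z(1) pt_sub[of p A] A(2) by auto
  have cz: "cen G {z} \<subseteq> M"
  proof (rule overA)
    show "sub (cen G {z})" "cen G {z} \<subseteq> G" by (simp_all add: sub_cen G cen_sub)
    show "A \<subseteq> cen G {z}" using zA A(2) by (auto simp: cen_def)
    show "cen G {z} \<noteq> G"
    proof
      assume e: "cen G {z} = G"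
      let ?Z = "range (\<lambda>n. tm n z)"
      have Z: "sub ?Z" "?Z \<subseteq> A" using sub_cyc[OF AS zG(2)] by auto
      have "?Z \<noteq> {0}" using z(2) tm_1[of z] by (metis rangeI singletonD)
      moreover have "nrm G ?Z = G"
      proof
        show "G \<subseteq> nrm G ?Z"
        proof
          fix x assume x: "x \<in> G"
          then have "x \<in> cen G {z}" using e by simp
          then have "z + x = x + z" by (simp add: cen_def)
          then have "x + tm n z = tm n z + x" for n using tm_commute(2)[of z x n] by simp
          then have "x \<in> cen G ?Z" using x by (auto simp: cen_def)
          then show "x \<in> nrm G ?Z" using cen_nrm[of G ?Z] by blast
        qed
      qed (rule nrm_sub)
      ultimately show False using nrm_proper[OF Z(1) _ Z(2)] by blast
    qed
  qed
  \<comment> \<open>The central element \<open>z\<close> lies in \<open>S\<close> but not in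
    \<open>D\<close>, so that \<open>W = S \<boxplus> D\<close> is strictly larger than
    \<open>D\<close> and its centraliser lies in \<open>M\<close> by maximality of
    \<open>D\<close>.\<close>
  have zD: "z \<notin> D"
  proof
    assume "z \<in> D"
    then have "cen G D \<subseteq> cen G {z}" by (auto simp: cen_def)
    then show False using cz D(4) by blast
  qed
  have zS: "z \<in> S" unfolding S_def K_def using z zG D(3) by (auto simp: cen_def)
  have SD: "sub (S \<boxplus> D)" "S \<boxplus> D = D \<boxplus> S"
  proof -
    have "cj x D \<subseteq> D" if "x \<in> S" for x
      using that cen_nrm[of G D] S(2) by (auto simp: nrm_def K_def)
    then show "sub (S \<boxplus> D)" "S \<boxplus> D = D \<boxplus> S" using sub_splus_norm[OF S(1) D(1)] by auto
  qed
  define W where "W = S \<boxplus> D"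
  have W: "sub W" "S \<subseteq> W" "D \<subseteq> W" "W \<subseteq> pt p A"
    using SD splus_left[of D S] splus_right[of S D] subD(2)[OF S(1)] subD(2)[OF D(1)] splus_subset[OF sA S(3) D(3)]
    by (auto simp: W_def)
  have W0: "W \<noteq> {0}" using zS z(2) W(2) by blast
  have CW: "cen G W \<subseteq> M" using DD(2)[of W] W W0 zS zD by (auto simp: Ds_def)
  \<comment> \<open>Frattini in the centraliser of \<open>W\<close>: up to an element of
    \<open>cen G W\<close>, each \<open>n\<close> normalises the Sylow subgroup \<open>?P\<close>,
    whose normaliser is inside \<open>M\<close>.\<close>
  have nW: "nrm G W \<subseteq> M"
  proof
    fix n assume n: "n \<in> nrm G W"
    have PC: "?P \<subseteq> cen G W" by (rule cenp[OF r(1) p(1) r(2) W(4)])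
    have s1: "syl r ?P (cen G W)" by (rule syl_between[OF r(1) sylR G sub_cen[OF G] PC cen_sub])
    obtain c where c: "c \<in> cen G W" "cj (c + n) ?P = ?P" using frattini[OF r(1) nml_cen_nrm[OF G] s1 n] by blast
    have "c + n \<in> nrm G ?P" using c n cen_sub[of G W] nrm_sub[of G W] subD(3)[OF G] by (auto simp: nrm_def)
    then have "c + n \<in> M" using nR[OF r(1,3)] by blast
    then show "n \<in> M" using sub_add_left[OF M(1), of c n] c(1) CW by blast
  qed
  have nS: "nrm K S \<subseteq> M"
  proof
    fix k assume k: "k \<in> nrm K S"
    then have "cj k S = S" "k \<in> K" by (auto simp: nrm_def)
    moreover then have "cj k D = D" using cen_nrm[of G D] by (auto simp: nrm_def K_def)
    ultimately have "cj k W = W" "k \<in> G" using K(2) by (auto simp: W_def cj_splus)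
    then show "k \<in> M" using nW by (auto simp: nrm_def)
  qed
  \<comment> \<open>A strictly larger \<open>p\<close>-subgroup of \<open>K\<close> would have an
    element outside \<open>S\<close> that normalises \<open>S\<close>; such an element lies in
    \<open>K \<inter> M \<subseteq> A\<close> and, being a \<open>p\<close>-element, in
    \<open>S\<close>.\<close>
  have sylS: "syl p S K"
  proof -
    obtain T where T: "sub T" "T \<subseteq> K" "card T = p ^ multiplicity p (card K)" using sylow_exists[OF K(1) p(1)] by blast
    then have sT: "syl p T K" by (simp add: syl_def)
    obtain h where h: "h \<in> K" "S \<subseteq> cj h T" using sylow_sub_conj[OF p(1) K(1) sT S(4,2)] by blast
    have sT': "syl p (cj h T) K" by (rule syl_cj[OF K(1) h(1) sT])
    have "S = cj h T"
    proof (rule ccontr)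
      assume "S \<noteq> cj h T"
      then obtain x where x: "x \<in> cj h T" "x \<notin> S" "cj x S = S"
        using pgrp_growth[OF p(1) syl_pgrp[OF sT'] S(1)] h(2) by blast
      have xK: "x \<in> K" using x(1) sT' by (auto simp: syl_def)
      then have "x \<in> M" using nS x(3) by (auto simp: nrm_def)
      then have "x \<in> A" using KM xK by blast
      moreover have "pel p x" by (rule pgrp_pel[OF syl_pgrp[OF sT'] x(1)])
      ultimately show False using x(2) xK by (auto simp: S_def pt_def)
    qed
    then show ?thesis using sT' by simp
  qed
  have PK: "?P \<subseteq> K" unfolding K_def by (rule cenp[OF r(1) p(1) r(2) D(3)])
  have sylP: "syl r ?P K" by (rule syl_between[OF r(1) sylR G K(1) PK K(2)])
  have PS: "x + y = y + x" if "x \<in> ?P" "y \<in> S" for x y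
    by (rule pt_commute[OF A(1) r(1) p(1) r(2) that(1)]) (use that(2) S(3) in blast)
  \<comment> \<open>\<open>S\<close> and its conjugate by \<open>k\<close> are Sylow subgroups of
    the centraliser of \<open>k + x + - k\<close>. Correcting \<open>k\<close> inside that
    centraliser moves it into \<open>nrm K S\<close>, hence into \<open>A\<close>, where only the
    \<open>r\<close>-part acts on \<open>x\<close>.\<close>
  have fus: "\<exists>y\<in>?P. y + x + - y = k + x + - k" if x: "x \<in> ?P" and k: "k \<in> K" and y0: "k + x + - k \<in> ?P" for x k
  proof -
    let ?C = "cen K {k + x + - k}"
    have C: "sub ?C" "?C \<subseteq> K" by (simp_all add: sub_cen K cen_sub)
    have c1: "S \<subseteq> ?C" using PS[OF y0] S(2) by (auto simp: cen_def)
    have c2: "cj k S \<subseteq> ?C"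
    proof
      fix y assume "y \<in> cj k S"
      then obtain t where t: "t \<in> S" "y = k + t + - k" by (auto simp: cj_def)
      have "y \<in> K" using t S(2) sub_cj_mem[OF K(1) k] by blast
      moreover have "y + (k + x + - k) = k + (t + x) + - k" using t(2) by (simp add: gs)
      moreover have "(k + x + - k) + y = k + (x + t) + - k" using t(2) by (simp add: gs)
      ultimately show "y \<in> ?C" using PS[OF x t(1)] by (simp add: cen_def)
    qed
    have s1: "syl p S ?C" by (rule syl_between[OF p(1) sylS K(1) C(1) c1 C(2)])
    have s2: "syl p (cj k S) ?C" by (rule syl_between[OF p(1) syl_cj[OF K(1) k sylS] K(1) C(1) c2 C(2)])
    obtain c where c: "c \<in> ?C" "S = cj c (cj k S)" using sylow_conj[OF p(1) C(1) s2 s1] by blast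
    have ck: "c + k \<in> K" using c(1) C(2) k subD(3)[OF K(1)] by blast
    then have "c + k \<in> nrm K S" using c(2) by (simp add: nrm_def)
    then have "c + k \<in> A" using nS KM ck by blast
    then obtain u v where uv: "u \<in> ?P" "c + k = u + v" "\<And>w. w \<in> ?P \<Longrightarrow> v + w = w + v" using nil_split[OF A(1) r(1)] by metis
    have "c + (k + x + - k) = (k + x + - k) + c" using c(1) by (simp add: cen_def)
    then have "k + x + - k = c + (k + x + - k) + - c" using cen_cj_id by metis
    also have "\<dots> = (c + k) + x + - (c + k)" by (simp add: gs)
    also have "\<dots> = u + (v + x + - v) + - u" unfolding uv(2) by (simp add: gs)
    also have "v + x + - v = x" by (rule cen_cj_id[OF uv(3)[OF x]])
    finally show ?thesis using uv(1) by (intro bexI[of _ u]) simp_all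
  qed
  obtain Y where Y: "nml Y K" "\<not> r dvd card Y" "K = Y \<boxplus> ?P" using normal_complement[OF K(1) r(1) sylP fus] by blast
  have YS: "sub Y" "Y \<subseteq> K" using Y by (auto simp: nml_def)
  \<comment> \<open>Since \<open>K\<close> is not inside \<open>M\<close>, for some prime
    \<open>s\<close> no Sylow \<open>s\<close>-subgroup of \<open>K\<close> lies in
    \<open>M\<close>. For primes of \<open>A\<close> there is one inside \<open>A\<close>, so
    \<open>s\<close> divides \<open>card B\<close>.\<close>
  have "\<exists>s. Factorial_Ring.prime s \<and> \<not> multiplicity s (card K) \<le> multiplicity s (card (K \<inter> M))"
  proof (rule ccontr)
    assume "\<not> ?thesis"
    then have "card K dvd card (K \<inter> M)" using sub_card_pos[OF K(1)] by (intro multiplicity_le_imp_dvd) auto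
    then have "card K \<le> card (K \<inter> M)" using sub_card_pos[OF sub_Int[OF K(1) M(1)]] by (rule dvd_imp_le)
    then have "K \<inter> M = K" by (intro sub_eqI[OF K(1)]) auto
    then show False using D(4) by (auto simp: K_def)
  qed
  then obtain s where s: "Factorial_Ring.prime s" "multiplicity s (card (K \<inter> M)) < multiplicity s (card K)" by (auto simp: not_le)
  have KIM: "sub (K \<inter> M)" by (rule sub_Int[OF K(1) M(1)])
  have inM: "\<not> (syl s T K \<and> T \<subseteq> M)" for T
    using s mult_le[OF KIM, of T s] syl_mult[OF s(1), of T K] by (auto simp: syl_def)
  have sK: "s dvd card K" using s(2) by (metis not_dvd_imp_multiplicity_0 not_less0)
  then have sG: "s dvd card G" using lagrange_sub[OF G K] dvd_trans by blast
  have sA': "\<not> s dvd card A"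
  proof
    assume d: "s dvd card A"
    show False
    proof (cases "s = p")
      case True then show ?thesis using inM[of S] sylS S(3) pt_sub[of p A] M(2) by blast
    next
      case False
      have "pt s A \<subseteq> K" unfolding K_def by (rule cenp[OF s(1) p(1) False D(3)])
      then have "syl s (pt s A) K" by (intro syl_between[OF s(1) sylG[OF s(1) d] G K(1) _ K(2)])
      then show ?thesis using inM[of "pt s A"] pt_sub[of s A] M(2) by blast
    qed
  qed
  then have sB: "s dvd card B" using sG s(1) by (simp add: cardG prime_dvd_mult_iff)
  have "s dvd card Y"
  proof -
    have "card K * card (Y \<inter> ?P) = card Y * card ?P" unfolding Y(3) by (rule card_splus[OF YS(1) sR])
    then have "s dvd card Y * card ?P" using sK by (metis dvd_mult2)
    moreover have "\<not> s dvd card ?P" using sA' lagrange_sub[OF AS sR pt_sub] dvd_trans by blast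
    ultimately show ?thesis using s(1) by (simp add: prime_dvd_mult_iff)
  qed
  obtain T where T: "sub T" "T \<subseteq> Y" "card T = s ^ multiplicity s (card Y)" using sylow_exists[OF YS(1) s(1)] by blast
  then have sT: "syl s T Y" by (simp add: syl_def)
  have "\<not> r dvd card ((\<lambda>u. cj u T) ` Y)" using card_conjugates[OF YS(1), of T] Y(2) by (metis dvd_mult2)
  moreover have PY: "cj x Y = Y" if "x \<in> ?P" for x using nml_cj[OF Y(1)] that PK by blast
  ultimately obtain u where u: "u \<in> Y" "\<And>x. x \<in> ?P \<Longrightarrow> cj x (cj u T) = cj u T"
    using fix_sylow[OF YS(1) nil_pgrp[OF r(1) A(1)] r(1) s(1) sT PY] by blast
  define Q where "Q = cj u T"
  have sQ: "syl s Q Y" unfolding Q_def by (rule syl_cj[OF YS(1) u(1) sT])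
  have Q0: "Q \<noteq> {0}"
  proof
    assume "Q = {0}"
    then have "card Q = 1" by simp
    then have "multiplicity s (card Y) = 0" using sQ s(1) by (metis One_nat_def nat_power_eq_Suc_0_iff not_prime_1 syl_def)
    then show False using \<open>s dvd card Y\<close> s(1) sub_card_pos[OF YS(1)] prime_multiplicity_gt_zero_iff[of s "card Y"] by auto
  qed
  have QG: "Q \<subseteq> G" "sub Q" using sQ YS(2) K(2) by (auto simp: syl_def)
  obtain h where h: "h \<in> G" "Q \<subseteq> cj h (pt s B)" using sylow_sub_conj[OF s(1) G sw.sylG[OF s(1) sB] syl_pgrp[OF sQ] QG(1)] by blast
  obtain a b where ab: "a \<in> A" "b \<in> B" "h = a + b" using h(1) GAB by (blast elim: splusE)
  have "cj h (pt s B) = cj a (pt s B)" using ab(3) nml_cj[OF sw.part_nml[OF s(1)] ab(2)] by (simp flip: cj_cj)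
  then have Qa: "cj (- a) Q \<subseteq> pt s B" using cj_mono[OF h(2), of "- a"] by simp
  have "?P \<subseteq> nrm G (cj (- a) Q)"
  proof
    fix x assume x: "x \<in> ?P"
    have "a + x + - a \<in> ?P" using nmlD(3)[OF part_nml[OF r(1)] ab(1) x] .
    then have e: "cj (a + x + - a) Q = Q" using u(2) by (simp add: Q_def del: cj_cj)
    have "cj x (cj (- a) Q) = cj (- a) (cj (a + x + - a) Q)" by (simp add: gs)
    then have "cj x (cj (- a) Q) = cj (- a) Q" using e by simp
    then show "x \<in> nrm G (cj (- a) Q)" using x pt_sub[of r A] A(2) by (auto simp: nrm_def)
  qed
  then show False
    using sw.part_not_normalized[OF sub_cj[OF QG(2)] _ Qa s(1) r(1,3)] Q0 by (simp add: cj_eq_zero)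
qed

theorem no_coprime_factor: False
proof -
  have "card A \<noteq> card B"
  proof
    assume "card A = card B"
    then have "card A = 1" using cop by simp
    then show False using sub_card1[OF AS] A(3) by blast
  qed
  then consider "card B < card A" | "card A < card B" by linarith
  then show False using card_less_False coprime_factor.card_less_False[OF swap] by cases
qed

end

subsection \<open>The complex group algebra\<close>

abbreviation (input) "lookup \<equiv> Poly_Mapping.lookup"
abbreviation (input) "keys \<equiv> Poly_Mapping.keys"

text \<open>Multiplication of \<open>poly_mapping\<close> is convolution along \<open>+\<close>;
  over a noncommutative \<open>group_add\<close> this is the group algebra of the whole type. The
  algebra of a finite subgroup \<open>G\<close> is cut out by supports in
  \<open>gal\<close>.\<close>

type_synonym 'g ga = "'g \<Rightarrow>\<^sub>0 complex"

definition cc :: "complex \<Rightarrow> 'g::group_add ga" where "cc c = Poly_Mapping.single 0 c"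
definition gg :: "'g \<Rightarrow> 'g::group_add ga" where "gg x = Poly_Mapping.single x 1"

lemma lookup_times:
  fixes f g :: "'g::group_add ga"
  assumes "finite S" "keys f \<subseteq> S"
  shows "lookup (f * g) k = (\<Sum>l\<in>S. lookup f l * lookup g (- l + k))"
proof -
  have e: "k = l + q \<longleftrightarrow> q = - l + k" for l q
  proof
    assume "k = l + q" then show "q = - l + k" by (simp add: gs)
  next
    assume "q = - l + k" then show "k = l + q" by (simp add: gs)
  qed
  have "lookup (f * g) k = Sum_any (\<lambda>l. lookup f l * lookup g (- l + k))"
    by (simp add: lookup_mult e)
  also have "\<dots> = (\<Sum>l\<in>S. lookup f l * lookup g (- l + k))"
    by (rule Sum_any.expand_superset[OF assms(1)]) (use assms(2) in \<open>auto simp: in_keys_iff\<close>)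
  finally show ?thesis .
qed

lemma lookup_single_times: "lookup (Poly_Mapping.single y c * a) x = c * lookup a (- y + x)" for a :: "'g::group_add ga"
  using lookup_times[of "{y}" "Poly_Mapping.single y c" a x] by (simp add: lookup_single)

lemma lookup_gg_times [simp]: "lookup (gg y * a) x = lookup a (- y + x)"
  by (simp add: gg_def lookup_single_times)

lemma lookup_cc_times [simp]: "lookup (cc c * a) x = c * lookup a x"
  by (simp add: cc_def lookup_single_times)

lemma lookup_times_single: "lookup (a * Poly_Mapping.single y c) x = lookup a (x + - y) * c" for a :: "'g::group_add ga"
proof -
  have e: "- l + x = y \<longleftrightarrow> l = x + - y" for l
  proof
    assume "- l + x = y"
    then have "l + (- l + x) + - y = l + y + - y" by simp
    then show "l = x + - y" by (simp add: gs)
  next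
    assume "l = x + - y" then show "- l + x = y" by (simp add: gs)
  qed
  have "lookup (a * Poly_Mapping.single y c) x = (\<Sum>l\<in>insert (x + - y) (keys a). lookup a l * lookup (Poly_Mapping.single y c) (- l + x))"
    by (rule lookup_times) auto
  also have "\<dots> = (\<Sum>l\<in>insert (x + - y) (keys a). if l = x + - y then lookup a l * c else 0)"
    by (intro sum.cong refl) (auto simp: lookup_single when_def e[symmetric])
  also have "\<dots> = lookup a (x + - y) * c" by (simp add: sum.delta)
  finally show ?thesis .
qed

lemma lookup_times_gg [simp]: "lookup (a * gg y) x = lookup a (x + - y)"
  by (simp add: gg_def lookup_times_single)

lemma cc_central: "a * cc c = cc c * a"
  by (rule poly_mapping_eqI) (simp add: cc_def lookup_times_single lookup_single_times mult.commute)

lemma cc_left: "a * (cc c * b) = cc c * (a * b)" by (metis cc_central mult.assoc)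

lemma cc_add: "cc (c + d) = cc c + cc d" by (simp add: cc_def single_add)
lemma cc_mult: "cc (c * d) = cc c * cc d" by (simp add: cc_def mult_single)
lemma cc_minus: "cc (- c) = - cc c" by (simp add: cc_def single_uminus)
lemma cc_0 [simp]: "cc 0 = 0" by (simp add: cc_def)
lemma cc_1 [simp]: "cc 1 = 1" by (simp add: cc_def)
lemma cc_cc: "cc c * (cc d * a) = cc (c * d) * a" by (simp add: cc_mult mult.assoc)
lemma gg_add: "gg (x + y) = gg x * gg y" by (simp add: gg_def mult_single)
lemma gg_0 [simp]: "gg 0 = 1" by (simp add: gg_def)
lemma cc_mult_eq_0: "cc c * a = 0 \<longleftrightarrow> c = 0 \<or> a = 0"
  by (auto simp: poly_mapping_eq_iff fun_eq_iff)
lemma cc_mult_cancel: "cc c * a = cc d * a \<Longrightarrow> a \<noteq> 0 \<Longrightarrow> c = d"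
  using cc_mult_eq_0[of "c - d" a] by (metis cc_add cc_minus diff_conv_add_uminus distrib_right eq_iff_diff_eq_0 mult_minus_left)

text \<open>Left multiplication by \<open>star f\<close> is the adjoint of left multiplication by
  \<open>f\<close> for the standard hermitian form.\<close>

lift_definition star :: "'g::group_add ga \<Rightarrow> 'g ga" is "\<lambda>f x. cnj (f (- x))"
proof -
  fix f :: "'g \<Rightarrow> complex" assume "finite {x. f x \<noteq> 0}"
  then have "finite (uminus -` {x. f x \<noteq> 0})" by (rule finite_vimageI) (simp add: inj_on_def)
  then show "finite {x. cnj (f (- x)) \<noteq> 0}" by (simp add: vimage_def)
qed

lemma lookup_star [simp]: "lookup (star a) x = cnj (lookup a (- x))" by transfer simp

lemma star_star [simp]: "star (star a) = a" by (rule poly_mapping_eqI) simp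
lemma star_add: "star (a + b) = star a + star b" by (rule poly_mapping_eqI) (simp add: lookup_add)
lemma star_diff: "star (a - b) = star a - star b" by (rule poly_mapping_eqI) (simp add: lookup_minus)
lemma star_0 [simp]: "star 0 = 0" by (rule poly_mapping_eqI) simp
lemma star_cc: "star (cc c) = cc (cnj c)"
  by (rule poly_mapping_eqI) (auto simp: cc_def lookup_single when_def)
lemma star_gg: "star (gg x) = gg (- x)"
  by (rule poly_mapping_eqI) (auto simp: gg_def lookup_single when_def)
lemma star_eq_0 [simp]: "star a = 0 \<longleftrightarrow> a = 0" by (metis star_0 star_star)
lemma star_1 [simp]: "star 1 = 1" using star_gg[of 0] by simp

lemma star_mult: "star (a * b) = star b * star a" for a b :: "'g::group_add ga"
proof (rule poly_mapping_eqI)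
  fix k :: 'g
  define M where "M = keys (star b) \<union> (+) k ` keys a"
  define S where "S = (+) (- k) ` M"
  have fM: "finite M" "finite S" by (simp_all add: M_def S_def)
  have kS: "keys a \<subseteq> S"
  proof
    fix x assume "x \<in> keys a"
    then have "- k + (k + x) \<in> S" unfolding S_def M_def by blast
    then show "x \<in> S" by (simp add: gs)
  qed
  have "lookup (star b * star a) k = (\<Sum>l\<in>M. lookup (star b) l * lookup (star a) (- l + k))"
    by (rule lookup_times) (simp_all add: fM, simp add: M_def)
  also have "\<dots> = (\<Sum>l\<in>S. lookup (star b) (k + l) * lookup (star a) (- (k + l) + k))"
    by (rule sum.reindex_bij_witness[of _ "(+) k" "(+) (- k)"]) (auto simp: S_def gs)
  also have "\<dots> = (\<Sum>l\<in>S. cnj (lookup a l * lookup b (- l + - k)))"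
    by (intro sum.cong refl) (simp add: gs mult.commute)
  also have "\<dots> = cnj (\<Sum>l\<in>S. lookup a l * lookup b (- l + - k))" by simp
  also have "\<dots> = cnj (lookup (a * b) (- k))"
    using lookup_times[OF fM(2) kS, of b "- k"] by simp
  finally show "lookup (star (a * b)) k = lookup (star b * star a) k" by simp
qed

text \<open>The coefficient of the product at 0 is the sum of the squared moduli of the coefficients
  of \<open>a\<close>. This definiteness takes the place of Maschke's theorem.\<close>

lemma star_times_0: "star a * a = 0 \<Longrightarrow> a = 0" for a :: "'g::group_add ga"
proof -
  assume z: "star a * a = 0"
  have "lookup (star a * a) 0 = (\<Sum>l\<in>keys (star a). of_real ((cmod (lookup a (- l)))\<^sup>2))"
    by (subst lookup_times[of "keys (star a)"]) (simp_all add: complex_mult_cnj cmod_power2 mult.commute del: of_real_power)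
  then have "(\<Sum>l\<in>keys (star a). (cmod (lookup a (- l)))\<^sup>2) = 0"
    using z by (simp del: of_real_power flip: of_real_sum)
  then have n: "lookup a (- l) = 0" if "l \<in> keys (star a)" for l
    using that by (subst (asm) sum_nonneg_eq_0_iff) auto
  have "keys (star a) = {}"
  proof (rule equals0I)
    fix l assume l: "l \<in> keys (star a)"
    then show False using n[OF l] by (simp add: in_keys_iff)
  qed
  then show "a = 0" by simp
qed

locale group_algebra =
  fixes G :: "'g::group_add set"
  assumes G: "sub G"
begin

definition gal :: "'g ga set" where "gal = {a. keys a \<subseteq> G}"

lemma gal_iff: "a \<in> gal \<longleftrightarrow> (\<forall>x. x \<notin> G \<longrightarrow> lookup a x = 0)"
  by (auto simp: gal_def in_keys_iff)

lemma gal_0 [simp]: "0 \<in> gal" by (simp add: gal_def)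
lemma gal_add: "a \<in> gal \<Longrightarrow> b \<in> gal \<Longrightarrow> a + b \<in> gal" by (simp add: gal_iff lookup_add)
lemma gal_minus: "a \<in> gal \<Longrightarrow> - a \<in> gal" by (simp add: gal_iff)
lemma gal_diff: "a \<in> gal \<Longrightarrow> b \<in> gal \<Longrightarrow> a - b \<in> gal" by (simp add: gal_iff lookup_minus)
lemma gal_single: "x \<in> G \<Longrightarrow> Poly_Mapping.single x c \<in> gal" by (auto simp: gal_iff lookup_single when_def)
lemma gal_gg: "x \<in> G \<Longrightarrow> gg x \<in> gal" by (simp add: gg_def gal_single)
lemma gal_cc: "cc c \<in> gal" by (simp add: cc_def gal_single subD[OF G])
lemma gal_1 [simp]: "1 \<in> gal" using gal_cc[of 1] by simp
lemma gal_star: "a \<in> gal \<Longrightarrow> star a \<in> gal"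
  using sub_minus_iff[OF G] by (simp add: gal_iff)
lemma gal_mult: assumes "a \<in> gal" "b \<in> gal" shows "a * b \<in> gal"
  unfolding gal_iff
proof (intro allI impI)
  fix x assume x: "x \<notin> G"
  have "- l + x \<notin> G" if "l \<in> G" for l
    using x sub_add_left[OF G, of "- l" x] sub_minus_iff[OF G, of l] that by simp
  then show "lookup (a * b) x = 0"
    using lookup_times[of G a b x] assms(1) assms(2)[unfolded gal_iff] subD(1)[OF G] by (simp add: gal_def)
qed
lemma gal_sum: "(\<And>i. i \<in> S \<Longrightarrow> f i \<in> gal) \<Longrightarrow> sum f S \<in> gal"
  by (induct S rule: infinite_finite_induct) (simp_all add: gal_add)
lemma gal_pow: "a \<in> gal \<Longrightarrow> a ^ n \<in> gal" by (induct n) (simp_all add: gal_mult)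

lemmas gal_intros = gal_add gal_minus gal_diff gal_gg gal_cc gal_star gal_mult gal_pow

lemma gal_expand: assumes "a \<in> gal" shows "a = (\<Sum>x\<in>G. cc (lookup a x) * gg x)"
proof (rule poly_mapping_eqI)
  fix k
  have "lookup (\<Sum>x\<in>G. cc (lookup a x) * gg x) k = (\<Sum>x\<in>G. if x = k then lookup a x else 0)"
    unfolding lookup_sum by (intro sum.cong refl) (simp add: gg_def lookup_single when_def)
  then show "lookup a k = lookup (\<Sum>x\<in>G. cc (lookup a x) * gg x) k"
    using assms subD(1)[OF G] by (simp add: gal_iff)
qed

text \<open>The algebra of \<open>G\<close> has dimension \<open>card G\<close>. If the sequence
  repeats a term, a dependence is read off at once; otherwise its range is a dependent set.\<close>

lemma dep: assumes v: "\<And>i. v i \<in> gal"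
  obtains c i where "(\<Sum>i\<le>card G. cc (c i) * v i) = 0" "i \<le> card G" "c i \<noteq> 0"
proof (cases "inj_on v {..card G}")
  case False
  then obtain i j where ij: "i \<le> card G" "j \<le> card G" "i \<noteq> j" "v i = v j" by (auto simp: inj_on_def)
  let ?c = "\<lambda>k. if k = i then 1 else if k = j then -1 else 0 :: complex"
  have "(\<Sum>k\<le>card G. cc (?c k) * v k) = (\<Sum>k\<le>card G. (if k = i then v i else 0) + (if k = j then - v j else 0))"
    by (intro sum.cong refl) (use ij in \<open>auto simp: cc_minus\<close>)
  also have "\<dots> = 0" using ij by (simp add: sum.distrib)
  finally show ?thesis using that[of ?c i] ij by simp
next
  case True
  interpret vs: vector_space "\<lambda>c (a::'g ga). cc c * a"
    by unfold_locales (simp_all add: distrib_left distrib_right cc_add cc_mult mult.assoc)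
  have "v ` {..card G} \<subseteq> vs.span (gg ` G)"
  proof
    fix a assume "a \<in> v ` {..card G}"
    then have "a \<in> gal" using v by blast
    then have e: "a = (\<Sum>x\<in>G. cc (lookup a x) * gg x)" by (rule gal_expand)
    have "(\<Sum>x\<in>G. cc (lookup a x) * gg x) \<in> vs.span (gg ` G)"
      by (intro vs.span_sum vs.span_scale vs.span_base) simp
    then show "a \<in> vs.span (gg ` G)" using e by simp
  qed
  moreover have "card (gg ` G) < card (v ` {..card G})"
    using card_image[OF True] card_image_le[OF subD(1)[OF G], of gg] by simp
  ultimately have "vs.dependent (v ` {..card G})"
    using vs.independent_span_bound[of "gg ` G" "v ` {..card G}"] subD(1)[OF G] by auto
  then obtain u w where u: "w \<in> v ` {..card G}" "u w \<noteq> 0" "(\<Sum>a\<in>v ` {..card G}. cc (u a) * a) = 0"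
    by (subst (asm) vs.dependent_finite) auto
  then obtain i where i: "i \<le> card G" "w = v i" by auto
  have "(\<Sum>i\<le>card G. cc (u (v i)) * v i) = 0" using u(3) by (simp add: sum.reindex[OF True])
  then show ?thesis using that[of "\<lambda>i. u (v i)" i] i u by simp
qed

definition proj :: "'g ga \<Rightarrow> bool" where
  "proj e \<longleftrightarrow> e \<in> gal \<and> e * e = e \<and> star e = e \<and> e \<noteq> 0"

text \<open>Primitive projections, in the form that Schur's lemma gives them: the corner at
  \<open>e\<close> consists of scalars.\<close>

definition minp :: "'g ga \<Rightarrow> bool" where
  "minp e \<longleftrightarrow> proj e \<and> (\<forall>a\<in>gal. \<exists>c. e * a * e = cc c * e)"

end

section \<open>Polynomials in an element of the group algebra\<close>

definition ev :: "'g::group_add ga \<Rightarrow> complex poly \<Rightarrow> 'g ga" where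
  "ev b P = fold_coeffs (\<lambda>a x. cc a + b * x) P 0"

lemma ev_0 [simp]: "ev b 0 = 0" by (simp add: ev_def)
lemma ev_pCons: "ev b (pCons a P) = cc a + b * ev b P"
  by (cases "P = 0 \<and> a = 0") (auto simp: ev_def)
lemma ev_add: "ev b (P + Q) = ev b P + ev b Q"
  by (induct P Q rule: poly_induct2) (simp_all add: ev_pCons cc_add distrib_left)
lemma ev_smult: "ev b (smult c P) = cc c * ev b P"
  by (induct P) (simp_all add: ev_pCons cc_mult distrib_left cc_left)
lemma ev_mult: "ev b (P * Q) = ev b P * ev b Q"
  by (induct P) (simp_all add: ev_pCons ev_add ev_smult distrib_right mult.assoc)
lemma ev_commute: "ev b P * ev b Q = ev b Q * ev b P" by (metis ev_mult mult.commute)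
lemma ev_star: assumes "star b = b" shows "star (ev b P) = ev b (map_poly cnj P)"
proof (induct P)
  case (pCons a P)
  have "ev b P * b = b * ev b P" using ev_commute[of b P "[:0,1:]"] by (simp add: ev_pCons)
  then show ?case using pCons assms
    by (simp add: ev_pCons star_add star_cc star_mult map_poly_pCons) (metis ev_commute ev_pCons star_mult)
qed simp
lemma ev_eigen: assumes "b * v = cc l * v" shows "ev b P * v = cc (poly P l) * v"
proof (induct P)
  case (pCons a P)
  have "ev b (pCons a P) * v = cc a * v + b * (ev b P * v)" by (simp add: ev_pCons distrib_right mult.assoc)
  also have "b * (ev b P * v) = cc (poly P l) * (b * v)" unfolding pCons by (rule cc_left)
  finally show ?case by (simp add: assms cc_cc cc_add distrib_right mult.commute)
qed simp
lemma ev_monoms: "ev b (\<Sum>i\<le>n. monom (c i) i) = (\<Sum>i\<le>n. cc (c i) * b ^ i)"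
proof -
  have m: "ev b (monom a i) = cc a * b ^ i" for a i
    by (induct i) (simp_all add: monom_Suc ev_pCons monom_0 cc_left)
  show ?thesis by (induct n) (simp_all add: ev_add m)
qed

text \<open>Linear factors of \<open>P\<close> are removed until the remaining polynomial no longer
  annihilates \<open>e\<close>; the factor removed last gives the eigenvalue.\<close>

lemma ev_root: assumes "P \<noteq> 0" "ev b P * e = 0" "e \<noteq> 0"
  obtains l r where "ev b r * e \<noteq> 0" "b * (ev b r * e) = cc l * (ev b r * e)"
  using assms
proof (induct "Polynomial.degree P" arbitrary: P thesis)
  case 0
  then obtain a where "P = [:a:]" "a \<noteq> 0" by (metis degree_eq_zeroE pCons_0_0)
  then show ?case using 0 by (simp add: ev_pCons cc_mult_eq_0)
next
  case (Suc n)
  then have "\<not> constant (poly P)" by (simp add: constant_degree)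
  then obtain l where "poly P l = 0" using fundamental_theorem_of_algebra by blast
  then obtain Q where Q: "P = [:- l, 1:] * Q" by (auto simp: poly_eq_0_iff_dvd elim: dvdE)
  have Q0: "Q \<noteq> 0" using Q Suc by auto
  have dQ: "Polynomial.degree Q = n" using Q Q0 Suc(2) by (simp add: degree_mult_eq del: mult_pCons_left)
  show ?case
  proof (cases "ev b Q * e = 0")
    case True then show ?thesis using Suc(1)[OF dQ[symmetric]] Suc(3) Q0 Suc(6) by blast
  next
    case False
    have "ev b P * e = (- cc l + b) * (ev b Q * e)" unfolding Q by (subst ev_mult) (simp add: ev_pCons cc_minus mult.assoc)
    then have "b * (ev b Q * e) = cc l * (ev b Q * e)" using Suc(5) by (simp add: distrib_right eq_neg_iff_add_eq_0 add.commute)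
      (metis add.commute add_eq_0_iff minus_minus)
    then show ?thesis using Suc(3)[OF False] by blast
  qed
qed

section \<open>Decomposition into minimal projections\<close>

context group_algebra
begin

lemma gal_ev: "b \<in> gal \<Longrightarrow> ev b P \<in> gal"
  by (induct P) (simp_all add: ev_pCons gal_intros)

text \<open>An eigenvector \<open>u\<close> of \<open>b\<close> of the form polynomial in
  \<open>b\<close> times \<open>e\<close> gives \<open>v = star u * u\<close> of the same form.
  Hence \<open>v * v\<close> is a multiple of \<open>v\<close> by a nonzero real scalar, and
  dividing \<open>v\<close> by it yields a projection; it differs from \<open>e\<close> because
  \<open>b\<close> acts on it by a scalar.\<close>

lemma spectral:
  assumes e: "proj e" and b: "b \<in> gal" "e * b = b" "b * e = b" "star b = b" and n: "\<And>c. b \<noteq> cc c * e"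
  obtains f where "proj f" "f * e = f" "e * f = f" "f \<noteq> e"
proof -
  have e': "e \<in> gal" "e * e = e" "star e = e" "e \<noteq> 0" using e by (auto simp: proj_def)
  obtain c i where c: "(\<Sum>i\<le>card G. cc (c i) * (b ^ i * e)) = 0" "i \<le> card G" "c i \<noteq> 0"
    using dep[of "\<lambda>i. b ^ i * e"] b(1) e'(1) by (auto simp: gal_intros)
  define P where "P = (\<Sum>i\<le>card G. monom (c i) i)"
  have "coeff P i = c i" using c(2) by (simp add: P_def coeff_sum if_distrib cong: if_cong)
  then have "P \<noteq> 0" using c(3) by auto
  moreover have "ev b P * e = 0" using c(1) by (simp add: P_def ev_monoms sum_distrib_right mult.assoc)
  ultimately obtain l r where r: "ev b r * e \<noteq> 0" "b * (ev b r * e) = cc l * (ev b r * e)"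
    using ev_root e'(4) by metis
  define u where "u = ev b r * e"
  have be: "ev b Q * e = e * ev b Q" for Q
  proof (induct Q)
    case (pCons a Q)
    have "ev b (pCons a Q) * e = cc a * e + b * (ev b Q * e)" by (simp add: ev_pCons distrib_right mult.assoc)
    also have "b * (ev b Q * e) = (b * e) * ev b Q" unfolding pCons by (simp add: mult.assoc)
    also have "b * e = e * b" using b by simp
    finally show ?case by (simp add: ev_pCons distrib_left mult.assoc cc_central)
  qed simp
  define s where "s = map_poly cnj r * r"
  define v where "v = star u * u"
  have "star u = e * ev b (map_poly cnj r)" by (simp add: u_def star_mult e' ev_star b)
  then have "star u * u = e * (ev b (map_poly cnj r) * ev b r * e)" by (simp add: u_def mult.assoc)
  also have "ev b (map_poly cnj r) * ev b r * e = ev b s * e" by (simp add: s_def ev_mult)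
  also have "e * (ev b s * e) = ev b s * e" unfolding be mult.assoc[symmetric] by (simp add: e')
  finally have vs: "v = ev b s * e" by (simp add: v_def)
  have v0: "v \<noteq> 0" using r(1) star_times_0[of u] by (auto simp: v_def u_def)
  have vv: "star v = v" by (simp add: v_def star_mult)
  have ve: "v * e = v" "e * v = v" unfolding vs be mult.assoc[symmetric] e'(2) by (simp_all add: mult.assoc e'(2) flip: be)
  have bv: "b * v = cc l * v"
  proof -
    have "b * star u = star u * b"
    proof -
      have "b * ev b Q = ev b Q * b" for Q using ev_commute[of b Q "[:0,1:]"] by (simp add: ev_pCons)
      then show ?thesis using \<open>star u = _\<close> b by (metis mult.assoc)
    qed
    then have "b * v = star u * (b * u)" by (simp add: v_def flip: mult.assoc)
    also have "\<dots> = star u * (cc l * u)" using r(2) by (simp add: u_def)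
    finally show ?thesis by (simp add: cc_left v_def)
  qed
  define c where "c = poly s l"
  have v2: "v * v = cc c * v"
  proof -
    have "v * v = ev b s * (e * v)" by (subst vs) (simp add: mult.assoc)
    then show ?thesis using ve ev_eigen[OF bv] by (simp add: c_def)
  qed
  have c0: "c \<noteq> 0" using v2 v0 star_times_0[of v] vv by auto
  have "star (v * v) = cc (cnj c) * v" unfolding v2 by (simp add: star_mult star_cc vv cc_central)
  moreover have "star (v * v) = v * v" by (simp only: star_mult vv)
  ultimately have "cc (cnj c) * v = cc c * v" using v2 by simp
  then have cr: "cnj c = c" using cc_mult_cancel v0 by blast
  define f where "f = cc (1 / c) * v"
  have vg: "v \<in> gal" unfolding vs by (simp add: gal_intros gal_ev b e')
  have "f * f = cc (1/c) * (v * (cc (1/c) * v))" by (simp only: f_def mult.assoc)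
  also have "v * (cc (1/c) * v) = cc (1/c) * (v * v)" by (rule cc_left)
  finally have "f * f = cc (1/c) * (cc (1/c) * (v * v))" .
  then have "f * f = f" using c0 by (simp add: v2 cc_cc f_def)
  moreover have "star f = f" using cr by (simp add: f_def star_mult star_cc vv cc_central)
  ultimately have "proj f" using vg c0 v0 by (simp add: proj_def f_def gal_intros cc_mult_eq_0)
  moreover have "f * e = f" using ve by (simp add: f_def mult.assoc)
  moreover have "e * f = f" unfolding f_def using cc_left[of e "1/c" v] ve by simp
  moreover have "f \<noteq> e"
  proof
    assume "f = e"
    have "b * f = cc (1/c) * (b * v)" unfolding f_def by (rule cc_left)
    then have "b * f = cc l * f" by (simp add: bv f_def cc_cc mult.commute)
    then show False using \<open>f = e\<close> b(3) n by auto
  qed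
  ultimately show ?thesis using that by blast
qed

text \<open>A corner element that is not a scalar has a real or imaginary part that is not a scalar;
  this part is self-adjoint, so \<open>spectral\<close> applies.\<close>

lemma not_minp_split:
  assumes e: "proj e" "\<not> minp e"
  obtains f where "proj f" "f * e = f" "e * f = f" "f \<noteq> e"
proof -
  have e': "e \<in> gal" "e * e = e" "star e = e" "e \<noteq> 0" using e by (auto simp: proj_def)
  obtain a where a: "a \<in> gal" "\<And>c. e * a * e \<noteq> cc c * e" using e by (auto simp: minp_def)
  define x where "x = e * a * e"
  have ee: "e * (e * y) = e * y" for y by (simp add: e'(2) flip: mult.assoc)
  have x: "x \<in> gal" "e * x = x" "x * e = x" "e * star x = star x" "star x * e = star x"
    by (simp_all add: x_def gal_intros e' a star_mult mult.assoc ee)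
  define h where "h = x + star x"
  define k where "k = cc \<i> * (x - star x)"
  have h: "h \<in> gal" "e * h = h" "h * e = h" "star h = h"
    by (simp_all add: h_def gal_intros x distrib_left distrib_right star_add add.commute)
  have k: "k \<in> gal" "e * k = k" "k * e = k" "star k = k"
    by (simp_all add: k_def gal_intros x star_mult star_cc star_diff cc_minus)
      (simp_all add: cc_left right_diff_distrib left_diff_distrib x mult.assoc, simp add: cc_central cc_minus right_diff_distrib left_diff_distrib)
  have xhk: "x = cc (1/2) * (h - cc \<i> * k)"
  proof (rule poly_mapping_eqI)
    fix y show "lookup x y = lookup (cc (1/2) * (h - cc \<i> * k)) y"
      by (simp add: h_def k_def lookup_add lookup_minus field_simps)
  qed
  show ?thesis
  proof (cases "(\<exists>c. h = cc c * e) \<and> (\<exists>c. k = cc c * e)")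
    case True
    then obtain c d where "h = cc c * e" "k = cc d * e" by blast
    then have "x = cc (1/2 * (c - \<i> * d)) * e"
      unfolding xhk by (intro poly_mapping_eqI) (simp add: lookup_minus algebra_simps)
    then show ?thesis using a(2) by (simp add: x_def)
  next
    case False
    then show ?thesis using spectral[OF e(1) h] spectral[OF e(1) k] that by metis
  qed
qed

definition family :: "'g ga \<Rightarrow> 'g ga set \<Rightarrow> bool" where
  "family f F \<longleftrightarrow> finite F \<and> (\<forall>e\<in>F. proj e) \<and> (\<forall>e\<in>F. \<forall>e'\<in>F. e \<noteq> e' \<longrightarrow> e * e' = 0) \<and> \<Sum>F = f"

lemma family_mult: assumes "family f F" "e \<in> F" shows "e * f = e" "f * e = e"
proof -
  have F: "finite F" "\<Sum>F = f" "e * e = e" using assms by (auto simp: family_def proj_def)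
  have "e * f = (\<Sum>e'\<in>F. if e' = e then e else 0)" unfolding F(2)[symmetric] sum_distrib_left
    by (intro sum.cong refl) (use assms F in \<open>auto simp: family_def\<close>)
  then show "e * f = e" using F assms(2) by simp
  have "f * e = (\<Sum>e'\<in>F. if e' = e then e else 0)" unfolding F(2)[symmetric] sum_distrib_right
    by (intro sum.cong refl) (use assms F in \<open>auto simp: family_def\<close>)
  then show "f * e = e" using F assms(2) by simp
qed

text \<open>Nonzero orthogonal projections are linearly independent, as multiplication by one of
  them isolates its coefficient.\<close>

lemma family_card: assumes "family f F" shows "card F \<le> card G"
proof (rule ccontr)
  assume "\<not> ?thesis"
  then have c: "Suc (card G) \<le> card F" by simp
  have fF: "finite F" using assms by (simp add: family_def)
  obtain v where v: "bij_betw v {0..<card F} F" using ex_bij_betw_nat_finite[OF fF] by blast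
  define w where "w i = (if i < card F then v i else 0)" for i
  have F: "e \<in> gal" "e * e = e" "e \<noteq> 0" if "e \<in> F" for e using assms that by (auto simp: family_def proj_def)
  have vF: "v i \<in> F" if "i < card F" for i using v that by (auto simp: bij_betw_def)
  have "w i \<in> gal" for i using F vF by (simp add: w_def)
  then obtain c i where ci: "(\<Sum>i\<le>card G. cc (c i) * w i) = 0" "i \<le> card G" "c i \<noteq> 0" using dep[of w] by blast
  have i: "i < card F" using ci c by simp
  have "(\<Sum>j\<le>card G. cc (c j) * (w j * w i)) = (\<Sum>j\<le>card G. cc (c j) * w j) * w i"
    by (simp add: sum_distrib_right mult.assoc)
  then have "(\<Sum>j\<le>card G. cc (c j) * (w j * w i)) = 0" by (simp add: ci(1))
  moreover have "cc (c j) * (w j * w i) = (if j = i then cc (c i) * v i else 0)" if "j \<le> card G" for j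
  proof (cases "j = i")
    case True then show ?thesis using i F(2)[OF vF[OF i]] by (simp add: w_def)
  next
    case False
    have j: "j < card F" using that c by simp
    then have "v j \<noteq> v i" using v i False by (auto simp: bij_betw_def inj_on_def)
    then show ?thesis using assms vF i j False by (auto simp: family_def w_def)
  qed
  ultimately have "(\<Sum>j\<le>card G. if j = i then cc (c i) * v i else 0) = 0" by simp
  then have "cc (c i) * v i = 0" using ci(2) by simp
  then show False using ci(3) F(3)[OF vF[OF i]] by (simp add: cc_mult_eq_0)
qed

text \<open>In a family of largest size every member is minimal, since a nonminimal \<open>e\<close>
  could be replaced by \<open>g\<close> and \<open>e - g\<close>.\<close>

lemma minp_family: assumes f: "proj f" obtains F where "family f F" "\<And>e. e \<in> F \<Longrightarrow> minp e"
proof -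
  have "family f {f}" using f by (simp add: family_def)
  then obtain F where F: "family f F" "\<And>F'. family f F' \<Longrightarrow> card F' \<le> card F"
    using ex_has_greatest_nat[of "family f" "{f}" card "Suc (card G)"] family_card le_imp_less_Suc by blast
  have "minp e" if e: "e \<in> F" for e
  proof (rule ccontr)
    assume n: "\<not> minp e"
    have pe: "proj e" using F(1) e by (simp add: family_def)
    have e': "e \<in> gal" "e * e = e" "star e = e" "e \<noteq> 0" using pe by (auto simp: proj_def)
    obtain g where g: "proj g" "g * e = g" "e * g = g" "g \<noteq> e" using not_minp_split[OF pe n] by blast
    define h where "h = e - g"
    have g': "g \<in> gal" "g * g = g" "star g = g" "g \<noteq> 0" using g(1) by (auto simp: proj_def)
    have h: "h * e = h" "e * h = h" "h * h = h" "g * h = 0" "h * g = 0"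
      by (simp_all add: h_def right_diff_distrib left_diff_distrib g g' e')
    have ph: "proj h" using h(3) g(4) by (simp add: proj_def) (simp add: h_def gal_diff e' g' star_diff)
    have h0: "h \<noteq> 0" using ph by (simp add: proj_def)
    define R where "R = F - {e}"
    have R0: "r * e = 0" "e * r = 0" "proj r" if "r \<in> R" for r using F(1) e that by (auto simp: R_def family_def)
    have Rg: "r * g = 0" "g * r = 0" "r * h = 0" "h * r = 0" if "r \<in> R" for r
    proof -
      have "r * g = r * e * g" "g * r = g * (e * r)" "r * h = r * e * h" "h * r = h * (e * r)"
        using g(2,3) h(1,2) by (simp_all add: mult.assoc) (simp_all flip: mult.assoc add: g h)
      then show "r * g = 0" "g * r = 0" "r * h = 0" "h * r = 0" using R0[OF that] by simp_all
    qed
    have gR: "g \<notin> R" using Rg(1)[of g] g' by auto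
    have hR: "h \<notin> R" using Rg(3)[of h] h h0 by auto
    have gh: "g \<noteq> h" using h g' by auto
    have fR: "finite R" "finite F" using F(1) by (auto simp: family_def R_def)
    have sF: "e + \<Sum>R = f" using F(1) e sum.remove[of F e id] by (simp add: family_def R_def)
    have "\<Sum>(insert g (insert h R)) = g + (h + \<Sum>R)" using gR hR gh fR by simp
    also have "\<dots> = f" using sF by (simp add: h_def)
    finally have "family f (insert g (insert h R))"
      unfolding family_def using fR g(1) ph R0(3) Rg h(4,5) F(1) by (auto simp: R_def family_def)
    then have "card (insert g (insert h R)) \<le> card F" by (rule F(2))
    moreover have "card (insert g (insert h R)) = Suc (card F)" using gR hR gh fR e by (simp add: R_def)
      (metis One_nat_def Suc_pred card_gt_0_iff empty_iff)
    ultimately show False by simp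
  qed
  then show ?thesis using that F(1) by blast
qed

text \<open>
  \<open>tau b c\<close> is the trace of \<open>a \<mapsto> b a c\<close> on the group algebra; so \<open>x \<mapsto> tau (gg x) e\<close> is the character of
  the left ideal generated by a projection \<open>e\<close>, an irreducible one if \<open>minp e\<close> holds.
\<close>

definition tau :: "'g ga \<Rightarrow> 'g ga \<Rightarrow> complex" where
  "tau b c = (\<Sum>y\<in>G. lookup (b * gg y * c) y)"

lemma tau_add: "tau (a + b) c = tau a c + tau b c" by (simp add: tau_def distrib_right lookup_add sum.distrib)
lemma tau_diff: "tau (a - b) c = tau a c - tau b c" by (simp add: tau_def left_diff_distrib lookup_minus sum_subtractf)
lemma tau_add_r: "tau a (b + c) = tau a b + tau a c" by (simp add: tau_def distrib_left lookup_add sum.distrib)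
lemma tau_diff_r: "tau a (b - c) = tau a b - tau a c" by (simp add: tau_def right_diff_distrib lookup_minus sum_subtractf)
lemma tau_0: "tau 0 c = 0" "tau c 0 = 0" by (simp_all add: tau_def)
lemma tau_cc: "tau (cc c * a) b = c * tau a b"
  by (simp add: tau_def sum_distrib_left mult.assoc)
lemma tau_cc_r: "tau a (cc c * b) = c * tau a b"
  by (simp add: tau_def sum_distrib_left cc_left mult.assoc)
lemma tau_sum: "tau (sum f S) c = (\<Sum>i\<in>S. tau (f i) c)"
  by (induct S rule: infinite_finite_induct) (simp_all add: tau_add tau_0)
lemma tau_sum_r: "tau c (sum f S) = (\<Sum>i\<in>S. tau c (f i))"
  by (induct S rule: infinite_finite_induct) (simp_all add: tau_add_r tau_0)

lemma gal_prod_0: assumes "a \<in> gal" "\<And>y. y \<in> G \<Longrightarrow> f * gg y * e = 0" shows "f * a * e = 0"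
proof -
  have "f * a * e = f * (\<Sum>x\<in>G. cc (lookup a x) * gg x) * e" using gal_expand[OF assms(1)] by simp
  also have "\<dots> = (\<Sum>x\<in>G. cc (lookup a x) * (f * gg x * e))"
    by (simp add: sum_distrib_left sum_distrib_right cc_left mult.assoc)
  finally show ?thesis using assms(2) by simp
qed

text \<open>\<open>v\<close> is a multiple of a partial isometry between \<open>e\<close> and
  \<open>f\<close>; computing \<open>v * star v * v\<close> in two ways shows that the two scalars
  agree.\<close>

lemma minp_link: assumes f: "minp f" and e: "minp e" and a: "a \<in> gal" and v: "v = f * a * e" "v \<noteq> 0"
  obtains c where "c \<noteq> 0" "star v * v = cc c * e" "v * star v = cc c * f"
proof -
  have e': "e \<in> gal" "e * e = e" "star e = e" "e \<noteq> 0" and f': "f \<in> gal" "f * f = f" "star f = f" "f \<noteq> 0"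
    using f e by (auto simp: minp_def proj_def)
  have sv: "star v = e * star a * f" by (simp add: v(1) star_mult e'(3) f'(3) mult.assoc)
  have ee: "e * (e * y) = e * y" and ff: "f * (f * y) = f * y" for y by (simp_all add: e'(2) f'(2) flip: mult.assoc)
  have "star v * v = (e * star a * f) * (f * a * e)" by (subst sv, subst v(1)) (rule refl)
  then have "star v * v = e * (star a * f * a) * e" by (simp add: mult.assoc ff)
  moreover have "star a * f * a \<in> gal" by (intro gal_mult gal_star a f'(1))
  ultimately obtain c where c: "star v * v = cc c * e" using e by (auto simp: minp_def)
  have "v * star v = (f * a * e) * (e * star a * f)" by (subst sv, subst v(1)) (rule refl)
  then have "v * star v = f * (a * e * star a) * f" by (simp add: mult.assoc ee)
  moreover have "a * e * star a \<in> gal" by (intro gal_mult gal_star a e'(1))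
  ultimately obtain d where d: "v * star v = cc d * f" using f by (auto simp: minp_def)
  have c0: "c \<noteq> 0" using c star_times_0[of v] v(2) by auto
  have ve: "v * e = v" "f * v = v" by (simp_all add: v(1) mult.assoc e') (simp flip: mult.assoc add: f')
  have "cc c * v = v * (star v * v)" by (simp add: c cc_left ve)
  also have "\<dots> = cc d * v" by (simp flip: mult.assoc add: d) (simp add: mult.assoc ve)
  finally have "c = d" using cc_mult_cancel v(2) by blast
  then show ?thesis using that c c0 d by blast
qed

text \<open>The space of all \<open>f * a * e\<close> is zero or spanned by one \<open>v\<close>,
  and \<open>tau f e\<close> is its dimension, being the trace of the idempotent map
  \<open>a \<mapsto> f * a * e\<close>.\<close>

lemma tau_minp: assumes f: "minp f" and e: "minp e"
  shows "tau f e = 1 \<and> (\<exists>y\<in>G. f * gg y * e \<noteq> 0) \<or> tau f e = 0 \<and> (\<forall>a\<in>gal. f * a * e = 0)"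
proof (cases "\<exists>y\<in>G. f * gg y * e \<noteq> 0")
  case False
  then have "tau f e = 0" by (simp add: tau_def)
  then show ?thesis using False gal_prod_0 by blast
next
  case True
  then obtain x where x: "x \<in> G" "f * gg x * e \<noteq> 0" by blast
  define v where "v = f * gg x * e"
  have e': "e \<in> gal" "e * e = e" "star e = e" "e \<noteq> 0" and f': "f \<in> gal" "f * f = f" "star f = f" "f \<noteq> 0"
    using f e by (auto simp: minp_def proj_def)
  obtain c where c: "c \<noteq> 0" "star v * v = cc c * e" "v * star v = cc c * f"
    using minp_link[OF f e gal_gg[OF x(1)] v_def] x by (auto simp: v_def)
  have vg: "v \<in> gal" by (simp add: v_def gal_intros e' f' x)
  have ve: "v * e = v" "f * v = v" by (simp_all add: v_def mult.assoc e') (simp flip: mult.assoc add: f')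
  \<comment> \<open>Replacing a multiple of \<open>f\<close> by \<open>v * star v\<close> leaves an
    element of the corner at \<open>e\<close> to the right of \<open>v\<close>, and that is a scalar
    multiple of \<open>e\<close>.\<close>
  have "\<exists>m. f * gg y * e = cc m * v" if y: "y \<in> G" for y
  proof -
    have "cc c * (f * gg y * e) = (cc c * f) * gg y * e" by (simp add: mult.assoc)
    also have "\<dots> = v * (star v * gg y) * e" unfolding c(3)[symmetric] by (simp add: mult.assoc)
    also have "\<dots> = v * (e * (star v * gg y) * e)" by (simp flip: mult.assoc add: ve)
    also obtain m where "e * (star v * gg y) * e = cc m * e"
    proof -
      have "star v * gg y \<in> gal" by (intro gal_mult gal_star vg gal_gg y)
      then show ?thesis using e that by (auto simp: minp_def)
    qed
    finally have "cc c * (f * gg y * e) = cc m * v" by (simp add: cc_left ve)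
    then have "cc (1/c) * (cc c * (f * gg y * e)) = cc (1/c) * (cc m * v)" by simp
    then show ?thesis using c(1) by (auto simp: cc_cc)
  qed
  then obtain m where m: "\<And>y. y \<in> G \<Longrightarrow> f * gg y * e = cc (m y) * v" by metis
  have "v = f * v * e" by (simp add: ve)
  also have "\<dots> = f * (\<Sum>x\<in>G. cc (lookup v x) * gg x) * e" using gal_expand[OF vg] by simp
  also have "\<dots> = (\<Sum>x\<in>G. cc (lookup v x) * (f * gg x * e))"
    by (simp add: sum_distrib_left sum_distrib_right cc_left mult.assoc)
  also have "\<dots> = (\<Sum>x\<in>G. cc (lookup v x * m x) * v)" by (intro sum.cong refl) (simp add: m cc_cc)
  also have "\<dots> = cc (\<Sum>x\<in>G. lookup v x * m x) * v"
    by (rule poly_mapping_eqI) (simp add: lookup_sum sum_distrib_right)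
  finally have "cc 1 * v = cc (\<Sum>x\<in>G. lookup v x * m x) * v" by simp
  then have "(\<Sum>x\<in>G. lookup v x * m x) = 1" using cc_mult_cancel[of 1 v] x by (simp add: v_def)
  moreover have "tau f e = (\<Sum>x\<in>G. lookup v x * m x)"
    unfolding tau_def by (intro sum.cong refl) (simp add: m mult.commute)
  ultimately show ?thesis using x by auto
qed

end

subsection \<open>Multipliers of a lattice are algebraic integers\<close>

definition lat :: "'i set \<Rightarrow> ('i \<Rightarrow> complex) \<Rightarrow> complex set" where
  "lat S v = range (\<lambda>M. \<Sum>t\<in>S. of_int (M t) * v t)"

text \<open>The multipliers of one fixed lattice form a ring by inspection, so that integrality of a
  whole expression follows from that of its ingredients with respect to the same lattice.\<close>

definition mult_ring :: "'i set \<Rightarrow> ('i \<Rightarrow> complex) \<Rightarrow> complex set" where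
  "mult_ring S v = {c. \<forall>s\<in>S. c * v s \<in> lat S v}"

lemma latI: "x = (\<Sum>t\<in>S. of_int (M t) * v t) \<Longrightarrow> x \<in> lat S v" by (auto simp: lat_def)

lemma lat_0: "0 \<in> lat S v" by (rule latI[of _ "\<lambda>_. 0"]) simp

lemma lat_base: "finite S \<Longrightarrow> s \<in> S \<Longrightarrow> v s \<in> lat S v"
  by (rule latI[of _ "\<lambda>t. if t = s then 1 else 0"]) (simp add: if_distrib if_distribR cong: if_cong)

lemma lat_add: assumes "x \<in> lat S v" "y \<in> lat S v" shows "x + y \<in> lat S v"
proof -
  obtain M N where "x = (\<Sum>t\<in>S. of_int (M t) * v t)" "y = (\<Sum>t\<in>S. of_int (N t) * v t)"
    using assms by (auto simp: lat_def)
  then show ?thesis by (intro latI[of _ "\<lambda>t. M t + N t"]) (simp add: sum.distrib distrib_right)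
qed

lemma lat_int: assumes "x \<in> lat S v" shows "of_int k * x \<in> lat S v"
proof -
  obtain M where "x = (\<Sum>t\<in>S. of_int (M t) * v t)" using assms by (auto simp: lat_def)
  then show ?thesis by (intro latI[of _ "\<lambda>t. k * M t"]) (simp add: sum_distrib_left mult.assoc)
qed

lemma lat_sum: "(\<And>i. i \<in> T \<Longrightarrow> f i \<in> lat S v) \<Longrightarrow> sum f T \<in> lat S v"
  by (induct T rule: infinite_finite_induct) (simp_all add: lat_0 lat_add)

lemma mult_ring_lat: assumes "c \<in> mult_ring S v" "x \<in> lat S v" shows "c * x \<in> lat S v"
proof -
  obtain M where x: "x = (\<Sum>t\<in>S. of_int (M t) * v t)" using assms(2) by (auto simp: lat_def)
  have "c * x = (\<Sum>t\<in>S. of_int (M t) * (c * v t))" by (simp add: x sum_distrib_left ac_simps)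
  then show ?thesis using assms(1) by (simp add: lat_sum lat_int mult_ring_def)
qed

lemma mult_ring_mult: assumes "c \<in> mult_ring S v" "d \<in> mult_ring S v" shows "c * d \<in> mult_ring S v"
  using assms(2) mult_ring_lat[OF assms(1)] by (simp add: mult_ring_def mult.assoc)

lemma mult_ring_add: "c \<in> mult_ring S v \<Longrightarrow> d \<in> mult_ring S v \<Longrightarrow> c + d \<in> mult_ring S v"
  by (simp add: mult_ring_def distrib_right lat_add)

lemma mult_ring_int: "finite S \<Longrightarrow> of_int k \<in> mult_ring S v"
  by (simp add: mult_ring_def lat_int lat_base)

lemma mult_ring_nat: "finite S \<Longrightarrow> of_nat k \<in> mult_ring S v"
  using mult_ring_int[of S "int k"] by simp

lemma mult_ring_sum: "finite S \<Longrightarrow> (\<And>i. i \<in> T \<Longrightarrow> f i \<in> mult_ring S v) \<Longrightarrow> sum f T \<in> mult_ring S v"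
  using mult_ring_int[of S 0 v] by (induct T rule: infinite_finite_induct) (simp_all add: mult_ring_add)

lemma mult_ring_pow: "finite S \<Longrightarrow> c \<in> mult_ring S v \<Longrightarrow> c ^ n \<in> mult_ring S v"
  using mult_ring_int[of S 1 v] by (induct n) (simp_all add: mult_ring_mult)

text \<open>On the spanning family, multiplication by \<open>c\<close> is given by an integer
  matrix, with the nonzero vector of the \<open>v s\<close> as eigenvector; so \<open>c\<close> is a
  root of a monic integral polynomial.\<close>

lemma mult_ring_algebraic_int:
  assumes S: "finite S" and s: "s \<in> S" "v s \<noteq> 0" and c: "c \<in> mult_ring S v"
  shows "algebraic_int c"
proof -
  define n where "n = card S"
  obtain g where g: "bij_betw g {0..<n} S" using ex_bij_betw_nat_finite[OF S] by (auto simp: n_def)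
  have "\<exists>M. \<forall>t\<in>S. c * v t = (\<Sum>u\<in>S. of_int (M t u) * v u)"
  proof -
    have "\<forall>t\<in>S. \<exists>M. c * v t = (\<Sum>u\<in>S. of_int (M u) * v u)"
      using c by (auto simp: mult_ring_def lat_def)
    then show ?thesis by (rule bchoice)
  qed
  then obtain M :: "'a \<Rightarrow> 'a \<Rightarrow> int" where M: "\<And>t. t \<in> S \<Longrightarrow> c * v t = (\<Sum>u\<in>S. of_int (M t u) * v u)" by blast
  define Z where "Z = mat n n (\<lambda>(i, j). M (g i) (g j))"
  define A where "A = map_mat (of_int :: int \<Rightarrow> complex) Z"
  define x where "x = vec n (\<lambda>i. v (g i))"
  have Z: "Z \<in> carrier_mat n n" by (simp add: Z_def)
  have A: "A \<in> carrier_mat n n" by (simp add: A_def Z)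
  have gS: "g i \<in> S" if "i < n" for i using g that by (auto simp: bij_betw_def)
  have "A *\<^sub>v x = c \<cdot>\<^sub>v x"
  proof (rule eq_vecI)
    fix i assume "i < dim_vec (c \<cdot>\<^sub>v x)"
    then have i: "i < n" by (simp add: x_def)
    have "(A *\<^sub>v x) $ i = (\<Sum>j = 0..<n. of_int (M (g i) (g j)) * v (g j))"
      using i Z by (simp add: A_def x_def scalar_prod_def) (intro sum.cong refl, simp add: Z_def)
    also have "\<dots> = (\<Sum>u\<in>S. of_int (M (g i) u) * v u)" by (rule sum.reindex_bij_betw[OF g])
    also have "\<dots> = c * v (g i)" using M[OF gS[OF i]] by simp
    finally show "(A *\<^sub>v x) $ i = (c \<cdot>\<^sub>v x) $ i" using i by (simp add: x_def)
  qed (use A in \<open>simp add: x_def\<close>)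
  moreover obtain i where i: "i < n" "g i = s" using g s(1) by (auto simp: bij_betw_def image_iff)
  then have "x $ i \<noteq> 0\<^sub>v n $ i" using s(2) by (simp add: x_def)
  then have "x \<noteq> 0\<^sub>v n" by auto
  ultimately have "eigenvalue A c"
    using A unfolding eigenvalue_def eigenvector_def by (intro exI[of _ x]) (simp add: x_def)
  then have "poly (char_poly A) c = 0" using eigenvalue_root_char_poly[OF A] by simp
  moreover have "char_poly A = map_poly of_int (char_poly Z)"
    unfolding A_def by (rule of_int_hom.char_poly_hom[OF Z])
  moreover have "lead_coeff (char_poly Z) = 1" using degree_monic_char_poly[OF Z] by simp
  ultimately show ?thesis unfolding algebraic_int_altdef_ipoly by metis
qed

subsection \<open>Sums over roots of unity\<close>

locale root_of_unity =
  fixes p :: nat and \<zeta> :: complex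
  assumes p: "Factorial_Ring.prime p" and zp: "\<zeta> ^ p = 1" and norm_zeta: "cmod \<zeta> = 1"
    and primitive: "\<And>j. 0 < j \<Longrightarrow> j < p \<Longrightarrow> \<zeta> ^ j \<noteq> 1"
begin

lemma p0: "p > 0" using p prime_gt_0_nat by blast

lemma pow_mod: "\<zeta> ^ i = \<zeta> ^ (i mod p)"
proof -
  have "\<zeta> ^ i = \<zeta> ^ (p * (i div p) + i mod p)" by simp
  then show ?thesis by (simp only: power_add power_mult zp power_one mult_1_left)
qed

lemma pow_eq_1: "\<zeta> ^ i = 1 \<longleftrightarrow> p dvd i"
  using pow_mod[of i] primitive[of "i mod p"] p0 by (auto simp: dvd_eq_mod_eq_0)

lemma sum_pow: "(\<Sum>j<p. \<zeta> ^ (i * j)) = (if p dvd i then of_nat p else 0)"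
proof (cases "p dvd i")
  case True
  then have "\<zeta> ^ (i * j) = 1" for j by (simp add: pow_eq_1)
  then show ?thesis using True by simp
next
  case False
  then have "\<zeta> ^ i \<noteq> 1" by (simp add: pow_eq_1)
  then have "(\<Sum>j<p. (\<zeta> ^ i) ^ j) = ((\<zeta> ^ i) ^ p - 1) / (\<zeta> ^ i - 1)" by (rule geometric_sum)
  also have "(\<zeta> ^ i) ^ p = 1" by (metis power_mult mult.commute zp power_one)
  finally show ?thesis using False by (simp add: power_mult)
qed

lemma cnj_zeta: "cnj \<zeta> * \<zeta> = 1"
  using norm_zeta complex_norm_square[of \<zeta>] by (simp add: mult.commute)

lemma cnj_pow: "cnj (\<zeta> ^ i) = \<zeta> ^ (i * (p - 1))"
proof -
  have "cnj \<zeta> = cnj \<zeta> * \<zeta> ^ p" using zp by simp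
  also have "\<dots> = (cnj \<zeta> * \<zeta>) * \<zeta> ^ (p - 1)" using p0 by (simp add: power_eq_if)
  finally have "cnj \<zeta> = \<zeta> ^ (p - 1)" by (simp add: cnj_zeta)
  then show ?thesis by (simp add: mult.commute flip: power_mult)
qed

lemma sum_cnj: assumes "j < p" shows "(\<Sum>i<p. cnj \<zeta> ^ (i * j)) = (if j = 0 then of_nat p else 0)"
proof -
  have "(\<Sum>i<p. cnj \<zeta> ^ (i * j)) = cnj (\<Sum>i<p. \<zeta> ^ (j * i))" by (simp add: mult.commute)
  also have "\<dots> = (if p dvd j then of_nat p else 0)" by (simp add: sum_pow)
  also have "p dvd j \<longleftrightarrow> j = 0" using assms p0 by (auto dest: dvd_imp_le)
  finally show ?thesis .
qed

text \<open>Summation over the nontrivial powers of \<open>\<zeta>\<close> acts as the trace of the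
  cyclotomic field; on a single power it gives \<open>p - 1\<close> or \<open>- 1\<close>.\<close>

lemma rat_poly_sum: assumes Q: "\<And>i. coeff Q i \<in> \<rat>" shows "(\<Sum>j=1..<p. poly Q (\<zeta> ^ j)) \<in> \<rat>"
proof -
  have s: "(\<Sum>j=1..<p. \<zeta> ^ (i * j)) \<in> \<rat>" for i
  proof -
    have "{..<p} = insert 0 {1..<p}" using p0 by auto
    then have "(\<Sum>j<p. \<zeta> ^ (i * j)) = 1 + (\<Sum>j=1..<p. \<zeta> ^ (i * j))" by simp
    then have "(\<Sum>j=1..<p. \<zeta> ^ (i * j)) = (if p dvd i then of_nat p else 0) - 1" by (simp add: sum_pow)
    then show ?thesis by (simp add: Rats_diff)
  qed
  have "(\<Sum>j=1..<p. poly Q (\<zeta> ^ j)) = (\<Sum>j=1..<p. \<Sum>i\<le>Polynomial.degree Q. coeff Q i * \<zeta> ^ (i * j))"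
    by (simp add: poly_altdef mult.commute flip: power_mult)
  also have "\<dots> = (\<Sum>i\<le>Polynomial.degree Q. coeff Q i * (\<Sum>j=1..<p. \<zeta> ^ (i * j)))"
    by (subst sum.swap) (simp add: sum_distrib_left)
  also have "\<dots> \<in> \<rat>" by (intro Rats_sum Rats_mult Q s)
  finally show ?thesis .
qed

end

lemma rat_coeff_mult: "(\<And>i. coeff P i \<in> \<rat>) \<Longrightarrow> (\<And>i. coeff Q i \<in> \<rat>) \<Longrightarrow> coeff (P * Q) i \<in> \<rat>"
  for P Q :: "complex poly"
  unfolding coeff_mult by (intro Rats_sum Rats_mult)

lemma rat_coeff_pow: "(\<And>i. coeff P i \<in> \<rat>) \<Longrightarrow> coeff (P ^ k) i \<in> \<rat>" for P :: "complex poly"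
proof (induct k arbitrary: i)
  case (Suc k) then show ?case by (simp add: rat_coeff_mult)
qed (simp add: of_bool_def)

lemma exists_root_of_unity: assumes "Factorial_Ring.prime p" obtains \<zeta> where "root_of_unity p \<zeta>"
proof
  have p0: "p > 0" using assms prime_gt_0_nat by blast
  show "root_of_unity p (cis (2 * pi / p))"
  proof
    have c: "cis (2 * pi / p) ^ j = cis (2 * pi * real j / p)" for j
      by (simp add: DeMoivre) (simp add: mult.commute)
    show "cis (2 * pi / p) ^ p = 1" unfolding c using p0 by simp
    show "cis (2 * pi / p) ^ j \<noteq> 1" if "0 < j" "j < p" for j
    proof
      assume "cis (2 * pi / p) ^ j = 1"
      then have "cis (2 * pi * real j / p) = cis (2 * pi * real 0 / p)" by (simp add: c)
      then have "j = 0" using bij_betw_roots_unity[OF p0] that p0 unfolding bij_betw_def inj_on_def by blast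
      then show False using that by simp
    qed
  qed (use assms in simp_all)
qed

subsection \<open>Characters\<close>

definition cls :: "'g::group_add set \<Rightarrow> 'g \<Rightarrow> 'g set" where
  "cls G x = (\<lambda>g. g + x + - g) ` G"

section \<open>Characters of minimal projections\<close>

context group_algebra
begin

lemma minp_nz: "minp e \<Longrightarrow> e \<noteq> 0" by (simp add: minp_def proj_def)
lemma minp_gal: "minp e \<Longrightarrow> e \<in> gal" by (simp add: minp_def proj_def)

text \<open>\<open>f\<close> is a sum of minimal projections, each of which contributes 0 or 1. The
  natural number is a multiplicity, and multiplicity 0 makes every \<open>f * a * e\<close>
  vanish.\<close>

lemma tau_nat: assumes f: "f = 0 \<or> proj f" and e: "minp e"
  obtains m :: nat where "tau f e = of_nat m" "m = 0 \<Longrightarrow> \<forall>a\<in>gal. f * a * e = 0"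
proof (cases "f = 0")
  case True then show ?thesis using that[of 0] by (simp add: tau_0)
next
  case False
  then obtain F where F: "family f F" "\<And>g. g \<in> F \<Longrightarrow> minp g" using f minp_family by blast
  have F': "finite F" "f = \<Sum>F" using F(1) by (auto simp: family_def)
  define m where "m = card {g \<in> F. tau g e = 1}"
  have d: "tau g e = (if tau g e = 1 then 1 else 0)" if "g \<in> F" for g using tau_minp[OF F(2)[OF that] e] by auto
  have "tau f e = (\<Sum>g\<in>F. tau g e)" unfolding F'(2) by (rule tau_sum)
  also have "\<dots> = (\<Sum>g\<in>F. if tau g e = 1 then 1 else 0)" by (rule sum.cong[OF refl d])
  also have "\<dots> = of_nat m" using F' by (simp add: m_def sum.If_cases Int_def)
  finally have t: "tau f e = of_nat m" .
  have "f * a * e = 0" if "m = 0" "a \<in> gal" for a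
  proof -
    have "{g \<in> F. tau g e = 1} = {}" using that(1) F'(1) by (simp add: m_def)
    then have "g * a * e = 0" if "g \<in> F" for g using tau_minp[OF F(2)[OF that] e] that \<open>a \<in> gal\<close> by auto
    then show ?thesis unfolding F'(2) by (simp add: sum_distrib_right)
  qed
  then show ?thesis using that t by blast
qed

lemma tau_gg: "tau (gg x) e = (\<Sum>y\<in>G. lookup e (- y + - x + y))"
  unfolding tau_def by (intro sum.cong refl) (simp add: mult.assoc add.assoc)

lemma tau_conj: assumes "g \<in> G" shows "tau (gg (g + x + - g)) e = tau (gg x) e"
  unfolding tau_gg
  by (rule sum.reindex_bij_witness[of _ "\<lambda>y. g + y" "\<lambda>y. - g + y"])
    (use assms in \<open>simp_all add: gs subD[OF G]\<close>)

lemma tau_cyc: assumes u: "u \<in> gal" and x: "v \<in> gal" shows "tau (gg x) (u * v) = tau (gg x) (v * u)"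
proof -
  have s: "tau (gg x) (gg s * v) = tau (gg x) (v * gg s)" if "s \<in> G" for s
    unfolding tau_gg
    by (rule sum.reindex_bij_witness[of _ "\<lambda>y. y + - s" "\<lambda>y. y + s"])
      (use that in \<open>simp_all add: gs subD[OF G]\<close>)
  have "tau (gg x) (u * v) = tau (gg x) ((\<Sum>s\<in>G. cc (lookup u s) * gg s) * v)" using gal_expand[OF u] by simp
  also have "\<dots> = (\<Sum>s\<in>G. lookup u s * tau (gg x) (gg s * v))"
    by (simp add: sum_distrib_right tau_sum_r tau_cc_r mult.assoc)
  also have "\<dots> = (\<Sum>s\<in>G. lookup u s * tau (gg x) (v * gg s))" by (simp add: s)
  also have "\<dots> = tau (gg x) (v * (\<Sum>s\<in>G. cc (lookup u s) * gg s))"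
    by (simp add: sum_distrib_left tau_sum_r tau_cc_r cc_left)
  finally show ?thesis using gal_expand[OF u] by simp
qed

text \<open>For minimal projections this is isomorphism of the left ideals that they generate;
  linked projections have the same character.\<close>

definition link :: "'g ga \<Rightarrow> 'g ga \<Rightarrow> bool" where
  "link f e \<longleftrightarrow> (\<exists>y\<in>G. f * gg y * e \<noteq> 0)"

lemma link_tau: "minp f \<Longrightarrow> minp e \<Longrightarrow> tau f e = (if link f e then 1 else 0)"
  using tau_minp[of f e] gal_gg by (auto simp: link_def)

lemma link_sym: assumes "minp f" "minp e" "link f e" shows "link e f"
proof -
  obtain y where y: "y \<in> G" "f * gg y * e \<noteq> 0" using assms by (auto simp: link_def)
  have "star (f * gg y * e) = e * gg (- y) * f"
    using assms by (simp add: star_mult star_gg minp_def proj_def mult.assoc)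
  then have "e * gg (- y) * f \<noteq> 0" using y star_eq_0 by metis
  then show ?thesis using y subD(4)[OF G] by (auto simp: link_def)
qed

lemma link_refl: assumes "minp e" shows "link e e"
proof -
  have "e * gg 0 * e \<noteq> 0" using assms by (simp add: minp_def proj_def)
  then show ?thesis using subD(2)[OF G] unfolding link_def by blast
qed

lemma link_trans: assumes f: "minp f" and e: "minp e" and g: "minp g" and "link f e" "link e g" shows "link f g"
proof -
  obtain y x where y: "y \<in> G" "f * gg y * e \<noteq> 0" and x: "x \<in> G" "e * gg x * g \<noteq> 0" using assms by (auto simp: link_def)
  define v where "v = f * gg y * e"
  obtain c where c: "c \<noteq> 0" "star v * v = cc c * e" using minp_link[OF f e gal_gg[OF y(1)] v_def] y by (auto simp: v_def)
  have ee: "e * (e * t) = e * t" for t using e by (simp add: minp_def proj_def flip: mult.assoc)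
  have "star v * (v * (e * gg x * g)) = (star v * v) * (e * gg x * g)" by (simp only: mult.assoc)
  also have "\<dots> = cc c * (e * gg x * g)" unfolding c(2) by (simp only: mult.assoc ee)
  finally have "v * (e * gg x * g) \<noteq> 0" using c(1) x(2) by (auto simp: cc_mult_eq_0)
  then have "f * (gg y * e * e * gg x) * g \<noteq> 0" by (simp add: v_def mult.assoc)
  moreover have "gg y * e * e * gg x \<in> gal" using minp_gal[OF e] x y by (simp add: gal_intros)
  ultimately show ?thesis using gal_prod_0 unfolding link_def by blast
qed

text \<open>With the same nonzero scalar, \<open>star v * v\<close> is a multiple of
  \<open>e\<close> and \<open>v * star v\<close> is one of \<open>f\<close>; by
  \<open>tau_cyc\<close> these products have equal traces.\<close>

lemma link_char: assumes f: "minp f" and e: "minp e" and l: "link f e" shows "tau (gg x) f = tau (gg x) e"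
proof -
  obtain y where y: "y \<in> G" "f * gg y * e \<noteq> 0" using l by (auto simp: link_def)
  define v where "v = f * gg y * e"
  obtain c where c: "c \<noteq> 0" "star v * v = cc c * e" "v * star v = cc c * f"
    using minp_link[OF f e gal_gg[OF y(1)] v_def] y by (auto simp: v_def)
  have v: "v \<in> gal" unfolding v_def by (intro gal_mult gal_gg minp_gal f e y)
  have "c * tau (gg x) f = c * tau (gg x) e"
    using tau_cyc[OF v gal_star[OF v], of x] by (simp add: c tau_cc_r)
  then show ?thesis using c(1) by simp
qed

lemma dim_pos: assumes e: "minp e" obtains n :: nat where "tau 1 e = of_nat n" "n > 0"
proof -
  have "proj 1" by (simp add: proj_def)
  then obtain n :: nat where n: "tau 1 e = of_nat n" "n = 0 \<Longrightarrow> \<forall>a\<in>gal. 1 * a * e = 0" using tau_nat[of 1 e] e by blast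
  have "n \<noteq> 0" using n(2) gal_1 minp_nz[OF e] by fastforce
  then show ?thesis using that n(1) by blast
qed

lemma cls_sub: "x \<in> G \<Longrightarrow> cls G x \<subseteq> G" using sub_cj_mem[OF G] by (auto simp: cls_def)

definition csum :: "'g \<Rightarrow> 'g ga" where "csum x = (\<Sum>c\<in>cls G x. gg c)"

lemma csum_central: assumes g: "g \<in> G" shows "gg g * csum x = csum x * gg g"
proof -
  have cl: "h + c + - h \<in> cls G x" if h: "h \<in> G" and cc: "c \<in> cls G x" for h c
  proof -
    obtain u where u: "u \<in> G" "c = u + x + - u" using cc by (auto simp: cls_def)
    then have "h + c + - h = (h + u) + x + - (h + u)" by (simp add: gs)
    then show ?thesis using subD(3)[OF G h u(1)] unfolding cls_def by blast
  qed
  have "csum x * gg g = (\<Sum>c\<in>cls G x. gg (c + g))" by (simp add: csum_def sum_distrib_right gg_add)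
  also have "\<dots> = (\<Sum>c\<in>cls G x. gg (g + c))"
    by (rule sum.reindex_bij_witness[of _ "\<lambda>c. g + c + - g" "\<lambda>c. - g + c + g"])
      (use cl[OF g] cl[OF subD(4)[OF G g]] in \<open>simp_all add: gs\<close>)
  also have "\<dots> = gg g * csum x" by (simp add: csum_def sum_distrib_left gg_add)
  finally show ?thesis by simp
qed

text \<open>The class sum is central, so minimality of \<open>e\<close> makes it act by a scalar
  \<open>w\<close>. Taking traces identifies \<open>w\<close> with the class size times the
  character value divided by the degree.\<close>

lemma central_char: assumes e: "minp e" and x: "x \<in> G"
  obtains w where "csum x * e = cc w * e" "of_nat (card (cls G x)) * tau (gg x) e = w * tau 1 e"
proof -
  have cg: "csum x \<in> gal" unfolding csum_def using cls_sub[OF x] by (intro gal_sum gal_gg) auto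
  have cm: "a * csum x = csum x * a" if "a \<in> gal" for a
  proof -
    have "(\<Sum>s\<in>G. cc (lookup a s) * gg s) * csum x = csum x * (\<Sum>s\<in>G. cc (lookup a s) * gg s)"
      by (simp add: sum_distrib_left sum_distrib_right cc_left csum_central mult.assoc)
    then show ?thesis using gal_expand[OF that] by simp
  qed
  have ee: "e * e = e" using e by (simp add: minp_def proj_def)
  have "e * csum x * e = csum x * e" by (simp add: cm[OF minp_gal[OF e]] mult.assoc ee)
  then obtain w where w: "csum x * e = cc w * e" using e cg by (metis minp_def)
  have "tau (csum x) e = (\<Sum>y\<in>G. lookup (cc w * (gg y * e)) y)" unfolding tau_def
  proof (intro sum.cong refl)
    fix y assume y: "y \<in> G"
    have "csum x * gg y * e = gg y * (csum x * e)" by (simp add: csum_central[OF y, symmetric] mult.assoc)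
    then show "lookup (csum x * gg y * e) y = lookup (cc w * (gg y * e)) y" by (simp only: w cc_left)
  qed
  then have "tau (csum x) e = w * tau 1 e" by (simp add: tau_def sum_distrib_left)
  moreover have "tau (csum x) e = (\<Sum>c\<in>cls G x. tau (gg x) e)"
    unfolding csum_def tau_sum by (intro sum.cong refl) (auto simp: cls_def tau_conj)
  ultimately show ?thesis using that[OF w] by simp
qed

end

section \<open>Eigenprojections of an element of order dividing a prime\<close>

locale group_root = group_algebra G + root_of_unity p \<zeta> for G :: "'g::group_add set" and p \<zeta> +
  fixes z assumes z: "z \<in> G" "tm p z = 0"
begin

text \<open>The projection onto the eigenspace of \<open>z\<close> with eigenvalue \<open>\<zeta>\<^sup>i\<close>.\<close>

definition fz :: "nat \<Rightarrow> 'g ga" where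
  "fz i = cc (1 / p) * (\<Sum>j<p. cc (cnj \<zeta> ^ (i * j)) * gg (tm j z))"

lemma fz_gal: "fz i \<in> gal"
  unfolding fz_def by (intro gal_mult gal_cc gal_sum gal_gg tm_mem[OF G z(1)])

lemma fz_eigen: "gg z * fz i = cc (\<zeta> ^ i) * fz i"
proof -
  define h where "h j = cc (\<zeta> ^ i * cnj \<zeta> ^ (i * j)) * gg (tm j z)" for j
  have one: "\<zeta> ^ i * cnj \<zeta> ^ i = 1" using cnj_zeta by (simp add: mult.commute flip: power_mult_distrib)
  have cp: "cnj \<zeta> ^ p = 1" using arg_cong[OF zp, of cnj] by simp
  have "cnj \<zeta> ^ (i * p) = 1" by (metis cp mult.commute power_mult power_one)
  then have "h p = h 0" by (simp add: h_def z)
  then have hs: "(\<Sum>j<p. h (Suc j)) = (\<Sum>j<p. h j)"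
    using sum.lessThan_Suc_shift[of h p] by simp
  have "gg z * fz i = cc (1/p) * (gg z * (\<Sum>j<p. cc (cnj \<zeta> ^ (i * j)) * gg (tm j z)))"
    unfolding fz_def by (rule cc_left)
  also have "gg z * (\<Sum>j<p. cc (cnj \<zeta> ^ (i * j)) * gg (tm j z)) = (\<Sum>j<p. h (Suc j))"
    unfolding sum_distrib_left
  proof (intro sum.cong refl)
    fix j
    have "\<zeta> ^ i * cnj \<zeta> ^ (i * Suc j) = (\<zeta> ^ i * cnj \<zeta> ^ i) * cnj \<zeta> ^ (i * j)" by (simp add: power_add)
    then have "h (Suc j) = cc (cnj \<zeta> ^ (i * j)) * gg (tm (Suc j) z)" by (simp only: h_def one mult_1_left)
    then show "gg z * (cc (cnj \<zeta> ^ (i * j)) * gg (tm j z)) = h (Suc j)" by (simp add: cc_left gg_add)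
  qed
  also have "\<dots> = (\<Sum>j<p. h j)" by (rule hs)
  also have "\<dots> = cc (\<zeta> ^ i) * (\<Sum>j<p. cc (cnj \<zeta> ^ (i * j)) * gg (tm j z))"
    by (simp add: h_def sum_distrib_left cc_mult mult.assoc)
  also have "cc (1 / p) * (cc (\<zeta> ^ i) * (\<Sum>j<p. cc (cnj \<zeta> ^ (i * j)) * gg (tm j z))) = cc (\<zeta> ^ i) * fz i"
    unfolding fz_def by (rule cc_left)
  finally show ?thesis .
qed

lemma fz_eigen_pow: "gg (tm j z) * fz i = cc (\<zeta> ^ (i * j)) * fz i"
proof (induct j)
  case (Suc j)
  have "gg (tm (Suc j) z) * fz i = gg z * (gg (tm j z) * fz i)" by (simp add: gg_add mult.assoc)
  also have "\<dots> = cc (\<zeta> ^ (i * j)) * (gg z * fz i)" unfolding Suc by (rule cc_left)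
  finally show ?case by (simp add: fz_eigen cc_cc power_add mult.commute)
qed simp

lemma cnj_cancel: "cnj \<zeta> ^ m * \<zeta> ^ m = 1" using cnj_zeta by (simp flip: power_mult_distrib)

lemma fz_eigen_neg: "gg (- tm j z) * fz i = cc (cnj \<zeta> ^ (i * j)) * fz i"
proof -
  have "gg (- tm j z) * (gg (tm j z) * fz i) = fz i" by (simp flip: mult.assoc gg_add)
  then have "cc (\<zeta> ^ (i * j)) * (gg (- tm j z) * fz i) = fz i" unfolding fz_eigen_pow cc_left .
  then have "cc (cnj \<zeta> ^ (i * j)) * (cc (\<zeta> ^ (i * j)) * (gg (- tm j z) * fz i)) = cc (cnj \<zeta> ^ (i * j)) * fz i" by simp
  then show ?thesis by (simp only: cc_cc cnj_cancel cc_1 mult_1_left)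
qed

lemma sum_cc_const: "(\<Sum>j<p. a) = cc (of_nat p) * a" for a :: "'g ga"
  by (simp add: cc_def)

lemma fz_proj: "fz i = 0 \<or> proj (fz i)"
proof -
  have p1: "(of_nat p :: complex) \<noteq> 0" using p0 by simp
  have "fz i * fz i = cc (1/p) * (\<Sum>j<p. cc (cnj \<zeta> ^ (i * j)) * (gg (tm j z) * fz i))"
    by (subst (1) fz_def) (simp only: sum_distrib_right mult.assoc)
  also have "(\<Sum>j<p. cc (cnj \<zeta> ^ (i * j)) * (gg (tm j z) * fz i)) = (\<Sum>j<p. fz i)"
    by (simp only: fz_eigen_pow cc_cc cnj_cancel cc_1 mult_1_left)
  finally have 1: "fz i * fz i = fz i" using p1 by (simp only: sum_cc_const cc_cc) simp
  have sf: "star (fz i) = cc (1/p) * (\<Sum>j<p. cc (\<zeta> ^ (i * j)) * gg (- tm j z))"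
  proof -
    have s: "star (sum f S) = (\<Sum>j\<in>S. star (f j))" for f :: "nat \<Rightarrow> 'g ga" and S
      by (induct S rule: infinite_finite_induct) (simp_all add: star_add)
    show ?thesis unfolding fz_def by (simp add: star_mult star_cc s star_gg cc_central)
  qed
  have "star (fz i) * fz i = cc (1/p) * (\<Sum>j<p. cc (\<zeta> ^ (i * j)) * (gg (- tm j z) * fz i))"
    by (subst sf) (simp only: sum_distrib_right mult.assoc)
  also have "(\<Sum>j<p. cc (\<zeta> ^ (i * j)) * (gg (- tm j z) * fz i)) = (\<Sum>j<p. fz i)"
    by (simp only: fz_eigen_neg cc_cc cnj_cancel cc_1 mult_1_left mult.commute[of "\<zeta> ^ _"])
  finally have 2: "star (fz i) * fz i = fz i" using p1 by (simp only: sum_cc_const cc_cc) simp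
  have "star (fz i) = star (star (fz i) * fz i)" by (simp only: 2)
  also have "\<dots> = fz i" unfolding star_mult star_star by (rule 2)
  finally show ?thesis using 1 fz_gal by (simp add: proj_def)
qed

lemma fz_sum: "(\<Sum>i<p. fz i) = 1"
proof (rule poly_mapping_eqI)
  fix k
  have "lookup (\<Sum>i<p. fz i) k = (\<Sum>i<p. \<Sum>j<p. 1/p * cnj \<zeta> ^ (i * j) * lookup (gg (tm j z)) k)"
    by (simp add: fz_def lookup_sum sum_distrib_left mult.assoc del: lookup_times_gg)
  also have "\<dots> = (\<Sum>j<p. 1/p * (\<Sum>i<p. cnj \<zeta> ^ (i * j)) * lookup (gg (tm j z)) k)"
    by (subst sum.swap) (simp add: sum_distrib_left sum_distrib_right mult.assoc)
  also have "\<dots> = (\<Sum>j<p. if j = 0 then lookup 1 k else 0)"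
    by (intro sum.cong refl) (use p0 in \<open>auto simp: sum_cnj\<close>)
  also have "\<dots> = lookup 1 k" using p0 by simp
  finally show "lookup (\<Sum>i<p. fz i) k = lookup 1 k" .
qed

text \<open>The number \<open>m i\<close> is the multiplicity of the eigenvalue
  \<open>\<zeta> ^ i\<close> of \<open>z\<close> in the representation belonging to
  \<open>e\<close>.\<close>

lemma char_decomp: assumes e: "minp e"
  obtains m :: "nat \<Rightarrow> nat" where "\<And>j. tau (gg (tm j z)) e = (\<Sum>i<p. of_nat (m i) * \<zeta> ^ (i * j))"
    "tau 1 e = of_nat (\<Sum>i<p. m i)" "\<And>i a. m i = 0 \<Longrightarrow> a \<in> gal \<Longrightarrow> fz i * a * e = 0"
proof -
  have "\<exists>m::nat. tau (fz i) e = of_nat m \<and> (m = 0 \<longrightarrow> (\<forall>a\<in>gal. fz i * a * e = 0))" for i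
    using tau_nat[OF fz_proj e, of i] by metis
  then obtain m :: "nat \<Rightarrow> nat" where m: "\<And>i. tau (fz i) e = of_nat (m i)" "\<And>i a. m i = 0 \<Longrightarrow> a \<in> gal \<Longrightarrow> fz i * a * e = 0" by metis
  have c: "tau (gg (tm j z)) e = (\<Sum>i<p. of_nat (m i) * \<zeta> ^ (i * j))" for j
  proof -
    have "gg (tm j z) = gg (tm j z) * (\<Sum>i<p. fz i)" by (simp add: fz_sum)
    also have "\<dots> = (\<Sum>i<p. cc (\<zeta> ^ (i * j)) * fz i)" by (simp add: sum_distrib_left fz_eigen_pow)
    finally have "tau (gg (tm j z)) e = (\<Sum>i<p. tau (cc (\<zeta> ^ (i * j)) * fz i) e)" by (simp add: tau_sum)
    then show ?thesis by (simp add: tau_cc m mult.commute)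
  qed
  moreover have "tau 1 e = of_nat (\<Sum>i<p. m i)" using c[of 0] by simp
  ultimately show ?thesis using that m(2) by blast
qed

end

subsection \<open>Burnside's theorem on classes of prime power size\<close>

text \<open>The difference of the power sums for \<open>k\<close> and \<open>Suc k\<close> is a
  nonnegative integer that tends to 0, so it vanishes for some \<open>k\<close>, and with it each
  summand \<open>r j ^ k * (1 - r j)\<close>.\<close>

lemma powers_collapse:
  fixes r :: "nat \<Rightarrow> real"
  assumes S: "finite S" and r: "\<And>j. j \<in> S \<Longrightarrow> 0 \<le> r j \<and> r j \<le> 1"
    and int: "\<And>k. (\<Sum>j\<in>S. r j ^ k) \<in> \<int>" and j: "j \<in> S"
  shows "r j = 0 \<or> r j = 1"
proof -
  define d where "d k = (\<Sum>j\<in>S. r j ^ k * (1 - r j))" for k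
  have "(\<lambda>k. r j ^ k * (1 - r j)) \<longlonglongrightarrow> 0" if "j \<in> S" for j
  proof (cases "r j = 1")
    case False
    then have "(\<lambda>k. r j ^ k) \<longlonglongrightarrow> 0" using r[OF that] by (intro LIMSEQ_power_zero) auto
    then show ?thesis using tendsto_mult_right[of "\<lambda>k. r j ^ k" 0 sequentially "1 - r j"] by simp
  qed simp
  then have "d \<longlonglongrightarrow> (\<Sum>j\<in>S. 0)" unfolding d_def by (intro tendsto_sum)
  then have "eventually (\<lambda>k. d k < 1) sequentially" by (intro order_tendstoD(2)[of d 0]) simp_all
  then obtain k where k: "d k < 1" by (auto simp: eventually_sequentially)
  have nn: "r j ^ k * (1 - r j) \<ge> 0" if "j \<in> S" for j using r[OF that] by simp
  have "d k = (\<Sum>j\<in>S. r j ^ k) - (\<Sum>j\<in>S. r j ^ Suc k)"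
    by (simp add: d_def algebra_simps flip: sum_subtractf)
  then have "d k \<in> \<int>" using int[of k] int[of "Suc k"] by (simp only: Ints_diff)
  moreover have "d k \<ge> 0" unfolding d_def by (rule sum_nonneg[OF nn])
  ultimately have "d k = 0" using k by (auto elim!: Ints_cases)
  then have "r j ^ k * (1 - r j) = 0" using sum_nonneg_eq_0_iff[OF S nn] j by (simp add: d_def)
  then show ?thesis by auto
qed

section \<open>Character values and conjugacy classes of prime power size\<close>

context group_root
begin

text \<open>As \<open>j\<close> is invertible modulo \<open>p\<close>, also \<open>z\<close> is a
  multiple of \<open>tm j z\<close>; so \<open>u\<close> and \<open>v\<close> conjugate the one
  alike exactly if they conjugate the other alike.\<close>

lemma cls_tm_card: assumes "coprime j p" shows "card (cls G (tm j z)) = card (cls G z)"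
  unfolding cls_def
proof (rule card_image_eq)
  obtain i where i: "[j * i = Suc 0] (mod p)" using cong_solve_coprime_nat[OF assms] by blast
  have inv: "tm i (tm j y) = y" if "tm p y = 0" for y :: 'g
  proof -
    have "tm (p * l) y = 0" for l using that tm_dvd[of p y "p * l"] by simp
    moreover obtain l l' where "p * l + j * i = p * l' + 1"
      using i unfolding cong_iff_lin_nat by (metis One_nat_def add.commute mult.commute)
    ultimately have "tm (j * i) y = tm 1 y" by (metis tm_add add.left_neutral)
    then show ?thesis by (simp add: mult.commute flip: tm_mult)
  qed
  fix u v
  have e: "tm p (g + z + - g) = 0" for g using z by (simp add: tm_cj)
  show "u + tm j z + - u = v + tm j z + - v \<longleftrightarrow> u + z + - u = v + z + - v"
    using inv[OF e[of u]] inv[OF e[of v]] by (metis tm_cj)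
qed

text \<open>The lattice is spanned by the coefficients of \<open>e\<close> times powers of
  \<open>\<zeta>\<close>. A class sum acts on coefficients by adding translates, so multiplication
  by its eigenvalue \<open>w\<close> maps the lattice into itself.\<close>

lemma eigen_ring: assumes e: "minp e"
  obtains S :: "(nat \<times> 'g) set" and v where "finite S" "\<zeta> \<in> mult_ring S v" "\<exists>s\<in>S. v s \<noteq> 0"
    "\<And>x w. x \<in> G \<Longrightarrow> csum x * e = cc w * e \<Longrightarrow> w \<in> mult_ring S v"
proof -
  define S where "S = {..<p} \<times> G"
  define v where "v = (\<lambda>(i, x). \<zeta> ^ i * lookup e x)"
  have S: "finite S" using subD(1)[OF G] by (simp add: S_def)
  have base: "\<zeta> ^ i * lookup e x \<in> lat S v" if "x \<in> G" for i x
  proof -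
    have "v (i mod p, x) \<in> lat S v" using that p0 by (intro lat_base S) (simp add: S_def)
    then show ?thesis by (simp add: v_def flip: pow_mod)
  qed
  have "\<zeta> \<in> mult_ring S v" unfolding mult_ring_def
  proof (intro CollectI ballI)
    fix s assume "s \<in> S"
    then obtain i x where s: "s = (i, x)" "x \<in> G" by (auto simp: S_def)
    then show "\<zeta> * v s \<in> lat S v" using base[OF s(2), of "Suc i"] by (simp add: v_def mult.assoc)
  qed
  moreover have "\<exists>s\<in>S. v s \<noteq> 0"
  proof -
    obtain x where "lookup e x \<noteq> 0" using minp_nz[OF e] by (metis poly_mapping_eqI lookup_zero)
    moreover then have "x \<in> G" using minp_gal[OF e] by (auto simp: gal_iff)
    ultimately show ?thesis using p0 by (intro bexI[of _ "(0, x)"]) (auto simp: S_def v_def)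
  qed
  moreover have "w \<in> mult_ring S v" if x: "x \<in> G" and w: "csum x * e = cc w * e" for x w
    unfolding mult_ring_def
  proof (intro CollectI ballI)
    fix s assume "s \<in> S"
    then obtain i y where s: "s = (i, y)" "y \<in> G" by (auto simp: S_def)
    have "w * lookup e y = lookup (csum x * e) y" by (simp add: w)
    also have "\<dots> = (\<Sum>c\<in>cls G x. lookup e (- c + y))" by (simp add: csum_def sum_distrib_right lookup_sum)
    finally have "w * v s = (\<Sum>c\<in>cls G x. \<zeta> ^ i * lookup e (- c + y))"
      by (simp add: s v_def sum_distrib_left mult.left_commute flip: sum_distrib_left)
    also have "\<dots> \<in> lat S v"
      using cls_sub[OF x] s(2) by (intro lat_sum base subD(3)[OF G] subD(4)[OF G]) auto
    finally show "w * v s \<in> lat S v" .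
  qed
  ultimately show ?thesis using that S by blast
qed

text \<open>Let \<open>a j\<close> be the character value at \<open>tm j z\<close> divided by the
  degree \<open>n\<close>. By Bezout with the class size it is a multiplier of the lattice for
  \<open>j\<close> prime to \<open>p\<close>. The power sums of the squared moduli are rational,
  hence integers, so \<open>powers_collapse\<close> leaves modulus 0 or 1; modulus 1 means that all
  eigenvalues of \<open>z\<close> coincide.\<close>

lemma char_zero_or_scalar:
  assumes e: "minp e" and n: "tau 1 e = of_nat n" and q: "coprime (card (cls G z)) n"
  shows "tau (gg z) e = 0 \<or> (\<exists>w. \<forall>a\<in>gal. gg z * a * e = cc w * (a * e))"
proof -
  obtain m where m: "\<And>j. tau (gg (tm j z)) e = (\<Sum>i<p. of_nat (m i) * \<zeta> ^ (i * j))"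
    "tau 1 e = of_nat (\<Sum>i<p. m i)" "\<And>i a. m i = 0 \<Longrightarrow> a \<in> gal \<Longrightarrow> fz i * a * e = 0"
    using char_decomp[OF e] by blast
  have nm: "n = (\<Sum>i<p. m i)" using n m(2) of_nat_eq_iff[where 'a = complex] by metis
  have n0: "n > 0" using dim_pos[OF e] n by (metis of_nat_eq_iff)
  obtain S :: "(nat \<times> 'g) set" and v where R: "finite S" "\<zeta> \<in> mult_ring S v" "\<exists>s\<in>S. v s \<noteq> 0"
    "\<And>x w. x \<in> G \<Longrightarrow> csum x * e = cc w * e \<Longrightarrow> w \<in> mult_ring S v" using eigen_ring[OF e] by blast
  define a where "a j = tau (gg (tm j z)) e / of_nat n" for j
  have aR: "a j \<in> mult_ring S v" if j: "coprime j p" for j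
  proof -
    have jG: "tm j z \<in> G" by (rule tm_mem[OF G z(1)])
    obtain w where w: "csum (tm j z) * e = cc w * e" "of_nat (card (cls G (tm j z))) * tau (gg (tm j z)) e = w * tau 1 e"
      using central_char[OF e jG] by blast
    have wa: "w = of_nat (card (cls G z)) * a j" using w(2) n0 by (simp add: a_def n cls_tm_card[OF j] field_simps)
    have chi: "of_nat n * a j \<in> mult_ring S v" using n0
      by (simp add: a_def m(1) mult_ring_sum mult_ring_mult mult_ring_nat mult_ring_pow R)
    obtain x y where xy: "x * int (card (cls G z)) + y * int n = 1" 
      using bezout_int[of "int (card (cls G z))" "int n"] q by (auto simp: coprime_iff_gcd_eq_1)
    have "a j = of_int (x * int (card (cls G z)) + y * int n) * a j" by (simp add: xy)
    also have "\<dots> = of_int x * w + of_int y * (of_nat n * a j)" by (simp add: wa algebra_simps)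
    also have "\<dots> \<in> mult_ring S v" by (intro mult_ring_add mult_ring_mult mult_ring_int R chi R(4)[OF jG w(1)])
    finally show ?thesis .
  qed
  have acnj: "cnj (a j) = a (j * (p - 1))" for j
    by (simp add: a_def m(1) cnj_pow mult.assoc del: complex_cnj_power)
  \<comment> \<open>A polynomial with rational coefficients whose value at
    \<open>\<zeta> ^ j\<close> is the squared modulus of \<open>a j\<close>; by \<open>acnj\<close>,
    complex conjugation multiplies the exponent by \<open>p - 1\<close>.\<close>
  define Q where "Q = (\<Sum>i<p. monom (of_nat (m i) / of_nat n :: complex) i) * (\<Sum>i<p. monom (of_nat (m i) / of_nat n) (i * (p - 1)))"
  have ratQ: "coeff Q i \<in> \<rat>" for i
    unfolding Q_def by (rule rat_coeff_mult) (auto simp: coeff_sum intro!: Rats_sum)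
  have Qv: "poly Q (\<zeta> ^ j) = of_real ((cmod (a j))\<^sup>2)" for j
  proof -
    have "poly Q (\<zeta> ^ j) = a j * a (j * (p - 1))"
      by (simp add: Q_def a_def m(1) poly_sum poly_monom sum_divide_distrib ac_simps flip: power_mult)
    then show ?thesis unfolding acnj[symmetric] by (simp only: complex_norm_square[symmetric])
  qed
  have cop: "coprime j p" if "j \<in> {1..<p}" for j
    using that p by (auto simp: coprime_commute[of j] intro!: prime_imp_coprime dest: dvd_imp_le)
  have cop1: "coprime (p - 1) p" using coprime_diff_one_left_nat[OF p0] .
  have int: "(\<Sum>j\<in>{1..<p}. ((cmod (a j))\<^sup>2) ^ k) \<in> \<int>" for k
  proof -
    let ?T = "\<Sum>j=1..<p. poly (Q ^ k) (\<zeta> ^ j)"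
    have T: "?T = of_real (\<Sum>j\<in>{1..<p}. ((cmod (a j))\<^sup>2) ^ k)" by (simp add: poly_power Qv)
    have "poly (Q ^ k) (\<zeta> ^ j) \<in> mult_ring S v" if "j \<in> {1..<p}" for j
    proof -
      have "poly Q (\<zeta> ^ j) = a j * a (j * (p - 1))" unfolding Qv acnj[symmetric] by (rule complex_norm_square)
      moreover have "a (j * (p - 1)) \<in> mult_ring S v" by (rule aR) (use cop[OF that] cop1 in simp)
      ultimately show ?thesis using aR[OF cop[OF that]] R(1) by (simp add: poly_power mult_ring_pow mult_ring_mult)
    qed
    then have "?T \<in> mult_ring S v" using R(1) by (intro mult_ring_sum) auto
    then have "algebraic_int ?T" using mult_ring_algebraic_int R(1,3) by metis
    moreover have "?T \<in> \<rat>" by (rule rat_poly_sum) (rule rat_coeff_pow[OF ratQ])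
    ultimately have "?T \<in> \<int>" by (rule rational_algebraic_int_is_int)
    then obtain i where "?T = of_int i" by (rule Ints_cases)
    then have "(\<Sum>j\<in>{1..<p}. ((cmod (a j))\<^sup>2) ^ k) = of_int i" unfolding T by (metis of_real_eq_iff of_real_of_int_eq)
    then show ?thesis by simp
  qed
  have le: "cmod (a j) \<le> 1" for j
  proof -
    have "cmod (\<Sum>i<p. of_nat (m i) * \<zeta> ^ (i * j)) \<le> (\<Sum>i<p. cmod (of_nat (m i) * \<zeta> ^ (i * j)))" by (rule norm_sum)
    also have "\<dots> = real n" by (simp add: nm norm_mult norm_power norm_zeta)
    finally show ?thesis using n0 by (simp add: a_def m(1) norm_divide)
  qed
  have "1 \<in> {1..<p}" using p prime_gt_1_nat by auto
  then have "(cmod (a 1))\<^sup>2 = 0 \<or> (cmod (a 1))\<^sup>2 = 1"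
    by (intro powers_collapse[where S = "{1..<p}" and r = "\<lambda>j. (cmod (a j))\<^sup>2"] int) (auto simp: le power_le_one)
  then have "cmod (a 1) = 0 \<or> cmod (a 1) = 1 \<or> cmod (a 1) = - 1" unfolding power2_eq_1_iff zero_eq_power2 by blast
  then consider "cmod (a 1) = 0" | "cmod (a 1) = 1" using norm_ge_zero[of "a 1"] by linarith
  then show ?thesis
  proof cases
    case 1 then show ?thesis using n0 by (simp add: a_def)
  next
    case 2
    define w where "w = a 1"
    have ww: "cnj w * w = 1" using 2 complex_norm_square[of w] by (simp add: w_def mult.commute)
    have chi: "of_nat n * w = (\<Sum>i<p. of_nat (m i) * \<zeta> ^ i)" using n0 m(1)[of 1] by (simp add: w_def a_def)
    \<comment> \<open>Equality in the triangle inequality: counted with multiplicity,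
      \<open>n\<close> is a sum of \<open>n\<close> numbers of modulus 1, so each of them has real
      part 1.\<close>
    have "of_nat n = cnj w * (of_nat n * w)" using ww by (simp add: mult.left_commute)
    also have "\<dots> = (\<Sum>i<p. of_nat (m i) * (cnj w * \<zeta> ^ i))" by (simp add: chi sum_distrib_left mult.left_commute)
    finally have "Re (of_nat n) = Re (\<Sum>i<p. of_nat (m i) * (cnj w * \<zeta> ^ i))" by simp
    then have "(\<Sum>i<p. real (m i) * (1 - Re (cnj w * \<zeta> ^ i))) = 0"
      by (simp add: nm right_diff_distrib sum_subtractf)
    moreover have n1: "cmod (cnj w * \<zeta> ^ i) = 1" for i using 2 by (simp add: norm_mult norm_power norm_zeta w_def)
    have nn: "real (m i) * (1 - Re (cnj w * \<zeta> ^ i)) \<ge> 0" for i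
      using complex_Re_le_cmod[of "cnj w * \<zeta> ^ i"] n1[of i] by simp
    ultimately have z0: "real (m i) * (1 - Re (cnj w * \<zeta> ^ i)) = 0" if "i < p" for i
      using sum_nonneg_eq_0_iff[of "{..<p}" "\<lambda>i. real (m i) * (1 - Re (cnj w * \<zeta> ^ i))"] that by simp
    have eqw: "\<zeta> ^ i = w" if "i < p" "m i \<noteq> 0" for i
    proof -
      have "Re (cnj w * \<zeta> ^ i) = 1" using z0[OF that(1)] that(2) by simp
      then have "cnj w * \<zeta> ^ i = 1" using n1[of i] by (simp add: cmod_def complex_eq_iff)
      then have "w * (cnj w * \<zeta> ^ i) = w" by simp
      moreover have "w * (cnj w * \<zeta> ^ i) = (cnj w * w) * \<zeta> ^ i" by (simp only: mult.left_commute mult.assoc)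
      ultimately show ?thesis using ww by simp
    qed
    have "gg z * b * e = cc w * (b * e)" if b: "b \<in> gal" for b
    proof -
      have "gg z * b * e = gg z * (\<Sum>i<p. fz i) * b * e" by (simp add: fz_sum)
      also have "\<dots> = (\<Sum>i<p. cc (\<zeta> ^ i) * (fz i * b * e))"
        by (simp add: sum_distrib_left sum_distrib_right fz_eigen mult.assoc)
      also have "\<dots> = (\<Sum>i<p. cc w * (fz i * b * e))"
      proof (intro sum.cong refl)
        fix i assume "i \<in> {..<p}"
        then show "cc (\<zeta> ^ i) * (fz i * b * e) = cc w * (fz i * b * e)"
          using eqw[of i] m(3)[OF _ b, of i] by (cases "m i = 0") auto
      qed
      also have "\<dots> = cc w * ((\<Sum>i<p. fz i) * b * e)" by (simp add: sum_distrib_left sum_distrib_right)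
      finally show ?thesis by (simp add: fz_sum)
    qed
    then show ?thesis by blast
  qed
qed

text \<open>\<open>N\<close> is the kernel of the representation belonging to \<open>e\<close>. As
  \<open>z\<close> acts by a scalar, all its commutators lie in \<open>N\<close>; if
  \<open>N\<close> were zero, \<open>z\<close> would be central. So \<open>N = G\<close> by
  simplicity.\<close>

lemma scalar_trivial:
  assumes simple: "\<And>N. nml N G \<Longrightarrow> N = {0} \<or> N = G" and nc: "cen G {z} \<noteq> G"
    and w: "\<And>a. a \<in> gal \<Longrightarrow> gg z * a * e = cc w * (a * e)" and e: "e \<in> gal" "e \<noteq> 0" and x: "x \<in> G"
  shows "gg x * e = e"
proof -
  define N where "N = {x \<in> G. \<forall>a\<in>gal. gg x * a * e = a * e}"
  have inv: "gg (- y) * (gg y * b) = b" "gg y * (gg (- y) * b) = b" for y b by (simp_all flip: mult.assoc gg_add)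
  have N: "nml N G" unfolding nml_def
  proof (intro conjI ballI)
    show "sub N"
    proof (rule subI)
      show "finite N" using subD(1)[OF G] by (simp add: N_def)
      show "0 \<in> N" using subD(2)[OF G] by (simp add: N_def)
      fix x assume x: "x \<in> N"
      have "gg (- x) * a * e = a * e" if a: "a \<in> gal" for a
      proof -
        have "gg x * (a * e) = a * e" using x a by (simp add: N_def mult.assoc)
        then have "gg (- x) * (a * e) = gg (- x) * (gg x * (a * e))" by simp
        then show ?thesis by (simp only: inv mult.assoc)
      qed
      then show "- x \<in> N" using x subD(4)[OF G] by (simp add: N_def)
    next
      fix x y assume xy: "x \<in> N" "y \<in> N"
      have "gg (x + y) * a * e = a * e" if a: "a \<in> gal" for a
      proof -
        have "gg (x + y) * a * e = gg x * (gg y * a * e)" by (simp add: gg_add mult.assoc)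
        also have "\<dots> = gg x * a * e" using xy a by (simp add: N_def mult.assoc)
        finally show ?thesis using xy a by (simp add: N_def)
      qed
      then show "x + y \<in> N" using xy subD(3)[OF G] by (simp add: N_def)
    qed
    show "N \<subseteq> G" by (auto simp: N_def)
    fix g x assume g: "g \<in> G" and x: "x \<in> N"
    have "gg (g + x + - g) * a * e = a * e" if a: "a \<in> gal" for a
    proof -
      have "gg (- g) * a \<in> gal" by (intro gal_mult gal_gg subD(4)[OF G] g a)
      then have "gg x * (gg (- g) * a) * e = gg (- g) * a * e" using x by (simp add: N_def)
      then have "gg g * (gg x * (gg (- g) * a) * e) = gg g * (gg (- g) * (a * e))" by (simp add: mult.assoc)
      then show ?thesis by (simp add: gg_add mult.assoc inv)
    qed
    then show "g + x + - g \<in> N" using x sub_cj_mem[OF G g, of x] by (simp add: N_def)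
  qed
  have "N \<noteq> {0}"
  proof
    assume N0: "N = {0}"
    have "G \<subseteq> cen G {z}"
    proof
      fix g assume g: "g \<in> G"
      let ?k = "z + g + - z + - g"
      have kG: "?k \<in> G" by (intro subD(3)[OF G] subD(4)[OF G] g z)
      have "gg ?k * a * e = a * e" if a: "a \<in> gal" for a
      proof -
        let ?b = "gg (- z) * (gg (- g) * a)"
        have "?b \<in> gal" "gg g * ?b \<in> gal" using a g z subD(4)[OF G] by (simp_all add: gal_intros)
        then have "gg z * ?b * e = cc w * (?b * e)" "gg z * (gg g * ?b) * e = cc w * (gg g * ?b * e)" by (auto simp only: w)
        moreover have "gg ?k * a * e = gg z * (gg g * ?b) * e" by (simp add: gg_add mult.assoc)
        moreover have "cc w * (gg g * ?b * e) = gg g * (cc w * (?b * e))" by (simp only: cc_left mult.assoc)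
        ultimately have "gg ?k * a * e = gg g * (gg z * ?b * e)" by simp
        also have "\<dots> = a * e" by (simp add: mult.assoc inv)
        finally show ?thesis .
      qed
      then have "?k \<in> N" using kG by (simp add: N_def)
      then have "?k = 0" using N0 by simp
      then have "?k + g + z = g + z" by simp
      then show "g \<in> cen G {z}" using g by (simp add: cen_def gs)
    qed
    then show False using nc cen_sub[of G "{z}"] by blast
  qed
  then have "N = G" using simple[OF N] by blast
  then have "x \<in> N" using x by simp
  then have "gg x * 1 * e = 1 * e" using gal_1 unfolding N_def by blast
  then show ?thesis by simp
qed

lemma class_card: "card (cls G z) * card (cen G {z}) = card G"
proof -
  have "card ((\<lambda>u. cj u {z}) ` G) = card (cls G z)" unfolding cls_def by (rule card_image_eq) (simp add: cj_def)
  moreover have "nrm G {z} = cen G {z}" by (auto simp: nrm_def cen_def cen_iff cj_def)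
  ultimately show ?thesis using card_conjugates[OF G, of "{z}"] by simp
qed

text \<open>The regular character without its trivial constituent has the value -1 at
  \<open>z\<close>. Grouped by irreducible characters, each contribution is degree times character
  value; it is 0 if \<open>q\<close> does not divide the degree, and otherwise \<open>q\<close>
  times a multiplier of the lattice of powers of \<open>\<zeta>\<close>. So \<open>- 1 / q\<close>
  would be an algebraic integer.\<close>

lemma no_prime_power_class:
  assumes simple: "\<And>N. nml N G \<Longrightarrow> N = {0} \<or> N = G" and nc: "cen G {z} \<noteq> G"
    and q: "Factorial_Ring.prime (q::nat)" "card (cls G z) = q ^ k"
  shows False
proof -
  have z0: "z \<noteq> 0" using nc subD(2)[OF G] by (auto simp: cen_def)
  have cG: "card G > 0" by (rule sub_card_pos[OF G])
  \<comment> \<open>\<open>e0\<close> is the projection onto the trivial representation; its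
    complement \<open>f\<close> carries the rest of the regular representation.\<close>
  define e0 where "e0 = cc (1 / of_nat (card G)) * (\<Sum>x\<in>G. gg x)"
  have l0: "lookup e0 x = (if x \<in> G then 1 / of_nat (card G) else 0)" for x
    using subD(1)[OF G] by (simp add: e0_def lookup_sum gg_def lookup_single when_def)
  have e0g: "gg y * e0 = e0" "e0 * gg y = e0" if "y \<in> G" for y
    using that sub_add_left[OF G, of "- y"] sub_add_right[OF G, of "- y"] sub_minus_iff[OF G, of y]
    by (auto intro!: poly_mapping_eqI simp: l0)
  have e0_gal: "e0 \<in> gal" by (simp add: gal_iff l0)
  have e0e: "e0 * b = b" if "\<And>x. x \<in> G \<Longrightarrow> gg x * b = b" for b
  proof -
    have "e0 * b = cc (1 / of_nat (card G)) * (\<Sum>x\<in>G. gg x * b)" by (simp add: e0_def sum_distrib_right mult.assoc)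
    also have "(\<Sum>x\<in>G. gg x * b) = (\<Sum>x\<in>G. b)" by (rule sum.cong[OF refl that])
    also have "\<dots> = cc (of_nat (card G)) * b" by (simp add: cc_def)
    finally show ?thesis using cG by (simp add: cc_cc del: single_of_nat)
  qed
  have e00: "e0 * e0 = e0" by (rule e0e[OF e0g(1)])
  have se0: "star e0 = e0" using sub_minus_iff[OF G] by (intro poly_mapping_eqI) (simp add: l0)
  define f where "f = 1 - e0"
  have "lookup f z \<noteq> 0" using z z0 cG by (simp add: f_def lookup_minus l0 lookup_one)
  then have "f \<noteq> 0" by auto
  then have "proj f" by (simp add: proj_def f_def gal_diff e0_gal star_diff se0 right_diff_distrib left_diff_distrib e00)
  then obtain F where F: "family f F" "\<And>e. e \<in> F \<Longrightarrow> minp e" using minp_family by blast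
  have F': "finite F" "\<Sum>F = f" using F(1) by (auto simp: family_def)
  have e0F: "e0 * e = 0" if "e \<in> F" for e
  proof -
    have "e0 * e = e0 * (f * e)" using family_mult(2)[OF F(1) that] by simp
    also have "\<dots> = (e0 * f) * e" by (simp only: mult.assoc)
    also have "e0 * f = 0" by (simp add: f_def right_diff_distrib e00)
    finally show ?thesis by simp
  qed
  \<comment> \<open>The size of \<open>cl e\<close> is the degree of the character of
    \<open>e\<close>, because an irreducible representation occurs in the regular one as often as
    its degree.\<close>
  define cl where "cl e = {g \<in> F. link g e}" for e
  have dim: "tau 1 e = of_nat (card (cl e))" if e: "e \<in> F" for e
  proof -
    have "tau e0 e = 0" unfolding tau_def by (simp add: e0g e0F[OF e])
    then have "tau 1 e = tau f e" by (simp add: f_def tau_diff)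
    also have "\<dots> = (\<Sum>g\<in>F. tau g e)" using F'(2) tau_sum[of "\<lambda>g. g" F e] by simp
    also have "\<dots> = (\<Sum>g\<in>F. if link g e then 1 else 0)" by (intro sum.cong refl link_tau F(2) e)
    also have "\<dots> = of_nat (card (cl e))" using F'(1) by (simp add: cl_def sum.If_cases Int_def)
    finally show ?thesis .
  qed
  have cl_eq: "cl e = cl g \<longleftrightarrow> link e g" if eg: "e \<in> F" "g \<in> F" for e g
  proof
    assume "cl e = cl g"
    then show "link e g" using link_refl[OF F(2)[OF eg(1)]] eg by (auto simp: cl_def)
  next
    assume l: "link e g"
    have "link h e \<longleftrightarrow> link h g" if "h \<in> F" for h
      using link_trans[OF F(2)[OF that] F(2)[OF eg(1)] F(2)[OF eg(2)] _ l]
        link_trans[OF F(2)[OF that] F(2)[OF eg(2)] F(2)[OF eg(1)] _ link_sym[OF F(2)[OF eg(1)] F(2)[OF eg(2)] l]] by blast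
    then show "cl e = cl g" by (auto simp: cl_def)
  qed
  define R where "R = mult_ring {..<p} (\<lambda>i. \<zeta> ^ i)"
  have fp: "finite {..<p}" by simp
  have zR: "\<zeta> \<in> R" unfolding R_def mult_ring_def
  proof (intro CollectI ballI)
    fix i :: nat
    have "\<zeta> ^ (Suc i mod p) \<in> lat {..<p} (\<lambda>i. \<zeta> ^ i)" using p0 by (intro lat_base[of "{..<p}" "Suc i mod p" "\<lambda>i. \<zeta> ^ i"]) simp_all
    then show "\<zeta> * \<zeta> ^ i \<in> lat {..<p} (\<lambda>i. \<zeta> ^ i)" by (simp flip: pow_mod)
  qed
  have chiR: "tau (gg z) e \<in> R" if e: "minp e" for e
  proof -
    obtain m where m: "\<And>j. tau (gg (tm j z)) e = (\<Sum>i<p. of_nat (m i) * \<zeta> ^ (i * j))"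
      "tau 1 e = of_nat (\<Sum>i<p. m i)" "\<And>i a. m i = 0 \<Longrightarrow> a \<in> gal \<Longrightarrow> fz i * a * e = 0"
      using char_decomp[OF e] by blast
    from m(1)[of 1] have "tau (gg z) e = (\<Sum>i<p. of_nat (m i) * \<zeta> ^ i)" by simp
    then show ?thesis using zR unfolding R_def by (simp add: mult_ring_sum mult_ring_mult mult_ring_nat mult_ring_pow)
  qed
  have part: "\<exists>r\<in>R. of_nat (card (cl e)) * tau (gg z) e = of_nat q * r" if e: "e \<in> F" for e
  proof (cases "q dvd card (cl e)")
    case True
    then obtain d where "card (cl e) = q * d" by (elim dvdE)
    moreover have "of_nat d * tau (gg z) e \<in> R" using chiR[OF F(2)[OF e]] unfolding R_def by (simp add: mult_ring_mult mult_ring_nat)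
    ultimately show ?thesis by (intro bexI[of _ "of_nat d * tau (gg z) e"]) simp_all
  next
    case False
    then have "coprime (card (cls G z)) (card (cl e))" using q by (simp add: prime_imp_coprime)
    then consider "tau (gg z) e = 0" | w where "\<forall>a\<in>gal. gg z * a * e = cc w * (a * e)"
      using char_zero_or_scalar[OF F(2)[OF e] dim[OF e]] by blast
    then show ?thesis
    proof cases
      case 1
      then show ?thesis using mult_ring_int[OF fp, of 0] by (intro bexI[of _ 0]) (simp_all add: R_def)
    next
      case (2 w)
      have "gg x * e = e" if "x \<in> G" for x
        by (rule scalar_trivial[OF simple nc _ minp_gal[OF F(2)[OF e]] minp_nz[OF F(2)[OF e]] that]) (use 2 in blast)+
      then have "e0 * e = e" by (rule e0e)
      then show ?thesis using e0F[OF e] minp_nz[OF F(2)[OF e]] by simp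
    qed
  qed
  have "- 1 = tau (gg z) f"
  proof -
    have "lookup 1 (- y + (- z + y)) = (0::complex)" if "y \<in> G" for y
    proof -
      have "- y + (- z + y) \<noteq> 0"
      proof
        assume "- y + (- z + y) = 0"
        then have "y + (- y + (- z + y)) + - y = 0" by simp
        then show False using z0 by (simp add: gs)
      qed
      then show ?thesis by (simp add: lookup_one)
    qed
    then have "tau (gg z) 1 = 0" by (simp add: tau_gg add.assoc)
    moreover have "tau (gg z) e0 = 1"
      using cG card_gt_0_iff[of G] by (simp add: tau_gg l0 subD[OF G] z)
    ultimately show ?thesis by (simp add: f_def tau_diff_r)
  qed
  also have "\<dots> = (\<Sum>e\<in>F. tau (gg z) e)" using F'(2) tau_sum_r[of "gg z" "\<lambda>g. g" F] by simp
  also have "\<dots> = (\<Sum>c\<in>cl ` F. \<Sum>e\<in>{e \<in> F. cl e = c}. tau (gg z) e)"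
    by (rule sum.group[symmetric]) (simp_all add: F')
  finally have tot: "- 1 = (\<Sum>c\<in>cl ` F. \<Sum>e\<in>{e \<in> F. cl e = c}. tau (gg z) e)" .
  have "\<exists>r\<in>R. (\<Sum>e\<in>{e \<in> F. cl e = c}. tau (gg z) e) = of_nat q * r" if "c \<in> cl ` F" for c
  proof -
    from that obtain e where e: "e \<in> F" "c = cl e" by (auto simp: image_iff)
    have "{g \<in> F. cl g = c} = cl e" unfolding e(2) using cl_eq[OF _ e(1)] by (auto simp: cl_def)
    then have "(\<Sum>g\<in>{g \<in> F. cl g = c}. tau (gg z) g) = (\<Sum>g\<in>cl e. tau (gg z) e)"
      by (simp only:) (intro sum.cong refl, auto simp: cl_def intro!: link_char F(2) e)
    then show ?thesis using part[OF e(1)] by simp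
  qed
  then obtain r where r: "\<And>c. c \<in> cl ` F \<Longrightarrow> r c \<in> R" "\<And>c. c \<in> cl ` F \<Longrightarrow> (\<Sum>e\<in>{e \<in> F. cl e = c}. tau (gg z) e) = of_nat q * r c"
    using bchoice[of "cl ` F" "\<lambda>c r. r \<in> R \<and> (\<Sum>e\<in>{e \<in> F. cl e = c}. tau (gg z) e) = of_nat q * r"] by auto
  define t where "t = (\<Sum>c\<in>cl ` F. r c)"
  have "t \<in> R" unfolding t_def R_def by (rule mult_ring_sum[OF fp]) (use r(1) in \<open>simp add: R_def\<close>)
  then have "algebraic_int t"
    unfolding R_def using p0 by (intro mult_ring_algebraic_int[OF fp, of 0 "\<lambda>i. \<zeta> ^ i"]) simp_all
  moreover have qt: "of_nat q * t = - 1" unfolding tot t_def sum_distrib_left by (rule sum.cong[OF refl r(2)[symmetric]])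
  then have "t = - 1 / of_nat q" using q(1) by (auto simp: field_simps)
  then have "t \<in> \<rat>" by simp
  ultimately obtain i where "t = of_int i" using rational_algebraic_int_is_int by (metis Ints_cases)
  then have "(of_int (int q * i) :: complex) = of_int (- 1)" using qt by simp
  then have "int q * i = - 1" by (simp only: of_int_eq_iff)
  then have "int q dvd 1" by (metis dvd_minus_iff dvd_triv_left)
  then show False using q(1) by simp
qed

end

subsection \<open>Symmetric groups and quotients\<close>

text \<open>Permutations with composition as addition. Since \<open>nat sym\<close> contains copies
  of all finite groups, an induction inside this type can pass to quotients.\<close>

typedef 'a sym = "{f :: 'a \<Rightarrow> 'a. bij f}" morphisms app Sym
  by (rule exI[of _ id]) simp

lemma bij_app: "bij (app f)" using app[of f] by simp

instantiation sym :: (type) group_add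
begin

definition "0 = Sym id"
definition "f + g = Sym (app f \<circ> app g)"
definition "- f = Sym (inv_into UNIV (app f))"
definition "f - g = f + - g" for f :: "'a sym"

lemma app_0: "app 0 = id" by (simp add: zero_sym_def Sym_inverse)
lemma app_add: "app (f + g) = app f \<circ> app g" by (simp add: plus_sym_def Sym_inverse bij_comp bij_app)
lemma app_minus: "app (- f) = inv_into UNIV (app f)" by (simp add: uminus_sym_def Sym_inverse bij_imp_bij_inv bij_app)

lemma sym_eqI: "app f = app g \<Longrightarrow> f = g" by (simp only: app_inject)

instance
proof
  fix a b c :: "'a sym"
  show "a + b + c = a + (b + c)" by (rule sym_eqI) (simp only: app_add o_assoc)
  show "0 + a = a" by (rule sym_eqI) (simp only: app_add app_0 id_o)
  show "a + 0 = a" by (rule sym_eqI) (simp only: app_add app_0 o_id)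
  show "- a + a = 0" by (rule sym_eqI) (simp only: app_add app_0 app_minus inv_o_cancel[OF bij_is_inj[OF bij_app]])
  show "a + - b = a - b" by (simp only: minus_sym_def)
qed

end

section \<open>Homomorphisms and quotients\<close>

definition hm :: "'g::group_add set \<Rightarrow> ('g \<Rightarrow> 'h::group_add) \<Rightarrow> bool" where
  "hm H f \<longleftrightarrow> sub H \<and> (\<forall>x\<in>H. \<forall>y\<in>H. f (x + y) = f x + f y)"

definition ker :: "'g::group_add set \<Rightarrow> ('g \<Rightarrow> 'h::group_add) \<Rightarrow> 'g set" where
  "ker H f = {x \<in> H. f x = 0}"

lemma hm_sub: "hm H f \<Longrightarrow> sub H" by (simp add: hm_def)
lemma hm_add: "hm H f \<Longrightarrow> x \<in> H \<Longrightarrow> y \<in> H \<Longrightarrow> f (x + y) = f x + f y" by (simp add: hm_def)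
lemma hm_0: assumes "hm H f" shows "f 0 = 0"
proof -
  have "f 0 + f 0 = f 0 + 0" using hm_add[OF assms, of 0 0] subD(2)[OF hm_sub[OF assms]] by simp
  then show ?thesis by (simp only: add_left_cancel)
qed
lemma hm_minus: assumes "hm H f" "x \<in> H" shows "f (- x) = - f x"
proof -
  have "f (- x) + f x = 0" using hm_add[OF assms(1), of "- x" x] assms hm_0 subD(4)[OF hm_sub] by force
  then have "f (- x) + f x + - f x = - f x" by simp
  then show ?thesis by (simp add: gs)
qed
lemma hm_tm: assumes "hm H f" "x \<in> H" shows "f (tm n x) = tm n (f x)"
  using hm_0[OF assms(1)] hm_add[OF assms(1,2)] tm_mem[OF hm_sub[OF assms(1)] assms(2)] by (induct n) simp_all
lemma hm_mono: "hm H f \<Longrightarrow> sub K \<Longrightarrow> K \<subseteq> H \<Longrightarrow> hm K f" by (auto simp: hm_def)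

lemma hm_image: assumes f: "hm H f" and K: "sub K" "K \<subseteq> H" shows "sub (f ` K)"
proof (rule subI)
  show "finite (f ` K)" using subD(1)[OF K(1)] by simp
  show "0 \<in> f ` K" using hm_0[OF f] subD(2)[OF K(1)] by (metis imageI)
  fix x assume "x \<in> f ` K"
  then obtain k where "k \<in> K" "x = f k" by blast
  then have "- x = f (- k)" "- k \<in> K" using hm_minus[OF f] K subD(4)[OF K(1)] by auto
  then show "- x \<in> f ` K" by simp
next
  fix x y assume "x \<in> f ` K" "y \<in> f ` K"
  then obtain k l where "k \<in> K" "x = f k" "l \<in> K" "y = f l" by blast
  then have "x + y = f (k + l)" "k + l \<in> K" using hm_add[OF f] K subD(3)[OF K(1)] by (auto simp: subset_iff)
  then show "x + y \<in> f ` K" by simp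
qed

lemma hm_splus: assumes "hm H f" "A \<subseteq> H" "B \<subseteq> H" shows "f ` (A \<boxplus> B) = f ` A \<boxplus> f ` B"
proof (intro equalityI subsetI)
  fix y assume "y \<in> f ` (A \<boxplus> B)"
  then obtain a b where "a \<in> A" "b \<in> B" "y = f (a + b)" by (auto elim: splusE)
  then have "y = f a + f b" using hm_add[OF assms(1), of a b] assms(2,3) by blast
  then show "y \<in> f ` A \<boxplus> f ` B" using splusI[of "f a" "f ` A" "f b" "f ` B"] \<open>a \<in> A\<close> \<open>b \<in> B\<close> by simp
next
  fix y assume "y \<in> f ` A \<boxplus> f ` B"
  then obtain a b where ab: "a \<in> A" "b \<in> B" "y = f a + f b" by (auto elim: splusE)
  then have "y = f (a + b)" using hm_add[OF assms(1), of a b] assms(2,3) by (simp add: subset_iff)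
  then show "y \<in> f ` (A \<boxplus> B)" using splusI[OF ab(1,2)] by blast
qed

lemma hm_vimage: assumes f: "hm H f" and N: "nml N (f ` H)" shows "nml {x \<in> H. f x \<in> N} H"
  unfolding nml_def
proof (intro conjI ballI)
  note H = hm_sub[OF f]
  have N': "sub N" using N by (simp add: nml_def)
  show "sub {x \<in> H. f x \<in> N}"
    by (rule subI) (use subD[OF H] subD[OF N'] hm_0[OF f] hm_add[OF f] hm_minus[OF f] in simp_all)
  fix h x assume h: "h \<in> H" and x: "x \<in> {x \<in> H. f x \<in> N}"
  then have "f (h + x + - h) = f h + f x + - f h" using subD(3,4)[OF H] by (simp add: hm_add[OF f] hm_minus[OF f])
  moreover have "f h + f x + - f h \<in> N" using N h x by (auto simp: nml_def)
  ultimately show "h + x + - h \<in> {x \<in> H. f x \<in> N}" using sub_cj_mem[OF H h] x by simp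
qed auto

lemma nml_ker: assumes f: "hm H f" shows "nml (ker H f) H"
proof -
  have "nml {0} (f ` H)" by (rule nml_zero[OF hm_image[OF f hm_sub[OF f] order_refl]])
  from hm_vimage[OF f this] show ?thesis by (simp add: ker_def)
qed

lemma hm_eq_iff: assumes "hm H f" "x \<in> H" "y \<in> H" shows "f x = f y \<longleftrightarrow> - x + y \<in> ker H f"
proof -
  have "f (- x + y) = - f x + f y" using assms subD(4)[OF hm_sub[OF assms(1)]] by (simp add: hm_add hm_minus)
  moreover have "- f x + f y = 0 \<longleftrightarrow> f x = f y"
  proof
    assume "- f x + f y = 0"
    then have "f x + (- f x + f y) = f x" by simp
    then show "f x = f y" by (simp add: gs)
  qed simp
  ultimately show ?thesis using assms subD(3,4)[OF hm_sub[OF assms(1)]] by (simp add: ker_def)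
qed

lemma card_hm: assumes f: "hm H f" and K: "sub K" "K \<subseteq> H" shows "card (f ` K) * card (K \<inter> ker H f) = card K"
proof -
  have N: "sub (K \<inter> ker H f)" using nml_ker[OF f] K by (auto simp: nml_def sub_Int)
  have "card (f ` K) = card (lcos K (K \<inter> ker H f))" unfolding lcos_def
  proof (rule card_image_eq)
    fix x y assume xy: "x \<in> K" "y \<in> K"
    then have "- x + y \<in> K" using subD(3,4)[OF K(1)] by simp
    then show "f x = f y \<longleftrightarrow> (+) x ` (K \<inter> ker H f) = (+) y ` (K \<inter> ker H f)"
      using hm_eq_iff[OF f, of x y] xy K(2) by (auto simp: lc_eq[OF N])
  qed
  then show ?thesis using card_lcos[OF K(1) N] by simp
qed

text \<open>\<open>H\<close> acts by translation on the cosets of the normal subgroup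
  \<open>N\<close>, with kernel \<open>N\<close>. Numbering the cosets by naturals makes
  \<open>nat sym\<close> the common home of all quotients.\<close>

lemma quotient_hm:
  fixes H :: "'g::group_add set"
  assumes H: "sub H" and N: "nml N H"
  obtains f :: "'g \<Rightarrow> nat sym" where "hm H f" "ker H f = N"
proof -
  have NS: "sub N" "N \<subseteq> H" using N by (auto simp: nml_def)
  define L where "L = lcos H N"
  define m where "m = card L"
  have fL: "finite L" using subD(1)[OF H] by (simp add: L_def lcos_def)
  obtain e where e: "bij_betw e {0..<m} L" using ex_bij_betw_nat_finite[OF fL] by (auto simp: m_def)
  define e' where "e' = inv_into {0..<m} e"
  have e': "e' c < m" "e (e' c) = c" if "c \<in> L" for c
    using bij_betw_inv_into_right[OF e that] bij_betwE[OF bij_betw_inv_into[OF e]] that by (auto simp: e'_def)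
  have ee: "e i \<in> L" "e' (e i) = i" if "i < m" for i
    using bij_betw_inv_into_left[OF e, of i] bij_betwE[OF e] that by (auto simp: e'_def)
  define a where "a h i = (if i < m then e' ((+) h ` e i) else i)" for h i
  have cl: "(+) h ` c \<in> L" if h: "h \<in> H" and cL: "c \<in> L" for h c
  proof -
    obtain x where "x \<in> H" "c = (+) x ` N" using cL by (auto simp: L_def lcos_def)
    then have "(+) h ` c = (+) (h + x) ` N" by (simp add: image_image add.assoc)
    then show ?thesis using subD(3)[OF H h \<open>x \<in> H\<close>] by (auto simp: L_def lcos_def)
  qed
  have add: "a (h + k) = a h \<circ> a k" if "h \<in> H" "k \<in> H" for h k
  proof
    fix i show "a (h + k) i = (a h \<circ> a k) i"
      using ee[of i] cl[OF that(2), of "e i"] e'[of "(+) k ` e i"] by (simp add: a_def image_image add.assoc)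
  qed
  have a0: "a 0 = id" using ee by (auto simp: a_def fun_eq_iff)
  have bij: "bij (a h)" if "h \<in> H" for h
  proof (rule o_bij)
    show "a (- h) \<circ> a h = id" using add[of "- h" h] a0 that subD(4)[OF H] by simp
    show "a h \<circ> a (- h) = id" using add[of h "- h"] a0 that subD(4)[OF H] by simp
  qed
  define f where "f h = Sym (a h)" for h
  have af: "app (f h) = a h" if "h \<in> H" for h using bij[OF that] by (simp add: f_def Sym_inverse)
  have "hm H f" unfolding hm_def
    using H subD(3)[OF H] by (auto simp: app_add af add simp flip: app_inject)
  moreover have "ker H f = N"
  proof (intro equalityI subsetI)
    fix h assume h: "h \<in> ker H f"
    then have hH: "h \<in> H" and "a h = id" using af[of h] by (auto simp: ker_def app_0)
    have NL: "N \<in> L" unfolding L_def lcos_def using subD(2)[OF H] by (force intro!: image_eqI[of _ _ 0])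
    have "a h (e' N) = e' N" using \<open>a h = id\<close> by simp
    then have "e' ((+) h ` N) = e' N" using e'[OF NL] by (simp add: a_def)
    then have "(+) h ` N = N" using e'(2)[OF NL] e'(2)[OF cl[OF hH NL]] by metis
    then have "h + 0 \<in> N" using subD(2)[OF NS(1)] by blast
    then show "h \<in> N" by simp
  next
    fix h assume h: "h \<in> N"
    have "(+) h ` c = c" if cL: "c \<in> L" for c
    proof -
      obtain x where x: "x \<in> H" "c = (+) x ` N" using cL by (auto simp: L_def lcos_def)
      have "- x + h + - (- x) \<in> N" by (rule nmlD(3)[OF N subD(4)[OF H x(1)] h])
      then have "- (h + x) + x \<in> N" using subD(4)[OF NS(1), of "- x + h + x"] by (simp add: gs)
      then have "(+) (h + x) ` N = (+) x ` N" by (simp add: lc_eq[OF NS(1)])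
      then show ?thesis by (simp add: x(2) image_image add.assoc)
    qed
    then have "a h = id" using ee by (auto simp: a_def fun_eq_iff)
    then show "h \<in> ker H f" using h NS(2) af[of h] by (auto simp: ker_def app_0 simp flip: app_inject)
  qed
  ultimately show ?thesis using that by blast
qed

text \<open>For the nontrivial inclusion, \<open>x\<close> is replaced by its multiple by
  \<open>m * i\<close>, where \<open>m\<close> is the part of \<open>card H\<close> prime to
  \<open>p\<close> and \<open>i\<close> inverts it modulo \<open>p ^ a\<close>: this multiple is a
  \<open>p\<close>-element with the same image.\<close>

lemma hm_pt: assumes f: "hm H f" and p: "Factorial_Ring.prime (p::nat)" shows "pt p (f ` H) = f ` pt p H"
proof (intro equalityI subsetI)
  fix y assume "y \<in> f ` pt p H"
  then obtain x k where "x \<in> H" "tm (p ^ k) x = 0" "y = f x" by (auto simp: pt_def pel_def)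
  moreover then have "tm (p ^ k) y = 0" using hm_tm[OF f] hm_0[OF f] by metis
  ultimately show "y \<in> pt p (f ` H)" by (auto simp: pt_def pel_def)
next
  note H = hm_sub[OF f]
  fix y assume "y \<in> pt p (f ` H)"
  then obtain x a where x: "x \<in> H" "y = f x" "tm (p ^ a) y = 0" by (auto simp: pt_def pel_def)
  have "card H \<noteq> 0" using sub_card_pos[OF H] by simp
  moreover have "\<not> is_unit p" using p not_prime_unit by blast
  ultimately obtain m where m: "card H = p ^ multiplicity p (card H) * m" "\<not> p dvd m"
    by (rule multiplicity_decompose')
  have "coprime m (p ^ a)" using prime_imp_coprime[OF p m(2)] by (simp add: coprime_commute)
  then obtain i where i: "[m * i = Suc 0] (mod p ^ a)" using cong_solve_coprime_nat by blast
  have "tm (p ^ multiplicity p (card H)) (tm (m * i) x) = tm i (tm (card H) x)"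
  proof -
    have "p ^ multiplicity p (card H) * (m * i) = i * card H" using m(1) by (metis mult.assoc mult.commute)
    then show ?thesis by (simp only: tm_mult[symmetric])
  qed
  then have "tm (m * i) x \<in> pt p H"
    using tm_card[OF H x(1)] tm_mem[OF H x(1)] by (auto simp: pt_def pel_def)
  moreover have "f (tm (m * i) x) = y"
  proof -
    have z: "tm (p ^ a * l) y = 0" for l using x(3) tm_dvd[of "p ^ a" y "p ^ a * l"] by simp
    obtain l l' where "p ^ a * l + m * i = p ^ a * l' + 1"
      using i unfolding cong_iff_lin_nat by (metis One_nat_def add.commute mult.commute)
    then have "tm (m * i) y = tm 1 y" using z by (metis tm_add add.left_neutral)
    then show ?thesis using hm_tm[OF f x(1)] x(2) by simp
  qed
  ultimately show "y \<in> f ` pt p H" by blast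
qed

lemma nil_hm: assumes f: "hm H f" and K: "nil K" "K \<subseteq> H" shows "nil (f ` K)"
  unfolding nil_def
proof (intro conjI allI impI)
  have KS: "sub K" using K nilD by blast
  show "sub (f ` K)" by (rule hm_image[OF f KS K(2)])
  fix p :: nat assume p: "Factorial_Ring.prime p"
  have "sub (f ` pt p K)" by (rule hm_image[OF f nilD(2)[OF K(1) p]]) (use K(2) pt_sub[of p K] in blast)
  then show "sub (pt p (f ` K))" using hm_pt[OF hm_mono[OF f KS K(2)] p] by simp
qed

lemma hm_gen: assumes f: "hm H f" and S: "S \<subseteq> H" shows "f ` gen S \<subseteq> gen (f ` S)"
proof -
  note H = hm_sub[OF f]
  have "grp {x \<in> H. f x \<in> gen (f ` S)}"
    using subD[OF H] grp_gen[of "f ` S"] hm_0[OF f] hm_add[OF f] hm_minus[OF f] by (simp add: grp_def)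
  then have "gen S \<subseteq> {x \<in> H. f x \<in> gen (f ` S)}" by (rule gen_least) (use S gen_inc[of "f ` S"] in auto)
  then show ?thesis by blast
qed

lemma hm_ders: assumes f: "hm H f" shows "f ` ders H n \<subseteq> ders (f ` H) n"
proof (induct n)
  case (Suc n)
  have s: "ders H n \<subseteq> H" "sub (ders H n)" using sub_ders[OF hm_sub[OF f]] by auto
  let ?S = "{x + y + - x + - y | x y. x \<in> ders H n \<and> y \<in> ders H n}"
  have SH: "?S \<subseteq> H"
  proof
    fix t assume "t \<in> ?S"
    then obtain x y where xy: "x \<in> ders H n" "y \<in> ders H n" and t: "t = x + y + - x + - y" by blast
    then have "x \<in> H" "y \<in> H" using s by auto
    then show "t \<in> H" unfolding t by (intro subD(3,4)[OF hm_sub[OF f]])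
  qed
  have "f ` ?S \<subseteq> {x + y + - x + - y | x y. x \<in> ders (f ` H) n \<and> y \<in> ders (f ` H) n}"
  proof
    fix t assume "t \<in> f ` ?S"
    then obtain x y where xy: "x \<in> ders H n" "y \<in> ders H n" "t = f (x + y + - x + - y)" by blast
    then have "x \<in> H" "y \<in> H" using s by auto
    then have "t = f x + f y + - f x + - f y"
      using xy(3) subD(3,4)[OF hm_sub[OF f]] by (simp add: hm_add[OF f] hm_minus[OF f])
    then show "t \<in> {x + y + - x + - y | x y. x \<in> ders (f ` H) n \<and> y \<in> ders (f ` H) n}"
      using xy(1,2) Suc by blast
  qed
  then have "gen (f ` ?S) \<subseteq> ders (f ` H) (Suc n)"
    unfolding ders.simps der_def by (intro gen_least grp_gen subset_trans[OF _ gen_inc])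
  moreover have "f ` ders H (Suc n) \<subseteq> gen (f ` ?S)" unfolding ders.simps der_def by (rule hm_gen[OF f SH])
  ultimately show ?case by blast
qed simp

lemma solv_ext: assumes f: "hm H f" and k: "solv (ker H f)" and i: "solv (f ` H)" shows "solv H"
proof -
  note H = hm_sub[OF f]
  obtain n where n: "ders (f ` H) n = {0}" using i by (auto simp: solv_def)
  obtain m where m: "ders (ker H f) m = {0}" using k by (auto simp: solv_def)
  have s: "ders H n \<subseteq> H" using sub_ders[OF H] by auto
  have "ders H n \<subseteq> ker H f" using hm_ders[OF f, of n] n s by (auto simp: ker_def)
  then have "ders H (n + m) \<subseteq> {0}" using ders_mono[of "ders H n" "ker H f" m] m by (simp add: ders_add)
  moreover have "0 \<in> ders H (n + m)" using sub_ders[OF H, of "n + m"] subD(2) by blast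
  ultimately show ?thesis using H unfolding solv_def by blast
qed

subsection \<open>Products of nilpotent groups of coprime order are solvable\<close>

lemma central_elem: assumes B: "nil B" "B \<noteq> {0}"
  obtains z p where "z \<in> B" "z \<noteq> 0" "Factorial_Ring.prime p" "tm p z = 0" "\<And>x. x \<in> B \<Longrightarrow> x + z = z + x"
proof -
  have BS: "sub B" using B nilD by blast
  obtain p where p: "Factorial_Ring.prime p" "pt p B \<noteq> {0}" using exists_part[OF BS B(2)] by blast
  obtain y where y: "y \<in> pt p B" "y \<noteq> 0" "\<And>x. x \<in> pt p B \<Longrightarrow> x + y = y + x"
    using pgrp_center[OF p(1) nil_pgrp[OF p(1) B(1)] nml_refl[OF nilD(2)[OF B(1) p(1)]] p(2)] by blast
  define k where "k = (LEAST k. tm (p ^ k) y = 0)"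
  have ex: "\<exists>k. tm (p ^ k) y = 0" using y(1) by (auto simp: pt_def pel_def)
  have k: "tm (p ^ k) y = 0" unfolding k_def by (rule LeastI_ex[OF ex])
  then have "k \<noteq> 0" using y(2) by (intro notI) simp
  then obtain l where l: "k = Suc l" using not0_implies_Suc by blast
  define z where "z = tm (p ^ l) y"
  have "z \<noteq> 0" unfolding z_def using not_less_Least[of l "\<lambda>k. tm (p ^ k) y = 0"] l by (simp add: k_def)
  moreover have "tm p z = 0" using k by (simp add: z_def l flip: tm_mult)
  moreover have "z \<in> B" using tm_mem[OF BS] y(1) pt_sub[of p B] unfolding z_def by blast
  moreover have "x + z = z + x" if "x \<in> B" for x
    using tm_commute(2)[of y x "p ^ l"] part_central[OF B(1) p(1) y(1,3) that] by (simp add: z_def)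
  ultimately show ?thesis using that p(1) by blast
qed

lemma simple_center:
  assumes G: "sub G" and simple: "\<And>N. nml N G \<Longrightarrow> N = {0} \<or> N = G"
    and z: "z \<in> G" "z \<noteq> 0" "\<And>x. x \<in> G \<Longrightarrow> x + z = z + x"
  shows "cen G G = G"
proof -
  have "z \<in> cen G G" using z(1,3) by (auto simp: cen_def)
  then have "cen G G \<noteq> {0}" using z(2) by blast
  then show ?thesis using simple[OF nml_cen[OF nml_refl[OF G] G]] by blast
qed

lemma solv_abelian: assumes G: "sub G" and c: "cen G G = G" shows "solv G"
proof -
  have "x + y + - x + - y = 0" if "x \<in> G" "y \<in> G" for x y
  proof -
    have "x \<in> cen G G" using that c by simp
    then have "x + y = y + x" using that(2) by (simp add: cen_def)
    then show ?thesis by (simp add: gs)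
  qed
  then have "{x + y + - x + - y | x y. x \<in> G \<and> y \<in> G} \<subseteq> {0}" by blast
  then have "der G \<subseteq> {0}" unfolding der_def by (intro gen_least) (simp_all add: grp_def)
  then have "ders G 1 = {0}" using subD(2)[OF sub_der(1)[OF G]] by auto
  then show ?thesis using G unfolding solv_def by blast
qed

text \<open>An element \<open>z\<close> of prime order in the centre of \<open>B\<close> is
  centralised by \<open>B\<close>, so the size of its class divides the order of \<open>A\<close>, a
  prime power. Burnside's theorem then leaves only the abelian case.\<close>

lemma simple_prime_power_factor:
  fixes G :: "'g::group_add set"
  assumes G: "sub G" and simple: "\<And>N. nml N G \<Longrightarrow> N = {0} \<or> N = G"
    and A: "sub A" "card A = q ^ k" "Factorial_Ring.prime q" and B: "nil B" "B \<noteq> {0}"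
    and GAB: "G = A \<boxplus> B" and cop: "coprime (card A) (card B)"
  shows "cen G G = G"
proof (rule ccontr)
  assume na: "cen G G \<noteq> G"
  have BS: "sub B" using B nilD by blast
  have BG: "B \<subseteq> G" unfolding GAB by (rule splus_right[OF subD(2)[OF A(1)]])
  obtain z p where z: "z \<in> B" "z \<noteq> 0" "Factorial_Ring.prime p" "tm p z = 0" "\<And>x. x \<in> B \<Longrightarrow> x + z = z + x"
    using central_elem[OF B] by metis
  obtain \<zeta> where "root_of_unity p \<zeta>" using exists_root_of_unity[OF z(3)] by blast
  then interpret gr: group_root G p \<zeta> z using G z BG by (auto simp: group_root_def group_algebra_def group_root_axioms_def)
  have nc: "cen G {z} \<noteq> G"
  proof
    assume c: "cen G {z} = G"
    have "x + z = z + x" if "x \<in> G" for x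
    proof -
      have "x \<in> cen G {z}" using that c by simp
      then show ?thesis by (simp add: cen_def)
    qed
    then show False using simple_center[OF G simple _ z(2)] z(1) BG na by blast
  qed
  have "B \<subseteq> cen G {z}" using z(5) BG by (auto simp: cen_def)
  then have "card B dvd card (cen G {z})" by (rule lagrange_sub[OF sub_cen[OF G] BS])
  then obtain m where m: "card (cen G {z}) = card B * m" by (rule dvdE)
  have "card (cls G z) * (card B * m) = card A * card B"
    using gr.class_card card_splus_coprime[OF A(1) BS cop] by (simp add: m GAB[symmetric])
  then have "card (cls G z) * m = card A" using sub_card_pos[OF BS] by simp
  then have "card (cls G z) dvd q ^ k" using A(2) by (metis dvd_triv_left)
  then obtain j where "card (cls G z) = q ^ j" using divides_primepow_nat[OF A(3)] by blast
  then show False using gr.no_prime_power_class[OF simple nc A(3)] by blast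
qed

lemma nil_single_part:
  assumes A: "nil A" "A \<noteq> {0}" and n: "\<not> (\<exists>r. Factorial_Ring.prime r \<and> r \<noteq> p \<and> pt r A \<noteq> {0})" and p: "Factorial_Ring.prime p"
  obtains k where "card A = p ^ k"
proof -
  have "pt p A = A"
  proof (rule nil_eqI[OF A(1) nilD(2)[OF A(1) p] pt_sub])
    fix r :: nat assume "Factorial_Ring.prime r"
    then have "r = p \<or> pt r A = {0}" using n by blast
    then show "pt r A \<subseteq> pt p A" using pt_0[OF nilD(1)[OF A(1)], of p] by auto
  qed
  then show ?thesis using nil_pgrp[OF p A(1)] that by (auto simp: pgrp_def)
qed

text \<open>A proper nonzero normal subgroup \<open>N\<close> lies in a proper subgroup
  \<open>A \<boxplus> N\<close> or \<open>B \<boxplus> N\<close>, which is factorised again; so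
  \<open>N\<close> and the quotient are solvable by induction. In a nonabelian simple
  \<open>G\<close> no factor has prime power order, and the assumptions of
  \<open>coprime_factor\<close> hold.\<close>

lemma coprime_nil_product_solv_step:
  fixes G :: "nat sym set"
  assumes IH: "\<And>G' A' B' :: nat sym set. card G' < card G \<Longrightarrow> sub G' \<Longrightarrow> nil A' \<Longrightarrow> nil B' \<Longrightarrow> G' = A' \<boxplus> B' \<Longrightarrow> coprime (card A') (card B') \<Longrightarrow> solv G'"
    and G: "sub G" and A: "nil A" and B: "nil B" and GAB: "G = A \<boxplus> B" and cop: "coprime (card A) (card B)"
  shows "solv G"
proof -
  have AS: "sub A" and BS: "sub B" using A B nilD by blast+
  have AG: "A \<subseteq> G" "B \<subseteq> G" unfolding GAB by (rule splus_left[OF subD(2)[OF BS]], rule splus_right[OF subD(2)[OF AS]])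
  have GBA: "G = B \<boxplus> A" using GAB sub_splus_comm[OF AS BS] G by simp
  have less: "card H < card G" if "sub H" "H \<subseteq> G" "H \<noteq> G" for H
    using that subD(1)[OF G] by (intro psubset_card_mono) auto
  have sub_fact: "solv (A' \<boxplus> B')" if "sub A'" "A' \<subseteq> A" "sub B'" "B' \<subseteq> B" "sub (A' \<boxplus> B')" "A' \<boxplus> B' \<noteq> G" for A' B'
  proof (rule IH[OF less[OF that(5) _ that(6)] that(5)])
    show "A' \<boxplus> B' \<subseteq> G" unfolding GAB by (rule splus_mono[OF that(2,4)])
    show "nil A'" by (rule nil_sub[OF A that(1,2)])
    show "nil B'" by (rule nil_sub[OF B that(3,4)])
    show "coprime (card A') (card B')" using coprime_divisors[OF lagrange_sub[OF AS that(1,2)] lagrange_sub[OF BS that(3,4)] cop] .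
  qed simp
  consider N where "nml N G" "N \<noteq> {0}" "N \<noteq> G" | "\<And>N. nml N G \<Longrightarrow> N = {0} \<or> N = G" by blast
  then show ?thesis
  proof cases
    case (1 N)
    have NS: "sub N" "N \<subseteq> G" using 1(1) by (auto simp: nml_def)
    have nsub: "sub (U \<boxplus> N)" "U \<boxplus> N = N \<boxplus> U" "U \<boxplus> N \<subseteq> G" "N \<subseteq> U \<boxplus> N" "U \<subseteq> U \<boxplus> N" if U: "sub U" "U \<subseteq> G" for U
    proof -
      have c: "cj x N \<subseteq> N" if "x \<in> U" for x using nml_cj[OF 1(1), of x] that U(2) by auto
      show "sub (U \<boxplus> N)" "U \<boxplus> N = N \<boxplus> U" using sub_splus_norm[OF U(1) NS(1) c] by auto
      show "U \<boxplus> N \<subseteq> G" by (rule splus_subset[OF G U(2) NS(2)])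
      show "N \<subseteq> U \<boxplus> N" by (rule splus_right[OF subD(2)[OF U(1)]])
      show "U \<subseteq> U \<boxplus> N" by (rule splus_left[OF subD(2)[OF NS(1)]])
    qed
    have ind: "(card G div card N) dvd card U" if U: "sub U" "U \<subseteq> G" and e: "U \<boxplus> N = G" for U
    proof -
      have "card G * card (U \<inter> N) = card U * card N" using card_splus[OF U(1) NS(1)] e by simp
      moreover obtain j where "card G = card N * j" using lagrange_sub[OF G NS] by (auto elim: dvdE)
      ultimately have "j * card (U \<inter> N) = card U" "card G div card N = j" using sub_card_pos[OF NS(1)] by auto
      then show ?thesis by (metis dvd_triv_left)
    qed
    have solvN: "solv N"
    proof -
      \<comment> \<open>Otherwise the index of \<open>N\<close> would divide the coprime orders of
        both factors.\<close>
      have "\<not> (A \<boxplus> N = G \<and> B \<boxplus> N = G)"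
      proof
        assume a: "A \<boxplus> N = G \<and> B \<boxplus> N = G"
        then have "(card G div card N) dvd card A" "(card G div card N) dvd card B" using ind AS BS AG by auto
        then have "card G div card N = 1" using cop coprime_common_divisor_nat[of "card A" "card B"] by blast
        moreover have "card N dvd card G" by (rule lagrange_sub[OF G NS])
        ultimately have "card N = card G" using dvd_mult_div_cancel[of "card N" "card G"] by simp
        then show False using 1(3) sub_eqI[OF G NS(2)] by simp
      qed
      then consider "A \<boxplus> N \<noteq> G" | "B \<boxplus> N \<noteq> G" by blast
      then show ?thesis
      proof cases
        case 1
        have "A \<boxplus> N = (A \<boxplus> N) \<inter> B \<boxplus> A"
          by (rule dedekind[OF nsub(1) nsub(5)]) (use AS AG nsub(3)[OF AS AG(1)] GBA in auto)
        moreover have "(A \<boxplus> N) \<inter> B \<boxplus> A = A \<boxplus> ((A \<boxplus> N) \<inter> B)"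
          using sub_splus_comm[of "(A \<boxplus> N) \<inter> B" A] calculation nsub(1)[OF AS AG(1)] AS BS by (simp add: sub_Int)
        ultimately have e: "A \<boxplus> N = A \<boxplus> ((A \<boxplus> N) \<inter> B)" by simp
        have "solv (A \<boxplus> ((A \<boxplus> N) \<inter> B))"
          by (rule sub_fact) (use AS BS e[symmetric] 1 nsub(1)[OF AS AG(1)] in \<open>auto simp: sub_Int\<close>)
        then have "solv (A \<boxplus> N)" using e by simp
        then show ?thesis by (rule solv_sub[OF _ NS(1) nsub(4)[OF AS AG(1)]])
      next
        case 2
        have e: "B \<boxplus> N = (B \<boxplus> N) \<inter> A \<boxplus> B"
          by (rule dedekind[OF nsub(1) nsub(5)]) (use BS AG nsub(3)[OF BS AG(2)] GAB in auto)
        have "solv ((B \<boxplus> N) \<inter> A \<boxplus> B)"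
          by (rule sub_fact) (use AS BS e[symmetric] 2 nsub(1)[OF BS AG(2)] in \<open>auto simp: sub_Int\<close>)
        then have "solv (B \<boxplus> N)" using e by simp
        then show ?thesis by (rule solv_sub[OF _ NS(1) nsub(4)[OF BS AG(2)]])
      qed
    qed
    obtain f :: "nat sym \<Rightarrow> nat sym" where f: "hm G f" "ker G f = N" using quotient_hm[OF G 1(1)] by blast
    have cf: "card (f ` G) * card N = card G" using card_hm[OF f(1) G order_refl] f(2) NS(2) by (simp add: Int_absorb1)
    have "card N > 1" using sub_card1[OF NS(1)] 1(2) sub_card_pos[OF NS(1)] by linarith
    then have lt: "card (f ` G) < card G" 
      using cf sub_card_pos[OF hm_image[OF f(1) G order_refl]] n_less_m_mult_n[of "card (f ` G)" "card N"] by (simp add: mult.commute)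
    have "solv (f ` G)"
    proof (rule IH[OF lt])
      show "sub (f ` G)" by (rule hm_image[OF f(1) G order_refl])
      show "nil (f ` A)" "nil (f ` B)" using nil_hm[OF f(1)] A B AG by auto
      show "f ` G = f ` A \<boxplus> f ` B" using hm_splus[OF f(1) AG] GAB by simp
      have "card (f ` A) dvd card A" "card (f ` B) dvd card B"
        using card_hm[OF f(1) AS AG(1)] card_hm[OF f(1) BS AG(2)] by (metis dvd_triv_left)+
      then show "coprime (card (f ` A)) (card (f ` B))" by (rule coprime_divisors[OF _ _ cop])
    qed
    then show ?thesis using solv_ext[OF f(1)] solvN f(2) by simp
  next
    case 2
    show ?thesis
    proof (cases "cen G G = G")
      case True then show ?thesis by (rule solv_abelian[OF G])
    next
      case False
      have center: "U \<noteq> G" if "nil U" for U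
      proof
        assume "U = G"
        then have "nil G" "G \<noteq> {0}" using that False subD(2)[OF sub_cen[OF G, of G]] cen_sub[of G G] by auto
        then obtain z p where "z \<in> G" "z \<noteq> 0" "Factorial_Ring.prime p" "tm p z = 0" "\<And>x. x \<in> G \<Longrightarrow> x + z = z + x"
          using central_elem by metis
        then show False using simple_center[OF G 2] False by blast
      qed
      have "A \<noteq> {0}" using center[OF B] GAB BS splus_right[of "{0}" B] by (auto simp: splus_def)
      have "B \<noteq> {0}" using center[OF A] GAB by (auto simp: splus_def)
      have A2: "\<exists>r. Factorial_Ring.prime r \<and> r \<noteq> p \<and> pt r A \<noteq> {0}" if p: "Factorial_Ring.prime p" for p
      proof (rule ccontr)
        assume "\<not> ?thesis"
        then obtain k where "card A = p ^ k" using nil_single_part[OF A \<open>A \<noteq> {0}\<close> _ p] by blast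
        then show False using simple_prime_power_factor[OF G 2 AS _ p B \<open>B \<noteq> {0}\<close> GAB cop] False by blast
      qed
      have B2: "\<exists>r. Factorial_Ring.prime r \<and> r \<noteq> p \<and> pt r B \<noteq> {0}" if p: "Factorial_Ring.prime p" for p
      proof (rule ccontr)
        assume "\<not> ?thesis"
        then obtain k where "card B = p ^ k" using nil_single_part[OF B \<open>B \<noteq> {0}\<close> _ p] by blast
        moreover have "coprime (card B) (card A)" using cop by (simp only: coprime_commute)
        ultimately show False using simple_prime_power_factor[OF G 2 BS _ p A \<open>A \<noteq> {0}\<close> GBA] False by blast
      qed
      have "coprime_factor G A B"
        by unfold_locales (fact G A AG \<open>A \<noteq> {0}\<close> B \<open>B \<noteq> {0}\<close> GAB cop 2 sub_fact A2 B2)+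
      then have False by (rule coprime_factor.no_coprime_factor)
      then show ?thesis ..
    qed
  qed
qed

theorem coprime_nil_product_solv:
  fixes G :: "nat sym set"
  assumes "sub G" "nil A" "nil B" "G = A \<boxplus> B" "coprime (card A) (card B)"
  shows "solv G"
  using assms
proof (induct "card G" arbitrary: G A B rule: less_induct)
  case less
  show ?case by (rule coprime_nil_product_solv_step[OF less(1) less(2-6)])
qed

subsection \<open>Products of two nilpotent groups\<close>

lemma pgrp_nil: assumes p: "Factorial_Ring.prime p" and G: "pgrp p G" shows "nil G"
proof (rule growth_nil)
  show "sub G" using G by (simp add: pgrp_def)
  fix L assume "sub L" "L \<subset> G"
  then obtain x where "x \<in> G" "x \<notin> L" "cj x L = L" using pgrp_growth[OF p G] by metis
  then show "\<exists>x\<in>G - L. cj x L = L" by blast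
qed

definition normal_over_factor :: "'g::group_add set \<Rightarrow> 'g set \<Rightarrow> 'g set \<Rightarrow> bool" where
  "normal_over_factor G U V \<longleftrightarrow> U = G \<and> V = G \<or> (\<exists>N. nml N G \<and> N \<noteq> G \<and> (U \<subseteq> N \<or> V \<subseteq> N))"

lemma normal_over_factor_nil: assumes G: "nil G" and U: "sub U" "U \<subseteq> G" and V: "sub V" "V \<subseteq> G" shows "normal_over_factor G U V"
proof -
  have "\<exists>N. nml N G \<and> N \<noteq> G \<and> W \<subseteq> N" if W: "sub W" "W \<subseteq> G" "W \<noteq> G" for W
    using nil_proper_normal[OF G W(1)] W by (metis psubsetI)
  then show ?thesis using U V unfolding normal_over_factor_def by blast
qed

text \<open>The elements \<open>x\<close> of \<open>gen (\<Union>\<K>)\<close> for which every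
  \<open>e + x\<close> lies in \<open>gen (\<Union>\<K>) \<boxplus> E\<close> form a subgroup that
  contains each \<open>K\<close>.\<close>

lemma perm_join:
  assumes H: "sub H" and E: "sub E" "E \<subseteq> H" and K: "\<Union>\<K> \<subseteq> H" "\<And>K. K \<in> \<K> \<Longrightarrow> E \<boxplus> K \<subseteq> K \<boxplus> E"
  shows "E \<boxplus> gen (\<Union>\<K>) \<subseteq> gen (\<Union>\<K>) \<boxplus> E"
proof -
  define L where "L = gen (\<Union>\<K>)"
  have L: "sub L" "L \<subseteq> H" using sub_gen[OF H K(1)] by (auto simp: L_def)
  define T where "T = {x \<in> L. \<forall>e\<in>E. e + x \<in> L \<boxplus> E}"
  have T0: "0 \<in> T" using subD(2)[OF L(1)] splusI[OF subD(2)[OF L(1)]] by (fastforce simp: T_def)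
  have Tadd: "x + y \<in> T" if x: "x \<in> T" and y: "y \<in> T" for x y
    unfolding T_def
  proof (intro CollectI conjI ballI)
    show "x + y \<in> L" using x y subD(3)[OF L(1)] by (simp add: T_def)
    fix e assume "e \<in> E"
    then have "e + x \<in> L \<boxplus> E" using x by (simp add: T_def)
    then obtain l e1 where 1: "l \<in> L" "e1 \<in> E" "e + x = l + e1" by (elim splusE)
    have "e1 + y \<in> L \<boxplus> E" using y 1 by (simp add: T_def)
    then obtain l2 e2 where 2: "l2 \<in> L" "e2 \<in> E" "e1 + y = l2 + e2" by (elim splusE)
    have "e + (x + y) = (e + x) + y" by (simp only: add.assoc)
    also have "\<dots> = l + (e1 + y)" unfolding 1(3) by (rule add.assoc)
    also have "\<dots> = (l + l2) + e2" unfolding 2(3) by (simp only: add.assoc)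
    finally show "e + (x + y) \<in> L \<boxplus> E" using splusI[OF subD(3)[OF L(1) 1(1) 2(1)] 2(2)] by simp
  qed
  have Ttm: "tm n x \<in> T" if "x \<in> T" for n x using Tadd[OF that] T0 by (induct n) simp_all
  have "grp T" unfolding grp_def
  proof (intro conjI ballI T0 Tadd)
    fix x assume x: "x \<in> T"
    then have xL: "x \<in> L" by (simp add: T_def)
    obtain n where n: "card L = Suc n" using sub_card_pos[OF L(1)] gr0_implies_Suc by blast
    have "x + tm n x = 0" using tm_card[OF L(1) xL] by (simp add: n)
    then have "- x = tm n x" by (metis minus_unique)
    then show "- x \<in> T" using Ttm[OF x] by simp
  qed
  moreover have "\<Union>\<K> \<subseteq> T"
  proof
    fix x assume "x \<in> \<Union>\<K>"
    then obtain K where k: "K \<in> \<K>" "x \<in> K" by blast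
    have KL: "K \<subseteq> L" using k(1) gen_inc[of "\<Union>\<K>"] by (auto simp: L_def)
    have "e + x \<in> L \<boxplus> E" if "e \<in> E" for e
      using K(2)[OF k(1)] splusI[OF that k(2)] splus_mono[OF KL order_refl] by blast
    then show "x \<in> T" using k(2) KL by (auto simp: T_def)
  qed
  ultimately have "L \<subseteq> T" unfolding L_def by (rule gen_least)
  then have "e + x \<in> L \<boxplus> E" if "e \<in> E" "x \<in> L" for e x using that by (auto simp: T_def)
  then show ?thesis unfolding L_def[symmetric] by (auto elim!: splusE)
qed

text \<open>\<open>red\<close> is what the induction leaves over: if one of the two sums is proper,
  the images of the factors do not both fill the quotient by \<open>C\<close>, and a normal subgroup
  lifts from there.\<close>

locale nil_product =
  fixes G U V :: "'g::group_add set"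
  assumes G: "sub G" and U: "nil U" and V: "nil V" and GUV: "G = U \<boxplus> V"
    and red: "\<And>C. nml C G \<Longrightarrow> C \<noteq> {0} \<Longrightarrow> U \<boxplus> C = G \<and> V \<boxplus> C = G"
begin

lemma US: "sub U" and VS: "sub V" using U V nilD by auto
lemma UG: "U \<subseteq> G" unfolding GUV by (rule splus_left[OF subD(2)[OF VS]])
lemma VG: "V \<subseteq> G" unfolding GUV by (rule splus_right[OF subD(2)[OF US]])
lemma GVU: "G = V \<boxplus> U" using GUV sub_splus_comm[OF US VS] G by simp

lemma normal_over_factor_if_nil: "nil G \<Longrightarrow> normal_over_factor G U V" by (rule normal_over_factor_nil[OF _ US UG VS VG])

text \<open>A factor containing \<open>D\<close> equals its sum with \<open>D\<close>, which is
  \<open>G\<close>; so \<open>G\<close> is nilpotent.\<close>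

lemma contained: assumes D: "nml D G" "D \<noteq> {0}" "D \<subseteq> U \<or> D \<subseteq> V" shows "normal_over_factor G U V"
proof -
  have DS: "sub D" using D(1) by (simp add: nml_def)
  have "U = G \<or> V = G"
    using D(3) red[OF D(1,2)] splus_absorb[OF US DS] splus_absorb[OF VS DS] by auto
  then have "nil G" using U V by auto
  then show ?thesis by (rule normal_over_factor_if_nil)
qed

text \<open>\<open>G\<close> is the sum of \<open>W\<close>, which normalises the intersection, and
  of the abelian \<open>C\<close>, which centralises it.\<close>

lemma Int_normal: assumes C: "nml C G" "\<And>x y. x \<in> C \<Longrightarrow> y \<in> C \<Longrightarrow> x + y = y + x" and W: "sub W" "W \<boxplus> C = G" "W \<subseteq> G"
  shows "nml (W \<inter> C) G"
  unfolding nml_def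
proof (intro conjI ballI)
  show "sub (W \<inter> C)" using C W sub_Int by (auto simp: nml_def)
  show "W \<inter> C \<subseteq> G" using W by blast
  fix g n assume g: "g \<in> G" and n: "n \<in> W \<inter> C"
  obtain u c where uc: "u \<in> W" "c \<in> C" "g = u + c" using g W(2) by (auto elim: splusE)
  have "c + n + - c = n" using C(2)[OF uc(2), of n] n by (intro cen_cj_id) simp
  then have "u + (c + n + - c) + - u = u + n + - u" by simp
  then have "g + n + - g = u + n + - u" by (simp add: uc(3) gs)
  moreover have "u + n + - u \<in> W" using sub_cj_mem[OF W(1) uc(1)] n by blast
  moreover have "u + n + - u \<in> C" using nmlD(3)[OF C(1), of u n] uc(1) W(3) n by blast
  ultimately show "g + n + - g \<in> W \<inter> C" by simp
qed

lemma sylow_complement: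
  assumes W: "nil W" "W \<subseteq> G" and c: "card G = card W * p ^ a" and p: "Factorial_Ring.prime p" and q: "Factorial_Ring.prime q" "q \<noteq> p"
  shows "syl q (pt q W) G"
proof -
  have WS: "sub W" using W nilD by blast
  have "card (pt q W) dvd card W" by (rule lagrange_sub[OF WS nilD(2)[OF W(1) q(1)] pt_sub])
  then obtain m where m: "card W = card (pt q W) * m" by (rule dvdE)
  have "\<not> q dvd m" by (rule syl_index[OF q(1) nil_syl[OF q(1) W(1)] WS]) (use m in \<open>simp add: mult.commute\<close>)
  moreover have "\<not> q dvd p ^ a" using q p by (metis prime_dvd_power primes_dvd_imp_eq)
  ultimately have nd: "\<not> q dvd m * p ^ a" using q(1) by (simp add: prime_dvd_mult_iff)
  show ?thesis
    by (rule sylI_nd[OF q(1) nil_pgrp[OF q(1) W(1)] _ G _ nd]) (use W(2) pt_sub[of q W] c m in \<open>auto simp: mult.assoc\<close>)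
qed

text \<open>If \<open>C\<close> meets a factor nontrivially, the intersection is normal. Otherwise
  both factors are complements of \<open>C\<close>, so for \<open>q\<close> other than
  \<open>p\<close> their \<open>q\<close>-parts are Sylow subgroups of \<open>G\<close>; these are
  conjugate, and the factorisation of the conjugating element makes them equal and normal. Without
  such a \<open>q\<close> the group \<open>G\<close> is a \<open>p\<close>-group.\<close>

lemma abelian_p:
  assumes C: "nml C G" "C \<noteq> {0}" "\<And>x y. x \<in> C \<Longrightarrow> y \<in> C \<Longrightarrow> x + y = y + x" and p: "Factorial_Ring.prime p" "pgrp p C"
  shows "normal_over_factor G U V"
proof -
  have CS: "sub C" using C(1) by (simp add: nml_def)
  have e: "U \<boxplus> C = G" "V \<boxplus> C = G" using red[OF C(1,2)] by auto
  have n: "nml (U \<inter> C) G" "nml (V \<inter> C) G"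
    using Int_normal[OF C(1,3) US e(1) UG] Int_normal[OF C(1,3) VS e(2) VG] by auto
  show ?thesis
  proof (cases "U \<inter> C = {0} \<and> V \<inter> C = {0}")
    case False
    then show ?thesis using contained[OF n(1)] contained[OF n(2)] by blast
  next
    case True
    obtain a where a: "card C = p ^ a" using p(2) by (auto simp: pgrp_def)
    have c: "card G = card U * p ^ a" "card G = card V * p ^ a"
      using card_splus[OF US CS] card_splus[OF VS CS] True e a by simp_all
    show ?thesis
    proof (cases "\<exists>q. Factorial_Ring.prime q \<and> q \<noteq> p \<and> pt q U \<noteq> {0}")
      case True
      then obtain q where q: "Factorial_Ring.prime q" "q \<noteq> p" "pt q U \<noteq> {0}" by blast
      obtain g where g: "g \<in> G" "pt q V = cj g (pt q U)"
        using sylow_conj[OF q(1) G sylow_complement[OF U UG c(1) p(1) q(1,2)] sylow_complement[OF V VG c(2) p(1) q(1,2)]] by blast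
      obtain v u where vu: "v \<in> V" "u \<in> U" "g = v + u" using g(1) GVU by (auto elim: splusE)
      have "pt q V = cj v (pt q U)" using g(2) nml_cj[OF nil_nml[OF q(1) U] vu(2)] by (simp add: vu(3) flip: cj_cj)
      then have "pt q U = cj (- v) (pt q V)" by simp
      then have UV: "pt q U = pt q V" using nml_cj[OF nil_nml[OF q(1) V] subD(4)[OF VS vu(1)]] by simp
      have "nml (pt q U) G"
      proof (rule nmlI_cj)
        show "sub (pt q U)" "pt q U \<subseteq> G" using nilD(2)[OF U q(1)] pt_sub[of q U] UG by auto
        fix h assume "h \<in> G"
        then obtain v u where vu: "v \<in> V" "u \<in> U" "h = v + u" using GVU by (auto elim: splusE)
        have "cj h (pt q U) = cj v (cj u (pt q U))" by (simp add: vu(3))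
        also have "cj u (pt q U) = pt q V" using nml_cj[OF nil_nml[OF q(1) U] vu(2)] UV by simp
        also have "cj v (pt q V) = pt q U" using nml_cj[OF nil_nml[OF q(1) V] vu(1)] UV by simp
        finally show "cj h (pt q U) \<subseteq> pt q U" by simp
      qed
      then show ?thesis using contained[of "pt q U"] q(3) pt_sub by blast
    next
      case False
      obtain k where "card U = p ^ k"
      proof (cases "U = {0}")
        case True then show ?thesis using that[of 0] by simp
      next
        case False2: False
        show ?thesis using nil_single_part[OF U False2 False p(1)] that by blast
      qed
      then have "card G = p ^ (k + a)" using c by (simp add: power_add)
      then have "pgrp p G" using G unfolding pgrp_def by blast
      then show ?thesis using normal_over_factor_if_nil pgrp_nil[OF p(1)] by blast
    qed
  qed
qed

lemma normal_p: assumes C: "nml C G" "C \<noteq> {0}" and p: "Factorial_Ring.prime p" "pgrp p C" shows "normal_over_factor G U V"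
proof -
  have CS: "sub C" "C \<subseteq> G" using C(1) by (auto simp: nml_def)
  define D where "D = cen G C \<inter> C"
  have D: "nml D G" unfolding D_def by (rule nml_Int2[OF nml_cen[OF C(1) G] C(1)])
  obtain z where z: "z \<in> C" "z \<noteq> 0" "\<And>x. x \<in> C \<Longrightarrow> x + z = z + x" using pgrp_center[OF p nml_refl[OF CS(1)] C(2)] by blast
  have "z \<in> D" using z CS by (auto simp: D_def cen_def)
  then have "D \<noteq> {0}" using z(2) by blast
  moreover have "pgrp p D" by (rule pgrp_sub[OF p nmlD(1)[OF D]]) (simp add: D_def)
  moreover have "x + y = y + x" if "x \<in> D" "y \<in> D" for x y
    using that unfolding D_def cen_def by blast
  ultimately show ?thesis by (intro abelian_p[OF D _ _ p(1)])
qed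

lemma abelian: assumes C: "nml C G" "C \<noteq> {0}" "\<And>x y. x \<in> C \<Longrightarrow> y \<in> C \<Longrightarrow> x + y = y + x" shows "normal_over_factor G U V"
proof -
  have CS: "sub C" using C(1) by (simp add: nml_def)
  have nC: "nil C" by (rule class2_nil[OF CS]) (use sub_der(2)[OF CS] C(3) in blast)
  obtain l where l: "Factorial_Ring.prime l" "pt l C \<noteq> {0}" using exists_part[OF CS C(2)] by blast
  show ?thesis by (rule normal_p[OF nml_pt[OF C(1) nC l(1)] l(2,1) nil_pgrp[OF l(1) nC]])
qed

lemma solvable: assumes s: "solv G" and G0: "G \<noteq> {0}" shows "normal_over_factor G U V"
proof -
  define n where "n = (LEAST n. ders G n = {0})"
  have n: "ders G n = {0}" unfolding n_def by (rule LeastI_ex) (use s in \<open>auto simp: solv_def\<close>)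
  then have "n \<noteq> 0" using G0 by (intro notI) simp
  then obtain m where m: "n = Suc m" using not0_implies_Suc by blast
  have "ders G m \<noteq> {0}" using not_less_Least[of m "\<lambda>n. ders G n = {0}"] m by (simp add: n_def)
  moreover have "x + y = y + x" if xy: "x \<in> ders G m" "y \<in> ders G m" for x y
  proof -
    have "x + y + - x + - y = 0" using der_comm[OF xy] n m by simp
    then have "(x + y + - x + - y) + y + x = y + x" by simp
    then show ?thesis by (simp add: gs)
  qed
  ultimately show ?thesis using abelian[OF nml_ders[OF nml_refl[OF G]]] by blast
qed

text \<open>Some Sylow subgroup \<open>Q\<close> of \<open>G\<close> contains both parts, because
  the conjugating element splits into elements that normalise them. The product formula for
  \<open>U\<close>, \<open>V\<close> and for their \<open>p\<close>-parts gives the sum of the parts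
  the order of \<open>Q\<close>. A general \<open>g\<close> splits in the same way.\<close>

lemma parts_product: assumes p: "Factorial_Ring.prime p" and g: "g \<in> G" shows "sub (pt p U \<boxplus> cj g (pt p V))"
proof -
  note nU = nml_cj[OF nil_nml[OF p U]] and nV = nml_cj[OF nil_nml[OF p V]]
  have sU: "sub (pt p U)" and sV: "sub (pt p V)" using nilD(2)[OF _ p] U V by auto
  have pU: "pgrp p (pt p U)" and pV: "pgrp p (pt p V)" using nil_pgrp[OF p] U V by auto
  obtain P0 where "sub P0" "P0 \<subseteq> G" "card P0 = p ^ multiplicity p (card G)" using sylow_exists[OF G p] by blast
  then have "syl p P0 G" by (simp add: syl_def)
  moreover obtain h0 where "h0 \<in> G" "pt p U \<subseteq> cj h0 P0" using sylow_sub_conj[OF p G calculation pU] pt_sub[of p U] UG by blast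
  ultimately obtain P where P: "syl p P G" "pt p U \<subseteq> P" using syl_cj[OF G] by blast
  obtain h where h: "h \<in> G" "pt p V \<subseteq> cj h P" using sylow_sub_conj[OF p G P(1) pV] pt_sub[of p V] VG by blast
  obtain v u where vu: "v \<in> V" "u \<in> U" "h = v + u" using h(1) GVU by (auto elim: splusE)
  define Q where "Q = cj u P"
  have uG: "u \<in> G" using vu UG by blast
  have Q: "syl p Q G" unfolding Q_def by (rule syl_cj[OF G uG P(1)])
  then have QS: "sub Q" "Q \<subseteq> G" by (auto simp: syl_def)
  have "cj (- v) (pt p V) \<subseteq> Q" using cj_mono[OF h(2), of "- v"] by (simp add: vu(3) Q_def)
  then have VQ: "pt p V \<subseteq> Q" using nV[OF subD(4)[OF VS vu(1)]] by simp
  have UQ: "pt p U \<subseteq> Q" using cj_mono[OF P(2), of u] nU[OF vu(2)] by (simp add: Q_def)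
  have nUV: "nil (U \<inter> V)" by (rule nil_sub[OF U sub_Int[OF US VS]]) simp
  have int: "pt p U \<inter> pt p V = pt p (U \<inter> V)" by (auto simp: pt_def)
  have "card (pt p U \<boxplus> pt p V) * card (pt p (U \<inter> V)) = card (pt p U) * card (pt p V)"
    using card_splus[OF sU sV] by (simp add: int)
  also have "\<dots> = p ^ (multiplicity p (card U) + multiplicity p (card V))"
    using nil_syl[OF p U] nil_syl[OF p V] by (simp add: syl_def power_add)
  also have "\<dots> = p ^ (multiplicity p (card G) + multiplicity p (card (U \<inter> V)))"
    using mult_splus[OF p US VS] by (simp add: GUV[symmetric])
  also have "\<dots> = card Q * card (pt p (U \<inter> V))"
    using nil_syl[OF p nUV] Q by (simp add: syl_def power_add)
  finally have "card (pt p U \<boxplus> pt p V) = card Q"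
    using sub_card_pos[OF nilD(2)[OF nUV p]] by simp
  moreover have "pt p U \<boxplus> pt p V \<subseteq> Q" by (rule splus_subset[OF QS(1) UQ VQ])
  ultimately have s: "sub (pt p U \<boxplus> pt p V)" using card_subset_eq[OF subD(1)[OF QS(1)]] QS(1) by metis
  obtain a b where ab: "a \<in> U" "b \<in> V" "g = a + b" using g GUV by (auto elim: splusE)
  have "cj g (pt p V) = cj a (pt p V)" using nV[OF ab(2)] by (simp add: ab(3) flip: cj_cj)
  then have "pt p U \<boxplus> cj g (pt p V) = cj a (pt p U \<boxplus> pt p V)" using nU[OF ab(1)] by (simp add: cj_splus)
  then show ?thesis using sub_cj[OF s] by simp
qed

lemma common_prime: assumes p: "Factorial_Ring.prime p" "p dvd card U" "p dvd card V" shows "normal_over_factor G U V"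
proof -
  have sU: "sub (pt p U)" and sV: "sub (pt p V)" using nilD(2)[OF _ p(1)] U V by auto
  have pU: "pgrp p (pt p U)" and pV: "pgrp p (pt p V)" using nil_pgrp[OF p(1)] U V by auto
  have VpG: "pt p V \<subseteq> G" using pt_sub[of p V] VG by blast
  have cjV: "sub (cj g (pt p V))" "cj g (pt p V) \<subseteq> G" "pgrp p (cj g (pt p V))" if "g \<in> G" for g
    using sub_cj[OF sV] cj_sub_mem[OF G that VpG] pV by (auto simp: pgrp_def)
  define S where "S = {W. pgrp p W \<and> pt p U \<subseteq> W \<and> W \<subseteq> G \<and> (\<forall>g\<in>G. sub (W \<boxplus> cj g (pt p V)))}"
  have fS: "finite S" by (rule finite_subset[of _ "Pow G"]) (use subD(1)[OF G] in \<open>auto simp: S_def\<close>)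
  have "pt p U \<in> S" unfolding S_def using pU pt_sub[of p U] UG parts_product[OF p(1)] by auto
  then obtain W where W: "W \<in> S" "\<And>E. E \<in> S \<Longrightarrow> W \<subseteq> E \<Longrightarrow> W = E" using finite_has_maximal[OF fS] by blast
  have W': "pgrp p W" "sub W" "pt p U \<subseteq> W" "W \<subseteq> G" "\<And>g. g \<in> G \<Longrightarrow> sub (W \<boxplus> cj g (pt p V))"
    using W(1) by (auto simp: S_def pgrp_def)
  \<comment> \<open>The group \<open>L\<close> generated by the conjugates of \<open>W\<close> under
    \<open>D\<close> lies in the \<open>p\<close>-group \<open>W \<boxplus> D\<close> and still
    permutes with all conjugates of \<open>pt p V\<close>; maximality gives
    \<open>W = L\<close>.\<close>
  have norm: "cj d W = W" if g: "g \<in> G" and d: "d \<in> cj g (pt p V)" for g d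
  proof -
    define D where "D = cj g (pt p V)"
    have D: "sub D" "D \<subseteq> G" "pgrp p D" using cjV[OF g] by (auto simp: D_def)
    define \<K> where "\<K> = (\<lambda>d. cj d W) ` D"
    define L where "L = gen (\<Union>\<K>)"
    have P: "sub (W \<boxplus> D)" "pgrp p (W \<boxplus> D)"
      using W'(5)[OF g] pgrp_splus[OF p(1) W'(1) D(3)] by (auto simp: D_def)
    have WP: "W \<subseteq> W \<boxplus> D" "D \<subseteq> W \<boxplus> D" using splus_left[OF subD(2)[OF D(1)]] splus_right[OF subD(2)[OF W'(2)]] by auto
    have KP: "\<Union>\<K> \<subseteq> W \<boxplus> D"
    proof
      fix x assume "x \<in> \<Union>\<K>"
      then obtain e where e: "e \<in> D" "x \<in> cj e W" by (auto simp: \<K>_def)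
      then have "e \<in> W \<boxplus> D" using WP by blast
      then show "x \<in> W \<boxplus> D" using cj_sub_mem[OF P(1) _ WP(1)] e(2) by blast
    qed
    have LP: "sub L" "L \<subseteq> W \<boxplus> D" using sub_gen[OF P(1) KP] by (auto simp: L_def)
    have PG: "W \<boxplus> D \<subseteq> G" by (rule splus_subset[OF G W'(4) D(2)])
    have cjL: "cj e W \<subseteq> L" if "e \<in> D" for e using gen_inc[of "\<Union>\<K>"] that by (auto simp: L_def \<K>_def)
    have WL: "W \<subseteq> L" using cjL[OF subD(2)[OF D(1)]] by simp
    have "L \<in> S" unfolding S_def
    proof (intro CollectI conjI ballI)
      show "pgrp p L" by (rule pgrp_sub[OF p(1) P(2) LP])
      show "pt p U \<subseteq> L" using W'(3) WL by blast
      show "L \<subseteq> G" using LP PG by blast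
      fix h assume h: "h \<in> G"
      define E where "E = cj h (pt p V)"
      have E: "sub E" "E \<subseteq> G" using cjV[OF h] by (auto simp: E_def)
      have "E \<boxplus> K \<subseteq> K \<boxplus> E" if KK: "K \<in> \<K>" for K
      proof -
        obtain e where e: "e \<in> D" "K = cj e W" using KK by (auto simp: \<K>_def)
        have "- e + h \<in> G" using e(1) D(2) h by (intro subD(3,4)[OF G]) auto
        then have "sub (cj e (W \<boxplus> cj (- e + h) (pt p V)))" by (intro sub_cj W'(5))
        then have "sub (K \<boxplus> E)" by (simp add: cj_splus e(2) E_def flip: add.assoc)
        then show ?thesis using sub_splus_comm[of K E] sub_cj[OF W'(2)] E(1) e(2) by simp
      qed
      then have "E \<boxplus> L \<subseteq> L \<boxplus> E" unfolding L_def using KP PG by (intro perm_join[OF G E]) auto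
      then show "sub (L \<boxplus> cj h (pt p V))" using sub_splus[OF LP(1) E(1)] by (simp add: E_def)
    qed
    then have "W = L" by (rule W(2)[OF _ WL])
    then have "cj d W \<subseteq> W" using cjL[of d] d by (simp add: D_def)
    then show ?thesis by (rule cj_eqI[OF subD(1)[OF W'(2)]])
  qed
  define C2 where "C2 = ncl G (pt p V)"
  have C2: "nml C2 G" "pt p V \<subseteq> C2" unfolding C2_def by (rule ncl_nml[OF G VpG])+
  have C2S: "sub C2" "C2 \<subseteq> G" using C2(1) by (auto simp: nml_def)
  have "C2 \<subseteq> nrm G W" unfolding C2_def
  proof (rule ncl_least[OF sub_nrm[OF G]])
    fix g assume g: "g \<in> G"
    show "cj g (pt p V) \<subseteq> nrm G W" using norm[OF g] cjV(2)[OF g] by (auto simp: nrm_def)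
  qed
  then have nW: "cj x W = W" if "x \<in> C2" for x using that by (auto simp: nrm_def)
  define D where "D = W \<inter> C2"
  have DS: "sub D" "D \<subseteq> C2" "D \<subseteq> G" unfolding D_def using sub_Int[OF W'(2) C2S(1)] W'(4) by auto
  have pD: "pgrp p D" by (rule pgrp_sub[OF p(1) W'(1) DS(1)]) (simp add: D_def)
  have DC: "nml D C2"
    by (rule nmlI_cj[OF DS(1,2)]) (simp add: D_def cj_Int nW sub_cj_self[OF C2S(1)])
  show ?thesis
  proof (cases "D = {0}")
    case False
    obtain P where "sub P" "P \<subseteq> C2" "card P = p ^ multiplicity p (card C2)" using sylow_exists[OF C2S(1) p(1)] by blast
    then have P: "syl p P C2" by (simp add: syl_def)
    \<comment> \<open>All conjugates of \<open>D\<close> are normal \<open>p\<close>-subgroups of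
      \<open>C2\<close>, hence lie in one Sylow subgroup \<open>P\<close>.\<close>
    have "ncl G D \<subseteq> P"
    proof (rule ncl_least)
      show "sub P" using P by (simp add: syl_def)
      fix g assume g: "g \<in> G"
      have gC: "cj g C2 = C2" by (rule nml_cj[OF C2(1) g])
      have "nml (cj g D) C2"
      proof (rule nmlI_cj[OF sub_cj[OF DS(1)]])
        show "cj g D \<subseteq> C2" using cj_mono[OF DS(2), of g] gC by simp
        fix c assume c: "c \<in> C2"
        then have "- g + c + g \<in> C2" using gC by (simp flip: cj_mem)
        then have "cj (- g + c + g) D = D" by (rule nml_cj[OF DC])
        then have "cj g (cj (- g + c + g) D) = cj g D" by simp
        then show "cj c (cj g D) \<subseteq> cj g D" by (simp add: gs)
      qed
      moreover have "pgrp p (cj g D)" using pD sub_cj by (auto simp: pgrp_def)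
      ultimately show "cj g D \<subseteq> P" by (rule nml_pgrp_syl[OF p(1) C2S(1) _ _ P])
    qed
    moreover have n: "nml (ncl G D) G" "D \<subseteq> ncl G D" by (rule ncl_nml[OF G DS(3)])+
    ultimately have "pgrp p (ncl G D)" using pgrp_sub[OF p(1) syl_pgrp[OF P]] by (auto simp: nml_def)
    moreover have "ncl G D \<noteq> {0}" using n(2) False subD(2)[OF DS(1)] by blast
    ultimately show ?thesis using normal_p[OF n(1) _ p(1)] by blast
  next
    case True
    define C1 where "C1 = cen G C2"
    have C1: "nml C1 G" unfolding C1_def by (rule nml_cen[OF C2(1) G])
    \<comment> \<open>\<open>C2\<close> normalises \<open>W\<close> and is normal in
      \<open>G\<close>, so commutators of \<open>W\<close> with \<open>C2\<close> lie in their
      intersection, which is 0.\<close>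
    have "pt p U \<subseteq> C1"
    proof
      fix x assume x: "x \<in> pt p U"
      then have xW: "x \<in> W" and xG: "x \<in> G" using W'(3,4) by auto
      have "x + c = c + x" if c: "c \<in> C2" for c
      proof -
        have "c + - x + - c \<in> cj c W" using subD(4)[OF W'(2) xW] by (auto simp: cj_def)
        then have "x + (c + - x + - c) \<in> W" using nW[OF c] subD(3)[OF W'(2) xW] by simp
        moreover have "(x + c + - x) + - c \<in> C2"
          by (rule subD(3)[OF C2S(1) nmlD(3)[OF C2(1) xG c] subD(4)[OF C2S(1) c]])
        ultimately have "x + c + - x + - c \<in> D" by (simp add: D_def gs)
        then have "x + c + - x + - c = 0" using True by simp
        then have "(x + c + - x + - c) + c + x = c + x" by simp
        then show ?thesis by (simp add: gs)
      qed
      then show "x \<in> C1" using xG by (simp add: C1_def cen_def)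
    qed
    then have C10: "C1 \<noteq> {0}" using pt_nontrivial[OF p(1) US p(2)] pt_0[OF US, of p] by blast
    have C20: "C2 \<noteq> {0}" using C2(2) pt_nontrivial[OF p(1) VS p(3)] pt_0[OF VS, of p] by blast
    show ?thesis
    proof (cases "C1 \<inter> C2 = {0}")
      case False
      show ?thesis by (rule abelian[OF nml_Int2[OF C1 C2(1)] False]) (unfold C1_def cen_def, blast)
    next
      case True
      have quot: "\<exists>f :: 'g \<Rightarrow> nat sym. hm G f \<and> ker G f = C \<and> nil (f ` G)" if C: "nml C G" "C \<noteq> {0}" for C
      proof -
        obtain f :: "'g \<Rightarrow> nat sym" where f: "hm G f" "ker G f = C" using quotient_hm[OF G C(1)] by blast
        have "f ` G = f ` U \<boxplus> f ` C" using hm_splus[OF f(1) UG] C(1) red[OF C] by (metis nmlD(2))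
        also have "f ` C = {0}" using f(2) subD(2)[OF nmlD(1)[OF C(1)]] hm_0[OF f(1)] by (auto simp: ker_def)
        also have "f ` U \<boxplus> {0} = f ` U" by (auto simp: splus_def)
        finally show ?thesis using f nil_hm[OF f(1) U UG] by auto
      qed
      obtain f1 :: "'g \<Rightarrow> nat sym" where f1: "hm G f1" "ker G f1 = C1" "nil (f1 ` G)" using quot[OF C1 C10] by blast
      obtain f2 :: "'g \<Rightarrow> nat sym" where f2: "hm G f2" "ker G f2 = C2" "nil (f2 ` G)" using quot[OF C2(1) C20] by blast
      \<comment> \<open>\<open>G\<close> embeds into the product of its quotients by
        \<open>C1\<close> and \<open>C2\<close>; by \<open>red\<close> these are images of
        \<open>U\<close>, hence nilpotent.\<close>
      have "nil G" unfolding nil_def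
      proof (intro conjI allI impI G)
        fix l :: nat assume l: "Factorial_Ring.prime l"
        have fa: "\<exists>k. f (tm (l ^ k) (x + y)) = 0" if f: "hm G f" "nil (f ` G)" and x: "x \<in> pt l G" and y: "y \<in> pt l G" for f :: "'g \<Rightarrow> nat sym" and x y
        proof -
          have xy: "x \<in> G" "y \<in> G" using x y pt_sub[of l G] by auto
          have "f x \<in> pt l (f ` G)" "f y \<in> pt l (f ` G)" using x y hm_pt[OF f(1) l] by auto
          then have "f x + f y \<in> pt l (f ` G)" using subD(3)[OF nilD(2)[OF f(2) l]] by blast
          then obtain k where "tm (l ^ k) (f x + f y) = 0" by (auto simp: pt_def pel_def)
          then show ?thesis using hm_tm[OF f(1) subD(3)[OF G xy]] hm_add[OF f(1) xy] by auto
        qed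
        show "sub (pt l G)"
        proof (rule subI)
          show "finite (pt l G)" using pt_sub finite_subset subD(1)[OF G] by blast
          show "0 \<in> pt l G" by (rule pt_0[OF G])
          show "- x \<in> pt l G" if "x \<in> pt l G" for x using that subD(4)[OF G] pel_minus by (auto simp: pt_def)
          fix x y assume x: "x \<in> pt l G" and y: "y \<in> pt l G"
          have xyG: "x + y \<in> G" using x y pt_sub[of l G] subD(3)[OF G] by blast
          obtain k1 where k1: "f1 (tm (l ^ k1) (x + y)) = 0" using fa[OF f1(1,3) x y] by blast
          obtain k2 where k2: "f2 (tm (l ^ k2) (x + y)) = 0" using fa[OF f2(1,3) x y] by blast
          have tG: "tm (l ^ k) (x + y) \<in> G" for k by (rule tm_mem[OF G xyG])
          let ?t = "tm (l ^ (k1 + k2)) (x + y)"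
          have "f1 ?t = 0"
            using hm_tm[OF f1(1) tG[of k1], of "l ^ k2"] k1 by (simp add: power_add mult.commute flip: tm_mult)
          moreover have "f2 ?t = 0"
            using hm_tm[OF f2(1) tG[of k2], of "l ^ k1"] k2 by (simp add: power_add flip: tm_mult)
          ultimately have "?t \<in> C1 \<inter> C2" using tG f1(2) f2(2) by (auto simp: ker_def)
          then have "?t = 0" using True by simp
          then show "x + y \<in> pt l G" using xyG by (auto simp: pt_def pel_def)
        qed
      qed
      then show ?thesis by (rule normal_over_factor_if_nil)
    qed
  qed
qed

lemma normal_over_factor: assumes "coprime (card U) (card V) \<Longrightarrow> solv G" shows "normal_over_factor G U V"
proof (cases "G = {0}")
  case True
  then have "U = G" "V = G" using UG VG subD(2)[OF US] subD(2)[OF VS] by auto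
  then show ?thesis by (simp add: normal_over_factor_def)
next
  case G0: False
  show ?thesis
  proof (cases "coprime (card U) (card V)")
    case True then show ?thesis using solvable assms G0 by blast
  next
    case False
    then have "gcd (card U) (card V) \<noteq> 1" by (simp add: coprime_iff_gcd_eq_1)
    then obtain l where "Factorial_Ring.prime l" "l dvd gcd (card U) (card V)" using prime_factor_nat by blast
    then show ?thesis using common_prime[of l] by simp
  qed
qed

end

theorem nil_product_normal_over_factor:
  fixes G :: "nat sym set"
  assumes "sub G" "nil U" "nil V" "G = U \<boxplus> V"
  shows "normal_over_factor G U V"
  using assms
proof (induct "card G" arbitrary: G U V rule: less_induct)
  case less
  note G = less(2) and U = less(3) and V = less(4) and GUV = less(5)
  have US: "sub U" and VS: "sub V" using U V nilD by auto
  have UG: "U \<subseteq> G" unfolding GUV by (rule splus_left[OF subD(2)[OF VS]])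
  have VG: "V \<subseteq> G" unfolding GUV by (rule splus_right[OF subD(2)[OF US]])
  show ?case
  proof (cases "\<forall>C. nml C G \<longrightarrow> C \<noteq> {0} \<longrightarrow> U \<boxplus> C = G \<and> V \<boxplus> C = G")
    case True
    then interpret nil_product G U V by unfold_locales (use G U V GUV in auto)
    show ?thesis by (rule normal_over_factor) (rule coprime_nil_product_solv[OF G U V GUV])
  next
    case False
    then obtain C where C: "nml C G" "C \<noteq> {0}" "\<not> (U \<boxplus> C = G \<and> V \<boxplus> C = G)" by blast
    have CS: "sub C" "C \<subseteq> G" using C(1) by (auto simp: nml_def)
    obtain f :: "nat sym \<Rightarrow> nat sym" where f: "hm G f" "ker G f = C" using quotient_hm[OF G C(1)] by blast
    have cf: "card (f ` G) * card C = card G" using card_hm[OF f(1) G order_refl] f(2) CS(2) by (simp add: Int_absorb1)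
    have "card C > 1" using sub_card1[OF CS(1)] C(2) sub_card_pos[OF CS(1)] by linarith
    then have lt: "card (f ` G) < card G"
      using cf sub_card_pos[OF hm_image[OF f(1) G order_refl]] n_less_m_mult_n[of "card (f ` G)" "card C"] by (simp add: mult.commute)
    have "normal_over_factor (f ` G) (f ` U) (f ` V)"
    proof (rule less(1)[OF lt])
      show "sub (f ` G)" by (rule hm_image[OF f(1) G order_refl])
      show "nil (f ` U)" "nil (f ` V)" using nil_hm[OF f(1)] U V UG VG by auto
      show "f ` G = f ` U \<boxplus> f ` V" using hm_splus[OF f(1) UG VG] GUV by simp
    qed
    moreover have full: "W \<boxplus> C = G" if W: "W \<subseteq> G" "f ` W = f ` G" for W
    proof
      show "W \<boxplus> C \<subseteq> G" by (rule splus_subset[OF G W(1) CS(2)])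
      show "G \<subseteq> W \<boxplus> C"
      proof
        fix g assume g: "g \<in> G"
        then obtain w where w: "w \<in> W" "f w = f g" using W(2) by (metis imageE imageI)
        then have "- w + g \<in> C" using hm_eq_iff[OF f(1), of w g] g W(1) f(2) by auto
        then have "w + (- w + g) \<in> W \<boxplus> C" by (rule splusI[OF w(1)])
        then show "g \<in> W \<boxplus> C" by (simp add: gs)
      qed
    qed
    then have "\<not> (f ` U = f ` G \<and> f ` V = f ` G)" using C(3) UG VG by blast
    ultimately obtain N where N: "nml N (f ` G)" "N \<noteq> f ` G" "f ` U \<subseteq> N \<or> f ` V \<subseteq> N" unfolding normal_over_factor_def by blast
    have "nml {x \<in> G. f x \<in> N} G" by (rule hm_vimage[OF f(1) N(1)])
    moreover have "{x \<in> G. f x \<in> N} \<noteq> G" using N(1,2) by (auto simp: nml_def)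
    moreover have "U \<subseteq> {x \<in> G. f x \<in> N} \<or> V \<subseteq> {x \<in> G. f x \<in> N}" using N(3) UG VG by blast
    ultimately show ?thesis unfolding normal_over_factor_def by blast
  qed
qed

section \<open>Normal subgroups of prime index\<close>

lemma nil_simple_prime:
  assumes K: "nil K" "K \<noteq> {0}" and simple: "\<And>N. nml N K \<Longrightarrow> N = {0} \<or> N = K"
  shows "Factorial_Ring.prime (card K)"
proof -
  have KS: "sub K" using K nilD by blast
  obtain z p where z: "z \<in> K" "z \<noteq> 0" "Factorial_Ring.prime p" "tm p z = 0" "\<And>x. x \<in> K \<Longrightarrow> x + z = z + x"
    using central_elem[OF K] by metis
  define N where "N = range (\<lambda>n. tm n z)"
  have N: "sub N" "N \<subseteq> K" unfolding N_def by (rule sub_cyc[OF KS z(1)])+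
  have "nml N K" unfolding nml_def
  proof (intro conjI ballI N)
    fix x y assume x: "x \<in> K" and y: "y \<in> N"
    then obtain n where n: "y = tm n z" by (auto simp: N_def)
    have "tm n z + x = x + tm n z" by (rule tm_commute(2)) (rule z(5)[OF x, symmetric])
    then have "x + y + - x = y" unfolding n by (intro cen_cj_id) simp
    then show "x + y + - x \<in> N" using y by simp
  qed
  moreover have zN: "z \<in> N" unfolding N_def by (metis rangeI tm_1)
  ultimately have NK: "N = K" using simple[of N] z(2) by blast
  have "pel p z" unfolding pel_def by (rule exI[of _ 1]) (simp add: z(4))
  then have "pgrp p N" unfolding N_def by (rule cyclic_pgrp(1)[OF KS z(1) _ z(3)])
  then obtain a where a: "card K = p ^ a" by (auto simp: pgrp_def NK)
  have p0: "p > 0" using z(3) prime_gt_0_nat by blast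
  have "tm n z = tm (n mod p) z" for n
  proof -
    have "tm n z = tm (p * (n div p) + n mod p) z" by simp
    also have "\<dots> = tm (n mod p) z" unfolding tm_add using tm_dvd[OF z(4), of "p * (n div p)"] by simp
    finally show ?thesis .
  qed
  then have "N \<subseteq> (\<lambda>n. tm n z) ` {..<p}" using p0 unfolding N_def by (metis image_eqI image_subsetI lessThan_iff mod_less_divisor)
  then have "card K \<le> p" unfolding NK[symmetric] using card_mono[of "(\<lambda>n. tm n z) ` {..<p}" N] card_image_le[of "{..<p}" "\<lambda>n. tm n z"] by simp
  moreover have "a \<noteq> 0" using a sub_card1[OF KS] K(2) by auto
  then have "p dvd card K" by (simp add: a)
  then have "p \<le> card K" using sub_card_pos[OF KS] by (rule dvd_imp_le)
  ultimately show ?thesis using z(3) by simp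
qed

text \<open>Take \<open>M\<close> maximal among the proper normal subgroups above \<open>N\<close>.
  The quotient by \<open>M\<close> is simple, and nilpotent as an image of \<open>V\<close>, so it
  has prime order.\<close>

lemma prime_index_above:
  fixes G :: "'g::group_add set"
  assumes G: "sub G" and N: "nml N G" "N \<noteq> G" and V: "nil V" "V \<subseteq> G" "G = N \<boxplus> V"
  obtains M where "nml M G" "N \<subseteq> M" "M \<noteq> G" "\<exists>p. Factorial_Ring.prime p \<and> card G = p * card M"
proof -
  define S where "S = {M. nml M G \<and> N \<subseteq> M \<and> M \<noteq> G}"
  have fS: "finite S" by (rule finite_subset[of _ "Pow G"]) (use subD(1)[OF G] in \<open>auto simp: S_def nml_def\<close>)
  have "N \<in> S" using N by (simp add: S_def)
  then obtain M where M: "M \<in> S" "\<And>E. E \<in> S \<Longrightarrow> M \<subseteq> E \<Longrightarrow> M = E" using finite_has_maximal[OF fS] by blast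
  have M': "nml M G" "N \<subseteq> M" "M \<noteq> G" using M(1) by (auto simp: S_def)
  have MS: "sub M" "M \<subseteq> G" using M'(1) by (auto simp: nml_def)
  obtain f :: "'g \<Rightarrow> nat sym" where f: "hm G f" "ker G f = M" using quotient_hm[OF G M'(1)] by blast
  have NG: "N \<subseteq> G" using N(1) by (simp add: nml_def)
  have "f ` N = {0}" using f(2) M'(2) hm_0[OF f(1)] subD(2)[OF nmlD(1)[OF N(1)]] by (auto simp: ker_def)
  then have "f ` G = f ` V" using hm_splus[OF f(1) NG V(2)] V(3) by (auto simp: splus_def)
  then have nK: "nil (f ` G)" using nil_hm[OF f(1) V(1,2)] by simp
  have K0: "f ` G \<noteq> {0}"
  proof
    assume "f ` G = {0}"
    then have "G \<subseteq> ker G f" by (auto simp: ker_def)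
    then show False using f(2) MS M'(3) by blast
  qed
  have "Factorial_Ring.prime (card (f ` G))"
  proof (rule nil_simple_prime[OF nK K0])
    fix E assume E: "nml E (f ` G)"
    define E' where "E' = {x \<in> G. f x \<in> E}"
    have E': "nml E' G" unfolding E'_def by (rule hm_vimage[OF f(1) E])
    have "0 \<in> E" using E subD(2) by (auto simp: nml_def)
    then have ME: "M \<subseteq> E'" using f(2) by (auto simp: E'_def ker_def)
    have EI: "E = f ` E'" using E by (auto simp: E'_def nml_def)
    show "E = {0} \<or> E = f ` G"
    proof (cases "E' = G")
      case True then show ?thesis using EI by simp
    next
      case False
      then have "M = E'" using M(2)[of E'] E' ME M'(2) by (auto simp: S_def)
      then have "f ` E' \<subseteq> {0}" using f(2) by (auto simp: ker_def)
      then show ?thesis using EI \<open>0 \<in> E\<close> by auto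
    qed
  qed
  moreover have "card G = card (f ` G) * card M"
    using card_hm[OF f(1) G order_refl] f(2) MS(2) by (simp add: Int_absorb1)
  ultimately show ?thesis using that[OF M'] by blast
qed

text \<open>The faithful map \<open>e\<close> moves the group into \<open>nat sym\<close>, where the
  induction was carried out; the normal subgroup found there is pulled back.\<close>

theorem nil_product_prime_index:
  fixes G :: "'g::group_add set"
  assumes G: "sub G" and U: "nil U" and V: "nil V" and GUV: "G = U \<boxplus> V" and ne: "\<not> (U = G \<and> V = G)"
  obtains p N where "Factorial_Ring.prime p" "nml N G" "card G = p * card N" "U \<subseteq> N \<or> V \<subseteq> N" "N \<noteq> G"
proof -
  have US: "sub U" and VS: "sub V" using U V nilD by auto
  have UG: "U \<subseteq> G" unfolding GUV by (rule splus_left[OF subD(2)[OF VS]])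
  have VG: "V \<subseteq> G" unfolding GUV by (rule splus_right[OF subD(2)[OF US]])
  have GVU: "G = V \<boxplus> U" using GUV sub_splus_comm[OF US VS] G by simp
  obtain e :: "'g \<Rightarrow> nat sym" where e: "hm G e" "ker G e = {0}" using quotient_hm[OF G nml_zero[OF G]] by blast
  have eq: "W = G" if W: "W \<subseteq> G" "e ` W = e ` G" for W
  proof
    show "G \<subseteq> W"
    proof
      fix g assume g: "g \<in> G"
      then obtain w where w: "w \<in> W" "e w = e g" using W(2) by (metis imageE imageI)
      then have "- w + g = 0" using hm_eq_iff[OF e(1), of w g] g W(1) e(2) by auto
      then have "w + (- w + g) = w" by simp
      then show "g \<in> W" using w(1) by (simp add: gs)
    qed
  qed (rule W(1))
  have "normal_over_factor (e ` G) (e ` U) (e ` V)"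
  proof (rule nil_product_normal_over_factor)
    show "sub (e ` G)" by (rule hm_image[OF e(1) G order_refl])
    show "nil (e ` U)" "nil (e ` V)" using nil_hm[OF e(1)] U V UG VG by auto
    show "e ` G = e ` U \<boxplus> e ` V" using hm_splus[OF e(1) UG VG] GUV by simp
  qed
  moreover have "\<not> (e ` U = e ` G \<and> e ` V = e ` G)" using eq UG VG ne by blast
  ultimately obtain N where N: "nml N (e ` G)" "N \<noteq> e ` G" "e ` U \<subseteq> N \<or> e ` V \<subseteq> N" unfolding normal_over_factor_def by blast
  define N' where "N' = {x \<in> G. e x \<in> N}"
  have N': "nml N' G" unfolding N'_def by (rule hm_vimage[OF e(1) N(1)])
  have N'G: "N' \<noteq> G" using N(1,2) by (auto simp: nml_def N'_def)
  have NS: "sub N'" "N' \<subseteq> G" using N' by (auto simp: nml_def)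
  have c: "U \<subseteq> N' \<or> V \<subseteq> N'" using N(3) UG VG by (auto simp: N'_def)
  obtain W where W: "nil W" "W \<subseteq> G" "G = N' \<boxplus> W"
  proof -
    have "G \<subseteq> N' \<boxplus> V" if "U \<subseteq> N'" using GUV splus_mono[OF that order_refl] by blast
    moreover have "G \<subseteq> N' \<boxplus> U" if "V \<subseteq> N'" using GVU splus_mono[OF that order_refl] by blast
    ultimately show ?thesis using that c U V UG VG splus_subset[OF G NS(2)] by (metis subset_antisym)
  qed
  obtain M where M: "nml M G" "N' \<subseteq> M" "M \<noteq> G" "\<exists>p. Factorial_Ring.prime p \<and> card G = p * card M"
    using prime_index_above[OF G N' N'G W] by blast
  obtain p where p: "Factorial_Ring.prime p" "card G = p * card M" using M(4) by blast
  have "U \<subseteq> M \<or> V \<subseteq> M" using c M(2) by (meson subset_trans)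
  then show ?thesis by (rule that[OF p(1) M(1) p(2) _ M(3)])
qed

subsection \<open>The permutation group of a skew brace\<close>

text \<open>Extended by the identity outside the carrier, a translation becomes a permutation of the
  whole type.\<close>

definition lperm :: "('a, 'm) monoid_scheme \<Rightarrow> 'a \<Rightarrow> 'a sym" where
  "lperm H a = Sym (\<lambda>x. if x \<in> carrier H then a \<otimes>\<^bsub>H\<^esub> x else x)"

lemma (in group) app_lperm: assumes a: "a \<in> carrier G"
  shows "app (lperm G a) = (\<lambda>x. if x \<in> carrier G then a \<otimes> x else x)"
proof -
  have "bij (\<lambda>x. if x \<in> carrier G then a \<otimes> x else x)"
    by (rule o_bij[of "\<lambda>x. if x \<in> carrier G then inv a \<otimes> x else x"])
      (use a in \<open>auto simp: fun_eq_iff m_assoc[symmetric]\<close>)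
  then show ?thesis by (simp add: lperm_def Sym_inverse)
qed

lemma (in group) lperm_mult: assumes "a \<in> carrier G" "b \<in> carrier G"
  shows "lperm G (a \<otimes> b) = lperm G a + lperm G b"
  by (rule sym_eqI) (use assms in \<open>auto simp: app_add app_lperm fun_eq_iff m_assoc\<close>)

lemma (in group) lperm_inj: assumes "a \<in> carrier G" "b \<in> carrier G" "lperm G a = lperm G b" shows "a = b"
proof -
  have "app (lperm G a) \<one> = app (lperm G b) \<one>" using assms(3) by simp
  then show ?thesis using assms(1,2) by (simp add: app_lperm)
qed

lemma (in group) additive_one: fixes h :: "'a \<Rightarrow> 'g::group_add"
  assumes h: "\<And>a b. a \<in> carrier G \<Longrightarrow> b \<in> carrier G \<Longrightarrow> h (a \<otimes> b) = h a + h b"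
  shows "h \<one> = 0"
proof -
  have "h \<one> + h \<one> = h \<one> + 0" using h[of \<one> \<one>] by simp
  then show ?thesis by (simp only: add_left_cancel)
qed

lemma (in group) additive_inv: fixes h :: "'a \<Rightarrow> 'g::group_add"
  assumes h: "\<And>a b. a \<in> carrier G \<Longrightarrow> b \<in> carrier G \<Longrightarrow> h (a \<otimes> b) = h a + h b" and a: "a \<in> carrier G"
  shows "h (inv a) = - h a"
proof -
  have "h a + h (inv a) = 0" using h[of a "inv a"] additive_one[OF h] a by simp
  then show ?thesis by (metis minus_unique)
qed

lemma (in group) sub_image: fixes h :: "'a \<Rightarrow> 'g::group_add"
  assumes fin: "finite (carrier G)"
    and h: "\<And>a b. a \<in> carrier G \<Longrightarrow> b \<in> carrier G \<Longrightarrow> h (a \<otimes> b) = h a + h b"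
  shows "sub (h ` carrier G)"
proof (rule subI)
  show "0 \<in> h ` carrier G" by (rule image_eqI[of _ _ \<one>]) (simp_all add: additive_one[OF h])
  show "- x \<in> h ` carrier G" if "x \<in> h ` carrier G" for x
    using that additive_inv[OF h] by (metis (no_types, lifting) image_iff inv_closed)
  show "x + y \<in> h ` carrier G" if "x \<in> h ` carrier G" "y \<in> h ` carrier G" for x y
    using that h by (metis (no_types, lifting) image_iff m_closed)
qed (use fin in simp)

text \<open>The images of the lower central series form the chain required by
  \<open>chain_nil\<close>.\<close>

lemma (in group) nil_image: fixes h :: "'a \<Rightarrow> 'g::group_add"
  assumes fin: "finite (carrier G)" and nil: "nilpotent_group G"
    and h: "\<And>a b. a \<in> carrier G \<Longrightarrow> b \<in> carrier G \<Longrightarrow> h (a \<otimes> b) = h a + h b"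
  shows "nil (h ` carrier G)"
proof -
  obtain n where n: "lower_central G n = {\<one>}" using nil by (auto simp: nilpotent_group_def)
  have le: "lower_central G i \<subseteq> carrier G" for i
  proof (induct i)
    case (Suc i)
    then have "(\<Union>x \<in> lower_central G i. \<Union>y \<in> carrier G. {x \<otimes> y \<otimes> inv x \<otimes> inv y}) \<subseteq> carrier G" by auto
    from generate_incl[OF this] show ?case by simp
  qed simp
  show ?thesis
  proof (rule chain_nil[OF sub_image[OF fin h], where Z = "\<lambda>i. h ` lower_central G i" and n = n])
    show "h ` lower_central G n = {0}" by (simp add: n additive_one[OF h])
    show "h ` lower_central G i \<subseteq> h ` carrier G" for i by (rule image_mono[OF le])
    fix i x y assume "x \<in> h ` lower_central G i" "y \<in> h ` carrier G"
    then obtain a b where ab: "a \<in> lower_central G i" "b \<in> carrier G" "x = h a" "y = h b" by blast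
    have a: "a \<in> carrier G" using ab(1) le by blast
    have "a \<otimes> b \<otimes> inv a \<otimes> inv b \<in> lower_central G (Suc i)"
      unfolding lower_central.simps by (rule generate.incl) (use ab in blast)
    moreover have "h (a \<otimes> b \<otimes> inv a \<otimes> inv b) = x + y + - x + - y"
      using a ab by (simp add: h additive_inv[OF h])
    ultimately show "x + y + - x + - y \<in> h ` lower_central G (Suc i)" by (metis imageI)
  qed simp_all
qed

section \<open>Translations, left multiplications and lambda maps\<close>

locale finite_brace = skew_brace B for B :: "('a, 'm) ring_scheme" (structure) +
  assumes fin: "finite (carrier B)"
begin

sublocale add: group "add_monoid B"
  rewrites "carrier (add_monoid B) = carrier B" and "monoid.mult (add_monoid B) = (\<oplus>)" and "monoid.one (add_monoid B) = \<zero>"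
    and "m_inv (add_monoid B) = a_inv B"
  by (rule additive_group) (simp_all add: a_inv_def fun_eq_iff)

definition T :: "'a \<Rightarrow> 'a sym" where "T a = lperm (add_monoid B) a"
definition L :: "'a \<Rightarrow> 'a sym" where "L a = lperm B a"
text \<open>On the carrier this permutation is \<open>lambda_map B a\<close>; outside it is the
  identity.\<close>

definition lam :: "'a \<Rightarrow> 'a sym" where "lam a = - T a + L a"

lemma T_app: "a \<in> carrier B \<Longrightarrow> app (T a) = (\<lambda>x. if x \<in> carrier B then a \<oplus> x else x)"
  using add.app_lperm[of a] by (simp add: T_def)
lemma L_app: "a \<in> carrier B \<Longrightarrow> app (L a) = (\<lambda>x. if x \<in> carrier B then a \<otimes> x else x)"
  by (simp add: L_def app_lperm)
lemma T_add: "a \<in> carrier B \<Longrightarrow> b \<in> carrier B \<Longrightarrow> T (a \<oplus> b) = T a + T b"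
  using add.lperm_mult[of a b] by (simp add: T_def)
lemma L_mult: "a \<in> carrier B \<Longrightarrow> b \<in> carrier B \<Longrightarrow> L (a \<otimes> b) = L a + L b"
  by (simp add: L_def lperm_mult)
lemma T_inj: "a \<in> carrier B \<Longrightarrow> b \<in> carrier B \<Longrightarrow> T a = T b \<Longrightarrow> a = b"
  using add.lperm_inj[of a b] by (simp add: T_def)
lemma T_minus: "a \<in> carrier B \<Longrightarrow> T (\<ominus> a) = - T a"
  using add.additive_inv[of T] T_add by simp
lemma L_split: "L a = T a + lam a" by (simp add: lam_def gs)

text \<open>The distributive law of the brace, read as an equation between permutations.\<close>

lemma brace_law: assumes "a \<in> carrier B" "b \<in> carrier B" shows "L a + T b = T (a \<otimes> b) + lam a"
proof -
  have "L a + T b = T ((a \<otimes> b) \<ominus> a) + L a"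
    by (rule sym_eqI) (use assms brace_distrib[OF assms] in \<open>auto simp: app_add T_app L_app fun_eq_iff a_minus_def\<close>)
  also have "T ((a \<otimes> b) \<ominus> a) = T (a \<otimes> b) + - T a" using assms by (simp add: a_minus_def T_add T_minus)
  finally show ?thesis by (simp add: lam_def gs)
qed

lemma lambda_closed: "a \<in> carrier B \<Longrightarrow> b \<in> carrier B \<Longrightarrow> lambda_map B a b \<in> carrier B"
  by (simp add: lambda_map_def)

lemma lam_T: assumes "a \<in> carrier B" "b \<in> carrier B" shows "lam a + T b + - lam a = T (lambda_map B a b)"
proof -
  have "lam a + T b = - T a + (L a + T b)" by (simp add: lam_def gs)
  also have "\<dots> = T (lambda_map B a b) + lam a"
    unfolding brace_law[OF assms] using assms by (simp add: lambda_map_def T_add T_minus gs)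
  finally show ?thesis by (simp add: gs)
qed

lemma lam_mult: assumes "a \<in> carrier B" "b \<in> carrier B" shows "lam (a \<otimes> b) = lam a + lam b"
proof -
  have "lam a + lam b = - T (a \<otimes> b) + (T (a \<otimes> b) + lam a) + - T b + L b" by (simp add: lam_def[of b] gs)
  also have "\<dots> = lam (a \<otimes> b)" unfolding brace_law[OF assms, symmetric] using assms by (simp add: lam_def L_mult gs)
  finally show ?thesis by simp
qed

lemma subs: "sub (T ` carrier B)" "sub (L ` carrier B)" "sub (lam ` carrier B)"
  using add.sub_image[of T] sub_image[of L] sub_image[of lam] fin T_add L_mult lam_mult by auto

definition Gam :: "'a sym set" where "Gam = lam ` carrier B \<boxplus> T ` carrier B"

lemma Gam: "sub Gam" "T ` carrier B \<subseteq> Gam" "lam ` carrier B \<subseteq> Gam" "L ` carrier B \<subseteq> Gam" "Gam = L ` carrier B \<boxplus> lam ` carrier B"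
proof -
  have n: "cj x (T ` carrier B) \<subseteq> T ` carrier B" if "x \<in> lam ` carrier B" for x
    using that lam_T lambda_closed by (auto simp: cj_def)
  show s: "sub Gam" unfolding Gam_def by (rule sub_splus_norm(1)[OF subs(3,1) n])
  have TL: "Gam = T ` carrier B \<boxplus> lam ` carrier B" unfolding Gam_def by (rule sub_splus_norm(2)[OF subs(3,1) n])
  show T: "T ` carrier B \<subseteq> Gam" unfolding Gam_def by (rule splus_right[OF subD(2)[OF subs(3)]])
  show lm: "lam ` carrier B \<subseteq> Gam" unfolding Gam_def by (rule splus_left[OF subD(2)[OF subs(1)]])
  show L: "L ` carrier B \<subseteq> Gam" using T lm subD(3)[OF s] by (auto simp: L_split)
  show "Gam = L ` carrier B \<boxplus> lam ` carrier B"
  proof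
    show "L ` carrier B \<boxplus> lam ` carrier B \<subseteq> Gam" by (rule splus_subset[OF s L lm])
    show "Gam \<subseteq> L ` carrier B \<boxplus> lam ` carrier B"
    proof
      fix x assume "x \<in> Gam"
      then obtain a b where ab: "a \<in> carrier B" "b \<in> carrier B" "x = T a + lam b" unfolding TL by (auto elim!: splusE)
      have "- lam a + lam b \<in> lam ` carrier B" using ab subD(3,4)[OF subs(3)] by simp
      then have "L a + (- lam a + lam b) \<in> L ` carrier B \<boxplus> lam ` carrier B" using ab by (intro splusI) auto
      moreover have "x = L a + (- lam a + lam b)" by (simp add: ab L_split gs)
      ultimately show "x \<in> L ` carrier B \<boxplus> lam ` carrier B" by simp
    qed
  qed
qed

text \<open>If \<open>L a\<close> equalled \<open>lam b\<close>, then \<open>L b\<close> would be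
  \<open>T b + L a\<close>; evaluation at zero gives \<open>b \<oplus> a = b\<close>, so
  \<open>a\<close> would be zero.\<close>

lemma not_both: assumes "card (carrier B) > 1" shows "\<not> (L ` carrier B = Gam \<and> lam ` carrier B = Gam)"
proof
  assume e: "L ` carrier B = Gam \<and> lam ` carrier B = Gam"
  have "\<not> carrier B \<subseteq> {\<zero>}" using assms card_mono[of "{\<zero>}" "carrier B"] by auto
  then obtain a where a: "a \<in> carrier B" "a \<noteq> \<zero>" by blast
  have "L a \<in> lam ` carrier B" using e a(1) by blast
  then obtain b where b: "b \<in> carrier B" "L a = lam b" by blast
  have "T b + L a = L b" unfolding b(2) by (rule L_split[symmetric])
  then have e0: "app (T b + L a) \<zero> = app (L b) \<zero>" by (rule arg_cong[of _ _ "\<lambda>f. app f \<zero>"])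
  have "a \<otimes> \<zero> = a" "b \<otimes> \<zero> = b" using a b r_one unfolding one_eq_zero by simp_all
  then have "app (T b + L a) \<zero> = b \<oplus> a" "app (L b) \<zero> = b"
    using a(1) b(1) by (simp_all add: app_add T_app L_app)
  then have "b \<oplus> a = b" using e0 by simp
  then show False using a b by simp
qed

lemma ideal_of_normal:
  assumes N: "nml N Gam" and c: "L ` carrier B \<subseteq> N \<or> lam ` carrier B \<subseteq> N" and ne: "N \<noteq> Gam"
    and p: "Factorial_Ring.prime p" "card Gam = p * card N"
  shows "\<exists>I. brace_ideal I B \<and> brace_index B I = p"
proof -
  define I where "I = {a \<in> carrier B. T a \<in> N}"
  have NS: "sub N" "N \<subseteq> Gam" using N by (auto simp: nml_def)
  have IB: "I \<subseteq> carrier B" by (auto simp: I_def)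
  have fI: "finite I" using IB fin by (rule finite_subset)
  have cjN: "g + n + - g \<in> N" if "g \<in> Gam" "n \<in> N" for g n by (rule nmlD(3)[OF N that])
  have Isub: "subgroup I (add_monoid B)"
  proof (rule add.subgroupI)
    show "I \<noteq> {}" using add.additive_one[of T] T_add subD(2)[OF NS(1)] by (auto simp: I_def)
  qed (use subD(3,4)[OF NS(1)] in \<open>auto simp: I_def T_add T_minus\<close>)
  have lamI: "lambda_map B b ` I = I" if b: "b \<in> carrier B" for b
  proof -
    have T: "T (lambda_map B b a) = lam b + T a + - lam b" if "a \<in> I" for a using lam_T[OF b] that IB by auto
    have lb: "lam b \<in> Gam" using b Gam(3) by blast
    have "lambda_map B b ` I \<subseteq> I"
      using cjN[OF lb] T lambda_closed[OF b] by (auto simp: I_def)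
    moreover have "inj_on (lambda_map B b) I"
    proof (rule inj_onI)
      fix x y assume xy: "x \<in> I" "y \<in> I" "lambda_map B b x = lambda_map B b y"
      then have "lam b + T x + - lam b = lam b + T y + - lam b" using T by metis
      then have "T x = T y" by simp
      then show "x = y" using T_inj xy IB by blast
    qed
    ultimately show ?thesis using endo_inj_surj[OF fI] by blast
  qed
  have Inorm: "I \<lhd> add_monoid B"
  proof (subst add.normal_inv_iff, intro conjI ballI)
    show "subgroup I (add_monoid B)" by (rule Isub)
    fix x h assume x: "x \<in> carrier B" and h: "h \<in> I"
    have "T (x \<oplus> h \<oplus> \<ominus> x) = T x + T h + - T x" using x h IB by (auto simp: T_add T_minus)
    moreover have "T x + T h + - T x \<in> N" using cjN[of "T x" "T h"] x h Gam(2) by (auto simp: I_def)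
    ultimately show "x \<oplus> h \<oplus> \<ominus> x \<in> I" using x h IB by (auto simp: I_def)
  qed
  \<comment> \<open>\<open>h\<close> is whichever of the multiplicative homomorphisms
    \<open>L\<close> and \<open>lam\<close> is not assumed to map into \<open>N\<close>; membership
    of \<open>T a\<close> in \<open>N\<close> can be tested on it.\<close>
  obtain h where h: "\<And>a b. a \<in> carrier B \<Longrightarrow> b \<in> carrier B \<Longrightarrow> h (a \<otimes> b) = h a + h b"
    "h ` carrier B \<subseteq> Gam" "\<And>a. a \<in> carrier B \<Longrightarrow> a \<in> I \<longleftrightarrow> h a \<in> N"
  proof (cases "lam ` carrier B \<subseteq> N")
    case True
    have "T a \<in> N \<longleftrightarrow> L a \<in> N" if "a \<in> carrier B" for a
      unfolding L_split using sub_add_right[OF NS(1), of "lam a" "T a"] True that by blast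
    then show ?thesis using that[of L] L_mult Gam(4) by (auto simp: I_def)
  next
    case False
    then have LN: "L ` carrier B \<subseteq> N" using c by blast
    have "T a \<in> N \<longleftrightarrow> lam a \<in> N" if "a \<in> carrier B" for a
      unfolding lam_def using sub_add_right[OF NS(1), of "L a" "- T a"] sub_minus_iff[OF NS(1), of "T a"] LN that by blast
    then show ?thesis using that[of lam] lam_mult Gam(3) by (auto simp: I_def)
  qed
  have Imult: "I \<lhd> B"
  proof (subst normal_inv_iff, intro conjI ballI)
    show "subgroup I B"
    proof (rule subgroupI)
      show "I \<noteq> {}" using subgroup.one_closed[OF Isub] by blast
      show "inv a \<in> I" if "a \<in> I" for a
      proof -
        have "a \<in> carrier B" using that IB by blast
        then show ?thesis using h(3)[of a] h(3)[of "inv a"] additive_inv[OF h(1), of a] that subD(4)[OF NS(1)] by simp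
      qed
      show "a \<otimes> b \<in> I" if "a \<in> I" "b \<in> I" for a b
      proof -
        have "a \<in> carrier B" "b \<in> carrier B" using that IB by auto
        then show ?thesis using h(3)[of a] h(3)[of b] h(3)[of "a \<otimes> b"] h(1)[of a b] that subD(3)[OF NS(1)] by simp
      qed
    qed (rule IB)
    fix x a assume x: "x \<in> carrier B" and a: "a \<in> I"
    then have aB: "a \<in> carrier B" using IB by blast
    have "h (x \<otimes> a \<otimes> inv x) = h x + h a + - h x" using x aB by (simp add: h(1) additive_inv[OF h(1)])
    moreover have "h x + h a + - h x \<in> N" using cjN[of "h x" "h a"] h(2) h(3)[OF aB] a x by blast
    ultimately show "x \<otimes> a \<otimes> inv x \<in> I" using h(3)[of "x \<otimes> a \<otimes> inv x"] x aB by simp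
  qed
  have ideal: "brace_ideal I B" using Isub lamI Inorm Imult by (simp add: brace_ideal_def left_brace_ideal_def)
  \<comment> \<open>If \<open>N\<close> contained all translations besides one of the two factors,
    it would contain the other factor as well, and be \<open>Gam\<close>.\<close>
  have TN: "\<not> T ` carrier B \<subseteq> N"
  proof
    assume TN: "T ` carrier B \<subseteq> N"
    have "lam ` carrier B \<subseteq> N"
    proof (cases "lam ` carrier B \<subseteq> N")
      case False
      then have "L ` carrier B \<subseteq> N" using c by blast
      then show ?thesis using TN unfolding lam_def by (auto intro!: subD(3,4)[OF NS(1)])
    qed
    then have "Gam \<subseteq> N" unfolding Gam_def using TN by (rule splus_subset[OF NS(1)])
    then show False using ne NS(2) by blast
  qed
  have TNs: "sub (T ` carrier B \<boxplus> N)"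
    by (rule sub_splus_norm(1)[OF subs(1) NS(1)]) (use nml_cj[OF N] Gam(2) in auto)
  have "T ` carrier B \<boxplus> N \<subseteq> Gam" by (rule splus_subset[OF Gam(1,2) NS(2)])
  then have d: "card (T ` carrier B \<boxplus> N) dvd p * card N" using lagrange_sub[OF Gam(1) TNs] p(2) by simp
  have Nle: "N \<subseteq> T ` carrier B \<boxplus> N" "T ` carrier B \<subseteq> T ` carrier B \<boxplus> N"
    using splus_right[OF subD(2)[OF subs(1)]] splus_left[OF subD(2)[OF NS(1)]] by auto
  \<comment> \<open>\<open>j\<close> is the index of \<open>N\<close> in the sum; it divides the
    prime \<open>p\<close> and is not 1, so the translations supplement \<open>N\<close> and
    \<open>I\<close> inherits its index.\<close>
  obtain j where j: "card (T ` carrier B \<boxplus> N) = card N * j" using lagrange_sub[OF TNs NS(1) Nle(1)] by (rule dvdE)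
  have N0: "card N > 0" by (rule sub_card_pos[OF NS(1)])
  have "j dvd p" using d j N0 by (simp add: mult.commute)
  moreover have "j \<noteq> 1"
  proof
    assume "j = 1"
    then have "N = T ` carrier B \<boxplus> N" using j Nle(1) subD(1)[OF TNs] by (intro card_subset_eq) simp_all
    then show False using TN Nle(2) by simp
  qed
  ultimately have "j = p" using p(1) by (metis prime_nat_iff)
  moreover have "T ` carrier B \<inter> N = T ` I" by (auto simp: I_def)
  ultimately have "card N * p * card (T ` I) = card (T ` carrier B) * card N"
    using card_splus[OF subs(1) NS(1)] j by simp
  then have "p * card (T ` I) = card (T ` carrier B)" using N0 by (simp add: ac_simps)
  moreover have "inj_on T (carrier B)" using T_inj by (rule inj_onI)
  ultimately have cI: "p * card I = card (carrier B)"
    using card_image[of T "carrier B"] card_image[of T I] IB inj_on_subset by metis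
  have "card (rcosets\<^bsub>add_monoid B\<^esub> I) * card I = Coset.order (add_monoid B)" by (rule add.lagrange[OF Isub])
  then have "brace_index B I * card I = p * card I"
    using cI by (simp add: brace_index_def FactRing_def A_RCOSETS_def Coset.order_def)
  moreover have "card I > 0" using fI subgroup.one_closed[OF Isub] card_gt_0_iff by blast
  ultimately show ?thesis using ideal by auto
qed

end

theorem corollary3p3:
  fixes B :: "('a, 'm) ring_scheme"
  assumes "skew_brace B"
    and "finite (carrier B)"
    and "card (carrier B) > 1"
    and "nilpotent_group B"
  shows "\<exists>(p::nat) I. Factorial_Ring.prime p \<and> brace_ideal I B \<and> brace_index B I = p"
proof -
  interpret finite_brace B using assms by (simp add: finite_brace_def finite_brace_axioms_def)
  have "nil (L ` carrier B)" "nil (lam ` carrier B)"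
    using nil_image[OF fin assms(4)] L_mult lam_mult by auto
  then obtain p N where "Factorial_Ring.prime p" "nml N Gam" "card Gam = p * card N"
    "L ` carrier B \<subseteq> N \<or> lam ` carrier B \<subseteq> N" "N \<noteq> Gam"
    using nil_product_prime_index[OF Gam(1) _ _ Gam(5) not_both[OF assms(3)]] by metis
  then show ?thesis using ideal_of_normal by metis
qed

end
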